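(* Assume the Halfin–Whitt condition (HW), the interruption condition (INT), and the distributional condition (REG) from the context. Let the $n$-th system be operated under the modified priority Markov policy $Z^n(t)=\check z^n(X^n(t))$ defined in the context. Then for any $\kappa>0$ there exists $\check n\in\mathbb N$ such that $$\sup_{n>\check n}\ \limsup_{T\to\infty}\ \frac1T\,E\Bigl[\int_0^T|\hat X^n(s)|^\kappa\,\mathrm ds\Bigr]<\infty.$$
   Context: Notation: $\mathcal I=\{1,\dots,d\}$, $e=(1,\dots,1)'$, $a^+=\max(a,0)$, $\lfloor a\rfloor$ integer part, $a\wedge b=\min(a,b)$. Model (for each $n$, $n$ servers, $d$ classes). Arrivals: for each $i$, $\{G_{i,j}\}_{j\ge1}$ i.i.d. strictly positive with $E[G_{i,1}]=1$, distribution function $F_i$, finite squared coefficient of variation, independent over $i$; $A_i^n(t)=\max\{m\ge0:\sum_{j=1}^mG_{i,j}\le\lambda_i^nt\}$. Service times exponential($\mu^n_i$), patience exponential($\gamma^n_i$). (HW): $\lambda_i^n/n\to\lambda_i>0$, $\mu_i^n\to\mu_i>0$, $\gamma_i^n\to\gamma_i\ge0$, $n^{-1/2}(\lambda_i^n-n\lambda_i)\to\hat\lambda_i$, $n^{1/2}(\mu_i^n-\mu_i)\to\hat\mu_i$, $\lambda_i^n/(n\mu_i^n)\to\rho_i=\lambda_i/\mu_i<1$, $\sum_i\rho_i=1$; $\inf_n\gamma^n_d>0$. Interruptions: i.i.d. positive $(u_k^n,d_k^n)$, $T_0^n=0$, $T^n_k=\sum_{i\le k}(u^n_i+d^n_i)$;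 $\Psi^n(t)=1$ on $[T^n_k,T^n_k+u^n_{k+1})$, $0$ on $[T^n_k+u^n_{k+1},T^n_{k+1})$; all servers stop when $\Psi^n=0$. (INT): $u^n_k,d^n_k$ independent, $u^n_k$ exponential with rate $\beta^n_{\mathsf u}\to\beta>0$, $d^n_k\sim d_1/\vartheta^n$, $d_1\ge0$, $E[d_1]=1$, $\vartheta^n/\sqrt n\to\vartheta>0$; $F^{d_1}$ the distribution function of $d_1$. (REG): (i) each $F_i$ and $F^{d_1}$ has a finite right derivative and is $<1$ at every $t\ge0$; (ii) there is $\hat C$ with $\int_t^\infty(1-F(y))\mathrm dy\le\hat C(1-F(t))$ for all $t\ge0$, $F\in\{F^{d_1},F_1,\dots,F_d\}$. State: $X^n_i=Q^n_i+Z^n_i$, $X_i^n(t)=X_i^n(0)+A_i^n(t)-S^n_{*,i}(\mu_i^n\int_0^tZ_i^n\Psi^n)-R^n_{*,i}(\gamma_i^n\int_0^tQ_i^n)$, unit-rate Poisson $S^n_{*,i},R^n_{*,i}$; primitives mutually independent and independent of the up-down cycles. $\hat X^n_i=n^{-1/2}(X^n_i-\rho_in)$, with $\hat X^n(0)$ deterministic. Policy: let $\mathcal I_0=\{i:\gamma_i=0\}$; classes are numbered so that $\mathcal I_0=\{1,\dots,|\mathcal I_0|\}$. Write $\sigma_0=\sum_{j\in\mathcal I_0}\rho_j$ and $k_j=\lfloor n\rho_j/\sigma_0\rfloor$. For $x\in\mathbb Z^d_+$, for $i\in\mathcal I_0$, $\check z^n_i(x)=\Bigl\lfloor \frac{n\rho_i}{\sigma_0}+\Bigl(n-\sum_{j\in\mathcal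 I_0}(x_j\wedge k_j)-\sum_{j=1}^{i-1}(x_j-k_j)^+\Bigr)^+\Bigr\rfloor\wedge x_i$, and for $i\in\mathcal I\setminus\mathcal I_0$, $\check z^n_i(x)=x_i\wedge\bigl(n-\sum_{j=1}^{i-1}x_j\bigr)^+$. *)

theory Defs
  imports "HOL-Probability.Probability"
begin

text \<open>Counting function of a sequence of inter-event times (0-based indices):
  count E t = max { m. E 0 + ... + E (m-1) <= t }.  With E the i.i.d. G_{i,j}
  this is the renewal counting process, with E i.i.d. Exp(1) it is a unit-rate
  Poisson process.\<close>
definition count_proc :: "(nat \<Rightarrow> real) \<Rightarrow> real \<Rightarrow> nat" where
  "count_proc E t = Sup {m::nat. (\<Sum>k<m. E k) \<le> t}"

definition cycle_start :: "(nat \<Rightarrow> real) \<Rightarrow> (nat \<Rightarrow> real) \<Rightarrow> nat \<Rightarrow> real" where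
  "cycle_start u dn k = (\<Sum>m<k. u m + dn m)"

definition up_indicator :: "(nat \<Rightarrow> real) \<Rightarrow> (nat \<Rightarrow> real) \<Rightarrow> real \<Rightarrow> real" where
  "up_indicator u dn t =
     (if \<exists>k. cycle_start u dn k \<le> t \<and> t < cycle_start u dn k + u k then 1 else 0)"

text \<open>The modified priority Markov policy zcheck^n(x), classes 1..d;
  rho = limiting traffic intensities, I0 = set of classes with gamma_i = 0.\<close>
definition zcheck :: "nat \<Rightarrow> nat \<Rightarrow> (nat \<Rightarrow> real) \<Rightarrow> nat set \<Rightarrow> (nat \<Rightarrow> nat) \<Rightarrow> nat \<Rightarrow> int" where
  "zcheck n d rho I0 x i =
    (let \<sigma>0 = (\<Sum>j\<in>I0. rho j);
         k = (\<lambda>j. \<lfloor>real n * rho j / \<sigma>0\<rfloor>)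
     in if i \<in> I0 then
          min (\<lfloor>real n * rho i / \<sigma>0
                 + real_of_int (max 0 (int n - (\<Sum>j\<in>I0. min (int (x j)) (k j))
                                     - (\<Sum>j\<in>{1..<i}. max 0 (int (x j) - k j))))\<rfloor>)
              (int (x i))
        else min (int (x i)) (max 0 (int n - (\<Sum>j\<in>{1..<i}. int (x j)))))"

datatype prim = Arr nat nat | Srv nat nat | Abd nat nat | Up nat | Dn nat

definition valid_prims :: "nat \<Rightarrow> prim set" where
  "valid_prims d = {p. case p of Arr i j \<Rightarrow> i \<in> {1..d} | Srv i k \<Rightarrow> i \<in> {1..d}
                     | Abd i k \<Rightarrow> i \<in> {1..d} | Up k \<Rightarrow> True | Dn k \<Rightarrow> True}"

definition prim_rv ::
  "(nat \<Rightarrow> nat \<Rightarrow> 'a \<Rightarrow> real) \<Rightarrow> (nat \<Rightarrow> nat \<Rightarrow> 'a \<Rightarrow> real) \<Rightarrow> (nat \<Rightarrow> nat \<Rightarrow> 'a \<Rightarrow> real)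
   \<Rightarrow> (nat \<Rightarrow> 'a \<Rightarrow> real) \<Rightarrow> (nat \<Rightarrow> 'a \<Rightarrow> real) \<Rightarrow> prim \<Rightarrow> 'a \<Rightarrow> real" where
  "prim_rv G ES ER U D1 p = (case p of Arr i j \<Rightarrow> G i j | Srv i k \<Rightarrow> ES i k
       | Abd i k \<Rightarrow> ER i k | Up k \<Rightarrow> U k | Dn k \<Rightarrow> D1 k)"

definition hat_norm :: "nat \<Rightarrow> nat \<Rightarrow> (nat \<Rightarrow> real) \<Rightarrow> (nat \<Rightarrow> nat) \<Rightarrow> real" where
  "hat_norm n d rho x = sqrt (\<Sum>i\<in>{1..d}. ((real (x i) - rho i * real n) / sqrt (real n))\<^sup>2)"

end

theory Submission
  imports Defs
begin

text \<open>
  The argument is pathwise. By the tail condition in (REG) all primitives have exponential moments,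
  so the partial sums of a centred inter-event sequence have finite \<open>p\<close>-variation in diffusive
  scaling: dyadic chaining inside index blocks of length about \<open>n\<close>, and exponential bounds for the
  excess over a linear drift beyond. Hence, for every renewal process composed with any
  nondecreasing clock, the noise over \<open>[s, t]\<close> is at most a small multiple of the clock increment
  plus \<open>(H t - H s) ^ (1 / p)\<close>, where \<open>H\<close> is nondecreasing and depends on the primitives only. As
  \<open>H\<close> telescopes, it does not matter how long a clock stalls, and neither martingales nor
  measurability of the state process are needed.

  For a fixed path, the priority rule makes the drift of the scaled state restoring, class by class.
  It is linear outside \<open>I0\<close>, up to an input from the classes of higher priority, and saturated at
  level \<open>sqrt n\<close> for large states of the classes in \<open>I0\<close>, where windows are extended until the
  state has come down. Contraction over the windows bounds the time integral of the state by
  \<open>T + H T\<close>. Since abandonments and service completions are at most the initial state plus the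
  arrivals, \<open>H T\<close> is a sum over a random number of blocks, of order \<open>T\<close>, with geometric tails.
\<close>

section \<open>Renewal paths: chaining control of the noise\<close>

text \<open>The service and abandonment clocks are functionals of the state, so the noise must be
  bounded for all clocks at once. The \<open>p\<close>-variation form does this: the
  \<open>p\<close>-th power of the noise over a window is bounded by an increment of
  \<open>H\<close>, and increments over disjoint windows add up. Classes in \<open>I0\<close> are
  stable without abandonment because class \<open>d\<close> abandons at a rate bounded below. Hence
  the traffic of \<open>I0\<close> is strictly less than one, and each of its classes owns a share
  of the servers larger than \<open>rho i\<close>. The surplus is of order \<open>n\<close>, so the
  drift is linear up to any fixed multiple of \<open>sqrt n\<close> and at least constant beyond it.
  A descent from height \<open>a\<close> at constant speed lasts about \<open>a\<close>, so the
  power \<open>p - 1\<close> integrated along it costs \<open>a ^ p\<close>: one power is lost,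
  whence \<open>\<kappa> \<le> p - 1\<close> with \<open>p = 4 * r\<close>. The blocks counted by
  \<open>H T\<close> are selected by variables that also occur in the summands; \<open>tame\<close>
  takes the place of independence there. The slope in \<open>T\<close> depends only on bounds valid
  for all large \<open>n\<close>; the initial state enters an additive term that disappears after
  division by \<open>T\<close>.\<close>

definition psum :: "(nat \<Rightarrow> real) \<Rightarrow> nat \<Rightarrow> real" where
  "psum E m = (\<Sum>k<m. E k)"

lemma psum_0 [simp]: "psum E 0 = 0" and psum_Suc: "psum E (Suc m) = psum E m + E m"
  by (simp_all add: psum_def)

locale renewal_path =
  fixes E :: "nat \<Rightarrow> real"
  assumes E_nonneg: "E k \<ge> 0"
    and unbounded: "\<exists>m. psum E m > x"
begin

abbreviation "cnt \<equiv> count_proc E"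

lemma psum_mono: "m \<le> m' \<Longrightarrow> psum E m \<le> psum E m'"
  unfolding psum_def by (rule sum_mono2) (auto simp: E_nonneg)

lemma finite_psum_le: "finite {m. psum E m \<le> x}"
proof -
  obtain m where m: "psum E m > x" using unbounded by blast
  have "{m. psum E m \<le> x} \<subseteq> {..m}"
  proof
    fix k assume "k \<in> {m. psum E m \<le> x}"
    then show "k \<in> {..m}" using m psum_mono[of m k] by (cases "k \<le> m") auto
  qed
  then show ?thesis using finite_subset by blast
qed

text \<open>Unbounded partial sums make the set under the \<open>Sup\<close> finite, so
  \<open>cnt u\<close> is a true maximum and not a default value. This adjunction between counting
  and partial sums is all that is used of \<open>count_proc\<close> afterwards.\<close>

lemma psum_le_iff: assumes "u \<ge> 0" shows "psum E m \<le> u \<longleftrightarrow> m \<le> cnt u"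
proof -
  let ?A = "{m. psum E m \<le> u}"
  have ne: "?A \<noteq> {}" using assms by (auto intro: exI[of _ 0])
  have eq: "cnt u = Max ?A"
    unfolding count_proc_def using finite_psum_le[of u] ne
    by (simp add: psum_def[symmetric] cSup_eq_Max)
  show ?thesis
  proof
    assume "psum E m \<le> u" then show "m \<le> cnt u" using eq finite_psum_le[of u] by simp
  next
    assume "m \<le> cnt u"
    moreover have "Max ?A \<in> ?A" using ne finite_psum_le[of u] by (rule Max_in[rotated])
    ultimately show "psum E m \<le> u" using eq psum_mono[of m "cnt u"] by auto
  qed
qed

lemma psum_cnt_le: "u \<ge> 0 \<Longrightarrow> psum E (cnt u) \<le> u"
  using psum_le_iff by blast

lemma less_psum_Suc_cnt: "u \<ge> 0 \<Longrightarrow> u < psum E (Suc (cnt u))"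
  using psum_le_iff[of u "Suc (cnt u)"] by (auto simp: not_le[symmetric])

lemma cnt_mono: "0 \<le> u \<Longrightarrow> u \<le> w \<Longrightarrow> cnt u \<le> cnt w"
  using psum_le_iff[of w "cnt u"] psum_cnt_le[of u] by simp

end

text \<open>Every increment of \<open>M\<close> splits into increments over dyadic intervals, at most two of
  each level below \<open>J\<close>.\<close>
lemma dyadic_chaining:
  fixes M :: "nat \<Rightarrow> real" and w :: "nat \<Rightarrow> real"
  assumes base: "\<And>r x. R \<le> r \<Longrightarrow> r \<le> x \<Longrightarrow> x \<le> X \<Longrightarrow> 2^J dvd r \<Longrightarrow> 2^J dvd x \<Longrightarrow> \<bar>M x - M r\<bar> \<le> B"
    and step: "\<And>i q. i < J \<Longrightarrow> 2^i dvd q \<Longrightarrow> R \<le> q \<Longrightarrow> q + 2^i \<le> X \<Longrightarrow> \<bar>M (q + 2^i) - M q\<bar> \<le> w i"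
    and w: "\<And>i. w i \<ge> 0"
    and B0: "B \<ge> 0"
    and r: "R \<le> r" "r \<le> x" "x \<le> X"
  shows "\<bar>M x - M r\<bar> \<le> B + 2 * (\<Sum>i<J. w i)"
proof -
  \<comment> \<open>Induction on the number \<open>k\<close> of levels below \<open>J\<close> that
    are needed: both end points are multiples of \<open>2^(J-k)\<close>.\<close>
  have "\<bar>M x - M r\<bar> \<le> B + 2 * (\<Sum>i\<in>{J - k..<J}. w i)"
    if "k \<le> J" "2^(J-k) dvd r" "2^(J-k) dvd x" "R \<le> r" "r \<le> x" "x \<le> X" for k r x
    using that
  proof (induction k arbitrary: r x)
    case 0 then show ?case using base by simp
  next
    case (Suc k)
    define i where "i = J - Suc k"
    have i: "i < J" "J - k = Suc i" "J - Suc k = i" using Suc.prems by (auto simp: i_def)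
    obtain a where a: "r = 2^i * a" using Suc.prems i by (auto elim: dvdE)
    obtain c where c: "x = 2^i * c" using Suc.prems i by (auto elim: dvdE)
    have ac: "a \<le> c" using Suc.prems(5) a c by simp
    have split: "{i..<J} = insert i {Suc i..<J}" using i by auto
    have sum: "(\<Sum>j\<in>{i..<J}. w j) = w i + (\<Sum>j\<in>{Suc i..<J}. w j)" unfolding split by simp
    show ?case
    proof (cases "x = r")
      case True
      have "0 \<le> (\<Sum>i\<in>{J - Suc k..<J}. w i)" by (intro sum_nonneg w)
      then show ?thesis using True B0 by simp
    next
      case False
      then have lt: "a < c" using ac a c by (cases "a = c") auto
      \<comment> \<open>The left end is rounded up and the right end down to even multiples. What
        remains in the middle is aligned one level higher, and each rounding uses at most one
        interval of level \<open>i\<close>.\<close>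
      define a' where "a' = (if odd a then a + 1 else a)"
      define c' where "c' = (if odd c then c - 1 else c)"
      have c1: "c' \<le> c" "odd c \<Longrightarrow> c' + 1 = c" using lt by (auto simp: c'_def)
      have ev: "even a'" "even c'" by (auto simp: a'_def c'_def)
      have le: "a' \<le> c'" using lt ev by (auto simp: a'_def c'_def elim!: oddE evenE)
      have al: "a \<le> a'" "a' \<le> c" using le c1 by (auto simp: a'_def)
      have "2^(J-k) dvd 2^i * a'" "2^(J-k) dvd 2^i * c'" using ev i by (auto simp: mult.commute intro: mult_dvd_mono)
      moreover have "R \<le> 2^i * a'" using al(1) Suc.prems(4) a
        by (meson le_trans mult_le_mono2)
      moreover have "2^i * a' \<le> 2^i * c'" using le by simp
      moreover have "2^i * c' \<le> X" using c1(1) Suc.prems(6) c by (meson le_trans mult_le_mono2)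
      ultimately have IH: "\<bar>M (2^i * c') - M (2^i * a')\<bar> \<le> B + 2 * (\<Sum>j\<in>{Suc i..<J}. w j)"
        using Suc.IH[of "2^i*a'" "2^i*c'"] Suc.prems(1) i by simp
      have L: "\<bar>M (2^i * a') - M r\<bar> \<le> w i"
      proof (cases "odd a")
        case True
        then have e: "2^i * a' = r + 2^i" using a by (simp add: a'_def algebra_simps)
        have "r + 2^i \<le> X" using e \<open>2^i * a' \<le> 2^i * c'\<close> \<open>2^i * c' \<le> X\<close> by simp
        then show ?thesis using step[of i r] i(1) Suc.prems e a by simp
      next
        case False then show ?thesis using w a by (simp add: a'_def)
      qed
      have U: "\<bar>M x - M (2^i * c')\<bar> \<le> w i"
      proof (cases "odd c")
        case True
        then have e: "2^i * c' + 2^i = x" using c c1(2) by (metis add.commute mult_Suc_right Suc_eq_plus1)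
        then show ?thesis using step[of i "2^i*c'"] i(1) \<open>R \<le> 2^i * a'\<close> \<open>2^i * a' \<le> 2^i * c'\<close> Suc.prems e by simp
      next
        case False then show ?thesis using w c by (simp add: c'_def)
      qed
      have tri: "\<And>p q r s w B S::real. \<bar>q - r\<bar> \<le> B + 2 * S \<Longrightarrow> \<bar>r - s\<bar> \<le> w \<Longrightarrow> \<bar>p - q\<bar> \<le> w
        \<Longrightarrow> \<bar>p - s\<bar> \<le> B + 2 * (w + S)" by (simp add: abs_le_iff algebra_simps)
      show ?thesis unfolding i(3) sum by (rule tri[OF IH L U])
    qed
  qed
  from this[of J r x] r show ?thesis by (simp add: lessThan_atLeast0)
qed


lemma root_geI: "p > 0 \<Longrightarrow> x ^ p \<le> D \<Longrightarrow> 0 \<le> x \<Longrightarrow> x \<le> root p D"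
  by (metis real_root_le_mono real_root_power_cancel)

text \<open>The number 17/20 is a rational upper bound for the fourth root of 1/2, the decay rate
  per level in the chaining. The induction runs with 17/3, the fixed point of
  \<open>x = (17/20) * (x + 1)\<close>.\<close>

lemma geometric_weights: "(\<Sum>i<J. (17/20::real) ^ (J - i)) \<le> 6"
proof -
  have "(\<Sum>i<J. (17/20::real) ^ (J - i)) \<le> 17/3"
  proof (induction J)
    case (Suc J)
    have "(\<Sum>i<Suc J. (17/20::real) ^ (Suc J - i)) = (\<Sum>i<J. (17/20) * (17/20) ^ (J - i)) + 17/20"
      by (simp add: Suc_diff_le)
    also have "\<dots> = (17/20) * (\<Sum>i<J. (17/20) ^ (J - i)) + 17/20" by (simp add: sum_distrib_left)
    also have "\<dots> \<le> (17/20) * (17/3) + 17/20" using Suc by simp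
    finally show ?case by simp
  qed simp
  then show ?thesis by simp
qed

text \<open>Each dyadic interval is charged to its last index, and each run of whole blocks to the
  last index of its first block. Such an index lies between the two counts whenever the interval
  does, so a single summand of the increment of \<open>H\<close> dominates. The weight
  \<open>2 ^ ((J - i) * r)\<close> splits a gain in two. A level-\<open>i\<close> increment has size
  about \<open>sqrt (2 ^ i)\<close>, so with \<open>sq\<close> of order \<open>sqrt (2 ^ J)\<close>
  its normalised \<open>4 * r\<close>-th power is of order \<open>2 ^ (- 2 * r * (J - i))\<close>.
  Half of this exponent makes the levels summable in the chaining, the other half pays for the
  \<open>2 ^ (J - i)\<close> intervals of that level in one block.\<close>

locale noise_control = renewal_path +
  fixes sq C' :: real and r J :: nat and \<eta> :: "nat \<Rightarrow> real"
  assumes sq: "sq > 0" and C': "C' \<ge> 0" and r: "r > 0"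
    and ctl_step: "\<And>q. (E q / sq) ^ (4 * r) + (1 / sq) ^ (4 * r) \<le> \<eta> q"
    and ctl_dyadic: "\<And>i q. i < J \<Longrightarrow> 2 ^ i dvd q \<Longrightarrow>
      2 ^ ((J - i) * r) * (\<bar>psum E (q + 2 ^ i) - psum E q - 2 ^ i\<bar> / sq) ^ (4 * r) \<le> \<eta> (q + 2 ^ i - 1)"
    and ctl_long: "\<And>N q. 2 ^ J dvd q \<Longrightarrow> N > 0 \<Longrightarrow>
      max 0 (\<bar>psum E (q + N * 2 ^ J) - psum E q - real N * 2 ^ J\<bar> / sq - C' * real N) ^ (4 * r)
        \<le> \<eta> (q + 2 ^ J - 1)"
begin

abbreviation "p \<equiv> 4 * r"

text \<open>Inside the running inter-event interval \<open>H\<close> rises linearly by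
  \<open>(E c / sq) ^ p\<close> in total, which \<open>ctl_step\<close> keeps below the next
  summand. So \<open>H\<close> is nondecreasing, and since
  \<open>x ^ p \<le> x * E c ^ (p - 1)\<close> for \<open>x \<le> E c\<close>, also a part of an
  interval is paid for by the increment of \<open>H\<close> over that part.\<close>

definition H :: "real \<Rightarrow> real" where
  "H u = (\<Sum>q<cnt u. \<eta> q) + (u - psum E (cnt u)) * E (cnt u) ^ (p - 1) / sq ^ p"

lemma p_pos: "p > 0" using r by simp

lemma \<eta>_nonneg: "\<eta> q \<ge> 0"
proof -
  have "0 \<le> (E q / sq) ^ p + (1 / sq) ^ p" using E_nonneg sq by simp
  then show ?thesis using ctl_step[of q] by linarith
qed

lemma piece_bound:
  assumes "0 \<le> x" "x \<le> E c"
  shows "(x / sq) ^ p \<le> x * E c ^ (p - 1) / sq ^ p"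
proof -
  have "x ^ p = x * x ^ (p - 1)" using p_pos by (metis power_eq_if not_less0)
  also have "\<dots> \<le> x * E c ^ (p - 1)" using assms by (intro mult_left_mono power_mono) auto
  finally show ?thesis using sq by (simp add: power_divide divide_right_mono)
qed

lemma increment_bound_same:
  assumes "0 \<le> u" "u \<le> w" "cnt u = cnt w"
  shows "w - u \<le> sq * root p (H w - H u)" "H u \<le> H w"
proof -
  let ?c = "cnt w"
  have "H w - H u = (w - u) * E ?c ^ (p - 1) / sq ^ p"
    unfolding H_def assms(3) by (simp add: diff_divide_distrib[symmetric] algebra_simps)
  moreover have "w - u \<le> E ?c"
    using less_psum_Suc_cnt[of w] psum_cnt_le[of u] assms by (simp add: psum_Suc)
  ultimately have b: "((w - u) / sq) ^ p \<le> H w - H u" using piece_bound[of "w - u" ?c] assms by simp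
  then have "(w - u) / sq \<le> root p (H w - H u)" using root_geI[OF p_pos b] sq assms by simp
  then show "w - u \<le> sq * root p (H w - H u)" using sq by (simp add: field_simps)
  have "0 \<le> ((w - u) / sq) ^ p" using assms sq by simp
  then show "H u \<le> H w" using b by simp
qed

text \<open>The time interval is cut into the rest of the running inter-event interval, the indices
  in between, and the elapsed part of the last one. The two incomplete pieces and the unit jump cost
  one root each; the chaining costs 1 for the long range and twice 6 for the dyadic levels, which
  makes 16.\<close>

lemma increment_bound_diff:
  assumes u: "0 \<le> u" "u \<le> w" and lt: "cnt u < cnt w"
  defines "l \<equiv> real (cnt w) - real (cnt u)"
  defines "D \<equiv> H w - H u"
  shows "\<bar>l - (w - u)\<bar> \<le> sq * (C' * (l / 2 ^ J)) + 16 * (sq * root p D)" "0 \<le> D"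
proof -
  let ?c = "cnt u" and ?c' = "cnt w"
  let ?M = "\<lambda>m. psum E m - real m"
  let ?first = "psum E (Suc ?c) - u" and ?last = "w - psum E ?c'"
  have first: "0 \<le> ?first" "?first \<le> E ?c"
    using less_psum_Suc_cnt[of u] psum_cnt_le[of u] u by (auto simp: psum_Suc)
  have last: "0 \<le> ?last" "?last \<le> E ?c'"
    using less_psum_Suc_cnt[of w] psum_cnt_le[of w] u by (auto simp: psum_Suc)
  have split: "{..<?c'} = {..<?c} \<union> {?c} \<union> {Suc ?c..<?c'}" using lt by auto
  have sum: "(\<Sum>q<?c'. \<eta> q) = (\<Sum>q<?c. \<eta> q) + \<eta> ?c + (\<Sum>q\<in>{Suc ?c..<?c'}. \<eta> q)"
    unfolding split by (subst sum.union_disjoint; (subst sum.union_disjoint)?) auto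
  define F where "F = ?first * E ?c ^ (p - 1) / sq ^ p"
  define L where "L = ?last * E ?c' ^ (p - 1) / sq ^ p"
  define S where "S = (\<Sum>q\<in>{Suc ?c..<?c'}. \<eta> q)"
  have F0: "0 \<le> F" "0 \<le> L" unfolding F_def L_def using first last E_nonneg sq by auto
  have S0: "0 \<le> S" unfolding S_def by (intro sum_nonneg \<eta>_nonneg)
  have one0: "0 \<le> (1 / sq) ^ p" using sq by simp
  have "E ?c ^ p = E ?c * E ?c ^ (p - 1)" using p_pos by (metis power_eq_if not_less0)
  then have "(E ?c / sq) ^ p = (u - psum E ?c) * E ?c ^ (p - 1) / sq ^ p + F"
    unfolding F_def psum_Suc by (simp add: power_divide add_divide_distrib[symmetric] diff_divide_distrib[symmetric] algebra_simps)
  \<comment> \<open>The summand at \<open>cnt u\<close> leaves room, after subtracting what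
    \<open>H u\<close> already contains, for the unfinished piece \<open>F\<close> and for
    \<open>(1 / sq) ^ p\<close>. The latter pays for the one renewal that ends this piece.\<close>
  then have D: "F + (1 / sq) ^ p + S + L \<le> D"
    using ctl_step[of ?c] unfolding D_def H_def sum S_def[symmetric] L_def by simp
  then show D0: "0 \<le> D" using F0 S0 one0 by linarith
  have rtI: "x \<le> sq * root p D" if "0 \<le> x" "(x / sq) ^ p \<le> D" for x
    using root_geI[OF p_pos that(2)] that(1) sq by (simp add: field_simps)
  have b1: "?first \<le> sq * root p D"
    using piece_bound[OF first] D F0 S0 one0 by (intro rtI first) (auto simp: F_def)
  have b2: "?last \<le> sq * root p D"
    using piece_bound[OF last] D F0 S0 one0 by (intro rtI last) (auto simp: L_def)
  have b3: "1 \<le> sq * root p D" using D F0 S0 by (intro rtI) auto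
  have SD: "S \<le> D" using D F0 one0 by linarith
  have \<eta>S: "\<eta> q \<le> D" if "Suc ?c \<le> q" "q < ?c'" for q
  proof -
    have "\<eta> q \<le> S" unfolding S_def using that \<eta>_nonneg by (intro member_le_sum) auto
    then show ?thesis using SD by linarith
  qed
  define W where "W i = sq * root p D * (17/20) ^ (J - i)" for i :: nat
  have rD: "0 \<le> root p D" using D0 by (rule real_root_ge_zero)
  note [simp del] = real_root_ge_0_iff
  have dy: "\<bar>?M (q + 2 ^ i) - ?M q\<bar> \<le> W i" if "i < J" "2 ^ i dvd q" "Suc ?c \<le> q" "q + 2 ^ i \<le> ?c'" for i q
  proof -
    define z where "z = \<bar>psum E (q + 2 ^ i) - psum E q - 2 ^ i\<bar> / sq"
    have z0: "0 \<le> z" using sq by (simp add: z_def)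
    have pos: "(0::nat) < 2 ^ i" by simp
    then have "q \<le> q + 2 ^ i - 1" "q + 2 ^ i - 1 < q + 2 ^ i" by linarith+
    then have "2 ^ ((J - i) * r) * z ^ p \<le> D"
      using ctl_dyadic[OF that(1,2)] \<eta>S[of "q + 2 ^ i - 1"] that(3,4) unfolding z_def by linarith
    then have "z ^ p \<le> D * (1/2) ^ ((J - i) * r)"
      by (simp only: power_divide power_one times_divide_eq_right mult_1_right pos_le_divide_eq zero_less_power zero_less_numeral mult.commute)
    \<comment> \<open>Here \<open>p = 4 * r\<close> enters: the factor
      \<open>2 ^ (- (J - i) * r)\<close> is the \<open>p\<close>-th power of
      \<open>2 ^ (- (J - i) / 4)\<close>, and \<open>(17/20) ^ 4 \<ge> 1/2\<close>.\<close>
    also have "\<dots> \<le> D * ((17/20) ^ 4) ^ ((J - i) * r)"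
      by (intro mult_left_mono power_mono D0) (auto simp: field_simps)
    also have "\<dots> = (root p D * (17/20) ^ (J - i)) ^ p"
    proof -
      have "((17/20::real) ^ 4) ^ ((J - i) * r) = ((17/20) ^ (J - i)) ^ p"
        by (simp only: power_mult[symmetric] mult_ac)
      then show ?thesis using real_root_pow_pos2[OF p_pos D0] by (simp only: power_mult_distrib)
    qed
    finally have "z \<le> root p D * (17/20) ^ (J - i)"
      using power_mono_iff[OF z0 _ p_pos, of "root p D * (17/20) ^ (J - i)"] rD by simp
    then show ?thesis unfolding W_def z_def using sq by (simp add: pos_divide_le_eq diff_diff_eq mult.commute mult.left_commute)
  qed
  let ?B = "sq * (C' * (l / 2 ^ J)) + sq * root p D"
  have l0: "0 \<le> l" using lt by (simp add: l_def)
  have base: "\<bar>?M x - ?M q\<bar> \<le> ?B"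
    if "Suc ?c \<le> q" "q \<le> x" "x \<le> ?c'" "2 ^ J dvd q" "2 ^ J dvd x" for q x
  proof -
    have "2 ^ J dvd x - q" using that(4,5) by (rule dvd_diff_nat[rotated])
    then obtain N where "x - q = 2 ^ J * N" by (rule dvdE)
    then have N: "x = q + N * 2 ^ J" using that(2) by (simp only: mult.commute)
    show ?thesis
    proof (cases "N = 0")
      case True then show ?thesis using N l0 sq C' rD by simp
    next
      case False
      define z where "z = \<bar>psum E x - psum E q - real N * 2 ^ J\<bar> / sq"
      have pos: "(0::nat) < 2 ^ J" "2 ^ J \<le> N * 2 ^ J" using False by auto
      \<comment> \<open>The index that carries the charge of this run is strictly below
        \<open>cnt w\<close> because the run contains at least one block.\<close>
      have "q + 2 ^ J - 1 < ?c'" "Suc ?c \<le> q + 2 ^ J - 1" using pos N that by linarith+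
      then have "max 0 (z - C' * real N) ^ p \<le> D"
        using ctl_long[OF that(4), of N] False \<eta>S[of "q + 2 ^ J - 1"] unfolding z_def N by linarith
      then have "max 0 (z - C' * real N) \<le> root p D" by (rule root_geI[OF p_pos]) simp
      then have "z \<le> C' * real N + root p D" by simp
      moreover have "C' * real N \<le> C' * (l / 2 ^ J)"
      proof (rule mult_left_mono[OF _ C'])
        have "N * 2 ^ J \<le> ?c' - ?c" using N that by linarith
        then have "real (N * 2 ^ J) \<le> real (?c' - ?c)" by (simp only: of_nat_le_iff)
        then have "real N * 2 ^ J \<le> l" using lt by (simp add: l_def of_nat_diff)
        then show "real N \<le> l / 2 ^ J" by (simp add: field_simps)
      qed
      ultimately have "z * sq \<le> (C' * (l / 2 ^ J) + root p D) * sq" using sq by simp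
      moreover have "\<bar>?M x - ?M q\<bar> = z * sq"
        unfolding z_def N using sq by (simp add: diff_diff_eq algebra_simps)
      ultimately show ?thesis by (simp only: distrib_right mult.commute[of sq])
    qed
  qed
  have "\<bar>?M ?c' - ?M (Suc ?c)\<bar> \<le> ?B + 2 * (\<Sum>i<J. W i)"
  proof (rule dyadic_chaining[where R = "Suc ?c" and X = ?c' and J = J and B = ?B])
    show "0 \<le> W i" for i unfolding W_def using rD sq by simp
    show "0 \<le> ?B" using rD sq l0 C' by simp
    show "Suc ?c \<le> ?c'" using lt by simp
  qed (use base dy in blast)+
  moreover have "(\<Sum>i<J. W i) \<le> sq * root p D * 6"
    unfolding W_def sum_distrib_left[symmetric] using rD sq by (intro mult_left_mono geometric_weights) auto
  ultimately have M: "\<bar>?M ?c' - ?M (Suc ?c)\<bar> \<le> sq * (C' * (l / 2 ^ J)) + 13 * (sq * root p D)" by linarith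
  have e: "l - (w - u) = 1 - ?first - ?last - (?M ?c' - ?M (Suc ?c))" by (simp add: l_def)
  show "\<bar>l - (w - u)\<bar> \<le> sq * (C' * (l / 2 ^ J)) + 16 * (sq * root p D)"
    using M b1 b2 b3 first(1) last(1) unfolding e abs_le_iff by (intro conjI; linarith)
qed

lemma H_mono: "0 \<le> u \<Longrightarrow> u \<le> w \<Longrightarrow> H u \<le> H w"
  using increment_bound_same(2)[of u w] increment_bound_diff(2)[of u w] cnt_mono[of u w]
  by (cases "cnt u = cnt w") auto

lemma H_0: "0 \<le> H 0"
proof -
  have "psum E (cnt 0) = 0"
    using psum_cnt_le[of 0] psum_mono[of 0 "cnt 0"] by simp
  then have "H 0 = (\<Sum>q<cnt 0. \<eta> q)" unfolding H_def by simp
  then show ?thesis using sum_nonneg[OF \<eta>_nonneg] by simp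
qed

lemma H_le: assumes "0 \<le> u" shows "H u \<le> (\<Sum>q\<le>cnt u. \<eta> q)"
proof -
  let ?c = "cnt u"
  have "u - psum E ?c \<le> E ?c" "0 \<le> u - psum E ?c"
    using less_psum_Suc_cnt[OF assms] psum_cnt_le[OF assms] by (auto simp: psum_Suc)
  then have "(u - psum E ?c) * E ?c ^ (p - 1) / sq ^ p \<le> E ?c * E ?c ^ (p - 1) / sq ^ p"
    using E_nonneg sq by (intro divide_right_mono mult_right_mono) auto
  also have "\<dots> = (E ?c / sq) ^ p" using p_pos by (metis power_eq_if not_less0 power_divide)
  also have "\<dots> \<le> \<eta> ?c" using ctl_step[of ?c] sq by (smt (verit) zero_le_power divide_nonneg_pos)
  finally show ?thesis unfolding H_def by (simp add: lessThan_Suc_atMost[symmetric])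
qed

text \<open>Absorption: the previous bound contains the number \<open>l\<close> of renewals itself.
  As \<open>eps \<le> 1/2\<close>, it first gives \<open>l \<le> 2 * (w - u) + 32 * z\<close>, and
  reinserting this replaces \<open>l\<close> by the clock increment at the price of doubling both
  constants.\<close>

lemma increment_bound:
  assumes u: "0 \<le> u" "u \<le> w" and eps: "sq * C' / 2 ^ J \<le> eps" "eps \<le> 1/2"
  shows "\<bar>real (cnt w) - real (cnt u) - (w - u)\<bar> \<le> 2 * eps * (w - u) + 32 * (sq * root p (H w - H u))"
proof -
  define l where "l = real (cnt w) - real (cnt u)"
  define z where "z = sq * root p (H w - H u)"
  have l0: "0 \<le> l" using cnt_mono[OF u] by (simp add: l_def)
  have z0: "0 \<le> z" proof -
    have "0 \<le> root p (H w - H u)" using H_mono[OF u] by (intro real_root_ge_zero) linarith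
    then show ?thesis unfolding z_def using sq by (simp del: real_root_ge_0_iff)
  qed
  have e0: "0 \<le> eps" using eps sq C' by (smt (verit) divide_nonneg_pos mult_nonneg_nonneg zero_less_power)
  have *: "\<bar>l - (w - u)\<bar> \<le> eps * l + 16 * z"
  proof (cases "cnt u = cnt w")
    case True
    then have "l = 0" by (simp add: l_def)
    then show ?thesis using increment_bound_same(1)[OF u True] z0 u unfolding z_def by simp
  next
    case False
    then have "\<bar>l - (w - u)\<bar> \<le> sq * (C' * (l / 2 ^ J)) + 16 * z"
      using increment_bound_diff(1)[OF u] cnt_mono[OF u] unfolding l_def z_def by simp
    moreover have "sq * (C' * (l / 2 ^ J)) = sq * C' / 2 ^ J * l" by simp
    moreover have "sq * C' / 2 ^ J * l \<le> eps * l" by (rule mult_right_mono[OF eps(1) l0])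
    ultimately show ?thesis by linarith
  qed
  have ar: "\<And>a b l d z::real. \<bar>l - d\<bar> \<le> a + 16 * z \<Longrightarrow> a \<le> l / 2 \<Longrightarrow> l \<le> 2 * d + 32 * z"
    "\<And>a b l d z::real. \<bar>l - d\<bar> \<le> a + 16 * z \<Longrightarrow> a \<le> b + 16 * z \<Longrightarrow> \<bar>l - d\<bar> \<le> b + 32 * z"
    by (simp_all add: abs_le_iff)
  have "eps * l \<le> l / 2" using mult_right_mono[OF eps(2) l0] by simp
  then have "l \<le> 2 * (w - u) + 32 * z" by (rule ar(1)[OF *])
  then have "eps * l \<le> eps * (2 * (w - u) + 32 * z)" by (rule mult_left_mono[OF _ e0])
  also have "\<dots> = 2 * eps * (w - u) + eps * (32 * z)" by (simp add: algebra_simps)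
  also have "\<dots> \<le> 2 * eps * (w - u) + 1/2 * (32 * z)" using eps z0 by (intro add_left_mono mult_right_mono) auto
  finally have "eps * l \<le> 2 * eps * (w - u) + 16 * z" by simp
  then have "\<bar>l - (w - u)\<bar> \<le> 2 * eps * (w - u) + 32 * z" by (rule ar(2)[OF *])
  then show ?thesis unfolding l_def z_def .
qed

end

section \<open>Down times\<close>

text \<open>Down times are of order \<open>1 / sq\<close> and their number per unit time is bounded,
  and only an upper bound for the lost time is wanted. So no dyadic levels occur: it suffices to
  control single down times and the excess of \<open>sq * dn\<close> over \<open>CU\<close> times
  the up times along any run of cycles.\<close>

locale down_control =
  fixes u dn :: "nat \<Rightarrow> real" and sq CU :: real and p :: nat and \<eta> :: "nat \<Rightarrow> real"
  assumes u_nonneg: "u k \<ge> 0" and dn_nonneg: "dn k \<ge> 0"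
    and cycles_unbounded: "\<exists>m. psum u m > x"
    and sq: "sq > 0" and CU: "CU \<ge> 0" and p: "p > 0"
    and ctl_step: "\<And>q. (sq * dn q) ^ p \<le> \<eta> q"
    and ctl_long: "\<And>N q. N > 0 \<Longrightarrow> max 0 (\<Sum>j\<in>{q..<q + N}. sq * dn j - CU * u j) ^ p \<le> \<eta> q"
begin

definition "cyc k = u k + dn k"

lemma psum_u_le: "psum u m \<le> psum cyc m"
  unfolding psum_def cyc_def by (intro sum_mono) (simp add: dn_nonneg)

sublocale renewal_path cyc
proof
  show "0 \<le> cyc k" for k using u_nonneg dn_nonneg by (simp add: cyc_def)
  show "\<exists>m. x < psum cyc m" for x
    using cycles_unbounded[of x] psum_u_le less_le_trans by blast
qed

abbreviation "T \<equiv> psum cyc"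
definition "off t = max 0 (t - T (cnt t) - u (cnt t))"
definition "down t = psum dn (cnt t) + off t"
text \<open>The interpolation is the one used for renewals, but it advances only while the servers
  are down.\<close>

definition "H t = (\<Sum>q<cnt t. \<eta> q) + off t * sq * (sq * dn (cnt t)) ^ (p - 1)"

lemma cycle_start_eq: "cycle_start u dn k = T k"
  by (simp add: cycle_start_def psum_def cyc_def)

lemma up_indicator_eq:
  assumes "t \<ge> 0" shows "up_indicator u dn t = (if t < T (cnt t) + u (cnt t) then 1 else 0)"
proof -
  have "(\<exists>k. T k \<le> t \<and> t < T k + u k) \<longleftrightarrow> t < T (cnt t) + u (cnt t)"
  proof
    assume "\<exists>k. T k \<le> t \<and> t < T k + u k"
    then obtain k where k: "T k \<le> t" "t < T k + u k" by blast
    have "k \<le> cnt t" using k(1) psum_le_iff[OF assms] by simp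
    moreover have "\<not> k < cnt t"
    proof
      assume "k < cnt t"
      then have "T (Suc k) \<le> T (cnt t)" by (intro psum_mono) simp
      then show False using k psum_cnt_le[OF assms] dn_nonneg[of k] by (simp add: psum_Suc cyc_def)
    qed
    ultimately show "t < T (cnt t) + u (cnt t)" using k by simp
  qed (use psum_cnt_le[OF assms] in blast)
  then show ?thesis unfolding up_indicator_def cycle_start_eq by simp
qed

lemma off_bounds: assumes "t \<ge> 0" shows "0 \<le> off t" "off t \<le> dn (cnt t)"
  using less_psum_Suc_cnt[OF assms] dn_nonneg[of "cnt t"] by (auto simp: off_def psum_Suc cyc_def)

lemma \<eta>_nonneg: "0 \<le> \<eta> q"
proof -
  have "0 \<le> (sq * dn q) ^ p" using sq dn_nonneg[of q] by simp
  then show ?thesis using ctl_step[of q] by linarith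
qed

lemma down_in_cycle:
  assumes t: "T c \<le> t" "t \<le> T (Suc c)"
  shows "((\<lambda>r. 1 - up_indicator u dn r) has_integral max 0 (t - T c - u c)) {T c..t}"
proof -
  have T0: "0 \<le> T c" using psum_mono[of 0 c] by simp
  let ?f = "\<lambda>r. if r < T c + u c then 0 else 1 :: real"
  \<comment> \<open>At \<open>T (Suc c)\<close> the cycle index has already advanced, possibly over
    several cycles of length zero. Hence the identification leaves out this single point, which the
    integral ignores.\<close>
  have ind: "1 - up_indicator u dn r = ?f r" if "r \<in> {T c..t} - {T (Suc c)}" for r
  proof -
    have "c \<le> cnt r" "\<not> Suc c \<le> cnt r"
      using that t T0 psum_le_iff[of r c] psum_le_iff[of r "Suc c"] by auto
    then have "cnt r = c" by simp
    then show ?thesis using up_indicator_eq[of r] that T0 by simp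
  qed
  have "(?f has_integral max 0 (t - T c - u c)) {T c..t}"
  proof (cases "t \<le> T c + u c")
    case True
    have "((\<lambda>r. 0::real) has_integral 0) {T c..t}" by simp
    then have "(?f has_integral 0) {T c..t}"
      by (rule has_integral_spike[where S = "{t}", rotated 2]) (use True in auto)
    then show ?thesis using True by simp
  next
    case False
    have "((\<lambda>r. 0::real) has_integral 0) {T c..T c + u c}" by simp
    then have 1: "(?f has_integral 0) {T c..T c + u c}"
      by (rule has_integral_spike[where S = "{T c + u c}", rotated 2]) auto
    have "((\<lambda>r. 1::real) has_integral (t - (T c + u c))) {T c + u c..t}"
      using has_integral_const_real[of "1::real" "T c + u c" t] False by (simp del: has_integral_const_real)
    then have 2: "(?f has_integral (t - (T c + u c))) {T c + u c..t}"
      by (rule has_integral_spike[where S = "{}", rotated 2]) auto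
    show ?thesis using has_integral_combine[OF _ _ 1 2] False u_nonneg[of c] by (simp add: algebra_simps)
  qed
  then show ?thesis
    by (rule has_integral_spike[where S = "{T (Suc c)}", rotated 2]) (use ind in auto)
qed

lemma down_upto_cycle: "((\<lambda>r. 1 - up_indicator u dn r) has_integral psum dn k) {0..T k}"
proof (induction k)
  case 0 then show ?case by (simp add: psum_0 has_integral_refl)
next
  case (Suc k)
  have "((\<lambda>r. 1 - up_indicator u dn r) has_integral max 0 (T (Suc k) - T k - u k)) {T k..T (Suc k)}"
    by (rule down_in_cycle) (use psum_mono in auto)
  moreover have "max 0 (T (Suc k) - T k - u k) = dn k" using dn_nonneg[of k] by (simp add: psum_Suc cyc_def)
  ultimately show ?case
    using has_integral_combine[OF _ _ Suc] psum_mono[of 0 k] psum_mono[of k "Suc k"]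
    by (simp add: psum_Suc)
qed

lemma down_has_integral:
  assumes "t \<ge> 0" shows "((\<lambda>r. 1 - up_indicator u dn r) has_integral down t) {0..t}"
  using has_integral_combine[OF _ _ down_upto_cycle[of "cnt t"] down_in_cycle[of "cnt t" t]]
    psum_cnt_le[OF assms] less_psum_Suc_cnt[OF assms] psum_mono[of 0 "cnt t"]
  by (simp add: down_def off_def)

lemma down_piece:
  assumes "0 \<le> x" "x \<le> dn c"
  shows "(sq * x) ^ p \<le> x * sq * (sq * dn c) ^ (p - 1)"
proof -
  have "(sq * x) ^ p = (sq * x) * (sq * x) ^ (p - 1)" using p by (metis power_eq_if not_less0)
  also have "\<dots> \<le> (sq * x) * (sq * dn c) ^ (p - 1)"
    using assms sq by (intro mult_left_mono power_mono) auto
  finally show ?thesis by (simp add: mult_ac)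
qed

text \<open>One root each is spent on the rest of the current down time, the elapsed part of the
  last one, and the complete cycles in between. The up times of the latter fit into the interval
  from \<open>s\<close> to \<open>t\<close>, which yields the linear term.\<close>

lemma down_increment:
  assumes s: "0 \<le> s" "s \<le> t"
  shows "H s \<le> H t" "sq * (down t - down s) \<le> CU * (t - s) + 3 * root p (H t - H s)"
proof -
  let ?c = "cnt s" and ?c' = "cnt t"
  define D where "D = H t - H s"
  have t0: "0 \<le> t" using s by simp
  note os = off_bounds[OF s(1)] and ot = off_bounds[OF t0]
  have CUts: "0 \<le> CU * (t - s)" using CU s by simp
  have le: "?c \<le> ?c'" by (rule cnt_mono[OF s])
  have rtI: "sq * x \<le> root p D" if "0 \<le> x" "(sq * x) ^ p \<le> D" for x
    using root_geI[OF p that(2)] that(1) sq by simp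
  have *: "0 \<le> D \<and> sq * (down t - down s) \<le> CU * (t - s) + 3 * root p D"
  proof (cases "?c = ?c'")
    case True
    let ?x = "off t - off s"
    have x: "0 \<le> ?x" "?x \<le> dn ?c'" using True s os ot unfolding off_def by auto
    have "D = ?x * sq * (sq * dn ?c') ^ (p - 1)" unfolding D_def H_def True by (simp add: algebra_simps)
    then have b: "(sq * ?x) ^ p \<le> D" using down_piece[OF x] by simp
    have "0 \<le> (sq * ?x) ^ p" using x sq by simp
    then have D0: "0 \<le> D" using b by linarith
    have "sq * (down t - down s) = sq * ?x" unfolding down_def True by simp
    then show ?thesis using rtI[OF x(1) b] D0 CUts real_root_ge_zero[OF D0, of p] by linarith
  next
    case False
    then have lt: "?c < ?c'" using le by simp
    have split: "{..<?c'} = {..<?c} \<union> {?c} \<union> {Suc ?c..<?c'}" using lt by auto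
    have sum: "(\<Sum>q<?c'. f q) = (\<Sum>q<?c. f q) + f ?c + (\<Sum>q\<in>{Suc ?c..<?c'}. f q)" for f :: "nat \<Rightarrow> real"
      unfolding split by (subst sum.union_disjoint; (subst sum.union_disjoint)?) auto
    define F where "F = (dn ?c - off s) * sq * (sq * dn ?c) ^ (p - 1)"
    define L where "L = off t * sq * (sq * dn ?c') ^ (p - 1)"
    define S where "S = (\<Sum>q\<in>{Suc ?c..<?c'}. \<eta> q)"
    have F0: "0 \<le> F" "0 \<le> L" unfolding F_def L_def using os ot dn_nonneg sq by auto
    have S0: "0 \<le> S" unfolding S_def by (intro sum_nonneg \<eta>_nonneg)
    have "(sq * dn ?c) ^ p = (sq * dn ?c) * (sq * dn ?c) ^ (p - 1)" using p by (metis power_eq_if not_less0)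
    then have "(sq * dn ?c) ^ p = off s * sq * (sq * dn ?c) ^ (p - 1) + F"
      unfolding F_def by (simp add: algebra_simps)
    then have D: "F + S + L \<le> D"
      using ctl_step[of ?c] unfolding D_def H_def sum[of \<eta>] S_def[symmetric] L_def by simp
    then have D0: "0 \<le> D" using F0 S0 by linarith
    have b1: "sq * (dn ?c - off s) \<le> root p D"
      by (rule rtI) (use down_piece[of "dn ?c - off s" ?c] os dn_nonneg D F0 S0 in \<open>auto simp: F_def\<close>)
    have b2: "sq * off t \<le> root p D"
      by (rule rtI) (use down_piece[of "off t" ?c'] ot D F0 S0 in \<open>auto simp: L_def\<close>)
    define G where "G = (\<Sum>j\<in>{Suc ?c..<?c'}. dn j)"
    have b3: "sq * G \<le> CU * (t - s) + root p D"
    proof (cases "Suc ?c = ?c'")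
      case True then show ?thesis using CUts real_root_ge_zero[OF D0, of p] by (simp add: G_def)
    next
      case False
      then have N: "Suc ?c + (?c' - Suc ?c) = ?c'" "?c' - Suc ?c > 0" "Suc ?c < ?c'" using lt by auto
      define Y where "Y = (\<Sum>j\<in>{Suc ?c..<?c'}. sq * dn j - CU * u j)"
      define V where "V = (\<Sum>j\<in>{Suc ?c..<?c'}. u j)"
      have "max 0 Y ^ p \<le> \<eta> (Suc ?c)" unfolding Y_def using ctl_long[OF N(2), of "Suc ?c"] N(1) by simp
      also have "\<dots> \<le> S" unfolding S_def using N(3) \<eta>_nonneg by (intro member_le_sum) auto
      also have "\<dots> \<le> D" using D F0 by linarith
      finally have "max 0 Y \<le> root p D" by (rule root_geI[OF p]) simp
      then have Y: "Y \<le> root p D" by simp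
      have Yeq: "Y = sq * G - CU * V" unfolding Y_def G_def V_def by (simp add: sum_subtractf sum_distrib_left)
      have "V \<le> (\<Sum>j\<in>{Suc ?c..<?c'}. cyc j)"
        unfolding V_def by (intro sum_mono) (simp add: cyc_def dn_nonneg)
      also have "\<dots> = T ?c' - T (Suc ?c)" using sum[of cyc] by (simp add: psum_def)
      also have "\<dots> \<le> t - s" using psum_cnt_le[OF t0] less_psum_Suc_cnt[OF s(1)] by simp
      finally have "CU * V \<le> CU * (t - s)" by (rule mult_left_mono[OF _ CU])
      then show ?thesis using Y Yeq by linarith
    qed
    have "down t - down s = (dn ?c - off s) + G + off t"
      unfolding down_def G_def psum_def sum[of dn] by simp
    then have "sq * (down t - down s) = sq * (dn ?c - off s) + sq * G + sq * off t"
      by (simp only: distrib_left)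
    then show ?thesis using b1 b2 b3 D0 by linarith
  qed
  then show "H s \<le> H t" "sq * (down t - down s) \<le> CU * (t - s) + 3 * root p (H t - H s)"
    unfolding D_def by auto
qed

lemma H_0: "0 \<le> H 0"
  unfolding H_def using off_bounds[of 0] sq dn_nonneg
  by (intro add_nonneg_nonneg sum_nonneg mult_nonneg_nonneg zero_le_power \<eta>_nonneg) auto

lemma H_le: assumes "0 \<le> t" shows "H t \<le> (\<Sum>q\<le>cnt t. \<eta> q)"
proof -
  let ?c = "cnt t"
  have "off t * sq * (sq * dn ?c) ^ (p - 1) \<le> dn ?c * sq * (sq * dn ?c) ^ (p - 1)"
    using off_bounds[OF assms] sq dn_nonneg by (intro mult_right_mono) auto
  also have "\<dots> = (sq * dn ?c) ^ p" using p by (metis power_eq_if not_less0 mult.commute)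
  also have "\<dots> \<le> \<eta> ?c" by (rule ctl_step)
  finally show ?thesis unfolding H_def by (simp add: lessThan_Suc_atMost[symmetric])
qed

end

section \<open>Paths driven by a restoring drift\<close>

text \<open>Jensen for the points \<open>a\<close> and \<open>z / (1 - \<rho>)\<close> with weights
  \<open>\<rho>\<close> and \<open>1 - \<rho>\<close>. In this form a contraction keeps its factor
  \<open>\<rho>\<close> when it is raised to the power \<open>p\<close>.\<close>

lemma convex_power_comb:
  fixes a z \<rho> :: real
  assumes "0 \<le> a" "0 \<le> z" "0 \<le> \<rho>" "\<rho> < 1"
  shows "(\<rho> * a + z) ^ p \<le> \<rho> * a ^ p + (1 - \<rho>) * (z / (1 - \<rho>)) ^ p"
proof -
  have "convex_on {0::real..} (\<lambda>x. x ^ p)"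
    using convex_power_odd[of p] convex_on_subset[OF convex_power_even[of p]] by (cases "even p") auto
  from convex_onD[OF this, of "1 - \<rho>" a "z / (1 - \<rho>)"] assms
  show ?thesis by simp
qed

lemma power_sum_le:
  fixes f :: "'b \<Rightarrow> real"
  assumes "finite A" "\<And>i. i \<in> A \<Longrightarrow> 0 \<le> f i" "p > 0"
  shows "(\<Sum>i\<in>A. f i) ^ p \<le> real (card A) ^ p * (\<Sum>i\<in>A. f i ^ p)"
proof (cases "A = {}")
  case True then show ?thesis using assms(3) by (simp add: power_0_left)
next
  case False
  define m where "m = Max (f ` A)"
  have m: "m \<in> f ` A" unfolding m_def using assms(1) False by simp
  then obtain j where j: "j \<in> A" "m = f j" by blast
  have "(\<Sum>i\<in>A. f i) \<le> real (card A) * m"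
    using sum_bounded_above[of A f m] assms(1) by (simp add: m_def)
  then have "(\<Sum>i\<in>A. f i) ^ p \<le> (real (card A) * m) ^ p" using assms(2) by (intro power_mono sum_nonneg) auto
  also have "\<dots> = real (card A) ^ p * f j ^ p" by (simp add: power_mult_distrib j)
  also have "\<dots> \<le> real (card A) ^ p * (\<Sum>i\<in>A. f i ^ p)"
    using assms j by (intro mult_left_mono member_le_sum) auto
  finally show ?thesis .
qed

lemma power_add_le: fixes a b :: real
  assumes "0 \<le> a" "0 \<le> b" "p > 0" shows "(a + b) ^ p \<le> 2 ^ p * (a ^ p + b ^ p)"
  using power_sum_le[of "{0,1::nat}" "\<lambda>i. if i = 0 then a else b" p] assms by simp

lemma power_add3_le: fixes a b c :: real
  assumes "0 \<le> a" "0 \<le> b" "0 \<le> c" "p > 0" shows "(a + b + c) ^ p \<le> 3 ^ p * (a ^ p + b ^ p + c ^ p)"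
  using power_sum_le[of "{0,1,2::nat}" "\<lambda>i. if i = 0 then a else if i = 1 then b else c" p] assms
  by (simp add: add.assoc)

lemma power_add4_le: fixes a b c e :: real
  assumes "0 \<le> a" "0 \<le> b" "0 \<le> c" "0 \<le> e" "p > 0"
  shows "(a + b + c + e) ^ p \<le> 4 ^ p * (a ^ p + b ^ p + c ^ p + e ^ p)"
  using power_sum_le[of "{0,1,2,3::nat}" "\<lambda>i. if i = 0 then a else if i = 1 then b else if i = 2 then c else e" p] assms
  by (simp add: add.assoc)

lemma power_le_1_power: fixes x :: real
  assumes "0 \<le> x" "k \<le> p" shows "x ^ k \<le> 1 + x ^ p"
proof (cases "x \<le> 1")
  case True then show ?thesis using assms power_le_one[of x k] zero_le_power[of x p] by linarith
next
  case False
  then have "x ^ k \<le> x ^ p" using assms by (intro power_increasing) auto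
  then show ?thesis by simp
qed

text \<open>The path \<open>y\<close> may jump. The allowance \<open>v\<close> covers the noise over
  any subinterval of the window, so each estimate below should use as few subintervals as
  possible.\<close>

locale driven =
  fixes y b :: "real \<Rightarrow> real" and \<alpha> \<beta> v :: real
  assumes b: "b integrable_on {\<alpha>..\<beta>}" and v: "v \<ge> 0"
    and inc: "\<And>s t. \<alpha> \<le> s \<Longrightarrow> s \<le> t \<Longrightarrow> t \<le> \<beta> \<Longrightarrow> y t - y s \<le> integral {s..t} b + v"
begin

lemma b_sub: "\<alpha> \<le> s \<Longrightarrow> t \<le> \<beta> \<Longrightarrow> b integrable_on {s..t}"
  using integrable_on_subinterval[OF b, of s t] by auto

lemma above:
  assumes "\<alpha> \<le> s" "s \<le> t" "t \<le> \<beta>" "\<And>r. s < r \<Longrightarrow> r \<le> t \<Longrightarrow> b r \<le> g"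
  shows "y t \<le> y s + v + g * (t - s)"
proof -
  have bi: "b integrable_on {s..t}" using b_sub assms by simp
  have "integral {s..t} b = integral {s..t} (\<lambda>r. if r = s then g else b r)"
    by (rule integral_spike[where S = "{s}"]) auto
  also have "\<dots> \<le> integral {s..t} (\<lambda>r. g)"
  proof (rule integral_le)
    show "(\<lambda>r. if r = s then g else b r) integrable_on {s..t}"
      by (rule integrable_spike[OF bi, where S = "{s}"]) auto
  qed (use assms in auto)
  finally show ?thesis using inc[OF assms(1-3)] assms(2) by (simp add: mult.commute)
qed

text \<open>The path is followed from its last visit to values at most \<open>lv\<close>. After that
  visit the drift is at most \<open>g\<close>, and only one interval, hence one \<open>v\<close>, is
  involved.\<close>

lemma after_dip:
  assumes st: "\<alpha> \<le> s" "s \<le> t" "t \<le> \<beta>" and r: "s \<le> r" "r \<le> t" "y r \<le> lv" and g: "0 \<le> g"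
    and drift: "\<And>r. s \<le> r \<Longrightarrow> r \<le> t \<Longrightarrow> y r > lv \<Longrightarrow> b r \<le> g"
  shows "y t \<le> lv + v + g * (t - s)"
proof -
  define A where "A = {q \<in> {s..t}. y q \<le> lv}"
  define z where "z = Sup A"
  have ne: "A \<noteq> {}" using r by (auto simp: A_def)
  have bdd: "bdd_above A" by (auto simp: A_def)
  have zs: "s \<le> z" "z \<le> t"
    unfolding z_def using cSup_least[OF ne, of t] cSup_upper[OF _ bdd, of r] r by (auto simp: A_def)
  have above_z: "y q > lv" if "z < q" "q \<le> t" for q
    using that zs cSup_upper[OF _ bdd, of q] unfolding z_def A_def by force
  have bi: "b integrable_on {s..t}" using b_sub st by simp
  \<comment> \<open>The supremum \<open>z\<close> of the visits need not be a visit, because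
    \<open>y\<close> may jump. A visit \<open>q\<close> shortly before \<open>z\<close> is used
    instead, and continuity of the indefinite integral makes the drift between \<open>q\<close> and
    \<open>z\<close> smaller than \<open>e\<close>.\<close>
  have "y t \<le> lv + v + g * (t - s) + e" if e: "e > 0" for e
  proof -
    have cont: "continuous_on {s..t} (\<lambda>x. integral {s..x} b)" by (rule indefinite_integral_continuous_1[OF bi])
    then obtain \<delta> where \<delta>: "\<delta> > 0" "\<And>x. x \<in> {s..t} \<Longrightarrow> dist x z < \<delta> \<Longrightarrow>
        dist (integral {s..x} b) (integral {s..z} b) < e"
      using zs e unfolding continuous_on_iff by (metis atLeastAtMost_iff)
    obtain q where q: "q \<in> A" "z - \<delta> < q" using less_cSupD[OF ne, of "z - \<delta>"] \<delta>(1) unfolding z_def by auto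
    have qz: "q \<le> z" unfolding z_def by (rule cSup_upper[OF q(1) bdd])
    have qs: "s \<le> q" "q \<le> t" "y q \<le> lv" using q by (auto simp: A_def)
    have "dist (integral {s..q} b) (integral {s..z} b) < e" using \<delta>(2)[of q] qs q qz by (simp add: dist_real_def)
    moreover have "integral {s..q} b + integral {q..z} b = integral {s..z} b"
      using Henstock_Kurzweil_Integration.integral_combine[OF qs(1) qz] b_sub[of s z] st zs by auto
    ultimately have 1: "integral {q..z} b < e" by (simp add: dist_real_def)
    have 2: "integral {q..t} b = integral {q..z} b + integral {z..t} b"
      by (rule Henstock_Kurzweil_Integration.integral_combine[OF qz zs(2), symmetric]) (use b_sub[of q t] st qs in auto)
    have "integral {z..t} b = integral {z..t} (\<lambda>r. if r = z then g else b r)"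
      by (rule integral_spike[where S = "{z}"]) auto
    also have "\<dots> \<le> integral {z..t} (\<lambda>r. g)"
    proof (rule integral_le)
      show "(\<lambda>r. if r = z then g else b r) integrable_on {z..t}"
        by (rule integrable_spike[OF b_sub[of z t], where S = "{z}"]) (use st zs in auto)
    qed (use above_z drift zs in auto)
    also have "\<dots> = g * (t - z)" using zs by (simp add: mult.commute)
    also have "\<dots> \<le> g * (t - s)" using zs g by (intro mult_left_mono) auto
    finally have 3: "integral {z..t} b \<le> g * (t - s)" .
    have "y t - y q \<le> integral {q..t} b + v" using inc[of q t] qs st by simp
    then show ?thesis using 1 2 3 qs by linarith
  qed
  then show ?thesis by (rule field_le_epsilon)
qed

lemma no_cross:
  assumes st: "\<alpha> \<le> s" "s \<le> t" "t \<le> \<beta>" and g: "0 \<le> g"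
    and drift: "\<And>r. s \<le> r \<Longrightarrow> r \<le> t \<Longrightarrow> y r > lv \<Longrightarrow> b r \<le> g"
  shows "y t \<le> max lv (y s) + v + g * (t - s)"
proof (cases "\<exists>r. s \<le> r \<and> r \<le> t \<and> y r \<le> lv")
  case True
  then show ?thesis using after_dip[OF st _ _ _ g drift] by fastforce
next
  case False
  then show ?thesis using above[OF st, of g] drift by (smt (verit) less_imp_le)
qed

text \<open>Two cases. If the path reaches half of its starting height, it ends near that half at
  most, and \<open>1/2 \<le> 1 - c / 2\<close> because \<open>c \<le> 1\<close>. Otherwise the drift
  is at most \<open>g - c * a / 2\<close> throughout, with \<open>a\<close> the starting height, and
  unit time turns this into the factor \<open>1 - c / 2\<close>.\<close>

lemma unit_contraction:
  assumes \<beta>: "\<beta> = \<alpha> + 1" and g: "0 \<le> g" and c: "0 < c" "c \<le> 1"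
    and drift: "\<And>r. \<alpha> \<le> r \<Longrightarrow> r \<le> \<beta> \<Longrightarrow> y r > 0 \<Longrightarrow> b r \<le> g"
    and drift': "\<And>r. \<alpha> \<le> r \<Longrightarrow> r \<le> \<beta> \<Longrightarrow> y r > max 0 (y \<alpha>) / 2 \<Longrightarrow> b r \<le> g - c * (max 0 (y \<alpha>) / 2)"
  shows "\<And>t. \<alpha> \<le> t \<Longrightarrow> t \<le> \<beta> \<Longrightarrow> y t \<le> max 0 (y \<alpha>) + v + g"
    and "max 0 (y \<beta>) \<le> (1 - c / 2) * max 0 (y \<alpha>) + v + g"
proof -
  let ?a = "max 0 (y \<alpha>)"
  fix t assume t: "\<alpha> \<le> t" "t \<le> \<beta>"
  have "y t \<le> max 0 (y \<alpha>) + v + g * (t - \<alpha>)" using no_cross[of \<alpha> t g 0] t g drift by simp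
  moreover have "g * (t - \<alpha>) \<le> g * 1" using g t \<beta> by (intro mult_left_mono) auto
  ultimately show "y t \<le> ?a + v + g" by simp
next
  let ?a = "max 0 (y \<alpha>)"
  have a0: "0 \<le> (1 - c / 2) * ?a" using c by simp
  have "y \<beta> \<le> (1 - c / 2) * ?a + v + g"
  proof (cases "\<exists>r. \<alpha> \<le> r \<and> r \<le> \<beta> \<and> y r \<le> ?a / 2")
    case True
    then obtain r where r: "\<alpha> \<le> r" "r \<le> \<beta>" "y r \<le> ?a / 2" by blast
    have "y \<beta> \<le> max 0 (y r) + v + g * (\<beta> - r)" using no_cross[of r \<beta> g 0] r g drift by simp
    moreover have "g * (\<beta> - r) \<le> g * 1" using g r \<beta> by (intro mult_left_mono) auto
    moreover have "1/2 * ?a \<le> (1 - c / 2) * ?a" using c by (intro mult_right_mono) auto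
    ultimately show ?thesis using r by (simp add: max_def split: if_splits)
  next
    case False
    then have "b r \<le> g - c * (?a / 2)" if "\<alpha> < r" "r \<le> \<beta>" for r using drift'[of r] that by force
    from above[OF _ _ _ this, of \<alpha> \<beta>] have "y \<beta> \<le> y \<alpha> + v + (g - c * (?a / 2))" using \<beta> by simp
    then show ?thesis by (simp add: algebra_simps)
  qed
  then show "max 0 (y \<beta>) \<le> (1 - c / 2) * ?a + v + g" using a0 v g by simp
qed

end

text \<open>By Jensen the recursion survives the \<open>p\<close>-th power with the factor
  \<open>1 - c / 2\<close>. Adding it over \<open>m\<close> telescopes and leaves
  \<open>c / 2\<close> times the sum of the powers on the left.\<close>

lemma contraction_sum:
  fixes a z :: "nat \<Rightarrow> real"
  assumes a: "\<And>m. m \<le> N \<Longrightarrow> 0 \<le> a m" and z: "\<And>m. m < N \<Longrightarrow> 0 \<le> z m" and c: "0 < c" "c \<le> 1" and p: "p > 0"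
    and rec: "\<And>m. m < N \<Longrightarrow> a (Suc m) \<le> (1 - c / 2) * a m + z m"
  shows "(\<Sum>m<N. (a m + z m) ^ p) \<le> 2 ^ p * ((2 / c) ^ Suc p + 1) * (a 0 ^ p + (\<Sum>m<N. z m ^ p))"
proof -
  define Z where "Z = (\<Sum>m<N. z m ^ p)"
  have Z0: "0 \<le> Z" unfolding Z_def using z by (intro sum_nonneg) auto
  have K1: "2 / c \<ge> 1" using c by simp
  have step: "a (Suc m) ^ p \<le> (1 - c / 2) * a m ^ p + (2 / c) ^ p * z m ^ p" if "m < N" for m
  proof -
    have "a (Suc m) ^ p \<le> ((1 - c / 2) * a m + z m) ^ p"
      using rec[OF that] a[of "Suc m"] that by (intro power_mono) auto
    also have "\<dots> \<le> (1 - c / 2) * a m ^ p + (1 - (1 - c / 2)) * (z m / (1 - (1 - c / 2))) ^ p"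
      using a[of m] z[OF that] c that by (intro convex_power_comb) auto
    also have "(1 - (1 - c / 2)) * (z m / (1 - (1 - c / 2))) ^ p \<le> 1 * (z m / (1 - (1 - c / 2))) ^ p"
      using c z[OF that] by (intro mult_right_mono) auto
    also have "\<dots> = (2 / c) ^ p * z m ^ p" by (simp add: power_divide power_mult_distrib)
    finally show ?thesis by simp
  qed
  have "a k ^ p + (c / 2) * (\<Sum>m<k. a m ^ p) \<le> a 0 ^ p + (2 / c) ^ p * (\<Sum>m<k. z m ^ p)" if "k \<le> N" for k
    using that
  proof (induction k)
    case (Suc k) then show ?case using step[of k] by (simp add: algebra_simps)
  qed simp
  from this[of N] have "(c / 2) * (\<Sum>m<N. a m ^ p) \<le> a 0 ^ p + (2 / c) ^ p * Z"
    using zero_le_power[OF a[of N], of p] unfolding Z_def by linarith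
  then have "(2 / c) * ((c / 2) * (\<Sum>m<N. a m ^ p)) \<le> (2 / c) * (a 0 ^ p + (2 / c) ^ p * Z)"
    using c by (intro mult_left_mono) auto
  then have S: "(\<Sum>m<N. a m ^ p) \<le> (2 / c) * (a 0 ^ p + (2 / c) ^ p * Z)" using c by simp
  have "(\<Sum>m<N. (a m + z m) ^ p) \<le> (\<Sum>m<N. 2 ^ p * (a m ^ p + z m ^ p))"
    using a z p by (intro sum_mono power_add_le) auto
  also have "\<dots> = 2 ^ p * ((\<Sum>m<N. a m ^ p) + Z)" by (simp add: sum_distrib_left[symmetric] sum.distrib Z_def)
  also have "\<dots> \<le> 2 ^ p * ((2 / c) * (a 0 ^ p + (2 / c) ^ p * Z) + Z)" using S by simp
  also have "\<dots> \<le> 2 ^ p * ((2 / c) ^ Suc p * a 0 ^ p + (2 / c) ^ Suc p * Z + (a 0 ^ p + Z))"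
  proof -
    have "(2 / c) * 1 \<le> (2 / c) * (2 / c) ^ p" using one_le_power[OF K1, of p] c by (intro mult_left_mono) auto
    then have "(2 / c) * a 0 ^ p \<le> (2 / c) ^ Suc p * a 0 ^ p" using a[of 0] by (intro mult_right_mono) auto
    moreover have "(2 / c) * (a 0 ^ p + (2 / c) ^ p * Z) = (2 / c) * a 0 ^ p + (2 / c) ^ Suc p * Z"
      by (simp only: distrib_left power_Suc mult.assoc)
    moreover have "0 \<le> a 0 ^ p" using a[of 0] by simp
    ultimately have "(2 / c) * (a 0 ^ p + (2 / c) ^ p * Z) + Z \<le> (2 / c) ^ Suc p * a 0 ^ p + (2 / c) ^ Suc p * Z + (a 0 ^ p + Z)"
      by linarith
    then show ?thesis by (rule mult_left_mono) simp
  qed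
  also have "\<dots> = 2 ^ p * ((2 / c) ^ Suc p + 1) * (a 0 ^ p + Z)" by (simp only: distrib_left distrib_right mult_1_left mult.assoc)
  finally show ?thesis unfolding Z_def .
qed

locale driven_long =
  fixes y b H :: "real \<Rightarrow> real" and N p :: nat and K :: real
  assumes b: "b integrable_on {0..real N}" and p: "p > 0" and K: "K \<ge> 0"
    and H_mono: "\<And>s t. 0 \<le> s \<Longrightarrow> s \<le> t \<Longrightarrow> t \<le> real N \<Longrightarrow> H s \<le> H t"
    and inc: "\<And>s t. 0 \<le> s \<Longrightarrow> s \<le> t \<Longrightarrow> t \<le> real N \<Longrightarrow>
        y t - y s \<le> integral {s..t} b + K * root p (H t - H s)"
begin

lemma window:
  assumes "0 \<le> \<alpha>" "\<alpha> \<le> \<beta>" "\<beta> \<le> real N"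
  shows "driven y b \<alpha> \<beta> (K * root p (H \<beta> - H \<alpha>))"
proof
  show "b integrable_on {\<alpha>..\<beta>}" using integrable_on_subinterval[OF b] assms by auto
  show "0 \<le> K * root p (H \<beta> - H \<alpha>)" using H_mono[OF assms] K by (intro mult_nonneg_nonneg real_root_ge_zero) auto
next
  fix s t assume st: "\<alpha> \<le> s" "s \<le> t" "t \<le> \<beta>"
  have "root p (H t - H s) \<le> root p (H \<beta> - H \<alpha>)"
    using H_mono[of \<alpha> s] H_mono[of t \<beta>] st assms p by (intro real_root_le_mono) auto
  then have "K * root p (H t - H s) \<le> K * root p (H \<beta> - H \<alpha>)" using K by (rule mult_left_mono)
  then show "y t - y s \<le> integral {s..t} b + K * root p (H \<beta> - H \<alpha>)" using inc[of s t] st assms by simp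
qed

text \<open>The bound \<open>g m\<close> may differ from window to window: for a class of lower
  priority it contains the maxima of the classes ahead of it. The exponent \<open>P\<close> of the
  conclusion is unrelated to the order \<open>p\<close> of the noise.\<close>

lemma linear_drift:
  assumes c: "0 < c" "c \<le> 1" and g: "\<And>m. m < N \<Longrightarrow> 0 \<le> g m" and P: "P > 0"
    and drift: "\<And>m r. m < N \<Longrightarrow> real m \<le> r \<Longrightarrow> r \<le> real m + 1 \<Longrightarrow> y r > 0 \<Longrightarrow> b r \<le> g m - c * y r"
  defines "z \<equiv> (\<lambda>m. K * root p (H (real m + 1) - H (real m)) + g m)"
  shows "\<exists>\<sigma>. (\<forall>m<N. 0 \<le> \<sigma> m \<and> (\<forall>t\<in>{real m..real m + 1}. y t \<le> \<sigma> m)) \<and>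
    (\<Sum>m<N. \<sigma> m ^ P) \<le> 2 ^ P * ((2 / c) ^ Suc P + 1) * (max 0 (y 0) ^ P + (\<Sum>m<N. z m ^ P))"
proof -
  let ?a = "\<lambda>m. max 0 (y (real m))"
  have w: "driven y b (real m) (real m + 1) (K * root p (H (real m + 1) - H (real m)))" if "m < N" for m
    using that by (intro window) auto
  have z0: "0 \<le> z m" if "m < N" for m
    using driven.v[OF w[OF that]] g[OF that] by (simp add: z_def)
  have dr: "b r \<le> g m" "y r > ?a m / 2 \<Longrightarrow> b r \<le> g m - c * (?a m / 2)"
    if "m < N" "real m \<le> r" "r \<le> real m + 1" "y r > 0" for m r
  proof -
    have "0 \<le> c * y r" using c that by simp
    then show "b r \<le> g m" using drift[OF that] by linarith
    assume "y r > ?a m / 2"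
    then have "c * (?a m / 2) \<le> c * y r" using c by (intro mult_left_mono) auto
    then show "b r \<le> g m - c * (?a m / 2)" using drift[OF that] by linarith
  qed
  have dr2: "b r \<le> g m - c * (?a m / 2)" if "m < N" "real m \<le> r" "r \<le> real m + 1" "y r > ?a m / 2" for m r
  proof -
    have "0 \<le> ?a m / 2" by simp
    then have "y r > 0" using that(4) by linarith
    then show ?thesis using dr(2) that by blast
  qed
  note uc = driven.unit_contraction[OF w refl g c]
  have bd: "y t \<le> ?a m + z m" if "m < N" "t \<in> {real m..real m + 1}" for m t
    using uc(1)[OF that(1) that(1) dr(1) dr2, of t] that by (simp add: z_def add.assoc)
  have rec: "?a (Suc m) \<le> (1 - c / 2) * ?a m + z m" if "m < N" for m
    using uc(2)[OF that that dr(1) dr2] that by (simp add: z_def add.assoc add.commute[of 1])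
  show ?thesis
    using contraction_sum[of N ?a z c P, OF _ z0 c P rec] bd z0
    by (intro exI[of _ "\<lambda>m. ?a m + z m"]) (auto intro!: add_nonneg_nonneg)
qed

text \<open>Above \<open>\<Lambda>\<close> the downward drift is guaranteed only to be constant, so
  a descent from height \<open>a\<close> may last about \<open>a\<close> and cost
  \<open>a * a ^ (p - 1)\<close>. Hence the exponent \<open>p - 1\<close> on the left against
  \<open>p\<close> for the initial value. The quantity \<open>Kp * a ^ p\<close> acts as a
  potential: over each window, the cost plus the new potential is at most the old potential plus a
  multiple of the increment of \<open>H\<close> plus a constant.\<close>

lemma saturated_drift:
  assumes c: "0 < c" "c \<le> 1" and g: "0 \<le> g" and \<Lambda>: "c * \<Lambda> / 2 \<ge> g + 1" and p2: "p \<ge> 2"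
    and drift: "\<And>r. 0 \<le> r \<Longrightarrow> r \<le> real N \<Longrightarrow> y r > 0 \<Longrightarrow> b r \<le> g - c * min (y r) \<Lambda>"
  shows "\<exists>\<sigma>. (\<forall>m<N. 0 \<le> \<sigma> m \<and> (\<forall>t\<in>{real m..real m + 1}. y t \<le> \<sigma> m)) \<and>
    (\<Sum>m<N. \<sigma> m ^ (p - 1)) \<le> (4 / c) ^ Suc p * 64 ^ p * (1 + K ^ p + g ^ p) * (max 0 (y 0) ^ p + (H (real N) - H 0) + real N)"
proof -
  \<comment> \<open>Chosen such that a contraction by \<open>1 - c / 2\<close> releases
    \<open>Kp * (c / 2) = 2 * 4 ^ p\<close> units of \<open>a ^ p\<close>, more than the
    \<open>4 ^ p\<close> units that a unit window costs.\<close>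
  define Kp where "Kp = 2 * 4 ^ p * (2 / c)"
  define Kq where "Kq = Kp * (2 / c) ^ p * 8 ^ p * (1 + K ^ p + g ^ p)"
  let ?a = "\<lambda>m. max 0 (y (real m))"
  have \<Lambda>0: "\<Lambda> > 0" using \<Lambda> g c by (smt (verit) divide_nonpos_pos mult_nonneg_nonpos)
  have K1: "2 / c \<ge> 2" using c by (simp add: field_simps)
  have Kp: "Kp \<ge> 4 * 4 ^ p" unfolding Kp_def using mult_left_mono[OF K1, of "2 * 4 ^ p"] by simp
  have Kp0: "0 \<le> Kp" by (rule order_trans[OF _ Kp]) simp
  have Kq0: "0 \<le> Kq" unfolding Kq_def using c g K Kp0 by simp
  have ge1_mult: "\<And>x y::real. 1 \<le> x \<Longrightarrow> 1 \<le> y \<Longrightarrow> 1 \<le> x * y"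
    using mult_mono[of 1 _ 1] by fastforce
  have dr0: "b r \<le> g" if "0 \<le> r" "r \<le> real N" "y r > 0" for r
  proof -
    have "0 \<le> c * min (y r) \<Lambda>" using that \<Lambda>0 c by simp
    then show ?thesis using drift[OF that] by linarith
  qed
  \<comment> \<open>Strong induction on the remaining time, since the windows have variable
    length.\<close>
  have main: "\<exists>\<sigma>. (\<forall>k\<in>{m..<N}. 0 \<le> \<sigma> k \<and> (\<forall>t\<in>{real k..real k + 1}. y t \<le> \<sigma> k)) \<and>
      (\<Sum>k\<in>{m..<N}. \<sigma> k ^ (p - 1)) \<le> Kp * ?a m ^ p + Kq * ((H (real N) - H (real m)) + (real N - real m))"
    if "m \<le> N" for m
    using that
  proof (induction "N - m" arbitrary: m rule: less_induct)
    case less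
    show ?case
    proof (cases "m = N")
      case True then show ?thesis using Kp0 by (intro exI[of _ "\<lambda>_. 0"]) auto
    next
      case False
      then have mN: "m < N" using less by simp
      \<comment> \<open>One window from \<open>m\<close> to \<open>m'\<close> on which
        \<open>A\<close> bounds the path. At \<open>m' = N\<close> no descent is guaranteed; the new
        potential is then left out, and no further window has to be paid for.\<close>
      have "\<exists>m' A. m < m' \<and> m' \<le> N \<and> 0 \<le> A \<and> (\<forall>t\<in>{real m..real m'}. y t \<le> A) \<and>
        real (m' - m) * A ^ (p - 1) + (if m' < N then Kp * ?a m' ^ p else 0)
          \<le> Kp * ?a m ^ p + Kq * ((H (real m') - H (real m)) + 1)"
      proof -
        define W where "W = (\<lambda>v. 1 + v ^ p + g ^ p)"
        define q where "q = Kp * (2 / c) ^ p"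
        have q: "q \<ge> Kp" "q \<ge> 4 * 4 ^ p"
        proof -
          have "Kp * 1 \<le> Kp * (2 / c) ^ p" using K1 Kp0 by (intro mult_left_mono one_le_power) auto
          then show "q \<ge> Kp" by (simp add: q_def)
          then show "q \<ge> 4 * 4 ^ p" using Kp by simp
        qed
        have budget: "q * 8 ^ p * W v \<le> Kq * (d + 1)" if "v ^ p = K ^ p * d" "0 \<le> d" for v d
        proof -
          have "W v \<le> (1 + K ^ p + g ^ p) * (d + 1)"
          proof -
            have "0 \<le> g ^ p * d" "0 \<le> K ^ p" using g K that by simp_all
            then show ?thesis using that by (simp add: W_def algebra_simps)
          qed
          then have "q * 8 ^ p * W v \<le> q * 8 ^ p * ((1 + K ^ p + g ^ p) * (d + 1))"
            using q order_trans[OF _ q(2)] by (intro mult_left_mono) auto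
          then show ?thesis by (simp add: Kq_def q_def mult.assoc)
        qed
        have v_pow: "(K * root p (H (real m') - H (real m))) ^ p = K ^ p * (H (real m') - H (real m))"
          "0 \<le> K * root p (H (real m') - H (real m))" "0 \<le> H (real m') - H (real m)"
          if "m \<le> m'" "m' \<le> N" for m'
        proof -
          show d: "0 \<le> H (real m') - H (real m)" using H_mono[of "real m" "real m'"] that by simp
          show "(K * root p (H (real m') - H (real m))) ^ p = K ^ p * (H (real m') - H (real m))"
            using real_root_pow_pos2[OF p d] by (simp add: power_mult_distrib)
          show "0 \<le> K * root p (H (real m') - H (real m))" using K d by (intro mult_nonneg_nonneg real_root_ge_zero)
        qed
        have pow1: "(1::real) \<le> 2 ^ p" "(2::real) ^ p * 2 \<le> 4 ^ p" "(4::real) ^ p * 2 \<le> 8 ^ p" "(3::real) ^ p \<le> 4 ^ p"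
        proof -
          have two: "(2::real) ^ 1 \<le> 2 ^ p" using p by (intro power_increasing) auto
          have e: "(4::real) ^ p = 2 ^ p * 2 ^ p" "(8::real) ^ p = 4 ^ p * 2 ^ p"
            by (simp_all add: power_mult_distrib[symmetric])
          show "(1::real) \<le> 2 ^ p" using two by simp
          show "(2::real) ^ p * 2 \<le> 4 ^ p" unfolding e using two by (intro mult_left_mono) auto
          show "(4::real) ^ p * 2 \<le> 8 ^ p" unfolding e(2) using two by (intro mult_left_mono) auto
          show "(3::real) ^ p \<le> 4 ^ p" by (intro power_mono) auto
        qed
        define a where "a = ?a m"
        have a0: "0 \<le> a" by (simp add: a_def)
        have ap0: "0 \<le> a ^ p" using a0 by simp
        show ?thesis
        \<comment> \<open>Up to \<open>2 * \<Lambda>\<close> the half level of the contraction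
          argument is at most \<open>\<Lambda>\<close>, so the saturation is not felt and a unit
          window suffices.\<close>
        proof (cases "a \<le> 2 * \<Lambda>")
          case True
          define v where "v = K * root p (H (real (Suc m)) - H (real m))"
          note vp = v_pow[of "Suc m", folded v_def]
          have vv: "v ^ p = K ^ p * (H (real (Suc m)) - H (real m))" "0 \<le> v" "0 \<le> H (real (Suc m)) - H (real m)"
            using vp mN by simp_all
          interpret driven y b "real m" "real (Suc m)" v unfolding v_def using mN by (intro window) auto
          have d1: "b r \<le> g" if "real m \<le> r" "r \<le> real (Suc m)" "y r > 0" for r
            using dr0[of r] that mN by simp
          have d2: "b r \<le> g - c * (?a m / 2)" if "real m \<le> r" "r \<le> real (Suc m)" "y r > ?a m / 2" for r
          proof -
            have "0 \<le> ?a m / 2" by simp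
            then have pos: "y r > 0" using that(3) by linarith
            have "?a m / 2 \<le> min (y r) \<Lambda>" using that(3) True by (simp add: a_def)
            then have "c * (?a m / 2) \<le> c * min (y r) \<Lambda>" using c by (intro mult_left_mono) auto
            then show ?thesis using drift[of r] pos that mN by simp
          qed
          note uc = unit_contraction[OF _ g c d1 d2]
          have A: "y t \<le> a + v + g" if "t \<in> {real m..real (Suc m)}" for t
            using uc(1)[of t] that by (simp add: a_def)
          have nxt: "?a (Suc m) \<le> (1 - c / 2) * a + (v + g)"
            using uc(2) by (simp add: a_def)
          have "?a (Suc m) ^ p \<le> ((1 - c / 2) * a + (v + g)) ^ p" using nxt by (intro power_mono) auto
          also have "\<dots> \<le> (1 - c / 2) * a ^ p + (1 - (1 - c / 2)) * ((v + g) / (1 - (1 - c / 2))) ^ p"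
            using a0 vv(2) g c by (intro convex_power_comb) auto
          also have "(1 - (1 - c / 2)) * ((v + g) / (1 - (1 - c / 2))) ^ p \<le> 1 * ((v + g) / (1 - (1 - c / 2))) ^ p"
            using c vv(2) g by (intro mult_right_mono) auto
          also have "\<dots> = (2 / c) ^ p * (v + g) ^ p" by (simp add: power_mult_distrib[symmetric] mult.commute algebra_simps)
          also have "\<dots> \<le> (2 / c) ^ p * (2 ^ p * (v ^ p + g ^ p))"
            using c vv(2) g p by (intro mult_left_mono power_add_le) auto
          finally have n1: "?a (Suc m) ^ p \<le> (1 - c / 2) * a ^ p + (2 / c) ^ p * (2 ^ p * (v ^ p + g ^ p))" by simp
          have "Kp * ?a (Suc m) ^ p \<le> Kp * ((1 - c / 2) * a ^ p + (2 / c) ^ p * (2 ^ p * (v ^ p + g ^ p)))"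
            using Kp0 by (intro mult_left_mono n1)
          also have "\<dots> = Kp * a ^ p - 2 * 4 ^ p * a ^ p + q * 2 ^ p * (v ^ p + g ^ p)"
            using c by (simp add: q_def Kp_def field_simps)
          finally have n2: "Kp * ?a (Suc m) ^ p \<le> Kp * a ^ p - 2 * 4 ^ p * a ^ p + q * 2 ^ p * (v ^ p + g ^ p)" .
          have "(a + v + g) ^ (p - 1) \<le> 1 + (a + v + g) ^ p" using a0 vv(2) g by (intro power_le_1_power) auto
          also have "(a + v + g) ^ p \<le> 3 ^ p * (a ^ p + v ^ p + g ^ p)" using a0 vv(2) g p by (intro power_add3_le) auto
          also have "\<dots> \<le> 4 ^ p * (a ^ p + v ^ p + g ^ p)" using pow1 a0 vv(2) g by (intro mult_right_mono) auto
          finally have n3: "(a + v + g) ^ (p - 1) \<le> 1 + 4 ^ p * a ^ p + 4 ^ p * (v ^ p + g ^ p)" by (simp add: algebra_simps)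
          define U where "U = v ^ p + g ^ p"
          have U: "0 \<le> U" "W v = 1 + U" using vv(2) g by (simp_all add: U_def W_def)
          have n4: "1 + 4 ^ p * U + q * 2 ^ p * U \<le> q * 8 ^ p * W v"
          proof -
            have "1 + 4 ^ p * U \<le> q * W v"
            proof -
              have q1: "1 \<le> q" "4 ^ p \<le> q" using q(2) one_le_power[of "4::real" p] by linarith+
              have "4 ^ p * U \<le> q * U" using q1 U by (intro mult_right_mono) auto
              then show ?thesis using q1 U by (simp add: distrib_left)
            qed
            moreover have "q * 2 ^ p * U \<le> q * 2 ^ p * W v"
              using U q order_trans[OF _ q(2)] by (intro mult_left_mono) auto
            moreover have "q * W v + q * 2 ^ p * W v = q * W v * (1 + 2 ^ p)" by (simp add: algebra_simps)
            moreover have "q * W v * (1 + 2 ^ p) \<le> q * W v * 8 ^ p"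
            proof (rule mult_left_mono)
              show "(1::real) + 2 ^ p \<le> 8 ^ p" using pow1 by linarith
              show "0 \<le> q * W v" using U q Kp0 by simp
            qed
            ultimately show ?thesis by (simp add: mult_ac)
          qed
          have "real (Suc m - m) * (a + v + g) ^ (p - 1) + (if Suc m < N then Kp * ?a (Suc m) ^ p else 0)
            \<le> (a + v + g) ^ (p - 1) + Kp * ?a (Suc m) ^ p"
            using Kp0 by auto
          also have "\<dots> \<le> Kp * a ^ p + (1 + 4 ^ p * U + q * 2 ^ p * U)"
          proof -
            have "0 \<le> 4 ^ p * a ^ p" using a0 by simp
            then show ?thesis using n2 n3 unfolding U_def by linarith
          qed
          also have "\<dots> \<le> Kp * a ^ p + Kq * ((H (real (Suc m)) - H (real m)) + 1)"
            using n4 budget[OF vv(1,3)] by linarith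
          finally show ?thesis
            using A mN a0 vv(2) g unfolding a_def by (intro exI[of _ "Suc m"] exI[of _ "?a m + v + g"]) auto
        next
          case False
          \<comment> \<open>The window is closed at the first grid point whose preceding unit
            interval contains a value of at most \<open>\<Lambda> / 2\<close>, or at
            \<open>N\<close>. Thus the windows keep integer end points although the path comes down
            at an arbitrary time.\<close>
          define dip where "dip k \<longleftrightarrow> (\<exists>r. real k - 1 \<le> r \<and> r \<le> real k \<and> y r \<le> \<Lambda> / 2)" for k
          define m' where "m' = (LEAST k. m < k \<and> (dip k \<or> k = N))"
          have m'P: "m < m' \<and> (dip m' \<or> m' = N)" unfolding m'_def by (rule LeastI[of _ N]) (use mN in auto)
          have m'N: "m' \<le> N" unfolding m'_def by (rule Least_le) (use mN in auto)
          have nodip: "\<not> dip k" if "m < k" "k < m'" for k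
            using not_less_Least[of k "\<lambda>k. m < k \<and> (dip k \<or> k = N)"] that unfolding m'_def by auto
          define v where "v = K * root p (H (real m') - H (real m))"
          note vm = v_pow[of m', OF less_imp_le m'N, folded v_def]
          have vv: "v ^ p = K ^ p * (H (real m') - H (real m))" "0 \<le> v" "0 \<le> H (real m') - H (real m)"
            using vm m'P by simp_all
          interpret driven y b "real m" "real m'" v unfolding v_def using m'P m'N by (intro window) auto
          have y_m: "y (real m) = a" "a > 2 * \<Lambda>" using False \<Lambda>0 by (auto simp: a_def max_def split: if_splits)
          define e where "e = c * \<Lambda> / 2 - g"
          have e: "e \<ge> 1" using \<Lambda> by (simp add: e_def)
          have high: "y r > \<Lambda> / 2" if "real m \<le> r" "r \<le> real m' - 1" for r
          proof (cases "r = real m")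
            case True then show ?thesis using y_m \<Lambda>0 by simp
          next
            case False
            define k where "k = nat \<lceil>r\<rceil>"
            have k: "real k - 1 \<le> r" "r \<le> real k" "m < k" "k < m'" using that False unfolding k_def by linarith+
            show ?thesis using nodip[OF k(3,4)] k(1,2) unfolding dip_def by force
          qed
          have long: "y t \<le> a + v - e * (t - real m)" if t: "real m \<le> t" "t \<le> real m' - 1" for t
          proof -
            have "b r \<le> - e" if r: "real m < r" "r \<le> t" for r
            proof -
              have hr: "y r > \<Lambda> / 2" using high[of r] r t by simp
              then have "c * (\<Lambda> / 2) \<le> c * min (y r) \<Lambda>" using c \<Lambda>0 by (intro mult_left_mono) auto
              then show ?thesis using drift[of r] hr r t m'N \<Lambda>0 unfolding e_def by simp
            qed
            from above[OF _ t(1) _ this] y_m t show ?thesis by simp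
          qed
          have m1: "real m \<le> real m' - 1" using m'P by linarith
          \<comment> \<open>One unit before the end the path is still above
            \<open>\<Lambda> / 2\<close>, hence positive, after falling at speed at least 1 from
            \<open>a\<close> with one noise allowance.\<close>
          have len: "real m' - 1 - real m \<le> a + v"
          proof -
            have "0 < a + v - e * (real m' - 1 - real m)" using long[OF m1] high[OF m1] \<Lambda>0 by simp
            moreover have "1 * (real m' - 1 - real m) \<le> e * (real m' - 1 - real m)" using e m1 by (intro mult_right_mono) auto
            ultimately show ?thesis by simp
          qed
          \<comment> \<open>One \<open>v\<close> for the descent up to \<open>m' - 1\<close>, a
            second \<open>v\<close> and \<open>g\<close> for the last unit interval, where the path
            may have come down and risen again.\<close>
          define A where "A = a + 2 * v + g"
          have early: "y t \<le> a + v" if "real m \<le> t" "t \<le> real m' - 1" for t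
          proof -
            have "0 \<le> e * (t - real m)" using e that by simp
            then show ?thesis using long[OF that] by linarith
          qed
          have A: "y t \<le> A" if t: "t \<in> {real m..real m'}" for t
          proof (cases "t \<le> real m' - 1")
            case True then show ?thesis using early[of t] t vv(2) g by (simp add: A_def)
          next
            case False
            have "y t \<le> max 0 (y (real m' - 1)) + v + g * (t - (real m' - 1))"
              by (rule no_cross) (use False t m1 g dr0 m'N in auto)
            moreover have "g * (t - (real m' - 1)) \<le> g * 1" using g t by (intro mult_left_mono) auto
            moreover have "max 0 (y (real m' - 1)) \<le> a + v" using early[OF m1] a0 vv(2) by simp
            ultimately show ?thesis unfolding A_def by linarith
          qed
          have A0: "0 \<le> A" using a0 vv(2) g by (simp add: A_def)
          have W: "W v = 1 + v ^ p + g ^ p" by (simp add: W_def)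
          have pw: "0 \<le> v ^ p" "0 \<le> g ^ p" using vv(2) g by simp_all
          \<comment> \<open>The length of the window is at most \<open>1 + A\<close>, so length
            times height to the power \<open>p - 1\<close> is at most \<open>(1 + A) ^ p\<close>:
            this is where one power is lost.\<close>
          have l1: "real (m' - m) * A ^ (p - 1) \<le> 4 ^ p * a ^ p + 8 ^ p * W v"
          proof -
            have "real (m' - m) \<le> 1 + A" using len m'P vv(2) g by (simp add: A_def of_nat_diff)
            then have "real (m' - m) * A ^ (p - 1) \<le> (1 + A) * A ^ (p - 1)" using A0 by (intro mult_right_mono) auto
            also have "\<dots> \<le> (1 + A) * (1 + A) ^ (p - 1)" using A0 by (intro mult_left_mono power_mono) auto
            also have "\<dots> = (1 + A) ^ p" using p by (metis power_eq_if not_less0)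
            also have "\<dots> = (1 + a + 2 * v + g) ^ p" by (simp add: A_def add.assoc)
            also have "\<dots> \<le> 4 ^ p * (1 ^ p + a ^ p + (2 * v) ^ p + g ^ p)" using a0 vv(2) g p by (intro power_add4_le) auto
            also have "\<dots> = 4 ^ p * a ^ p + 4 ^ p * (1 + 2 ^ p * v ^ p + g ^ p)" by (simp add: algebra_simps power_mult_distrib)
            also have "\<dots> \<le> 4 ^ p * a ^ p + 4 ^ p * (2 ^ p * W v)"
            proof -
              have "1 * g ^ p \<le> 2 ^ p * g ^ p" by (rule mult_right_mono[OF pow1(1) pw(2)])
              then have "1 + 2 ^ p * v ^ p + g ^ p \<le> 2 ^ p * W v"
                unfolding W distrib_left mult_1_right using pow1(1) by linarith
              then show ?thesis by simp
            qed
            also have "4 ^ p * (2 ^ p * W v) = 8 ^ p * W v" by (simp add: power_mult_distrib[symmetric] mult.assoc[symmetric])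
            finally show ?thesis .
          qed
          \<comment> \<open>If the window closed before \<open>N\<close>, the path was low within
            its last unit interval. It therefore ends below \<open>a / 2 + v + g\<close>, and at
            least half of the potential of \<open>a\<close> is set free.\<close>
          have l2: "Kp * ?a m' ^ p \<le> Kp * (1/2) * a ^ p + Kp * 4 ^ p * W v" if "m' < N"
          proof -
            have "dip m'" using m'P that by auto
            then obtain r where r: "real m' - 1 \<le> r" "r \<le> real m'" "y r \<le> \<Lambda> / 2" unfolding dip_def by blast
            have "y (real m') \<le> \<Lambda> / 2 + v + g * (real m' - r)"
              by (rule after_dip[of r _ r]) (use r m1 g dr0 m'N \<Lambda>0 in auto)
            moreover have "g * (real m' - r) \<le> g * 1" using g r by (intro mult_left_mono) auto
            ultimately have "?a m' \<le> 1/2 * a + (v + g)" using y_m \<Lambda>0 vv(2) g a0 by simp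
            then have "?a m' ^ p \<le> (1/2 * a + (v + g)) ^ p" by (intro power_mono) auto
            also have "\<dots> \<le> 1/2 * a ^ p + (1 - 1/2) * ((v + g) / (1 - 1/2)) ^ p"
              using a0 vv(2) g by (intro convex_power_comb) auto
            also have "\<dots> = 1/2 * a ^ p + 1/2 * (2 ^ p * (v + g) ^ p)" by (simp add: power_mult_distrib[symmetric] algebra_simps)
            also have "\<dots> \<le> 1/2 * a ^ p + 1/2 * (2 ^ p * (2 ^ p * (v ^ p + g ^ p)))"
              using vv(2) g p by (intro add_left_mono mult_left_mono power_add_le) auto
            also have "2 ^ p * (2 ^ p * (v ^ p + g ^ p)) = 4 ^ p * (v ^ p + g ^ p)"
              by (simp add: power_mult_distrib[symmetric] mult.assoc[symmetric])
            also have "1/2 * a ^ p + 1/2 * (4 ^ p * (v ^ p + g ^ p)) \<le> 1/2 * a ^ p + 4 ^ p * W v"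
            proof -
              have "1/2 * (v ^ p + g ^ p) \<le> W v" unfolding W using pw by simp
              from mult_left_mono[OF this, of "4 ^ p"] show ?thesis by simp
            qed
            finally have "Kp * ?a m' ^ p \<le> Kp * (1/2 * a ^ p + 4 ^ p * W v)"
              using Kp0 by (intro mult_left_mono)
            then show ?thesis by (simp add: algebra_simps)
          qed
          have l3: "8 ^ p * W v + Kp * 4 ^ p * W v \<le> q * 8 ^ p * W v"
          proof -
            have W0: "0 \<le> W v" unfolding W using pw by simp
            have Kp2: "2 \<le> Kp" using Kp one_le_power[of "4::real" p] by linarith
            have "2 * 8 ^ p \<le> Kp * 8 ^ p" using Kp2 by (intro mult_right_mono) auto
            moreover have "Kp * (4 ^ p * 2) \<le> Kp * 8 ^ p" using Kp2 pow1 by (intro mult_left_mono) auto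
            moreover have "Kp * 8 ^ p \<le> q * 8 ^ p" using q by (intro mult_right_mono) auto
            ultimately have "8 ^ p + Kp * 4 ^ p \<le> q * 8 ^ p" by linarith
            from mult_right_mono[OF this W0] show ?thesis by (simp add: distrib_right)
          qed
          have "real (m' - m) * A ^ (p - 1) + (if m' < N then Kp * ?a m' ^ p else 0) \<le> Kp * a ^ p + q * 8 ^ p * W v"
          proof -
            have "4 * 4 ^ p * a ^ p \<le> Kp * a ^ p" using Kp ap0 by (rule mult_right_mono)
            moreover have "0 \<le> 4 ^ p * a ^ p" using a0 by simp
            moreover have "0 \<le> Kp * 4 ^ p * W v" unfolding W using Kp0 pw by simp
            ultimately show ?thesis using l1 l2 l3 by (cases "m' < N") auto
          qed
          also have "\<dots> \<le> Kp * a ^ p + Kq * ((H (real m') - H (real m)) + 1)" using budget[OF vv(1,3)] by simp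
          finally show ?thesis using A A0 m'P m'N unfolding a_def by (intro exI[of _ m'] exI[of _ A]) auto
        qed
      qed
      then obtain m' A where m': "m < m'" "m' \<le> N" and A: "0 \<le> A" "\<And>t. t \<in> {real m..real m'} \<Longrightarrow> y t \<le> A"
        and le: "real (m' - m) * A ^ (p - 1) + (if m' < N then Kp * ?a m' ^ p else 0)
          \<le> Kp * ?a m ^ p + Kq * ((H (real m') - H (real m)) + 1)" by blast
      have "N - m' < N - m" using m' by simp
      from less.hyps[OF this m'(2)] obtain \<sigma> where
        \<sigma>: "\<And>k. k \<in> {m'..<N} \<Longrightarrow> 0 \<le> \<sigma> k \<and> (\<forall>t\<in>{real k..real k + 1}. y t \<le> \<sigma> k)"
        "(\<Sum>k\<in>{m'..<N}. \<sigma> k ^ (p - 1)) \<le> Kp * ?a m' ^ p + Kq * ((H (real N) - H (real m')) + (real N - real m'))"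
        by blast
      define \<tau> where "\<tau> k = (if k < m' then A else \<sigma> k)" for k
      have \<tau>: "0 \<le> \<tau> k \<and> (\<forall>t\<in>{real k..real k + 1}. y t \<le> \<tau> k)" if "k \<in> {m..<N}" for k
      proof (cases "k < m'")
        case True
        then have "real k + 1 \<le> real m'" by linarith
        then show ?thesis using True A that by (auto simp: \<tau>_def)
      next
        case False then show ?thesis using \<sigma>(1)[of k] that by (simp add: \<tau>_def)
      qed
      have split: "{m..<N} = {m..<m'} \<union> {m'..<N}" using m' by auto
      have "(\<Sum>k\<in>{m..<N}. \<tau> k ^ (p - 1)) = (\<Sum>k\<in>{m..<m'}. \<tau> k ^ (p - 1)) + (\<Sum>k\<in>{m'..<N}. \<tau> k ^ (p - 1))"
        unfolding split by (rule sum.union_disjoint) auto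
      also have "(\<Sum>k\<in>{m..<m'}. \<tau> k ^ (p - 1)) = real (m' - m) * A ^ (p - 1)" by (simp add: \<tau>_def)
      also have "(\<Sum>k\<in>{m'..<N}. \<tau> k ^ (p - 1)) = (\<Sum>k\<in>{m'..<N}. \<sigma> k ^ (p - 1))"
        by (intro sum.cong) (auto simp: \<tau>_def)
      also have "real (m' - m) * A ^ (p - 1) + (\<Sum>k\<in>{m'..<N}. \<sigma> k ^ (p - 1))
        \<le> Kp * ?a m ^ p + Kq * ((H (real N) - H (real m)) + (real N - real m))"
      proof (cases "m' < N")
        case True
        have "1 + (real N - real m') \<le> real N - real m" using m' by linarith
        from mult_left_mono[OF this Kq0] show ?thesis using le \<sigma>(2) True by (simp add: algebra_simps)
      next
        case False
        then have eq: "m' = N" using m' by simp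
        have "1 \<le> real N - real m" using m' by linarith
        from mult_left_mono[OF this Kq0] show ?thesis using le eq by (simp add: algebra_simps)
      qed
      finally show ?thesis using \<tau> by blast
    qed
  qed
  from main[of 0] obtain \<sigma> where \<sigma>: "\<forall>k\<in>{0..<N}. 0 \<le> \<sigma> k \<and> (\<forall>t\<in>{real k..real k + 1}. y t \<le> \<sigma> k)"
    "(\<Sum>k\<in>{0..<N}. \<sigma> k ^ (p - 1)) \<le> Kp * max 0 (y 0) ^ p + Kq * ((H (real N) - H 0) + real N)" by auto
  define C where "C = (4 / c) ^ Suc p * 64 ^ p * (1 + K ^ p + g ^ p)"
  have X: "(4 / c) ^ Suc p = 2 * 2 ^ p * (2 / c) ^ Suc p"
    by (simp add: power_mult_distrib[symmetric] power_Suc[symmetric] del: power_Suc)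
  have Y: "(64::real) ^ p = 8 ^ p * 8 ^ p" "(8::real) ^ p = 4 ^ p * 2 ^ p" by (simp_all add: power_mult_distrib[symmetric])
  have W1: "1 \<le> 1 + K ^ p + g ^ p" using K g by simp
  have pos: "(1::real) \<le> 2 ^ p" "(1::real) \<le> 8 ^ p" "(1::real) \<le> (2 / c) ^ p" using K1 by (auto intro: one_le_power)
  have KqC: "Kq \<le> C"
  proof -
    have "C = Kq * 2 ^ p * 2 ^ p"
      unfolding C_def Kq_def Kp_def X Y by (simp add: mult_ac)
    moreover have "Kq * 1 \<le> Kq * (2 ^ p * 2 ^ p)" using pos(1) Kq0 by (intro mult_left_mono ge1_mult)
    ultimately show ?thesis by (simp add: mult.assoc)
  qed
  have KpKq: "Kp \<le> Kq"
  proof -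
    have "Kp * 1 \<le> Kp * ((2 / c) ^ p * 8 ^ p * (1 + K ^ p + g ^ p))"
      using Kp0 pos W1 by (intro mult_left_mono ge1_mult)
    then show ?thesis by (simp add: Kq_def mult.assoc)
  qed
  have "0 \<le> max 0 (y 0) ^ p" "0 \<le> (H (real N) - H 0) + real N" using H_mono[of 0 "real N"] by simp_all
  then have "Kp * max 0 (y 0) ^ p + Kq * ((H (real N) - H 0) + real N) \<le> C * max 0 (y 0) ^ p + C * ((H (real N) - H 0) + real N)"
    using KqC KpKq by (intro add_mono mult_right_mono) auto
  also have "\<dots> = C * (max 0 (y 0) ^ p + (H (real N) - H 0) + real N)" by (simp add: algebra_simps)
  finally show ?thesis using \<sigma> unfolding C_def by (intro exI[of _ \<sigma>]) (auto simp: lessThan_atLeast0)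
qed

end

section \<open>Exponential moments and tame variables\<close>

lemma power_le_fact_exp:
  fixes x :: real assumes "0 \<le> x" shows "x ^ p \<le> fact p * exp x"
proof -
  obtain t where t: "exp x = (\<Sum>m<Suc p. (x ^ m) / fact m) + (exp t / fact (Suc p)) * x ^ Suc p"
    using Maclaurin_exp_le[of x "Suc p"] by blast
  have "x ^ p / fact p \<le> (\<Sum>m<Suc p. (x ^ m) / fact m)"
    using assms by (intro member_le_sum) auto
  moreover have "0 \<le> (exp t / fact (Suc p)) * x ^ Suc p" using assms by simp
  ultimately have "x ^ p / fact p \<le> exp x" using t by linarith
  then show ?thesis by (simp add: field_simps)
qed

lemma exp_le_quadratic: fixes x :: real shows "exp x \<le> 1 + x + x\<^sup>2 * exp \<bar>x\<bar>"
proof -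
  obtain t where t: "\<bar>t\<bar> \<le> \<bar>x\<bar>" "exp x = (\<Sum>m<2. (x ^ m) / fact m) + (exp t / fact 2) * x ^ 2"
    using Maclaurin_exp_le[of x 2] by blast
  have "exp t \<le> exp \<bar>x\<bar>" using t(1) by simp
  then have "exp t / 2 \<le> exp \<bar>x\<bar>" using exp_gt_zero[of t] by linarith
  then have "(exp t / 2) * x\<^sup>2 \<le> exp \<bar>x\<bar> * x\<^sup>2" by (rule mult_right_mono) simp
  then show ?thesis using t(2) by (simp add: eval_nat_numeral mult.commute)
qed

lemma ennreal_term_le_suminf: "f k \<le> (\<Sum>k. f k)" for f :: "nat \<Rightarrow> ennreal"
  using sum_le_suminf[of f "{k}"] by simp

text \<open>For a tail that halves on every stretch of length \<open>a\<close>: over such a stretch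
  the exponential grows by 3/2, so that the products decay with ratio 3/4.\<close>

definition exp_rate :: "real \<Rightarrow> real" where "exp_rate a = ln (3/2) / a"
text \<open>The factor 56 is 8 from bounding a square by an exponential, times the bound 7 of the
  exponential moment.\<close>

definition mgf_const :: "real \<Rightarrow> real" where "mgf_const a = 56 * exp (exp_rate a) / (exp_rate a)\<^sup>2"

lemma exp_rate_pos: "a > 0 \<Longrightarrow> exp_rate a > 0" by (simp add: exp_rate_def)

lemma mgf_const_pos: "a > 0 \<Longrightarrow> mgf_const a > 0" using exp_rate_pos[of a] by (simp add: mgf_const_def)

context prob_space
begin

text \<open>On each layer between \<open>a * k\<close> and \<open>a * (k + 1)\<close> the
  exponential is at most \<open>(3/2) ^ (k + 1)\<close>, and the layer has probability at most
  \<open>(1/2) ^ k\<close>. The geometric series sums to 6, and 1 is added for the value at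
  zero.\<close>

lemma exp_moment_le:
  fixes X :: "'a \<Rightarrow> real"
  assumes [measurable]: "X \<in> borel_measurable M" and nonneg: "AE \<omega> in M. 0 \<le> X \<omega>" and a: "a > 0"
    and tail: "\<And>k::nat. prob {\<omega> \<in> space M. X \<omega> > a * real k} \<le> (1/2) ^ k"
  shows "(\<integral>\<^sup>+\<omega>. ennreal (exp (exp_rate a * X \<omega>)) \<partial>M) \<le> ennreal 7"
proof -
  let ?A = "\<lambda>k::nat. {\<omega> \<in> space M. X \<omega> > a * real k}"
  have A[measurable]: "?A k \<in> sets M" for k by measurable
  have "(\<integral>\<^sup>+\<omega>. ennreal (exp (exp_rate a * X \<omega>)) \<partial>M)
      \<le> (\<integral>\<^sup>+\<omega>. 1 + (\<Sum>k. ennreal ((3/2) ^ Suc k) * indicator (?A k) \<omega>) \<partial>M)"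
  proof (rule nn_integral_mono_AE)
    show "AE \<omega> in M. ennreal (exp (exp_rate a * X \<omega>)) \<le> 1 + (\<Sum>k. ennreal ((3/2) ^ Suc k) * indicator (?A k) \<omega>)"
      using nonneg AE_space
    proof eventually_elim
      case (elim \<omega>)
      show ?case
      proof (cases "X \<omega> \<le> 0")
        case True
        then have "X \<omega> = 0" using elim by simp
        then show ?thesis by simp
      next
        case False
        \<comment> \<open>The ceiling minus one, and not the floor: the lower end of the layer must
          be strictly below \<open>X \<omega>\<close>, as in the tail event.\<close>
        define k where "k = nat (\<lceil>X \<omega> / a\<rceil> - 1)"
        have pos: "X \<omega> / a > 0" using False a by simp
        then have "\<lceil>X \<omega> / a\<rceil> \<ge> 1" by simp
        then have k: "real k = of_int \<lceil>X \<omega> / a\<rceil> - 1" unfolding k_def by simp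
        have k1: "real k < X \<omega> / a" "X \<omega> / a \<le> real (Suc k)" using k by linarith+
        have "exp (exp_rate a * X \<omega>) \<le> exp (ln (3/2) * real (Suc k))"
        proof -
          have "exp_rate a * X \<omega> = ln (3/2) * (X \<omega> / a)" by (simp add: exp_rate_def)
          also have "\<dots> \<le> ln (3/2) * real (Suc k)" using k1 by (intro mult_left_mono) auto
          finally show ?thesis by simp
        qed
        also have "exp (ln (3/2) * real (Suc k)) = (3/2::real) ^ Suc k"
          using powr_realpow[of "3/2" "Suc k"] by (simp add: powr_def mult.commute)
        finally have "ennreal (exp (exp_rate a * X \<omega>)) \<le> ennreal ((3/2) ^ Suc k)" by (rule ennreal_leI)
        also have "\<dots> = ennreal ((3/2) ^ Suc k) * indicator (?A k) \<omega>"
          using k1 elim a by (simp add: indicator_def field_simps)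
        also have "\<dots> \<le> (\<Sum>k. ennreal ((3/2) ^ Suc k) * indicator (?A k) \<omega>)"
          by (rule ennreal_term_le_suminf)
        finally show ?thesis by (simp add: add_increasing)
      qed
    qed
  qed
  also have "\<dots> = 1 + (\<Sum>k. ennreal ((3/2) ^ Suc k) * emeasure M (?A k))"
    by (subst nn_integral_add) (auto simp: nn_integral_suminf nn_integral_cmult emeasure_space_1)
  also have "\<dots> \<le> 1 + (\<Sum>k. ennreal ((3/2) * (3/4) ^ k))"
  proof (intro add_left_mono suminf_le allI)
    fix k
    have "emeasure M (?A k) \<le> ennreal ((1/2) ^ k)" using tail[of k] by (simp add: emeasure_eq_measure ennreal_leI)
    then have "ennreal ((3/2) ^ Suc k) * emeasure M (?A k) \<le> ennreal ((3/2) ^ Suc k) * ennreal ((1/2) ^ k)" by (rule mult_left_mono) simp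
    also have "\<dots> = ennreal ((3/2) * (3/4) ^ k)"
      by (simp add: ennreal_mult[symmetric] power_mult_distrib[symmetric] del: ennreal_power)
    finally show "ennreal ((3/2) ^ Suc k) * emeasure M (?A k) \<le> ennreal ((3/2) * (3/4) ^ k)" .
  qed auto
  also have "(\<Sum>k. ennreal ((3/2) * (3/4) ^ k)) = ennreal 6"
  proof (rule suminf_ennreal_eq)
    show "(\<lambda>k. (3/2) * (3/4::real) ^ k) sums 6" using sums_mult[OF geometric_sums[of "3/4::real"], of "3/2"] by simp
  qed auto
  also have "1 + ennreal 6 = ennreal 7" by (metis ennreal_1 ennreal_plus zero_le_one zero_le_numeral one_plus_numeral semiring_norm(3) semiring_norm(10))
  finally show ?thesis .
qed

text \<open>A second-order expansion of the exponential, whose linear term vanishes because the mean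
  is 1. Only half of the rate is granted to \<open>s\<close>; the other half dominates the factor
  \<open>(x - 1)\<^sup>2\<close> of the remainder, as in \<open>(x - 1)\<^sup>2 * exp \<bar>s * (x -
  1)\<bar> \<le> C * exp (\<alpha> * x)\<close>.\<close>

lemma mgf_centered_le:
  fixes X :: "'a \<Rightarrow> real"
  assumes [measurable]: "X \<in> borel_measurable M" and nonneg: "AE \<omega> in M. 0 \<le> X \<omega>" and a: "a > 0"
    and tail: "\<And>k::nat. prob {\<omega> \<in> space M. X \<omega> > a * real k} \<le> (1/2) ^ k"
    and mean: "integrable M X" "expectation X = 1"
    and s: "\<bar>s\<bar> \<le> exp_rate a / 2"
  shows "(\<integral>\<^sup>+\<omega>. ennreal (exp (s * (X \<omega> - 1))) \<partial>M) \<le> ennreal (exp (mgf_const a * s\<^sup>2))"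
proof -
  define \<alpha> where "\<alpha> = exp_rate a"
  have \<alpha>: "\<alpha> > 0" using exp_rate_pos[OF a] by (simp add: \<alpha>_def)
  have ex: "(\<integral>\<^sup>+\<omega>. ennreal (exp (\<alpha> * X \<omega>)) \<partial>M) \<le> ennreal 7"
    unfolding \<alpha>_def by (rule exp_moment_le) (use assms in auto)
  have int: "integrable M (\<lambda>\<omega>. exp (\<alpha> * X \<omega>))"
    by (rule integrableI_nonneg) (use ex in \<open>auto simp: less_top[symmetric] top_unique intro: le_less_trans[OF ex]\<close>)
  have ex7: "expectation (\<lambda>\<omega>. exp (\<alpha> * X \<omega>)) \<le> 7"
    using ex by (subst integral_eq_nn_integral) (auto intro: enn2real_leI)
  define C where "C = 8 * exp \<alpha> / \<alpha>\<^sup>2"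
  have C0: "C \<ge> 0" by (simp add: C_def)
  have pt: "exp (s * (x - 1)) \<le> 1 + s * (x - 1) + s\<^sup>2 * (C * exp (\<alpha> * x))" if x: "0 \<le> x" for x
  proof -
    have "(\<alpha> * \<bar>x - 1\<bar> / 2) ^ 2 \<le> fact 2 * exp (\<alpha> * \<bar>x - 1\<bar> / 2)" using \<alpha> by (intro power_le_fact_exp) simp
    then have sq: "(x - 1)\<^sup>2 \<le> 8 / \<alpha>\<^sup>2 * exp (\<alpha> * \<bar>x - 1\<bar> / 2)"
      using \<alpha> by (simp add: power_mult_distrib power_divide field_simps eval_nat_numeral)
    have "\<bar>s * (x - 1)\<bar> \<le> \<alpha> * \<bar>x - 1\<bar> / 2"
      using mult_right_mono[OF s, of "\<bar>x - 1\<bar>"] by (simp add: abs_mult \<alpha>_def)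
    then have e: "exp \<bar>s * (x - 1)\<bar> \<le> exp (\<alpha> * \<bar>x - 1\<bar> / 2)" by simp
    have "(x - 1)\<^sup>2 * exp \<bar>s * (x - 1)\<bar> \<le> (8 / \<alpha>\<^sup>2 * exp (\<alpha> * \<bar>x - 1\<bar> / 2)) * exp (\<alpha> * \<bar>x - 1\<bar> / 2)"
      using sq e by (intro mult_mono) auto
    also have "\<dots> = 8 / \<alpha>\<^sup>2 * exp (\<alpha> * \<bar>x - 1\<bar>)" by (simp add: exp_add[symmetric])
    also have "\<dots> \<le> 8 / \<alpha>\<^sup>2 * exp (\<alpha> * (x + 1))" using \<alpha> x by (intro mult_left_mono) auto
    also have "\<dots> = C * exp (\<alpha> * x)" by (simp add: C_def distrib_left exp_add)
    finally have "s\<^sup>2 * ((x - 1)\<^sup>2 * exp \<bar>s * (x - 1)\<bar>) \<le> s\<^sup>2 * (C * exp (\<alpha> * x))" by (rule mult_left_mono) simp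
    then show ?thesis using exp_le_quadratic[of "s * (x - 1)"] by (simp add: power_mult_distrib mult.assoc)
  qed
  have int2: "integrable M (\<lambda>\<omega>. 1 + s * (X \<omega> - 1) + s\<^sup>2 * (C * exp (\<alpha> * X \<omega>)))"
    using mean(1) int by auto
  have ae: "AE \<omega> in M. exp (s * (X \<omega> - 1)) \<le> 1 + s * (X \<omega> - 1) + s\<^sup>2 * (C * exp (\<alpha> * X \<omega>))"
    using nonneg by eventually_elim (rule pt)
  have "(\<integral>\<^sup>+\<omega>. ennreal (exp (s * (X \<omega> - 1))) \<partial>M) \<le> (\<integral>\<^sup>+\<omega>. ennreal (1 + s * (X \<omega> - 1) + s\<^sup>2 * (C * exp (\<alpha> * X \<omega>))) \<partial>M)"
    by (rule nn_integral_mono_AE) (use ae in \<open>eventually_elim, auto intro: ennreal_leI\<close>)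
  also have "\<dots> = ennreal (expectation (\<lambda>\<omega>. 1 + s * (X \<omega> - 1) + s\<^sup>2 * (C * exp (\<alpha> * X \<omega>))))"
    by (rule nn_integral_eq_integral[OF int2]) (use ae in \<open>eventually_elim, auto intro: order_trans[OF less_imp_le[OF exp_gt_zero]]\<close>)
  also have "expectation (\<lambda>\<omega>. 1 + s * (X \<omega> - 1) + s\<^sup>2 * (C * exp (\<alpha> * X \<omega>)))
      = 1 + s\<^sup>2 * (C * expectation (\<lambda>\<omega>. exp (\<alpha> * X \<omega>)))"
    using mean int by (simp add: prob_space)
  also have "\<dots> \<le> 1 + mgf_const a * s\<^sup>2"
  proof -
    have "s\<^sup>2 * (C * expectation (\<lambda>\<omega>. exp (\<alpha> * X \<omega>))) \<le> s\<^sup>2 * (C * 7)"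
      using ex7 C0 by (intro mult_left_mono) auto
    also have "\<dots> = mgf_const a * s\<^sup>2" by (simp add: mgf_const_def C_def \<alpha>_def)
    finally show ?thesis by simp
  qed
  also have "\<dots> \<le> exp (mgf_const a * s\<^sup>2)" by (rule exp_ge_add_one_self)
  finally show ?thesis by (simp add: ennreal_leI)
qed

lemma nn_integral_prod_indep:
  fixes X :: "'i \<Rightarrow> 'a \<Rightarrow> real" and g :: "'i \<Rightarrow> real \<Rightarrow> real"
  assumes ind: "indep_vars (\<lambda>_. borel) X V" and I: "finite I" "I \<subseteq> V"
    and g: "\<And>i. i \<in> I \<Longrightarrow> g i \<in> borel_measurable borel" "\<And>i x. 0 \<le> g i x"
  shows "(\<integral>\<^sup>+\<omega>. ennreal (\<Prod>i\<in>I. g i (X i \<omega>)) \<partial>M) = (\<Prod>i\<in>I. \<integral>\<^sup>+\<omega>. ennreal (g i (X i \<omega>)) \<partial>M)"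
proof -
  have "indep_vars (\<lambda>_. borel) X I" using indep_vars_subset[OF ind I(2)] .
  then have "indep_vars (\<lambda>_. borel) (\<lambda>i \<omega>. ennreal (g i (X i \<omega>))) I"
    by (rule indep_vars_compose2) (use g in auto)
  from indep_vars_nn_integral[OF I(1) this] g(2) show ?thesis
    by (simp add: prod_ennreal[symmetric])
qed


lemma unbounded_AE_geometric:
  fixes S :: "nat \<Rightarrow> 'a \<Rightarrow> real"
  assumes [measurable]: "\<And>m. S m \<in> borel_measurable M" and q: "0 < q" "q < 1"
    and le: "\<And>x m. prob {\<omega> \<in> space M. S m \<omega> \<le> x} \<le> K x * q ^ m"
  shows "AE \<omega> in M. \<forall>x. \<exists>m. S m \<omega> > x"
proof -
  have "AE \<omega> in M. \<exists>m. S m \<omega> > real k" for k :: nat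
  proof -
    let ?N = "{\<omega> \<in> space M. \<not> (\<exists>m. S m \<omega> > real k)}"
    have N[measurable]: "?N \<in> events" by measurable
    have le: "prob ?N \<le> K (real k) * q ^ m" for m
    proof -
      have "prob ?N \<le> prob {\<omega> \<in> space M. S m \<omega> \<le> real k}"
        by (rule finite_measure_mono) (auto simp: not_less)
      also have "\<dots> \<le> K (real k) * q ^ m" by (rule le)
      finally show ?thesis .
    qed
    have lim: "(\<lambda>m. K (real k) * q ^ m) \<longlonglongrightarrow> K (real k) * 0"
      using q by (intro tendsto_mult tendsto_const LIMSEQ_realpow_zero) auto
    have "prob ?N \<le> K (real k) * 0"
      by (rule LIMSEQ_le_const[OF lim]) (intro exI[of _ 0] allI impI le)
    then have "prob ?N = 0" using measure_nonneg[of M ?N] by linarith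
    then have "emeasure M ?N = 0" by (simp add: emeasure_eq_measure)
    then show ?thesis by (intro AE_I[of _ _ ?N]) auto
  qed
  then have "AE \<omega> in M. \<forall>k::nat. \<exists>m. S m \<omega> > real k" by (simp add: AE_all_countable)
  then show ?thesis
  proof eventually_elim
    case (elim \<omega>)
    show ?case
    proof
      fix x
      obtain k :: nat where "x < real k" using reals_Archimedean2 by blast
      then show "\<exists>m. S m \<omega> > x" using elim less_trans by blast
    qed
  qed
qed

text \<open>Minimising over \<open>\<eta>\<close> gives \<open>2 * C * sqrt (prob B)\<close>, the
  Cauchy-Schwarz bound for a variable with bounded second moment. Keeping \<open>\<eta>\<close> free
  makes the bound linear in \<open>C\<close>, so that it is inherited by sums and series, and it
  holds for events \<open>B\<close> that depend on \<open>f\<close>.\<close>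

definition tame :: "real \<Rightarrow> ('a \<Rightarrow> ennreal) \<Rightarrow> bool" where
  "tame C f \<longleftrightarrow> f \<in> borel_measurable M \<and> 0 \<le> C \<and>
    (\<forall>B\<in>events. \<forall>\<eta>>0. (\<integral>\<^sup>+\<omega>. f \<omega> * indicator B \<omega> \<partial>M) \<le> ennreal (C * (\<eta> + prob B / \<eta>)))"

lemma tameD: "tame C f \<Longrightarrow> B \<in> events \<Longrightarrow> \<eta> > 0 \<Longrightarrow>
    (\<integral>\<^sup>+\<omega>. f \<omega> * indicator B \<omega> \<partial>M) \<le> ennreal (C * (\<eta> + prob B / \<eta>))"
  and tame_nonneg: "tame C f \<Longrightarrow> 0 \<le> C"
  and tame_measurable: "tame C f \<Longrightarrow> f \<in> borel_measurable M"
  by (auto simp: tame_def)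

lemma tame_finite: assumes "tame C f" shows "AE \<omega> in M. f \<omega> < top"
proof -
  have "(\<integral>\<^sup>+\<omega>. f \<omega> \<partial>M) = (\<integral>\<^sup>+\<omega>. f \<omega> * indicator (space M) \<omega> \<partial>M)"
    by (intro nn_integral_cong) simp
  also have "\<dots> \<le> ennreal (C * (1 + prob (space M) / 1))" by (rule tameD[OF assms]) auto
  also have "\<dots> < top" by simp
  finally have "(\<integral>\<^sup>+\<omega>. f \<omega> \<partial>M) \<noteq> \<infinity>" by simp
  from nn_integral_noteq_infinite[OF tame_measurable[OF assms] this] show ?thesis by (simp add: less_top)
qed

lemma tame_mono:
  assumes "tame C f" "g \<in> borel_measurable M" "\<And>\<omega>. g \<omega> \<le> f \<omega>" "C \<le> C'"
  shows "tame C' g"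
  unfolding tame_def
proof (intro conjI ballI allI impI)
  show "0 \<le> C'" using tame_nonneg[OF assms(1)] assms(4) by simp
  fix B \<eta> assume B: "B \<in> events" "(0::real) < \<eta>"
  have "(\<integral>\<^sup>+\<omega>. g \<omega> * indicator B \<omega> \<partial>M) \<le> (\<integral>\<^sup>+\<omega>. f \<omega> * indicator B \<omega> \<partial>M)"
    by (intro nn_integral_mono mult_right_mono assms) auto
  also have "\<dots> \<le> ennreal (C * (\<eta> + prob B / \<eta>))" by (rule tameD[OF assms(1) B])
  also have "\<dots> \<le> ennreal (C' * (\<eta> + prob B / \<eta>))"
    using B assms(4) by (intro ennreal_leI mult_right_mono) auto
  finally show "(\<integral>\<^sup>+\<omega>. g \<omega> * indicator B \<omega> \<partial>M) \<le> ennreal (C' * (\<eta> + prob B / \<eta>))" .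
qed (rule assms)

lemma tame_0: "tame 0 (\<lambda>_. 0)" by (simp add: tame_def)

lemma tame_add: assumes "tame C f" "tame D g" shows "tame (C + D) (\<lambda>\<omega>. f \<omega> + g \<omega>)"
  unfolding tame_def
proof (intro conjI ballI allI impI)
  note [measurable] = tame_measurable[OF assms(1)] tame_measurable[OF assms(2)]
  show "(\<lambda>\<omega>. f \<omega> + g \<omega>) \<in> borel_measurable M" by measurable
  show "0 \<le> C + D" using assms tame_nonneg by (simp add: tame_def)
  fix B \<eta> assume B: "B \<in> events" "(0::real) < \<eta>"
  have [measurable]: "B \<in> events" by (rule B)
  have "(\<integral>\<^sup>+\<omega>. (f \<omega> + g \<omega>) * indicator B \<omega> \<partial>M)
      = (\<integral>\<^sup>+\<omega>. f \<omega> * indicator B \<omega> \<partial>M) + (\<integral>\<^sup>+\<omega>. g \<omega> * indicator B \<omega> \<partial>M)"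
    unfolding distrib_right by (rule nn_integral_add) auto
  also have "\<dots> \<le> ennreal (C * (\<eta> + prob B / \<eta>)) + ennreal (D * (\<eta> + prob B / \<eta>))"
    by (intro add_mono tameD[OF assms(1)] tameD[OF assms(2)] B)
  also have "\<dots> = ennreal ((C + D) * (\<eta> + prob B / \<eta>))"
    using B tame_nonneg[OF assms(1)] tame_nonneg[OF assms(2)] by (simp add: ennreal_plus[symmetric] distrib_right del: ennreal_plus)
  finally show "(\<integral>\<^sup>+\<omega>. (f \<omega> + g \<omega>) * indicator B \<omega> \<partial>M) \<le> ennreal ((C + D) * (\<eta> + prob B / \<eta>))" .
qed

lemma tame_sum:
  assumes "finite I" "\<And>i. i \<in> I \<Longrightarrow> tame (C i) (f i)"
  shows "tame (\<Sum>i\<in>I. C i) (\<lambda>\<omega>. \<Sum>i\<in>I. f i \<omega>)"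
  using assms by (induction I rule: finite_induct) (auto intro: tame_0 tame_add)

lemma tame_cmult:
  assumes "tame C f" "0 \<le> a" shows "tame (a * C) (\<lambda>\<omega>. ennreal a * f \<omega>)"
  unfolding tame_def
proof (intro conjI ballI allI impI)
  note [measurable] = tame_measurable[OF assms(1)]
  show "(\<lambda>\<omega>. ennreal a * f \<omega>) \<in> borel_measurable M" by measurable
  show "0 \<le> a * C" using assms tame_nonneg by simp
  fix B \<eta> assume B: "B \<in> events" "(0::real) < \<eta>"
  have [measurable]: "B \<in> events" by (rule B)
  have "(\<integral>\<^sup>+\<omega>. ennreal a * f \<omega> * indicator B \<omega> \<partial>M) = ennreal a * (\<integral>\<^sup>+\<omega>. f \<omega> * indicator B \<omega> \<partial>M)"
    unfolding mult.assoc by (rule nn_integral_cmult) measurable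
  also have "\<dots> \<le> ennreal a * ennreal (C * (\<eta> + prob B / \<eta>))" by (intro mult_left_mono tameD[OF assms(1)] B) auto
  also have "\<dots> = ennreal (a * C * (\<eta> + prob B / \<eta>))"
    using assms B tame_nonneg[OF assms(1)] by (simp add: ennreal_mult[symmetric] mult.assoc)
  finally show "(\<integral>\<^sup>+\<omega>. ennreal a * f \<omega> * indicator B \<omega> \<partial>M) \<le> ennreal (a * C * (\<eta> + prob B / \<eta>))" .
qed

lemma tame_suminf:
  fixes f :: "nat \<Rightarrow> 'a \<Rightarrow> ennreal"
  assumes "\<And>i. tame (C i) (f i)" "summable C"
  shows "tame (suminf C) (\<lambda>\<omega>. \<Sum>i. f i \<omega>)"
  unfolding tame_def
proof (intro conjI ballI allI impI)
  note [measurable] = tame_measurable[OF assms(1)]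
  show "(\<lambda>\<omega>. \<Sum>i. f i \<omega>) \<in> borel_measurable M" by measurable
  show "0 \<le> suminf C" using assms tame_nonneg by (intro suminf_nonneg) auto
  fix B \<eta> assume B: "B \<in> events" "(0::real) < \<eta>"
  have [measurable]: "B \<in> events" by (rule B)
  have "(\<integral>\<^sup>+\<omega>. (\<Sum>i. f i \<omega>) * indicator B \<omega> \<partial>M) = (\<integral>\<^sup>+\<omega>. (\<Sum>i. f i \<omega> * indicator B \<omega>) \<partial>M)" by simp
  also have "\<dots> = (\<Sum>i. \<integral>\<^sup>+\<omega>. f i \<omega> * indicator B \<omega> \<partial>M)" by (rule nn_integral_suminf) measurable
  also have "\<dots> \<le> (\<Sum>i. ennreal (C i * (\<eta> + prob B / \<eta>)))"
    by (intro suminf_le allI tameD[OF assms(1)] B) auto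
  also have "\<dots> = ennreal (\<Sum>i. C i * (\<eta> + prob B / \<eta>))"
    using B tame_nonneg[OF assms(1)] by (intro suminf_ennreal2 summable_mult2 assms) auto
  also have "(\<Sum>i. C i * (\<eta> + prob B / \<eta>)) = suminf C * (\<eta> + prob B / \<eta>)"
    by (rule suminf_mult2[symmetric, OF assms(2)])
  finally show "(\<integral>\<^sup>+\<omega>. (\<Sum>i. f i \<omega>) * indicator B \<omega> \<partial>M) \<le> ennreal (suminf C * (\<eta> + prob B / \<eta>))" .
qed

text \<open>AM-GM: \<open>X \<le> w (\<eta> (X / w)\<^sup>2 + 1 / \<eta>)\<close>.\<close>
lemma tame_square:
  fixes X :: "'a \<Rightarrow> real"
  assumes [measurable]: "X \<in> borel_measurable M" and X: "\<And>\<omega>. 0 \<le> X \<omega>" and w: "w > 0" and C: "0 \<le> C"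
    and sq: "(\<integral>\<^sup>+\<omega>. ennreal ((X \<omega>)\<^sup>2) \<partial>M) \<le> ennreal C"
  shows "tame (C / w + w) (\<lambda>\<omega>. ennreal (X \<omega>))"
  unfolding tame_def
proof (intro conjI ballI allI impI)
  show "(\<lambda>\<omega>. ennreal (X \<omega>)) \<in> borel_measurable M" by measurable
  show "0 \<le> C / w + w" using w C by simp
  fix B \<eta> assume B: "B \<in> events" "(0::real) < \<eta>"
  have [measurable]: "B \<in> events" by (rule B)
  have pt: "x \<le> (\<eta> / w) * x\<^sup>2 + w / \<eta>" if "0 \<le> x" for x
  proof -
    have "0 \<le> (x * \<eta> / w - 1)\<^sup>2 * (w / \<eta>)" using w B by simp
    also have "(x * \<eta> / w - 1)\<^sup>2 * (w / \<eta>) = (\<eta> / w) * x\<^sup>2 + w / \<eta> - 2 * x"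
      using w B by (simp add: power2_eq_square field_simps)
    finally show ?thesis using that by linarith
  qed
  have "(\<integral>\<^sup>+\<omega>. ennreal (X \<omega>) * indicator B \<omega> \<partial>M)
    \<le> (\<integral>\<^sup>+\<omega>. ennreal (\<eta> / w) * ennreal ((X \<omega>)\<^sup>2) + ennreal (w / \<eta>) * indicator B \<omega> \<partial>M)"
  proof (rule nn_integral_mono)
    fix \<omega>
    have "ennreal (X \<omega>) \<le> ennreal ((\<eta> / w) * (X \<omega>)\<^sup>2 + w / \<eta>)" by (intro ennreal_leI pt X)
    also have "\<dots> = ennreal (\<eta> / w) * ennreal ((X \<omega>)\<^sup>2) + ennreal (w / \<eta>)"
      using w B by (simp add: ennreal_mult[symmetric] ennreal_plus[symmetric] del: ennreal_plus)
    finally show "ennreal (X \<omega>) * indicator B \<omega> \<le> ennreal (\<eta> / w) * ennreal ((X \<omega>)\<^sup>2) + ennreal (w / \<eta>) * indicator B \<omega>"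
      by (cases "\<omega> \<in> B") auto
  qed
  also have "\<dots> = ennreal (\<eta> / w) * (\<integral>\<^sup>+\<omega>. ennreal ((X \<omega>)\<^sup>2) \<partial>M) + ennreal (w / \<eta>) * emeasure M B"
    by (subst nn_integral_add) (auto simp: nn_integral_cmult)
  also have "\<dots> \<le> ennreal (\<eta> / w) * ennreal C + ennreal (w / \<eta>) * ennreal (prob B)"
    by (intro add_mono mult_left_mono sq) (auto simp: emeasure_eq_measure)
  also have "\<dots> = ennreal ((\<eta> / w) * C + (w / \<eta>) * prob B)"
    using w B C by (simp add: ennreal_mult[symmetric] ennreal_plus[symmetric] del: ennreal_plus)
  also have "\<dots> \<le> ennreal ((C / w + w) * (\<eta> + prob B / \<eta>))"
  proof (rule ennreal_leI)
    have "0 \<le> C / w * (prob B / \<eta>) + w * \<eta>" using w B C by simp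
    moreover have "(C / w + w) * (\<eta> + prob B / \<eta>) = (\<eta> / w) * C + (w / \<eta>) * prob B + (C / w * (prob B / \<eta>) + w * \<eta>)"
      by (simp only: distrib_left distrib_right times_divide_eq_left times_divide_eq_right add_divide_distrib mult_ac add_ac)
    ultimately show "(\<eta> / w) * C + (w / \<eta>) * prob B \<le> (C / w + w) * (\<eta> + prob B / \<eta>)"
      by linarith
  qed
  finally show "(\<integral>\<^sup>+\<omega>. ennreal (X \<omega>) * indicator B \<omega> \<partial>M) \<le> ennreal ((C / w + w) * (\<eta> + prob B / \<eta>))" .
qed

lemma tame_const: assumes "0 \<le> a" shows "tame (2 * a) (\<lambda>_. ennreal a)"
proof -
  have "tame (1 / 1 + 1) (\<lambda>_. ennreal 1)" by (rule tame_square) (auto simp: emeasure_space_1)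
  from tame_cmult[OF this assms] show ?thesis by (simp add: mult.commute)
qed

text \<open>The exponential moments bound the second moment of the \<open>N\<close>-th term by a
  multiple of \<open>(1/4) ^ N\<close>. With weight \<open>(1/2) ^ N\<close> in
  \<open>tame_square\<close>, its constant becomes a multiple of \<open>(1/2) ^ N\<close>, which is
  summable.\<close>

lemma tame_exp_tail:
  fixes Y :: "nat \<Rightarrow> 'a \<Rightarrow> real"
  assumes [measurable]: "\<And>N. Y N \<in> borel_measurable M" and \<theta>: "\<theta> > 0" and K: "K \<ge> 0" and p: "p > 0"
    and mgf: "\<And>N. (\<integral>\<^sup>+\<omega>. ennreal (exp (\<theta> * Y N \<omega>)) \<partial>M) \<le> ennreal (K * (1/4) ^ N)"
  shows "tame (2 * (fact (2 * p) / \<theta> ^ (2 * p) * K + 1)) (\<lambda>\<omega>. \<Sum>N. ennreal (max 0 (Y N \<omega>) ^ p))"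
proof -
  define D where "D = fact (2 * p) / \<theta> ^ (2 * p)"
  have D0: "D \<ge> 0" using \<theta> by (simp add: D_def)
  have "tame ((D * K + 1) * (1/2) ^ N) (\<lambda>\<omega>. ennreal (max 0 (Y N \<omega>) ^ p))" for N
  proof -
    have pt: "(max 0 y ^ p)\<^sup>2 \<le> D * exp (\<theta> * y)" for y
    proof (cases "y \<le> 0")
      case True then show ?thesis using D0 p by (simp add: max_def power_0_left)
    next
      case False
      then have "(\<theta> * y) ^ (2 * p) \<le> fact (2 * p) * exp (\<theta> * y)" using \<theta> by (intro power_le_fact_exp) simp
      then have "y ^ (2 * p) \<le> D * exp (\<theta> * y)" using \<theta> by (simp add: D_def power_mult_distrib field_simps)
      then show ?thesis using False by (simp add: power_mult[symmetric] mult.commute)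
    qed
    have "(\<integral>\<^sup>+\<omega>. ennreal ((max 0 (Y N \<omega>) ^ p)\<^sup>2) \<partial>M) \<le> (\<integral>\<^sup>+\<omega>. ennreal D * ennreal (exp (\<theta> * Y N \<omega>)) \<partial>M)"
      by (rule nn_integral_mono) (use pt D0 in \<open>auto simp: ennreal_mult[symmetric] intro!: ennreal_leI\<close>)
    also have "\<dots> = ennreal D * (\<integral>\<^sup>+\<omega>. ennreal (exp (\<theta> * Y N \<omega>)) \<partial>M)" by (rule nn_integral_cmult) measurable
    also have "\<dots> \<le> ennreal D * ennreal (K * (1/4) ^ N)" by (intro mult_left_mono mgf) auto
    also have "\<dots> = ennreal (D * K * (1/4) ^ N)" using D0 K by (simp add: ennreal_mult[symmetric] mult.assoc del: ennreal_power)
    finally have "tame (D * K * (1/4) ^ N / (1/2) ^ N + (1/2) ^ N) (\<lambda>\<omega>. ennreal (max 0 (Y N \<omega>) ^ p))"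
      using D0 K by (intro tame_square) auto
    moreover have "D * K * (1/4) ^ N / (1/2) ^ N + (1/2) ^ N = (D * K + 1) * (1/2::real) ^ N"
    proof -
      have "(1/4::real) ^ N = (1/2) ^ N * (1/2) ^ N" by (simp add: power_mult_distrib[symmetric])
      then show ?thesis by (simp add: distrib_right)
    qed
    ultimately show ?thesis by simp
  qed
  moreover have "summable (\<lambda>N. (D * K + 1) * (1/2::real) ^ N)" by (intro summable_mult summable_geometric) auto
  ultimately have "tame (\<Sum>N. (D * K + 1) * (1/2) ^ N) (\<lambda>\<omega>. \<Sum>N. ennreal (max 0 (Y N \<omega>) ^ p))" by (rule tame_suminf)
  moreover have "(\<Sum>N. (D * K + 1) * (1/2) ^ N) = 2 * (D * K + 1)"
    using suminf_mult[OF summable_geometric[of "1/2::real"], of "D * K + 1"] suminf_geometric[of "1/2::real"] by simp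
  ultimately show ?thesis unfolding D_def by simp
qed

text \<open>In the \<open>k\<close>-th term \<open>\<eta>\<close> is the square root of the bound
  for the probability of \<open>B k\<close>, so the term decays geometrically after
  \<open>k0\<close>. No independence between \<open>\<xi> k\<close> and \<open>B k\<close> enters,
  although in the application both come from the same primitives.\<close>

lemma tame_random_sum:
  fixes \<xi> :: "nat \<Rightarrow> 'a \<Rightarrow> ennreal"
  assumes \<xi>: "\<And>k. tame C (\<xi> k)" and B: "\<And>k. B k \<in> events" and a: "a > 0"
    and PB: "\<And>k. k \<ge> k0 \<Longrightarrow> prob (B k) \<le> exp (- a * real (k - k0))"
  shows "(\<integral>\<^sup>+\<omega>. (\<Sum>k. \<xi> k \<omega> * indicator (B k) \<omega>) \<partial>M) \<le> ennreal (2 * C * (real k0 + 1 / (1 - exp (- a / 2))))"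
proof -
  define q where "q = exp (- a / 2)"
  have q: "0 < q" "q < 1" using a by (auto simp: q_def)
  have C: "0 \<le> C" using tame_nonneg[OF \<xi>[of 0]] .
  note [measurable] = tame_measurable[OF \<xi>] B
  have "(\<integral>\<^sup>+\<omega>. (\<Sum>k. \<xi> k \<omega> * indicator (B k) \<omega>) \<partial>M) = (\<Sum>k. \<integral>\<^sup>+\<omega>. \<xi> k \<omega> * indicator (B k) \<omega> \<partial>M)"
    by (rule nn_integral_suminf) measurable
  also have "\<dots> \<le> (\<Sum>k. ennreal (2 * C * q ^ (k - k0)))"
  proof (intro suminf_le allI)
    fix k
    have "(\<integral>\<^sup>+\<omega>. \<xi> k \<omega> * indicator (B k) \<omega> \<partial>M) \<le> ennreal (C * (q ^ (k - k0) + prob (B k) / q ^ (k - k0)))"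
      using q by (intro tameD[OF \<xi> B]) auto
    also have "\<dots> \<le> ennreal (C * (2 * q ^ (k - k0)))"
    proof (intro ennreal_leI mult_left_mono C)
      \<comment> \<open>For \<open>k < k0\<close> the truncated subtraction makes the right side 1;
        these indices contribute the summand \<open>k0\<close> of the result.\<close>
      have "prob (B k) \<le> q ^ (k - k0) * q ^ (k - k0)"
      proof (cases "k \<ge> k0")
        case True
        have "exp (- a * real (k - k0)) = q ^ (k - k0) * q ^ (k - k0)"
          unfolding q_def exp_of_nat_mult[symmetric] exp_add[symmetric] by (simp add: mult.commute)
        then show ?thesis using PB[OF True] by simp
      qed simp
      then show "q ^ (k - k0) + prob (B k) / q ^ (k - k0) \<le> 2 * q ^ (k - k0)" using q by (simp add: field_simps)
    qed
    finally show "(\<integral>\<^sup>+\<omega>. \<xi> k \<omega> * indicator (B k) \<omega> \<partial>M) \<le> ennreal (2 * C * q ^ (k - k0))" by (simp add: mult_ac)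
  qed auto
  also have "\<dots> = ennreal (2 * C * (real k0 + 1 / (1 - q)))"
  proof (rule suminf_ennreal_eq)
    show "0 \<le> 2 * C * q ^ (k - k0)" for k using C q by simp
    have "(\<lambda>k. q ^ (k + k0 - k0)) sums (1 / (1 - q))" using geometric_sums[of q] q by simp
    then have "(\<lambda>k. q ^ (k - k0)) sums (1 / (1 - q) + (\<Sum>k<k0. q ^ (k - k0)))" by (subst (asm) sums_iff_shift)
    moreover have "(\<Sum>k<k0. q ^ (k - k0)) = real k0" by simp
    ultimately have "(\<lambda>k. q ^ (k - k0)) sums (real k0 + 1 / (1 - q))" by (simp add: add.commute)
    from sums_mult[OF this, of "2 * C"] show "(\<lambda>k. 2 * C * q ^ (k - k0)) sums (2 * C * (real k0 + 1 / (1 - q)))" .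
  qed
  finally show ?thesis unfolding q_def .
qed

end

section \<open>Induction over the classes\<close>

locale class_paths =
  fixes d p :: nat and c g0 K1 K2 \<Lambda> :: real
    and y bU bL H :: "nat \<Rightarrow> real \<Rightarrow> real" and I0 :: "nat set" and N :: nat
  assumes p: "p \<ge> 2" and c: "0 < c" "c \<le> 1" and g0: "g0 \<ge> 0" and K1: "K1 \<ge> 0" and K2: "K2 \<ge> 0"
    and \<Lambda>: "c * \<Lambda> / 2 \<ge> g0 + 1" and N: "N > 0"
    and bU: "\<And>i. i \<in> {1..d} \<Longrightarrow> bU i integrable_on {0..real N}"
    and bL: "\<And>i. i \<in> {1..d} \<Longrightarrow> bL i integrable_on {0..real N}"
    and H_mono: "\<And>i s t. i \<in> {1..d} \<Longrightarrow> 0 \<le> s \<Longrightarrow> s \<le> t \<Longrightarrow> t \<le> real N \<Longrightarrow> H i s \<le> H i t"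
    and incU: "\<And>i s t. i \<in> {1..d} \<Longrightarrow> 0 \<le> s \<Longrightarrow> s \<le> t \<Longrightarrow> t \<le> real N \<Longrightarrow>
      y i t - y i s \<le> integral {s..t} (bU i) + K1 * root p (H i t - H i s)"
    and incL: "\<And>i s t. i \<in> {1..d} \<Longrightarrow> 0 \<le> s \<Longrightarrow> s \<le> t \<Longrightarrow> t \<le> real N \<Longrightarrow>
      y i s - y i t \<le> integral {s..t} (bL i) + K1 * root p (H i t - H i s)"
    and driftU_sat: "\<And>i r. i \<in> {1..d} \<Longrightarrow> i \<in> I0 \<Longrightarrow> 0 \<le> r \<Longrightarrow> r \<le> real N \<Longrightarrow> y i r > 0 \<Longrightarrow>
      bU i r \<le> g0 - c * min (y i r) \<Lambda>"
    and driftU: "\<And>i r. i \<in> {1..d} \<Longrightarrow> i \<notin> I0 \<Longrightarrow> 0 \<le> r \<Longrightarrow> r \<le> real N \<Longrightarrow> y i r > 0 \<Longrightarrow>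
      bU i r \<le> g0 + K2 * (\<Sum>j\<in>{1..<i}. \<bar>y j r\<bar>) - c * y i r"
    and driftL: "\<And>i r. i \<in> {1..d} \<Longrightarrow> 0 \<le> r \<Longrightarrow> r \<le> real N \<Longrightarrow> y i r < 0 \<Longrightarrow>
      bL i r \<le> g0 + K2 * (\<Sum>j\<in>{1..<i}. \<bar>y j r\<bar>) - c * (- y i r)"
begin

definition "budget = (\<Sum>i\<in>{1..d}. \<bar>y i 0\<bar> ^ p) + real N + (\<Sum>i\<in>{1..d}. H i (real N) - H i 0)"

lemma H_diff_nonneg: "i \<in> {1..d} \<Longrightarrow> 0 \<le> H i (real N) - H i 0"
  using H_mono[of i 0 "real N"] by simp

lemma budget_ge:
  assumes "i \<in> {1..d}"
  shows "1 \<le> budget" "real N \<le> budget" "\<bar>y i 0\<bar> ^ p \<le> budget" "H i (real N) - H i 0 \<le> budget"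
    "\<bar>y i 0\<bar> ^ p + (H i (real N) - H i 0) + real N \<le> budget"
proof -
  have a: "\<bar>y i 0\<bar> ^ p \<le> (\<Sum>i\<in>{1..d}. \<bar>y i 0\<bar> ^ p)" using assms by (intro member_le_sum) auto
  have h: "H i (real N) - H i 0 \<le> (\<Sum>i\<in>{1..d}. H i (real N) - H i 0)"
    using assms H_diff_nonneg by (intro member_le_sum) auto
  have 0: "0 \<le> \<bar>y i 0\<bar> ^ p" by simp
  show "1 \<le> budget" "real N \<le> budget" "\<bar>y i 0\<bar> ^ p \<le> budget" "H i (real N) - H i 0 \<le> budget"
    "\<bar>y i 0\<bar> ^ p + (H i (real N) - H i 0) + real N \<le> budget"
    unfolding budget_def using a h 0 H_diff_nonneg[OF assms] N by linarith+
qed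

lemma upper_long: "i \<in> {1..d} \<Longrightarrow> driven_long (y i) (bU i) (H i) N p K1"
  using p K1 by unfold_locales (auto intro: bU H_mono incU)

lemma lower_long: "i \<in> {1..d} \<Longrightarrow> driven_long (\<lambda>t. - y i t) (bL i) (H i) N p K1"
  using p K1 by unfold_locales (auto intro: bL H_mono incL)

definition "lin_const = 2 ^ (p - 1) * ((2 / c) ^ p + 1)"
definition "sat_const = (4 / c) ^ Suc p * 64 ^ p * (1 + K1 ^ p + g0 ^ p)"

lemma consts_nonneg: "0 \<le> lin_const" "0 \<le> sat_const"
  using c g0 K1 by (simp_all add: lin_const_def sat_const_def)

text \<open>The path \<open>z\<close> stands for \<open>y i\<close> as well as for its negative,
  since the same \<open>H i\<close> controls both directions. A root of order \<open>p\<close>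
  raised to \<open>p - 1\<close> is at most one plus the increment of \<open>H i\<close>, so the
  noise over all windows telescopes into \<open>budget\<close>.\<close>

lemma linear_bound:
  assumes i: "i \<in> {1..d}" and D: "driven_long z b (H i) N p K1"
    and \<sigma>: "\<And>m. m < N \<Longrightarrow> 0 \<le> S m"
    and drift: "\<And>m r. m < N \<Longrightarrow> real m \<le> r \<Longrightarrow> r \<le> real m + 1 \<Longrightarrow> z r > 0 \<Longrightarrow> b r \<le> g0 + K2 * S m - c * z r"
    and z0: "\<bar>z 0\<bar> = \<bar>y i 0\<bar>"
  shows "\<exists>\<tau>. (\<forall>m<N. 0 \<le> \<tau> m \<and> (\<forall>t\<in>{real m..real m + 1}. z t \<le> \<tau> m)) \<and>
    (\<Sum>m<N. \<tau> m ^ (p - 1)) \<le> lin_const * (2 * budget + 3 ^ (p - 1) * (K1 ^ (p - 1) * (2 * budget) + g0 ^ (p - 1) * budget + K2 ^ (p - 1) * (\<Sum>m<N. S m ^ (p - 1))))"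
proof -
  let ?P = "p - 1"
  have P: "?P > 0" "Suc ?P = p" "?P \<le> p" using p by auto
  let ?g = "\<lambda>m. g0 + K2 * S m"
  let ?h = "\<lambda>m. H i (real m + 1) - H i (real m)"
  let ?z = "\<lambda>m. K1 * root p (?h m) + ?g m"
  from driven_long.linear_drift[OF D c _ P(1), of ?g] drift \<sigma> g0 K2
  obtain \<tau> where \<tau>: "\<forall>m<N. 0 \<le> \<tau> m \<and> (\<forall>t\<in>{real m..real m + 1}. z t \<le> \<tau> m)"
    "(\<Sum>m<N. \<tau> m ^ ?P) \<le> 2 ^ ?P * ((2 / c) ^ Suc ?P + 1) * (max 0 (z 0) ^ ?P + (\<Sum>m<N. ?z m ^ ?P))"
    by (auto simp: add_nonneg_nonneg)
  have "max 0 (z 0) ^ ?P \<le> 1 + max 0 (z 0) ^ p" using P by (intro power_le_1_power) auto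
  also have "max 0 (z 0) ^ p \<le> \<bar>y i 0\<bar> ^ p" using z0 by (intro power_mono) auto
  finally have 1: "max 0 (z 0) ^ ?P \<le> 2 * budget" using budget_ge[OF i] by linarith
  have h0: "0 \<le> ?h m" if "m < N" for m using H_mono[OF i, of "real m" "real m + 1"] that by simp
  have zm: "?z m ^ ?P \<le> 3 ^ ?P * (K1 ^ ?P * (1 + ?h m) + g0 ^ ?P + K2 ^ ?P * S m ^ ?P)" if m: "m < N" for m
  proof -
    have r0: "0 \<le> root p (?h m)" using h0[OF m] by (rule real_root_ge_zero)
    have "?z m ^ ?P = (K1 * root p (?h m) + g0 + K2 * S m) ^ ?P" by (simp add: add.assoc)
    also have "\<dots> \<le> 3 ^ ?P * ((K1 * root p (?h m)) ^ ?P + g0 ^ ?P + (K2 * S m) ^ ?P)"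
      using K1 r0 g0 K2 \<sigma>[OF m] P by (intro power_add3_le) auto
    also have "(K1 * root p (?h m)) ^ ?P = K1 ^ ?P * root p (?h m) ^ ?P" by (rule power_mult_distrib)
    also have "K1 ^ ?P * root p (?h m) ^ ?P \<le> K1 ^ ?P * (1 + ?h m)"
    proof (rule mult_left_mono)
      have "root p (?h m) ^ ?P \<le> 1 + root p (?h m) ^ p" using r0 P by (intro power_le_1_power) auto
      also have "root p (?h m) ^ p = ?h m" using real_root_pow_pos2[OF _ h0[OF m]] p by simp
      finally show "root p (?h m) ^ ?P \<le> 1 + ?h m" .
    qed (use K1 in simp)
    finally show ?thesis by (simp add: power_mult_distrib)
  qed
  have tel: "(\<Sum>m<N. ?h m) = H i (real N) - H i 0"
    using sum_lessThan_telescope[of "\<lambda>m. H i (real m)" N] by (simp add: add.commute)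
  have "(\<Sum>m<N. ?z m ^ ?P) \<le> (\<Sum>m<N. 3 ^ ?P * (K1 ^ ?P * (1 + ?h m) + g0 ^ ?P + K2 ^ ?P * S m ^ ?P))"
    by (intro sum_mono zm) auto
  also have "\<dots> = 3 ^ ?P * (K1 ^ ?P * (real N + (\<Sum>m<N. ?h m)) + real N * g0 ^ ?P + K2 ^ ?P * (\<Sum>m<N. S m ^ ?P))"
    by (simp add: sum_distrib_left[symmetric] sum.distrib)
  also have "\<dots> \<le> 3 ^ ?P * (K1 ^ ?P * (2 * budget) + g0 ^ ?P * budget + K2 ^ ?P * (\<Sum>m<N. S m ^ ?P))"
  proof (intro mult_left_mono add_mono order_refl)
    show "real N + (\<Sum>m<N. ?h m) \<le> 2 * budget" unfolding tel using budget_ge[OF i] by linarith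
    show "real N * g0 ^ ?P \<le> g0 ^ ?P * budget" using budget_ge[OF i] g0 by (subst mult.commute) (intro mult_left_mono, auto)
  qed (use K1 K2 in auto)
  finally have 2: "(\<Sum>m<N. ?z m ^ ?P) \<le> 3 ^ ?P * (K1 ^ ?P * (2 * budget) + g0 ^ ?P * budget + K2 ^ ?P * (\<Sum>m<N. S m ^ ?P))" .
  have "(\<Sum>m<N. \<tau> m ^ ?P) \<le> lin_const * (max 0 (z 0) ^ ?P + (\<Sum>m<N. ?z m ^ ?P))"
    using \<tau>(2) unfolding lin_const_def P(2) .
  also have "\<dots> \<le> lin_const * (2 * budget + 3 ^ ?P * (K1 ^ ?P * (2 * budget) + g0 ^ ?P * budget + K2 ^ ?P * (\<Sum>m<N. S m ^ ?P)))"
    using consts_nonneg by (intro mult_left_mono add_mono 1 2)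
  finally show ?thesis using \<tau>(1) by blast
qed

text \<open>The negative part always has a linear drift. The positive part uses the saturated
  estimate for \<open>i \<in> I0\<close> and the linear one otherwise. The window maxima of the
  classes ahead enter as an input that is constant on each window.\<close>

lemma next_class:
  assumes i: "i \<in> {1..d}" and B: "B \<ge> 0"
    and \<sigma>: "\<And>j m. j \<in> {1..<i} \<Longrightarrow> m < N \<Longrightarrow> 0 \<le> \<sigma> j m"
    and \<sigma>y: "\<And>j m t. j \<in> {1..<i} \<Longrightarrow> m < N \<Longrightarrow> t \<in> {real m..real m + 1} \<Longrightarrow> \<bar>y j t\<bar> \<le> \<sigma> j m"
    and \<sigma>B: "(\<Sum>j\<in>{1..<i}. \<Sum>m<N. \<sigma> j m ^ (p - 1)) \<le> B * budget"
  shows "\<exists>\<tau>. (\<forall>m<N. 0 \<le> \<tau> m \<and> (\<forall>t\<in>{real m..real m + 1}. \<bar>y i t\<bar> \<le> \<tau> m)) \<and>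
    (\<Sum>m<N. \<tau> m ^ (p - 1)) \<le> 2 ^ (p - 1) * (sat_const + 2 * (lin_const * (2 + 3 ^ (p - 1) * (2 * K1 ^ (p - 1) + g0 ^ (p - 1) + K2 ^ (p - 1) * (real d ^ (p - 1) * B))))) * budget"
proof -
  let ?P = "p - 1"
  let ?S = "\<lambda>m. \<Sum>j\<in>{1..<i}. \<sigma> j m"
  let ?L = "lin_const * (2 + 3 ^ ?P * (2 * K1 ^ ?P + g0 ^ ?P + K2 ^ ?P * (real d ^ ?P * B)))"
  have P: "?P > 0" using p by simp
  have S0: "0 \<le> ?S m" if "m < N" for m using \<sigma> that by (intro sum_nonneg) auto
  have "(\<Sum>m<N. ?S m ^ ?P) \<le> (\<Sum>m<N. real d ^ ?P * (\<Sum>j\<in>{1..<i}. \<sigma> j m ^ ?P))"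
  proof (rule sum_mono)
    fix m assume m: "m \<in> {..<N}"
    have "?S m ^ ?P \<le> real (card {1..<i}) ^ ?P * (\<Sum>j\<in>{1..<i}. \<sigma> j m ^ ?P)"
      using \<sigma> m P by (intro power_sum_le) auto
    also have "\<dots> \<le> real d ^ ?P * (\<Sum>j\<in>{1..<i}. \<sigma> j m ^ ?P)"
      using \<sigma> m i by (intro mult_right_mono power_mono sum_nonneg) auto
    finally show "?S m ^ ?P \<le> real d ^ ?P * (\<Sum>j\<in>{1..<i}. \<sigma> j m ^ ?P)" .
  qed
  also have "\<dots> = real d ^ ?P * (\<Sum>j\<in>{1..<i}. \<Sum>m<N. \<sigma> j m ^ ?P)"
    unfolding sum_distrib_left[symmetric] by (subst sum.swap) simp
  also have "\<dots> \<le> real d ^ ?P * (B * budget)" by (intro mult_left_mono \<sigma>B) auto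
  finally have SB: "(\<Sum>m<N. ?S m ^ ?P) \<le> real d ^ ?P * (B * budget)" .
  have ysum: "K2 * (\<Sum>j\<in>{1..<i}. \<bar>y j r\<bar>) \<le> K2 * ?S m" if "m < N" "real m \<le> r" "r \<le> real m + 1" for m r
    using \<sigma>y that K2 by (intro mult_left_mono sum_mono) auto
  have Lle: "lin_const * (2 * budget + 3 ^ ?P * (K1 ^ ?P * (2 * budget) + g0 ^ ?P * budget + K2 ^ ?P * (\<Sum>m<N. ?S m ^ ?P))) \<le> ?L * budget"
  proof -
    have "lin_const * (2 * budget + 3 ^ ?P * (K1 ^ ?P * (2 * budget) + g0 ^ ?P * budget + K2 ^ ?P * (\<Sum>m<N. ?S m ^ ?P)))
      \<le> lin_const * (2 * budget + 3 ^ ?P * (K1 ^ ?P * (2 * budget) + g0 ^ ?P * budget + K2 ^ ?P * (real d ^ ?P * (B * budget))))"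
      using consts_nonneg K2 by (intro mult_left_mono add_mono SB order_refl) auto
    also have "\<dots> = ?L * budget" by (simp add: algebra_simps)
    finally show ?thesis .
  qed
  have b0: "0 \<le> budget" using budget_ge[OF i] by simp
  have L0: "0 \<le> ?L" using consts_nonneg K1 g0 K2 B by (intro mult_nonneg_nonneg add_nonneg_nonneg) auto
  have rN: "0 \<le> r" "r \<le> real N" if "m < N" "real m \<le> r" "r \<le> real m + 1" for m :: nat and r using that by linarith+
  have "\<exists>\<tau>. (\<forall>m<N. 0 \<le> \<tau> m \<and> (\<forall>t\<in>{real m..real m + 1}. - y i t \<le> \<tau> m)) \<and>
    (\<Sum>m<N. \<tau> m ^ ?P) \<le> lin_const * (2 * budget + 3 ^ ?P * (K1 ^ ?P * (2 * budget) + g0 ^ ?P * budget + K2 ^ ?P * (\<Sum>m<N. ?S m ^ ?P)))"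
  proof (rule linear_bound[OF i lower_long[OF i] S0])
    fix m r assume r: "m < N" "real m \<le> r" "r \<le> real m + 1" "- y i r > 0"
    have "bL i r \<le> g0 + K2 * (\<Sum>j\<in>{1..<i}. \<bar>y j r\<bar>) - c * (- y i r)"
      using driftL[OF i rN[OF r(1-3)]] r(4) by simp
    then show "bL i r \<le> g0 + K2 * ?S m - c * (- y i r)" using ysum[OF r(1-3)] by linarith
  qed auto
  then obtain \<tau>L where \<tau>L: "\<And>m. m < N \<Longrightarrow> 0 \<le> \<tau>L m" "\<And>m t. m < N \<Longrightarrow> t \<in> {real m..real m + 1} \<Longrightarrow> - y i t \<le> \<tau>L m"
    "(\<Sum>m<N. \<tau>L m ^ ?P) \<le> lin_const * (2 * budget + 3 ^ ?P * (K1 ^ ?P * (2 * budget) + g0 ^ ?P * budget + K2 ^ ?P * (\<Sum>m<N. ?S m ^ ?P)))"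
    by blast
  have \<tau>LB: "(\<Sum>m<N. \<tau>L m ^ ?P) \<le> ?L * budget" by (rule order_trans[OF \<tau>L(3) Lle])
  have "\<exists>\<tau>. (\<forall>m<N. 0 \<le> \<tau> m \<and> (\<forall>t\<in>{real m..real m + 1}. y i t \<le> \<tau> m)) \<and>
    (\<Sum>m<N. \<tau> m ^ ?P) \<le> (sat_const + ?L) * budget"
  proof (cases "i \<in> I0")
    case True
    from driven_long.saturated_drift[OF upper_long[OF i] c g0 \<Lambda> p driftU_sat[OF i True]]
    obtain \<tau> where \<tau>: "\<forall>m<N. 0 \<le> \<tau> m \<and> (\<forall>t\<in>{real m..real m + 1}. y i t \<le> \<tau> m)"
      "(\<Sum>m<N. \<tau> m ^ ?P) \<le> sat_const * (max 0 (y i 0) ^ p + (H i (real N) - H i 0) + real N)"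
      unfolding sat_const_def by blast
    have "max 0 (y i 0) ^ p \<le> \<bar>y i 0\<bar> ^ p" by (intro power_mono) auto
    then have "max 0 (y i 0) ^ p + (H i (real N) - H i 0) + real N \<le> budget" using budget_ge(5)[OF i] by linarith
    then have "sat_const * (max 0 (y i 0) ^ p + (H i (real N) - H i 0) + real N) \<le> sat_const * budget"
      using consts_nonneg by (intro mult_left_mono)
    moreover have "0 \<le> ?L * budget" using L0 b0 by (rule mult_nonneg_nonneg)
    ultimately have "(\<Sum>m<N. \<tau> m ^ ?P) \<le> (sat_const + ?L) * budget" unfolding distrib_right using \<tau>(2) by linarith
    then show ?thesis using \<tau>(1) by blast
  next
    case False
    have "\<exists>\<tau>. (\<forall>m<N. 0 \<le> \<tau> m \<and> (\<forall>t\<in>{real m..real m + 1}. y i t \<le> \<tau> m)) \<and>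
      (\<Sum>m<N. \<tau> m ^ ?P) \<le> lin_const * (2 * budget + 3 ^ ?P * (K1 ^ ?P * (2 * budget) + g0 ^ ?P * budget + K2 ^ ?P * (\<Sum>m<N. ?S m ^ ?P)))"
    proof (rule linear_bound[OF i upper_long[OF i] S0])
      fix m r assume r: "m < N" "real m \<le> r" "r \<le> real m + 1" "y i r > 0"
      have "bU i r \<le> g0 + K2 * (\<Sum>j\<in>{1..<i}. \<bar>y j r\<bar>) - c * y i r"
        using driftU[OF i False rN[OF r(1-3)] r(4)] .
      then show "bU i r \<le> g0 + K2 * ?S m - c * y i r" using ysum[OF r(1-3)] by linarith
    qed auto
    then obtain \<tau> where \<tau>: "\<forall>m<N. 0 \<le> \<tau> m \<and> (\<forall>t\<in>{real m..real m + 1}. y i t \<le> \<tau> m)"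
      and \<tau>': "(\<Sum>m<N. \<tau> m ^ ?P) \<le> lin_const * (2 * budget + 3 ^ ?P * (K1 ^ ?P * (2 * budget) + g0 ^ ?P * budget + K2 ^ ?P * (\<Sum>m<N. ?S m ^ ?P)))"
      by blast
    have "0 \<le> sat_const * budget" using consts_nonneg b0 by simp
    then have "?L * budget \<le> (sat_const + ?L) * budget" unfolding distrib_right by linarith
    from order_trans[OF order_trans[OF \<tau>' Lle] this] \<tau> show ?thesis by blast
  qed
  then obtain \<tau>U where \<tau>U: "\<And>m. m < N \<Longrightarrow> 0 \<le> \<tau>U m" "\<And>m t. m < N \<Longrightarrow> t \<in> {real m..real m + 1} \<Longrightarrow> y i t \<le> \<tau>U m"
    "(\<Sum>m<N. \<tau>U m ^ ?P) \<le> (sat_const + ?L) * budget" by blast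
  have "(\<Sum>m<N. (\<tau>U m + \<tau>L m) ^ ?P) \<le> (\<Sum>m<N. 2 ^ ?P * (\<tau>U m ^ ?P + \<tau>L m ^ ?P))"
    using \<tau>U(1) \<tau>L(1) P by (intro sum_mono power_add_le) auto
  also have "\<dots> = 2 ^ ?P * ((\<Sum>m<N. \<tau>U m ^ ?P) + (\<Sum>m<N. \<tau>L m ^ ?P))"
    by (simp only: sum_distrib_left[symmetric] sum.distrib)
  also have "\<dots> \<le> 2 ^ ?P * ((sat_const + ?L) * budget + ?L * budget)" by (intro mult_left_mono add_mono \<tau>U(3) \<tau>LB) auto
  also have "\<dots> = 2 ^ ?P * (sat_const + 2 * ?L) * budget" by (simp only: distrib_right mult_2 mult.assoc add.assoc)
  finally have "(\<Sum>m<N. (\<tau>U m + \<tau>L m) ^ ?P) \<le> 2 ^ ?P * (sat_const + 2 * ?L) * budget" .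
  moreover have "0 \<le> \<tau>U m + \<tau>L m \<and> (\<forall>t\<in>{real m..real m + 1}. \<bar>y i t\<bar> \<le> \<tau>U m + \<tau>L m)" if "m < N" for m
  proof (intro conjI ballI)
    show "0 \<le> \<tau>U m + \<tau>L m" using \<tau>U(1) \<tau>L(1) that by simp
    fix t assume "t \<in> {real m..real m + 1}"
    then show "\<bar>y i t\<bar> \<le> \<tau>U m + \<tau>L m" using \<tau>U(1)[OF that] \<tau>L(1)[OF that] \<tau>U(2)[OF that] \<tau>L(2)[OF that]
      by (simp add: abs_le_iff add.commute add_increasing add_increasing2)
  qed
  ultimately show ?thesis by (intro exI[of _ "\<lambda>m. \<tau>U m + \<tau>L m"]) blast
qed

end

text \<open>The order of the quantifiers matters: \<open>K\<close> is fixed before the saturation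
  level, the paths, the controls and the horizon, so that a single \<open>K\<close> serves all
  systems \<open>n\<close> and all \<open>T\<close>.\<close>

lemma class_paths_bound:
  fixes d p :: nat and c g0 K1 K2 :: real
  shows "\<exists>K\<ge>0. \<forall>\<Lambda> y bU bL H I0 N. class_paths d p c g0 K1 K2 \<Lambda> y bU bL H I0 N \<longrightarrow>
    (\<exists>\<sigma>. (\<forall>j\<in>{1..d}. \<forall>m<N. 0 \<le> \<sigma> j m \<and> (\<forall>t\<in>{real m..real m + 1}. \<bar>y j t\<bar> \<le> \<sigma> j m)) \<and>
      (\<Sum>j\<in>{1..d}. \<Sum>m<N. \<sigma> j m ^ (p - 1)) \<le> K * class_paths.budget d p y H N)"
proof -
  define Q where "Q i K \<longleftrightarrow> (\<forall>\<Lambda> y bU bL H I0 N. class_paths d p c g0 K1 K2 \<Lambda> y bU bL H I0 N \<longrightarrow>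
    (\<exists>\<sigma>. (\<forall>j\<in>{1..i}. \<forall>m<N. 0 \<le> \<sigma> j m \<and> (\<forall>t\<in>{real m..real m + 1}. \<bar>y j t\<bar> \<le> \<sigma> j m)) \<and>
      (\<Sum>j\<in>{1..i}. \<Sum>m<N. \<sigma> j m ^ (p - 1)) \<le> K * class_paths.budget d p y H N))" for i and K :: real
  have "\<exists>K\<ge>0. Q i K" if "i \<le> d" for i
    using that
  proof (induction i)
    case 0
    have "Q 0 0" unfolding Q_def by (intro allI impI exI[of _ "\<lambda>_ _. 0"]) simp
    then show ?case by blast
  next
    case (Suc i)
    then obtain K where K: "K \<ge> 0" and IH: "Q i K" by (meson Suc_leD)
    \<comment> \<open>The absolute value provides a nonnegative \<open>K'\<close> at a place where
      no instance of the locale, and with it no sign of its constants, is available.\<close>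
    define K' where "K' = K + \<bar>2 ^ (p - 1) * (class_paths.sat_const p c g0 K1 + 2 * (class_paths.lin_const p c *
      (2 + 3 ^ (p - 1) * (2 * K1 ^ (p - 1) + g0 ^ (p - 1) + K2 ^ (p - 1) * (real d ^ (p - 1) * K)))))\<bar>"
    show ?case
    proof (intro exI[of _ K'] conjI)
      show "0 \<le> K'" using K by (simp add: K'_def)
      show "Q (Suc i) K'" unfolding Q_def
      proof (intro allI impI)
      fix \<Lambda> y bU bL H I0 N
      assume cp: "class_paths d p c g0 K1 K2 \<Lambda> y bU bL H I0 N"
      then interpret class_paths d p c g0 K1 K2 \<Lambda> y bU bL H I0 N .
      from IH[unfolded Q_def, rule_format, OF cp] obtain \<sigma> where \<sigma>: "\<forall>j\<in>{1..i}. \<forall>m<N. 0 \<le> \<sigma> j m \<and> (\<forall>t\<in>{real m..real m + 1}. \<bar>y j t\<bar> \<le> \<sigma> j m)"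
        "(\<Sum>j\<in>{1..i}. \<Sum>m<N. \<sigma> j m ^ (p - 1)) \<le> K * budget" by blast
      have e: "{1..<Suc i} = {1..i}" by auto
      have i: "Suc i \<in> {1..d}" using Suc.prems by simp
      have "\<exists>\<tau>. (\<forall>m<N. 0 \<le> \<tau> m \<and> (\<forall>t\<in>{real m..real m + 1}. \<bar>y (Suc i) t\<bar> \<le> \<tau> m)) \<and>
        (\<Sum>m<N. \<tau> m ^ (p - 1)) \<le> 2 ^ (p - 1) * (sat_const + 2 * (lin_const * (2 + 3 ^ (p - 1) * (2 * K1 ^ (p - 1) + g0 ^ (p - 1) + K2 ^ (p - 1) * (real d ^ (p - 1) * K))))) * budget"
        by (rule next_class[OF i K, of \<sigma>]) (use \<sigma> e in auto)
      then obtain \<tau> where \<tau>: "\<forall>m<N. 0 \<le> \<tau> m \<and> (\<forall>t\<in>{real m..real m + 1}. \<bar>y (Suc i) t\<bar> \<le> \<tau> m)"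
        "(\<Sum>m<N. \<tau> m ^ (p - 1)) \<le> 2 ^ (p - 1) * (sat_const + 2 * (lin_const * (2 + 3 ^ (p - 1) * (2 * K1 ^ (p - 1) + g0 ^ (p - 1) + K2 ^ (p - 1) * (real d ^ (p - 1) * K))))) * budget"
        by blast
      have b0: "0 \<le> budget" using budget_ge[OF i] by simp
      define \<sigma>' where "\<sigma>' = \<sigma>(Suc i := \<tau>)"
      have "(\<Sum>j\<in>{1..Suc i}. \<Sum>m<N. \<sigma>' j m ^ (p - 1)) = (\<Sum>j\<in>{1..i}. \<Sum>m<N. \<sigma>' j m ^ (p - 1)) + (\<Sum>m<N. \<sigma>' (Suc i) m ^ (p - 1))"
        by simp
      also have "(\<Sum>j\<in>{1..i}. \<Sum>m<N. \<sigma>' j m ^ (p - 1)) = (\<Sum>j\<in>{1..i}. \<Sum>m<N. \<sigma> j m ^ (p - 1))"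
        by (intro sum.cong) (auto simp: \<sigma>'_def)
      also have "(\<Sum>m<N. \<sigma>' (Suc i) m ^ (p - 1)) = (\<Sum>m<N. \<tau> m ^ (p - 1))" by (simp add: \<sigma>'_def)
      also have "(\<Sum>j\<in>{1..i}. \<Sum>m<N. \<sigma> j m ^ (p - 1)) + (\<Sum>m<N. \<tau> m ^ (p - 1)) \<le> K' * budget"
        unfolding K'_def distrib_right
        by (rule add_mono[OF \<sigma>(2) order_trans[OF \<tau>(2) mult_right_mono[OF abs_ge_self b0]]])
      finally show "\<exists>\<sigma>. (\<forall>j\<in>{1..Suc i}. \<forall>m<N. 0 \<le> \<sigma> j m \<and> (\<forall>t\<in>{real m..real m + 1}. \<bar>y j t\<bar> \<le> \<sigma> j m)) \<and>
        (\<Sum>j\<in>{1..Suc i}. \<Sum>m<N. \<sigma> j m ^ (p - 1)) \<le> K' * budget"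
        using \<sigma>(1) \<tau>(1) by (intro exI[of _ \<sigma>']) (auto simp: \<sigma>'_def le_Suc_eq)
      qed
    qed
  qed
  from this[of d] show ?thesis unfolding Q_def by (simp only: order_refl simp_thms)
qed

section \<open>Moments of the renewal noise\<close>

lemma psum_diff: "psum E (k + L) - psum E k - real L = (\<Sum>j\<in>{k..<k + L}. E j - 1)"
proof -
  have "psum E (k + L) = psum E k + (\<Sum>j\<in>{k..<k + L}. E j)"
    by (induction L) (auto simp: psum_Suc)
  then show ?thesis by (simp add: sum_subtractf)
qed

lemma two_ge_one_power: "(1::real) \<le> 2 ^ p" by simp

lemma ennreal_le_sum3:
  fixes a b c :: ennreal
  shows "a \<le> a + b + c" "b \<le> a + b + c" "c \<le> a + b + c"
  unfolding le_iff_add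
  by (rule exI[of _ "b + c"], simp only: ac_simps, rule exI[of _ "a + c"], simp only: ac_simps,
      rule exI[of _ "a + b"], simp only: ac_simps)

lemma ennreal_distrib:
  "0 \<le> a \<Longrightarrow> 0 \<le> x \<Longrightarrow> 0 \<le> y \<Longrightarrow> ennreal (a * (x + y)) = ennreal a * (ennreal x + ennreal y)"
  by (simp add: ennreal_mult)

text \<open>The condition is on \<open>Suc q\<close> because dyadic intervals are charged to their
  last index: the count is the number of intervals of level \<open>i\<close> that end in the
  block.\<close>

lemma card_dyadic: assumes "i \<le> J"
  shows "card {q \<in> {k * 2^J..<Suc k * 2^J}. 2^i dvd Suc q} \<le> 2^(J - i)"
proof -
  let ?A = "{q \<in> {k * 2^J..<Suc k * 2^J}. 2^i dvd Suc q}"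
  have e: "(2::nat)^J = 2^i * 2^(J - i)" using assms by (simp add: power_add[symmetric])
  have "?A \<subseteq> (\<lambda>m. 2^i * m - 1) ` {Suc (k * 2^(J-i))..Suc k * 2^(J-i)}"
  proof
    fix q assume q: "q \<in> ?A"
    then obtain m where m: "Suc q = 2^i * m" by (auto elim: dvdE)
    have e2: "a * 2^J = 2^i * (a * 2^(J-i))" for a :: nat by (simp only: e mult.left_commute)
    have "k * 2^J < 2^i * m" "2^i * m \<le> Suc k * 2^J" using q m by auto
    then have "2^i * (k * 2^(J-i)) < 2^i * m" "2^i * m \<le> 2^i * (Suc k * 2^(J-i))" by (simp_all only: e2)
    then have "k * 2^(J-i) < m" "m \<le> Suc k * 2^(J-i)" by (simp_all only: nat_mult_less_cancel1 nat_mult_le_cancel1 zero_less_power pos2)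
    then show "q \<in> (\<lambda>m. 2^i * m - 1) ` {Suc (k * 2^(J-i))..Suc k * 2^(J-i)}"
      using m by (intro image_eqI[of _ _ m]) auto
  qed
  then have "card ?A \<le> card ((\<lambda>m. 2^i * m - 1) ` {Suc (k * 2^(J-i))..Suc k * 2^(J-i)})" by (intro card_mono) auto
  also have "\<dots> \<le> card {Suc (k * 2^(J-i))..Suc k * 2^(J-i)}" by (rule card_image_le) simp
  also have "\<dots> = 2^(J-i)" by simp
  finally show ?thesis .
qed

lemma geometric_half: "(\<Sum>i<J. (1/2::real) ^ (J - i)) \<le> 1"
proof (induction J)
  case (Suc J)
  have "(\<Sum>i<Suc J. (1/2::real) ^ (Suc J - i)) = (\<Sum>i<J. (1/2) * (1/2) ^ (J - i)) + 1/2"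
    by (simp add: Suc_diff_le)
  also have "\<dots> = (1/2) * (\<Sum>i<J. (1/2) ^ (J - i)) + 1/2" by (simp add: sum_distrib_left)
  finally show ?case using Suc by simp
qed simp

locale subexp_seq = prob_space M for M :: "'a measure" +
  fixes E :: "nat \<Rightarrow> 'a \<Rightarrow> real" and c s0 :: real
  assumes E_meas [measurable]: "\<And>j. E j \<in> borel_measurable M"
    and E_nonneg_AE: "\<And>j. AE \<omega> in M. 0 \<le> E j \<omega>"
    and c: "c \<ge> 0" and s0: "s0 > 0"
    and mgf: "\<And>I s. finite I \<Longrightarrow> \<bar>s\<bar> \<le> s0 \<Longrightarrow>
      (\<integral>\<^sup>+\<omega>. ennreal (exp (s * (\<Sum>j\<in>I. E j \<omega> - 1))) \<partial>M) \<le> ennreal (exp (c * s\<^sup>2 * real (card I)))"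
begin

abbreviation "ps m \<omega> \<equiv> psum (\<lambda>j. E j \<omega>) m"

lemma ps_meas [measurable]: "ps m \<in> borel_measurable M"
  unfolding psum_def by measurable

definition "hit_rate = min s0 (1 / (2 * (c + 1)))"

lemma hit_rate_pos: "hit_rate > 0" using s0 c by (simp add: hit_rate_def)

text \<open>Chernoff bound for the lower tail of a sum with mean \<open>m\<close>. The choice of
  \<open>hit_rate\<close> gives \<open>c * hit_rate \<le> 1/2\<close>, so the quadratic term takes
  away at most half of the linear gain; hence \<open>m / 2\<close>.\<close>

lemma hit_prob: "prob {\<omega> \<in> space M. ps m \<omega> \<le> x} \<le> exp (hit_rate * (x - real m / 2))"
proof -
  let ?B = "{\<omega> \<in> space M. ps m \<omega> \<le> x}"
  let ?s = hit_rate
  have s: "0 < ?s" "\<bar>- ?s\<bar> \<le> s0" using hit_rate_pos by (auto simp: hit_rate_def)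
  have "c * ?s \<le> c * (1 / (2 * (c + 1)))" using c by (intro mult_left_mono) (auto simp: hit_rate_def)
  also have "\<dots> \<le> 1/2" using c by (simp add: field_simps)
  finally have cs: "c * ?s \<le> 1/2" .
  have "emeasure M ?B = (\<integral>\<^sup>+\<omega>. indicator ?B \<omega> \<partial>M)" by (rule nn_integral_indicator[symmetric]) measurable
  also have "\<dots> \<le> (\<integral>\<^sup>+\<omega>. ennreal (exp (?s * (x - real m))) * ennreal (exp (- ?s * (\<Sum>j\<in>{..<m}. E j \<omega> - 1))) \<partial>M)"
  proof (rule nn_integral_mono)
    fix \<omega>
    show "indicator ?B \<omega> \<le> ennreal (exp (?s * (x - real m))) * ennreal (exp (- ?s * (\<Sum>j\<in>{..<m}. E j \<omega> - 1)))"
    proof (cases "\<omega> \<in> ?B")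
      case True
      have "0 \<le> ?s * (x - ps m \<omega>)" using True s by simp
      also have "?s * (x - ps m \<omega>) = ?s * (x - real m) + - ?s * (\<Sum>j\<in>{..<m}. E j \<omega> - 1)"
        by (simp add: psum_def sum_subtractf algebra_simps)
      finally have "1 \<le> exp (?s * (x - real m)) * exp (- ?s * (\<Sum>j\<in>{..<m}. E j \<omega> - 1))"
        unfolding exp_add[symmetric] by simp
      then show ?thesis using True by (simp add: ennreal_mult[symmetric])
    qed simp
  qed
  also have "\<dots> = ennreal (exp (?s * (x - real m))) * (\<integral>\<^sup>+\<omega>. ennreal (exp (- ?s * (\<Sum>j\<in>{..<m}. E j \<omega> - 1))) \<partial>M)"
    by (rule nn_integral_cmult) measurable
  also have "\<dots> \<le> ennreal (exp (?s * (x - real m))) * ennreal (exp (c * (- ?s)\<^sup>2 * real (card {..<m})))"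
    by (intro mult_left_mono mgf s) auto
  also have "\<dots> = ennreal (exp (?s * (x - real m) + (c * ?s) * ?s * real m))"
    by (simp add: ennreal_mult[symmetric] exp_add power2_eq_square mult.assoc)
  also have "\<dots> \<le> ennreal (exp (?s * (x - real m / 2)))"
  proof (intro ennreal_leI)
    have "(c * ?s) * (?s * real m) \<le> 1/2 * (?s * real m)" using cs s by (intro mult_right_mono) auto
    then show "exp (?s * (x - real m) + (c * ?s) * ?s * real m) \<le> exp (?s * (x - real m / 2))"
      by (simp add: algebra_simps)
  qed
  finally show ?thesis by (simp add: emeasure_eq_measure)
qed

lemma unbounded_AE: "AE \<omega> in M. \<forall>x. \<exists>m. ps m \<omega> > x"
proof (rule unbounded_AE_geometric[where q = "exp (- hit_rate / 2)" and K = "\<lambda>x. exp (hit_rate * x)"])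
  fix x m
  have "exp (hit_rate * (x - real m / 2)) = exp (hit_rate * x) * exp (- hit_rate / 2) ^ m"
    unfolding exp_of_nat_mult[symmetric] exp_add[symmetric] by (simp add: algebra_simps)
  then show "prob {\<omega> \<in> space M. ps m \<omega> \<le> x} \<le> exp (hit_rate * x) * exp (- hit_rate / 2) ^ m"
    using hit_prob[of m x] by simp
qed (use hit_rate_pos in auto)

lemma renewal_path_AE: "AE \<omega> in M. renewal_path (\<lambda>j. E j \<omega>)"
proof -
  have "AE \<omega> in M. \<forall>j. 0 \<le> E j \<omega>" using E_nonneg_AE by (simp add: AE_all_countable)
  then show ?thesis using unbounded_AE by eventually_elim (unfold_locales, auto)
qed

definition "moment_const k = 2 * fact k / s0 ^ k * exp (c * s0\<^sup>2)"

lemma moment_const_nonneg: "0 \<le> moment_const k" using s0 by (simp add: moment_const_def)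

text \<open>At the scale \<open>s0 / sqrt L\<close> the variance term of the moment generating
  function no longer depends on \<open>L\<close>, so all centred sums have uniformly bounded moments
  after division by \<open>sqrt L\<close>.\<close>

lemma moment_le:
  assumes I: "finite I" "card I = L" "L > 0"
  shows "(\<integral>\<^sup>+\<omega>. ennreal ((\<bar>\<Sum>j\<in>I. E j \<omega> - 1\<bar> / sqrt (real L)) ^ k) \<partial>M) \<le> ennreal (moment_const k)"
proof -
  define s where "s = s0 / sqrt (real L)"
  let ?S = "\<lambda>\<omega>. \<Sum>j\<in>I. E j \<omega> - 1"
  have L1: "sqrt (real L) \<ge> 1" using I by simp
  have s: "0 < s" "s \<le> s0" using s0 L1 by (auto simp: s_def divide_le_eq mult_le_cancel_left1)
  have m: "(\<integral>\<^sup>+\<omega>. ennreal (exp (t * ?S \<omega>)) \<partial>M) \<le> ennreal (exp (c * s0\<^sup>2))" if "t = s \<or> t = - s" for t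
  proof -
    have "(\<integral>\<^sup>+\<omega>. ennreal (exp (t * ?S \<omega>)) \<partial>M) \<le> ennreal (exp (c * t\<^sup>2 * real (card I)))"
      using that s by (intro mgf I) auto
    also have "c * t\<^sup>2 * real (card I) = c * s0\<^sup>2"
    proof -
      have "t\<^sup>2 = s0\<^sup>2 / real L" using that by (auto simp: s_def power_divide)
      then show ?thesis using I(2,3) by simp
    qed
    finally show ?thesis .
  qed
  have pt: "(\<bar>x\<bar> / sqrt (real L)) ^ k \<le> fact k / s0 ^ k * (exp (s * x) + exp (- s * x))" for x
  proof -
    have "(s * \<bar>x\<bar>) ^ k \<le> fact k * exp (s * \<bar>x\<bar>)" using s by (intro power_le_fact_exp) simp
    also have "\<dots> \<le> fact k * (exp (s * x) + exp (- s * x))" by (intro mult_left_mono) (auto simp: abs_real_def)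
    also have "(s * \<bar>x\<bar>) ^ k = s0 ^ k * (\<bar>x\<bar> / sqrt (real L)) ^ k" by (simp add: s_def power_mult_distrib power_divide)
    finally show ?thesis using s0 by (simp add: field_simps)
  qed
  have "(\<integral>\<^sup>+\<omega>. ennreal ((\<bar>?S \<omega>\<bar> / sqrt (real L)) ^ k) \<partial>M)
    \<le> (\<integral>\<^sup>+\<omega>. ennreal (fact k / s0 ^ k) * (ennreal (exp (s * ?S \<omega>)) + ennreal (exp (- s * ?S \<omega>))) \<partial>M)"
  proof (rule nn_integral_mono)
    fix \<omega>
    have "ennreal ((\<bar>?S \<omega>\<bar> / sqrt (real L)) ^ k) \<le> ennreal (fact k / s0 ^ k * (exp (s * ?S \<omega>) + exp (- s * ?S \<omega>)))"
      by (intro ennreal_leI pt)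
    also have "\<dots> = ennreal (fact k / s0 ^ k) * (ennreal (exp (s * ?S \<omega>)) + ennreal (exp (- s * ?S \<omega>)))"
      using s0 by (intro ennreal_distrib) auto
    finally show "ennreal ((\<bar>?S \<omega>\<bar> / sqrt (real L)) ^ k)
      \<le> ennreal (fact k / s0 ^ k) * (ennreal (exp (s * ?S \<omega>)) + ennreal (exp (- s * ?S \<omega>)))" .
  qed
  also have "\<dots> = ennreal (fact k / s0 ^ k) * ((\<integral>\<^sup>+\<omega>. ennreal (exp (s * ?S \<omega>)) \<partial>M) + (\<integral>\<^sup>+\<omega>. ennreal (exp (- s * ?S \<omega>)) \<partial>M))"
    by (subst nn_integral_cmult, measurable, subst nn_integral_add) auto
  also have "\<dots> \<le> ennreal (fact k / s0 ^ k) * (ennreal (exp (c * s0\<^sup>2)) + ennreal (exp (c * s0\<^sup>2)))"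
    by (intro mult_left_mono add_mono m) auto
  also have "\<dots> = ennreal (moment_const k)"
    using s0 by (simp add: moment_const_def ennreal_mult[symmetric] ennreal_plus[symmetric] del: ennreal_plus)
  finally show ?thesis .
qed

lemma tame_moment:
  assumes "finite I" "card I = L" "L > 0"
  shows "tame (moment_const (2 * k) + 1) (\<lambda>\<omega>. ennreal ((\<bar>\<Sum>j\<in>I. E j \<omega> - 1\<bar> / sqrt (real L)) ^ k))"
proof -
  have "tame (moment_const (2 * k) / 1 + 1) (\<lambda>\<omega>. ennreal ((\<bar>\<Sum>j\<in>I. E j \<omega> - 1\<bar> / sqrt (real L)) ^ k))"
    by (rule tame_square) (use moment_le[OF assms, of "2 * k"] moment_const_nonneg in
      \<open>auto simp: power_mult[symmetric] mult.commute\<close>)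
  then show ?thesis by simp
qed

end

locale noise_seq = subexp_seq +
  fixes n r J :: nat
  assumes r2: "r \<ge> 2" and J: "2 ^ J \<le> n"
begin

abbreviation "p \<equiv> 4 * r"
definition "sq = sqrt (real n)"
text \<open>Solves \<open>s0 * C' = c * s0\<^sup>2 + 2\<close>. The first part cancels the growth of
  the moment generating function over one block of at most \<open>n\<close> indices; the second
  leaves a factor \<open>exp (-2) \<le> 1/4\<close> for each block.\<close>

definition "C' = c * s0 + 2 / s0"

lemma n_pos: "n > 0" using J by (metis gr0I not_less_eq_eq power_eq_0_iff le_0_eq zero_neq_numeral)

lemma real_J: "(2::real) ^ J \<le> real n" using J by (metis of_nat_le_iff of_nat_numeral of_nat_power)

lemma sq_pos: "sq > 0" using n_pos by (simp add: sq_def)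
lemma C'_nonneg: "C' \<ge> 0" using c s0 by (simp add: C'_def)

lemma sq_pow_p: "sq ^ p = real n ^ (2 * r)"
proof -
  have "sq ^ p = (sq\<^sup>2) ^ (2 * r)" by (simp add: power_mult[symmetric])
  then show ?thesis by (simp add: sq_def)
qed

definition "Y k N \<omega> = \<bar>ps (k + Suc N * 2 ^ J) \<omega> - ps k \<omega> - real (Suc N) * 2 ^ J\<bar> / sq - C' * real (Suc N)"
text \<open>The sum over \<open>N\<close> dominates the supremum over all runs of blocks starting at
  \<open>k\<close>, and series preserve \<open>tame\<close>.\<close>

definition "V k \<omega> = (\<Sum>N. ennreal (max 0 (Y k N \<omega>) ^ p))"
definition "dyad i q \<omega> = \<bar>ps (Suc q) \<omega> - ps (Suc q - 2 ^ i) \<omega> - 2 ^ i\<bar> / sq"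
text \<open>Extended nonnegative values allow the definition on every path; finiteness almost surely
  follows later from \<open>tame\<close>. The index \<open>Suc q\<close> is the right end of the
  intervals charged to \<open>q\<close>, and \<open>Suc q - 2 ^ J\<close> is the left end of the
  block ending there.\<close>

definition "etaE q \<omega> = ennreal ((E q \<omega> / sq) ^ p + (1 / sq) ^ p)
  + (\<Sum>i<J. if 2 ^ i dvd Suc q then ennreal (2 ^ ((J - i) * r) * dyad i q \<omega> ^ p) else 0)
  + (if 2 ^ J dvd Suc q then V (Suc q - 2 ^ J) \<omega> else 0)"

lemma Y_meas [measurable]: "Y k N \<in> borel_measurable M" unfolding Y_def by measurable

definition "m1 = moment_const (2 * p) + 1"
definition "CV = 2 * (fact (2 * p) / s0 ^ (2 * p) * 2 + 1)"
definition "w i = m1 * (2 ^ ((J - i) * r) * (sqrt (2 ^ i) / sq) ^ p)"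

lemma m1: "m1 \<ge> 1" using moment_const_nonneg by (simp add: m1_def)
lemma CV: "CV \<ge> 0" using s0 by (simp add: CV_def)

lemma V_tame: "tame CV (V k)"
  unfolding V_def CV_def
proof (rule tame_exp_tail)
  show "s0 > 0" "0 \<le> (2::real)" "p > 0" using s0 r2 by auto
  fix N
  let ?L = "Suc N * 2 ^ J"
  let ?S = "\<lambda>\<omega>. \<Sum>j\<in>{k..<k + ?L}. E j \<omega> - 1"
  let ?s = "s0 / sq"
  have sq1: "sq \<ge> 1" using n_pos by (simp add: sq_def)
  have s: "0 < ?s" "?s \<le> s0" using s0 sq_pos sq1 by (auto simp: divide_le_eq mult_le_cancel_left1)
  have m: "(\<integral>\<^sup>+\<omega>. ennreal (exp (t * ?S \<omega>)) \<partial>M) \<le> ennreal (exp (c * s0\<^sup>2 * real (Suc N)))" if "t = ?s \<or> t = - ?s" for t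
  proof -
    have "(\<integral>\<^sup>+\<omega>. ennreal (exp (t * ?S \<omega>)) \<partial>M) \<le> ennreal (exp (c * t\<^sup>2 * real (card {k..<k + ?L})))"
      using that s by (intro mgf) auto
    also have "c * t\<^sup>2 * real (card {k..<k + ?L}) \<le> c * s0\<^sup>2 * real (Suc N)"
    proof -
      have "t\<^sup>2 = s0\<^sup>2 / real n" using that by (auto simp: power_divide sq_def)
      moreover have "real ?L \<le> real (Suc N) * real n"
        using mult_left_mono[OF real_J, of "real (Suc N)"] by (simp only: of_nat_mult of_nat_power of_nat_numeral of_nat_0_le_iff)
      then have "real ?L / real n \<le> real (Suc N)" using n_pos by (simp add: divide_le_eq)
      then have "(c * s0\<^sup>2) * (real ?L / real n) \<le> (c * s0\<^sup>2) * real (Suc N)" using c by (intro mult_left_mono) auto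
      ultimately show ?thesis by simp
    qed
    then have "ennreal (exp (c * t\<^sup>2 * real (card {k..<k + ?L}))) \<le> ennreal (exp (c * s0\<^sup>2 * real (Suc N)))" by (intro ennreal_leI) simp
    finally show ?thesis .
  qed
  define D where "D = exp (- s0 * C' * real (Suc N))"
  have Yeq: "Y k N \<omega> = \<bar>?S \<omega>\<bar> / sq - C' * real (Suc N)" for \<omega>
    unfolding Y_def psum_diff[symmetric] by (simp only: of_nat_mult of_nat_power of_nat_numeral)
  have "(\<integral>\<^sup>+\<omega>. ennreal (exp (s0 * Y k N \<omega>)) \<partial>M)
    \<le> (\<integral>\<^sup>+\<omega>. ennreal D * (ennreal (exp (?s * ?S \<omega>)) + ennreal (exp (- ?s * ?S \<omega>))) \<partial>M)"
  proof (rule nn_integral_mono)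
    fix \<omega>
    have "exp (s0 * Y k N \<omega>) = D * exp (?s * \<bar>?S \<omega>\<bar>)"
      unfolding Yeq D_def exp_add[symmetric] by (simp add: algebra_simps)
    also have "\<dots> \<le> D * (exp (?s * ?S \<omega>) + exp (- ?s * ?S \<omega>))"
      by (intro mult_left_mono) (auto simp: abs_real_def D_def)
    finally have "ennreal (exp (s0 * Y k N \<omega>)) \<le> ennreal (D * (exp (?s * ?S \<omega>) + exp (- ?s * ?S \<omega>)))" by (rule ennreal_leI)
    also have "\<dots> = ennreal D * (ennreal (exp (?s * ?S \<omega>)) + ennreal (exp (- ?s * ?S \<omega>)))"
      by (intro ennreal_distrib) (auto simp: D_def)
    finally show "ennreal (exp (s0 * Y k N \<omega>)) \<le> ennreal D * (ennreal (exp (?s * ?S \<omega>)) + ennreal (exp (- ?s * ?S \<omega>)))" .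
  qed
  also have "\<dots> = ennreal D * ((\<integral>\<^sup>+\<omega>. ennreal (exp (?s * ?S \<omega>)) \<partial>M) + (\<integral>\<^sup>+\<omega>. ennreal (exp (- ?s * ?S \<omega>)) \<partial>M))"
    by (subst nn_integral_cmult, measurable, subst nn_integral_add) auto
  also have "\<dots> \<le> ennreal D * (ennreal (exp (c * s0\<^sup>2 * real (Suc N))) + ennreal (exp (c * s0\<^sup>2 * real (Suc N))))"
    by (intro mult_left_mono add_mono m) auto
  also have "\<dots> = ennreal (2 * exp (- 2 * real (Suc N)))"
  proof -
    have "D * exp (c * s0\<^sup>2 * real (Suc N)) = exp (- 2 * real (Suc N))"
      unfolding D_def exp_add[symmetric] C'_def using s0 by (simp add: algebra_simps power2_eq_square)
    then show ?thesis by (simp add: ennreal_mult[symmetric] ennreal_plus[symmetric] D_def del: ennreal_plus)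
  qed
  also have "\<dots> \<le> ennreal (2 * (1/4) ^ N)"
  proof (intro ennreal_leI mult_left_mono)
    have "exp (- 2 * real (Suc N)) = exp (-2) ^ Suc N" unfolding exp_of_nat_mult[symmetric] by (simp add: mult.commute)
    also have "\<dots> \<le> (1/4) ^ Suc N"
    proof (rule power_mono)
      have "(4::real) \<le> exp 1 * exp 1" using exp_ge_add_one_self[of "1::real"] mult_mono[of 2 "exp 1::real" 2 "exp 1"] by simp
      then have "(4::real) \<le> exp 2" by (simp add: exp_add[symmetric])
      then show "exp (-2::real) \<le> 1/4" by (simp add: exp_minus field_simps)
    qed simp
    also have "\<dots> \<le> (1/4::real) ^ N" by (simp add: power_decreasing)
    finally show "exp (- 2 * real (Suc N)) \<le> (1/4) ^ N" .
  qed simp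
  finally show "(\<integral>\<^sup>+\<omega>. ennreal (exp (s0 * Y k N \<omega>)) \<partial>M) \<le> ennreal (2 * (1/4) ^ N)" .
qed measurable

lemma dyad_tame:
  assumes "2 ^ i dvd Suc q"
  shows "tame (w i) (\<lambda>\<omega>. ennreal (2 ^ ((J - i) * r) * dyad i q \<omega> ^ p))"
proof -
  have le: "2 ^ i \<le> Suc q" using assms by (intro dvd_imp_le) auto
  define k where "k = Suc q - 2 ^ i"
  have k: "Suc q = k + 2 ^ i" using le by (simp add: k_def)
  define a where "a = 2 ^ ((J - i) * r) * (sqrt (2 ^ i) / sq) ^ p"
  have a0: "a \<ge> 0" using sq_pos by (simp add: a_def)
  have "tame (moment_const (2 * p) + 1) (\<lambda>\<omega>. ennreal ((\<bar>\<Sum>j\<in>{k..<k + 2 ^ i}. E j \<omega> - 1\<bar> / sqrt (real (2 ^ i))) ^ p))"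
    by (rule tame_moment) auto
  from tame_cmult[OF this a0] have "tame (a * m1) (\<lambda>\<omega>. ennreal a * ennreal ((\<bar>\<Sum>j\<in>{k..<k + 2 ^ i}. E j \<omega> - 1\<bar> / sqrt (real (2 ^ i))) ^ p))"
    by (simp add: m1_def)
  moreover have "ennreal a * ennreal ((\<bar>\<Sum>j\<in>{k..<k + 2 ^ i}. E j \<omega> - 1\<bar> / sqrt (real (2 ^ i))) ^ p)
     = ennreal (2 ^ ((J - i) * r) * dyad i q \<omega> ^ p)" for \<omega>
  proof -
    have "dyad i q \<omega> = \<bar>\<Sum>j\<in>{k..<k + 2 ^ i}. E j \<omega> - 1\<bar> / sq"
      using psum_diff[of "\<lambda>j. E j \<omega>" k "2 ^ i"] unfolding dyad_def k by simp
    also have "\<dots> = (sqrt (2 ^ i) / sq) * (\<bar>\<Sum>j\<in>{k..<k + 2 ^ i}. E j \<omega> - 1\<bar> / sqrt (2 ^ i))" by simp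
    finally have "dyad i q \<omega> ^ p = (sqrt (2 ^ i) / sq) ^ p * (\<bar>\<Sum>j\<in>{k..<k + 2 ^ i}. E j \<omega> - 1\<bar> / sqrt (2 ^ i)) ^ p"
      by (simp only: power_mult_distrib)
    then show ?thesis using a0 by (simp add: ennreal_mult[symmetric] a_def mult.assoc)
  qed
  ultimately show ?thesis by (simp add: w_def a_def mult.commute)
qed

lemma first_tame: "tame (2 ^ p / sq ^ p * (m1 + 4)) (\<lambda>\<omega>. ennreal ((E q \<omega> / sq) ^ p + (1 / sq) ^ p))"
proof -
  have "tame (moment_const (2 * p) + 1) (\<lambda>\<omega>. ennreal ((\<bar>\<Sum>j\<in>{q}. E j \<omega> - 1\<bar> / sqrt (real 1)) ^ p))"
    by (rule tame_moment) auto
  then have "tame m1 (\<lambda>\<omega>. ennreal (\<bar>E q \<omega> - 1\<bar> ^ p))" by (simp add: m1_def)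
  from tame_cmult[OF tame_add[OF this tame_const[of 2]], of "2 ^ p / sq ^ p"]
  have t: "tame (2 ^ p / sq ^ p * (m1 + 2 * 2)) (\<lambda>\<omega>. ennreal (2 ^ p / sq ^ p) * (ennreal (\<bar>E q \<omega> - 1\<bar> ^ p) + ennreal 2))"
    using sq_pos by simp
  show ?thesis
  proof (rule tame_mono[OF t])
    fix \<omega>
    have "E q \<omega> ^ p = \<bar>E q \<omega>\<bar> ^ p" by (simp add: power_even_abs)
    also have "\<dots> \<le> (\<bar>E q \<omega> - 1\<bar> + 1) ^ p" by (intro power_mono) auto
    also have "\<dots> \<le> 2 ^ p * (\<bar>E q \<omega> - 1\<bar> ^ p + 1 ^ p)" using r2 by (intro power_add_le) auto
    finally have "E q \<omega> ^ p + 1 \<le> 2 ^ p * (\<bar>E q \<omega> - 1\<bar> ^ p + 2)"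
      using two_ge_one_power[of p] unfolding distrib_left power_one by linarith
    then have "(E q \<omega> ^ p + 1) / sq ^ p \<le> 2 ^ p * (\<bar>E q \<omega> - 1\<bar> ^ p + 2) / sq ^ p" using sq_pos by (intro divide_right_mono) auto
    then have "ennreal ((E q \<omega> / sq) ^ p + (1 / sq) ^ p) \<le> ennreal (2 ^ p / sq ^ p * (\<bar>E q \<omega> - 1\<bar> ^ p + 2))"
      by (intro ennreal_leI) (simp add: power_divide add_divide_distrib)
    also have "\<dots> = ennreal (2 ^ p / sq ^ p) * (ennreal (\<bar>E q \<omega> - 1\<bar> ^ p) + ennreal 2)"
      using sq_pos by (subst ennreal_mult) auto
    finally show "ennreal ((E q \<omega> / sq) ^ p + (1 / sq) ^ p) \<le> ennreal (2 ^ p / sq ^ p) * (ennreal (\<bar>E q \<omega> - 1\<bar> ^ p) + ennreal 2)" .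
  qed (use sq_pos in auto)
qed

definition "teta q = 2 ^ p / sq ^ p * (m1 + 4) + (\<Sum>i<J. if 2 ^ i dvd Suc q then w i else 0) + (if 2 ^ J dvd Suc q then CV else 0)"

lemma etaE_tame: "tame (teta q) (etaE q)"
  unfolding teta_def etaE_def
proof (intro tame_add tame_sum first_tame)
  show "tame (if 2 ^ i dvd Suc q then w i else 0) (\<lambda>\<omega>. if 2 ^ i dvd Suc q then ennreal (2 ^ ((J - i) * r) * dyad i q \<omega> ^ p) else 0)" for i
    using dyad_tame tame_0 by auto
  show "tame (if 2 ^ J dvd Suc q then CV else 0) (\<lambda>\<omega>. if 2 ^ J dvd Suc q then V (Suc q - 2 ^ J) \<omega> else 0)"
    using V_tame tame_0 by auto
qed auto

definition "Cxi = 2 ^ p * (m1 + 4) + m1 + CV"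

text \<open>The left factor counts the level-\<open>i\<close> intervals in one block. What remains
  per level is \<open>2 ^ (1 - r)\<close>, which is at most 1/2 because
  \<open>r \<ge> 2\<close>.\<close>

lemma w_bound: assumes "i < J" shows "2 ^ (J - i) * w i \<le> m1 * (1/2) ^ (J - i)"
proof -
  define k where "k = J - i"
  have e: "(2::real) ^ J = 2 ^ i * 2 ^ k" using assms by (simp add: k_def power_add[symmetric])
  have "(sqrt (2 ^ i) / sq) ^ p = (2 ^ i) ^ (2 * r) / real n ^ (2 * r)"
  proof -
    have "sqrt (2 ^ i) ^ p = ((sqrt (2 ^ i))\<^sup>2) ^ (2 * r)" by (simp only: power_mult[symmetric]) simp
    then show ?thesis by (simp add: power_divide sq_pow_p)
  qed
  also have "\<dots> = (2 ^ i / real n) ^ (2 * r)" by (simp add: power_divide)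
  also have "\<dots> \<le> (2 ^ i / 2 ^ J) ^ (2 * r)"
  proof -
    show ?thesis using real_J by (intro power_mono divide_left_mono) (use n_pos in auto)
  qed
  also have "2 ^ i / (2::real) ^ J = (1/2) ^ k" by (simp add: e power_divide)
  finally have "(sqrt (2 ^ i) / sq) ^ p \<le> ((1/2) ^ k) ^ (2 * r)" .
  then have "2 ^ k * (m1 * (2 ^ (k * r) * (sqrt (2 ^ i) / sq) ^ p)) \<le> 2 ^ k * (m1 * (2 ^ (k * r) * ((1/2) ^ k) ^ (2 * r)))"
    using m1 by (intro mult_left_mono) auto
  also have "\<dots> = m1 * ((2 * (2 ^ r * (1/2) ^ (2 * r))) ^ k)"
  proof -
    have "(2::real) ^ (k * r) = (2 ^ r) ^ k" by (simp only: power_mult[symmetric] mult.commute[of k])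
    moreover have "((1/2::real) ^ k) ^ (2 * r) = ((1/2) ^ (2 * r)) ^ k" by (simp only: power_mult[symmetric] mult.commute[of k])
    ultimately show ?thesis by (simp only: power_mult_distrib mult.left_commute)
  qed
  also have "\<dots> \<le> m1 * (1/2) ^ k"
  proof (intro mult_left_mono power_mono)
    have "(2::real) ^ r * (1/2) ^ (2 * r) = (1/2) ^ r" by (simp add: power_mult_distrib power_divide mult_2 power_add)
    also have "\<dots> \<le> (1/2) ^ 2" using r2 by (intro power_decreasing) auto
    finally show "2 * ((2::real) ^ r * (1/2) ^ (2 * r)) \<le> 1/2" by (simp add: power2_eq_square)
  qed (use m1 in auto)
  finally show ?thesis unfolding w_def k_def .
qed

text \<open>Uniformity in \<open>n\<close> is obtained here: the \<open>2 ^ J\<close> single steps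
  are each of size \<open>1 / sq ^ p\<close> with \<open>2 ^ J \<le> n \<le> sq ^ p\<close>, the
  dyadic levels form a geometric series, and each block contains one end point of level
  \<open>J\<close>, which carries one copy of \<open>V\<close>.\<close>

lemma block_sum: "(\<Sum>q\<in>{k * 2 ^ J..<Suc k * 2 ^ J}. teta q) \<le> Cxi"
proof -
  let ?B = "{k * 2 ^ J..<Suc k * 2 ^ J}"
  have w0: "w i \<ge> 0" for i using m1 sq_pos by (simp add: w_def)
  have cnt: "(\<Sum>q\<in>?B. if 2 ^ i dvd Suc q then a else 0) \<le> 2 ^ (J - i) * a" if "i \<le> J" "0 \<le> a" for i and a :: real
  proof -
    have "(\<Sum>q\<in>?B. if 2 ^ i dvd Suc q then a else 0) = (\<Sum>q\<in>{q\<in>?B. 2 ^ i dvd Suc q}. a)"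
      by (rule sum.inter_filter[symmetric]) simp
    also have "\<dots> = real (card {q\<in>?B. 2 ^ i dvd Suc q}) * a" by simp
    also have "\<dots> \<le> real (2 ^ (J - i)) * a" using card_dyadic[OF that(1), of k] that(2) by (intro mult_right_mono) (simp_all only: of_nat_le_iff)
    finally show ?thesis by simp
  qed
  have "(\<Sum>q\<in>?B. teta q) = 2 ^ J * (2 ^ p / sq ^ p * (m1 + 4)) + (\<Sum>i<J. \<Sum>q\<in>?B. if 2 ^ i dvd Suc q then w i else 0)
     + (\<Sum>q\<in>?B. if 2 ^ J dvd Suc q then CV else 0)"
    unfolding teta_def sum.distrib by (subst sum.swap) simp
  also have "(\<Sum>i<J. \<Sum>q\<in>?B. if 2 ^ i dvd Suc q then w i else 0) \<le> (\<Sum>i<J. m1 * (1/2) ^ (J - i))"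
  proof (rule sum_mono)
    fix i assume "i \<in> {..<J}"
    then show "(\<Sum>q\<in>?B. if 2 ^ i dvd Suc q then w i else 0) \<le> m1 * (1/2) ^ (J - i)"
      using cnt[of i "w i"] w_bound[of i] w0[of i] by simp
  qed
  also have "\<dots> = m1 * (\<Sum>i<J. (1/2) ^ (J - i))" by (simp add: sum_distrib_left)
  also have "\<dots> \<le> m1 * 1" using m1 by (intro mult_left_mono geometric_half) auto
  also have "(\<Sum>q\<in>?B. if 2 ^ J dvd Suc q then CV else 0) \<le> CV" using cnt[of J CV] CV by simp
  also have "2 ^ J * (2 ^ p / sq ^ p * (m1 + 4)) \<le> 2 ^ p * (m1 + 4)"
  proof -
    have "(2::real) ^ J \<le> real n" by (rule real_J)
    also have "\<dots> \<le> real n ^ (2 * r)" using n_pos r2 by (intro self_le_power) auto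
    finally have "2 ^ J / sq ^ p \<le> 1" using n_pos by (simp add: sq_pow_p divide_le_eq)
    then have "(2 ^ J / sq ^ p) * (2 ^ p * (m1 + 4)) \<le> 1 * (2 ^ p * (m1 + 4))" using m1 by (intro mult_right_mono) auto
    then show ?thesis by simp
  qed
  finally show ?thesis by (simp add: Cxi_def)
qed

definition "xi k \<omega> = (\<Sum>q\<in>{k * 2 ^ J..<Suc k * 2 ^ J}. etaE q \<omega>)"

lemma xi_tame: "tame Cxi (xi k)"
proof -
  have t: "tame (\<Sum>q\<in>{k * 2 ^ J..<Suc k * 2 ^ J}. teta q) (xi k)"
    unfolding xi_def by (intro tame_sum etaE_tame) simp
  then show ?thesis by (rule tame_mono) (use tame_measurable[OF t] block_sum in auto)
qed

definition "eta q \<omega> = enn2real (etaE q \<omega>)"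

lemma noise_control_AE: "AE \<omega> in M. noise_control (\<lambda>j. E j \<omega>) sq C' r J (\<lambda>q. eta q \<omega>) \<and> (\<forall>q. ennreal (eta q \<omega>) = etaE q \<omega>)"
proof -
  have "AE \<omega> in M. \<forall>q. etaE q \<omega> < top" using tame_finite[OF etaE_tame] by (simp add: AE_all_countable)
  then show ?thesis using renewal_path_AE
  proof eventually_elim
    case (elim \<omega>)
    have eq: "ennreal (eta q \<omega>) = etaE q \<omega>" for q using elim(1) by (simp add: eta_def)
    have eta0: "0 \<le> eta q \<omega>" for q by (simp add: eta_def)
    have le: "x \<le> eta q \<omega>" if "ennreal x \<le> etaE q \<omega>" for x q
      using that eta0[of q] unfolding eq[symmetric] by simp
    interpret renewal_path "\<lambda>j. E j \<omega>" by (rule elim(2))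
    show ?case
    proof
      show "noise_control (\<lambda>j. E j \<omega>) sq C' r J (\<lambda>q. eta q \<omega>)"
      proof
        show "sq > 0" "C' \<ge> 0" "r > 0" using sq_pos C'_nonneg r2 by auto
        show "(E q \<omega> / sq) ^ p + (1 / sq) ^ p \<le> eta q \<omega>" for q
          unfolding etaE_def by (rule le[unfolded etaE_def]) (rule ennreal_le_sum3)
        show "2 ^ ((J - i) * r) * (\<bar>ps (q + 2 ^ i) \<omega> - ps q \<omega> - 2 ^ i\<bar> / sq) ^ p \<le> eta (q + 2 ^ i - 1) \<omega>"
          if "i < J" "2 ^ i dvd q" for i q
        proof (rule le)
          have S: "Suc (q + 2 ^ i - 1) = q + 2 ^ i" by simp
          let ?f = "\<lambda>i. if 2 ^ i dvd Suc (q + 2 ^ i - 1) then ennreal (2 ^ ((J - i) * r) * dyad i (q + 2 ^ i - 1) \<omega> ^ p) else 0"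
          have "ennreal (2 ^ ((J - i) * r) * (\<bar>ps (q + 2 ^ i) \<omega> - ps q \<omega> - 2 ^ i\<bar> / sq) ^ p)
            = (if 2 ^ i dvd Suc (q + 2 ^ i - 1) then ennreal (2 ^ ((J - i) * r) * dyad i (q + 2 ^ i - 1) \<omega> ^ p) else 0)"
            unfolding dyad_def S using that by simp
          also have "\<dots> \<le> (\<Sum>l<J. if 2 ^ l dvd Suc (q + 2 ^ i - 1) then ennreal (2 ^ ((J - l) * r) * dyad l (q + 2 ^ i - 1) \<omega> ^ p) else 0)"
            using that by (intro member_le_sum) auto
          also have "\<dots> \<le> etaE (q + 2 ^ i - 1) \<omega>" unfolding etaE_def by (rule ennreal_le_sum3)
          finally show "ennreal (2 ^ ((J - i) * r) * (\<bar>ps (q + 2 ^ i) \<omega> - ps q \<omega> - 2 ^ i\<bar> / sq) ^ p) \<le> etaE (q + 2 ^ i - 1) \<omega>" .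
        qed
        show "max 0 (\<bar>ps (q + N * 2 ^ J) \<omega> - ps q \<omega> - real N * 2 ^ J\<bar> / sq - C' * real N) ^ p \<le> eta (q + 2 ^ J - 1) \<omega>"
          if "2 ^ J dvd q" "0 < N" for N q
        proof (rule le)
          have S: "Suc (q + 2 ^ J - 1) = q + 2 ^ J" by simp
          have "\<exists>N'. N = Suc N'" using that(2) by (rule gr0_implies_Suc)
          then obtain N' where N': "N = Suc N'" by blast
          have "ennreal (max 0 (\<bar>ps (q + N * 2 ^ J) \<omega> - ps q \<omega> - real N * 2 ^ J\<bar> / sq - C' * real N) ^ p)
            = ennreal (max 0 (Y q N' \<omega>) ^ p)" by (simp add: Y_def N')
          also have "\<dots> \<le> V q \<omega>" unfolding V_def by (rule ennreal_term_le_suminf)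
          also have "\<dots> = (if 2 ^ J dvd q + 2 ^ J then V (q + 2 ^ J - 2 ^ J) \<omega> else 0)" using that by simp
          also have "\<dots> \<le> etaE (q + 2 ^ J - 1) \<omega>" unfolding etaE_def S by (rule ennreal_le_sum3)
          finally show "ennreal (max 0 (\<bar>ps (q + N * 2 ^ J) \<omega> - ps q \<omega> - real N * 2 ^ J\<bar> / sq - C' * real N) ^ p)
            \<le> etaE (q + 2 ^ J - 1) \<omega>" .
        qed
      qed
    qed (use eq in auto)
  qed
qed

text \<open>The index range is rounded up to whole blocks. A block contributes only if its first
  index is at most \<open>m\<close>, and this event is what the indicators record.\<close>

lemma sum_eta_le:
  assumes "\<forall>q. ennreal (eta q \<omega>) = etaE q \<omega>" "\<And>k. k * 2 ^ J \<le> m \<Longrightarrow> \<omega> \<in> B k"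
  shows "ennreal (\<Sum>q\<le>m. eta q \<omega>) \<le> (\<Sum>k. xi k \<omega> * indicator (B k) \<omega>)"
proof -
  define K where "K = m div 2 ^ J"
  have "m mod 2 ^ J < 2 ^ J" by simp
  then have sub: "m < Suc K * 2 ^ J" unfolding K_def using div_mult_mod_eq[of m "2 ^ J"] by (simp only: mult_Suc)
  have "ennreal (\<Sum>q\<le>m. eta q \<omega>) = (\<Sum>q\<le>m. ennreal (eta q \<omega>))" by (rule sum_ennreal[symmetric]) (simp add: eta_def)
  also have "\<dots> = (\<Sum>q\<le>m. etaE q \<omega>)" using assms(1) by simp
  also have "\<dots> \<le> (\<Sum>q<Suc K * 2 ^ J. etaE q \<omega>)" using sub by (intro sum_mono2) auto
  also have "\<dots> = (\<Sum>k<Suc K. xi k \<omega>)"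
    unfolding xi_def using sum.nat_group[of "\<lambda>q. etaE q \<omega>" "2 ^ J" "Suc K"] by (simp only: mult_Suc add.commute)
  also have "\<dots> = (\<Sum>k<Suc K. xi k \<omega> * indicator (B k) \<omega>)"
  proof (rule sum.cong)
    fix k assume "k \<in> {..<Suc K}"
    then have "k * 2 ^ J \<le> K * 2 ^ J" by simp
    also have "\<dots> \<le> m" unfolding K_def by simp
    finally show "xi k \<omega> = xi k \<omega> * indicator (B k) \<omega>" using assms(2)[of k] by simp
  qed simp
  also have "\<dots> \<le> (\<Sum>k. xi k \<omega> * indicator (B k) \<omega>)" by (rule sum_le_suminf) auto
  finally show ?thesis .
qed

end

section \<open>Inter-event laws and down times\<close>

context prob_space
begin

lemma subexp_seq_indep:
  fixes X :: "'i \<Rightarrow> 'a \<Rightarrow> real" and e :: "nat \<Rightarrow> 'i"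
  assumes ind: "indep_vars (\<lambda>_. borel) X V" and e: "inj e" "range e \<subseteq> V" and a: "a > 0"
    and nonneg: "\<And>j. AE \<omega> in M. 0 \<le> X (e j) \<omega>"
    and tail: "\<And>j k. prob {\<omega> \<in> space M. X (e j) \<omega> > a * real k} \<le> (1/2) ^ k"
    and mean: "\<And>j. integrable M (X (e j))" "\<And>j. expectation (X (e j)) = 1"
  shows "subexp_seq M (\<lambda>j. X (e j)) (mgf_const a) (exp_rate a / 2)"
proof
  show "X (e j) \<in> borel_measurable M" for j
    using ind e unfolding indep_vars_def by auto
  show "AE \<omega> in M. 0 \<le> X (e j) \<omega>" for j by (rule nonneg)
  show "0 \<le> mgf_const a" "0 < exp_rate a / 2" using mgf_const_pos[OF a] exp_rate_pos[OF a] by auto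
  fix I :: "nat set" and s :: real assume I: "finite I" and s: "\<bar>s\<bar> \<le> exp_rate a / 2"
  have "(\<integral>\<^sup>+\<omega>. ennreal (exp (s * (\<Sum>j\<in>I. X (e j) \<omega> - 1))) \<partial>M) = (\<integral>\<^sup>+\<omega>. ennreal (\<Prod>i\<in>e ` I. exp (s * (X i \<omega> - 1))) \<partial>M)"
  proof (rule nn_integral_cong)
    fix \<omega>
    have "(\<Prod>i\<in>e ` I. exp (s * (X i \<omega> - 1))) = (\<Prod>j\<in>I. exp (s * (X (e j) \<omega> - 1)))"
      by (rule prod.reindex_cong[of e]) (use e in \<open>auto intro: inj_on_subset\<close>)
    then show "ennreal (exp (s * (\<Sum>j\<in>I. X (e j) \<omega> - 1))) = ennreal (\<Prod>i\<in>e ` I. exp (s * (X i \<omega> - 1)))"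
      using I by (simp add: exp_sum sum_distrib_left)
  qed
  also have "\<dots> = (\<Prod>i\<in>e ` I. \<integral>\<^sup>+\<omega>. ennreal (exp (s * (X i \<omega> - 1))) \<partial>M)"
    by (rule nn_integral_prod_indep[OF ind, of "e ` I" "\<lambda>_ x. exp (s * (x - 1))"]) (use I e in auto)
  also have "\<dots> \<le> (\<Prod>i\<in>e ` I. ennreal (exp (mgf_const a * s\<^sup>2)))"
  proof (rule prod_mono_ennreal)
    fix i assume "i \<in> e ` I"
    then obtain j where j: "i = e j" by blast
    have "X (e j) \<in> borel_measurable M" using ind e unfolding indep_vars_def by auto
    then show "(\<integral>\<^sup>+\<omega>. ennreal (exp (s * (X i \<omega> - 1))) \<partial>M) \<le> ennreal (exp (mgf_const a * s\<^sup>2))"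
      unfolding j by (rule mgf_centered_le[OF _ nonneg a tail mean s])
  qed
  also have "\<dots> = ennreal (exp (mgf_const a * s\<^sup>2)) ^ card I"
    using e by (simp add: card_image inj_on_subset)
  also have "\<dots> = ennreal (exp (mgf_const a * s\<^sup>2 * real (card I)))"
    by (simp add: ennreal_power exp_of_nat_mult[symmetric] mult.commute)
  finally show "(\<integral>\<^sup>+\<omega>. ennreal (exp (s * (\<Sum>j\<in>I. X (e j) \<omega> - 1))) \<partial>M) \<le> ennreal (exp (mgf_const a * s\<^sup>2 * real (card I)))" .
qed

lemma exponential_tail:
  assumes "distributed M lborel X (exponential_density 1)" "a \<ge> 1"
  shows "prob {\<omega> \<in> space M. X \<omega> > a * real k} \<le> (1/2) ^ k"
proof -
  have "prob {\<omega> \<in> space M. X \<omega> > a * real k} = exp (- (a * real k) * 1)"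
    using exponential_distributedD_gt[OF assms(1), of "a * real k"] assms(2) by simp
  also have "\<dots> \<le> exp (real k * - 1)" using mult_right_mono[OF assms(2), of "real k"] by simp
  also have "\<dots> = exp (-1) ^ k" by (rule exp_of_nat_mult)
  also have "\<dots> \<le> (1/2) ^ k"
    using exp_ge_add_one_self[of "1::real"] by (intro power_mono) (auto simp: exp_minus field_simps)
  finally show ?thesis .
qed

lemma exponential_nonneg:
  assumes D: "distributed M lborel X (exponential_density l)" and l: "l > 0"
  shows "AE \<omega> in M. 0 < X \<omega>"
proof -
  have [measurable]: "X \<in> borel_measurable M" using distributed_measurable[OF D] by simp
  have "prob {\<omega> \<in> space M. X \<omega> \<le> 0} = 0" using exponential_distributedD_le[OF D _ l, of 0] by simp
  then have "emeasure M {\<omega> \<in> space M. X \<omega> \<le> 0} = 0" by (simp add: emeasure_eq_measure)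
  then show ?thesis by (intro AE_I[of _ _ "{\<omega> \<in> space M. X \<omega> \<le> 0}"]) (auto simp: not_less)
qed

text \<open>Tilting: the density of rate \<open>l\<close> times \<open>exp (- s * x)\<close> is
  \<open>l / (l + s)\<close> times the density of rate \<open>l + s\<close>.\<close>

lemma exponential_laplace:
  assumes D: "distributed M lborel X (exponential_density l)" and l: "l > 0" and s: "s > 0"
  shows "(\<integral>\<^sup>+\<omega>. ennreal (exp (- s * X \<omega>)) \<partial>M) = ennreal (l / (l + s))"
proof -
  have "(\<integral>\<^sup>+\<omega>. ennreal (exp (- s * X \<omega>)) \<partial>M) = (\<integral>\<^sup>+x. ennreal (exponential_density l x) * ennreal (exp (- s * x)) \<partial>lborel)"
    using distributed_nn_integral[OF D, of "\<lambda>x. ennreal (exp (- s * x))"] by simp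
  also have "\<dots> = (\<integral>\<^sup>+x. ennreal (l / (l + s)) * ennreal (exponential_density (l + s) x) \<partial>lborel)"
  proof (rule nn_integral_cong)
    fix x :: real
    have "exponential_density l x * exp (- s * x) = (l / (l + s)) * exponential_density (l + s) x"
    proof (cases "x < 0")
      case False
      have e: "exp (- x * (l + s)) = exp (- x * l) * exp (- s * x)"
        unfolding exp_add[symmetric] by (simp add: algebra_simps)
      have "l + s \<noteq> 0" using l s by simp
      then show ?thesis unfolding exponential_density_def e using False by simp
    qed (simp add: exponential_density_def)
    then show "ennreal (exponential_density l x) * ennreal (exp (- s * x)) = ennreal (l / (l + s)) * ennreal (exponential_density (l + s) x)"
      using l s by (simp add: ennreal_mult[symmetric] exponential_density_nonneg)
  qed
  also have "\<dots> = ennreal (l / (l + s)) * (\<integral>\<^sup>+x. ennreal (exponential_density (l + s) x) \<partial>lborel)"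
    by (rule nn_integral_cmult) simp
  also have "(\<integral>\<^sup>+x. ennreal (exponential_density (l + s) x) \<partial>lborel) = 1"
  proof -
    interpret P: prob_space "density lborel (exponential_density (l + s))"
      by (rule prob_space_exponential_density) (use l s in simp)
    show ?thesis using P.emeasure_space_1 by (simp add: emeasure_density)
  qed
  finally show ?thesis by simp
qed

end

text \<open>The tail is decreasing, so its integral from \<open>t\<close> on is at least
  \<open>2 * C\<close> times its value at \<open>t + 2 * C\<close>, while by assumption it is at
  most \<open>C\<close> times its value at \<open>t\<close>. Thus the tail halves on every stretch
  of length \<open>2 * C\<close>.\<close>

lemma residual_life_tail:
  fixes F :: "real \<Rightarrow> real"
  assumes F: "mono F" "F 0 \<ge> 0" and C: "C \<ge> 1"
    and R: "\<And>t. t \<ge> 0 \<Longrightarrow> (\<integral>\<^sup>+ y\<in>{t..}. ennreal (1 - F y) \<partial>lborel) \<le> ennreal (C * (1 - F t))"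
    and F1: "\<And>t. F t \<le> 1"
  shows "1 - F (2 * C * real k) \<le> (1/2) ^ k"
proof (induction k)
  case 0 then show ?case using F(2) by simp
next
  case (Suc k)
  let ?t = "2 * C * real k" and ?u = "2 * C * real (Suc k)"
  have u: "?u = ?t + 2 * C" by (simp add: algebra_simps)
  have t0: "0 \<le> ?t" using C by simp
  have "ennreal (2 * C * (1 - F ?u)) = (\<integral>\<^sup>+ y. ennreal (1 - F ?u) * indicator {?t..?u} y \<partial>lborel)"
  proof -
    have "emeasure lborel {?t..?u} = ennreal (2 * C)" using C u by simp
    then show ?thesis using C F1[of ?u]
      by (subst nn_integral_cmult_indicator) (auto simp: ennreal_mult[symmetric] mult.commute)
  qed
  also have "\<dots> \<le> (\<integral>\<^sup>+ y\<in>{?t..}. ennreal (1 - F y) \<partial>lborel)"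
    by (intro nn_integral_mono) (auto simp: indicator_def intro!: ennreal_leI monoD[OF F(1)])
  also have "\<dots> \<le> ennreal (C * (1 - F ?t))" by (rule R[OF t0])
  finally have "2 * C * (1 - F ?u) \<le> C * (1 - F ?t)" using C F1[of ?t] by simp
  then have "2 * (1 - F ?u) \<le> 1 - F ?t" using C by (simp add: mult.assoc mult.left_commute[of 2])
  then show ?case using Suc by simp
qed

text \<open>The joint moment bound treats down and up times of a cycle together: \<open>CU\<close>
  is so large that the up time compensates the exponential moment of the down time and a factor 1/4
  per cycle remains.\<close>

locale down_seq = prob_space M for M :: "'a measure" +
  fixes U Dn :: "nat \<Rightarrow> 'a \<Rightarrow> real" and sq CU \<theta> :: real and p :: nat
  assumes U_meas [measurable]: "\<And>j. U j \<in> borel_measurable M" and D_meas [measurable]: "\<And>j. Dn j \<in> borel_measurable M"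
    and U_nonneg_AE: "\<And>j. AE \<omega> in M. 0 \<le> U j \<omega>" and D_nonneg_AE: "\<And>j. AE \<omega> in M. 0 \<le> Dn j \<omega>"
    and sq: "sq > 0" and CU: "CU > 0" and \<theta>: "\<theta> > 0" and p: "p > 0"
    and joint: "\<And>q N. (\<integral>\<^sup>+\<omega>. ennreal (exp (\<theta> * (\<Sum>j\<in>{q..<q + N}. sq * Dn j \<omega> - CU * U j \<omega>))) \<partial>M) \<le> ennreal ((1/4) ^ N)"
    and D_exp: "\<And>q. (\<integral>\<^sup>+\<omega>. ennreal (exp (\<theta> * (sq * Dn q \<omega>))) \<partial>M) \<le> ennreal 7"
begin

abbreviation "us m \<omega> \<equiv> psum (\<lambda>j. U j \<omega>) m"

lemma us_meas [measurable]: "us m \<in> borel_measurable M"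
  unfolding psum_def by measurable

text \<open>Markov's inequality for the joint exponential moment, in which the nonnegative down
  times are dropped from the exponent. Since \<open>exp 1 \<le> 4\<close>, each cycle gains at least
  a factor \<open>exp (-1)\<close>.\<close>

lemma hit_prob: "prob {\<omega> \<in> space M. us m \<omega> \<le> x} \<le> exp (\<theta> * CU * x - real m)"
proof -
  let ?B = "{\<omega> \<in> space M. us m \<omega> \<le> x}"
  have "emeasure M ?B = (\<integral>\<^sup>+\<omega>. indicator ?B \<omega> \<partial>M)" by (rule nn_integral_indicator[symmetric]) measurable
  also have "\<dots> \<le> (\<integral>\<^sup>+\<omega>. ennreal (exp (\<theta> * CU * x)) * ennreal (exp (\<theta> * (\<Sum>j\<in>{0..<0 + m}. sq * Dn j \<omega> - CU * U j \<omega>))) \<partial>M)"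
  proof (rule nn_integral_mono_AE)
    have "AE \<omega> in M. \<forall>j. 0 \<le> Dn j \<omega>" using D_nonneg_AE by (simp add: AE_all_countable)
    then show "AE \<omega> in M. indicator ?B \<omega> \<le> ennreal (exp (\<theta> * CU * x)) * ennreal (exp (\<theta> * (\<Sum>j\<in>{0..<0 + m}. sq * Dn j \<omega> - CU * U j \<omega>)))"
    proof eventually_elim
      case (elim \<omega>)
      show ?case
      proof (cases "\<omega> \<in> ?B")
        case True
        have "CU * us m \<omega> \<le> CU * x" using True CU by (intro mult_left_mono) auto
        moreover have "0 \<le> (\<Sum>j<m. sq * Dn j \<omega>)" using elim sq by (intro sum_nonneg) auto
        ultimately have "0 \<le> CU * x + (\<Sum>j\<in>{0..<0 + m}. sq * Dn j \<omega> - CU * U j \<omega>)"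
          by (simp add: psum_def sum_subtractf sum_distrib_left lessThan_atLeast0)
        then have "0 \<le> \<theta> * (CU * x + (\<Sum>j\<in>{0..<0 + m}. sq * Dn j \<omega> - CU * U j \<omega>))" using \<theta> by simp
        then have "1 \<le> exp (\<theta> * CU * x) * exp (\<theta> * (\<Sum>j\<in>{0..<0 + m}. sq * Dn j \<omega> - CU * U j \<omega>))"
          unfolding exp_add[symmetric] by (simp add: distrib_left mult.assoc)
        then show ?thesis using True by (simp add: ennreal_mult[symmetric])
      qed simp
    qed
  qed
  also have "\<dots> = ennreal (exp (\<theta> * CU * x)) * (\<integral>\<^sup>+\<omega>. ennreal (exp (\<theta> * (\<Sum>j\<in>{0..<0 + m}. sq * Dn j \<omega> - CU * U j \<omega>))) \<partial>M)"
    by (rule nn_integral_cmult) measurable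
  also have "\<dots> \<le> ennreal (exp (\<theta> * CU * x)) * ennreal ((1/4) ^ m)" by (intro mult_left_mono joint) auto
  also have "\<dots> = ennreal (exp (\<theta> * CU * x) * (1/4) ^ m)" by (simp add: ennreal_mult[symmetric] del: ennreal_power)
  also have "\<dots> \<le> ennreal (exp (\<theta> * CU * x - real m))"
  proof (rule ennreal_leI)
    have "exp (1::real) \<le> 4" using exp_le by simp
    then have "(1/4::real) \<le> exp (-1)" by (simp add: exp_minus field_simps)
    then have "(1/4::real) ^ m \<le> exp (-1) ^ m" by (intro power_mono) auto
    also have "\<dots> = exp (- real m)" unfolding exp_of_nat_mult[symmetric] by simp
    finally show "exp (\<theta> * CU * x) * (1/4) ^ m \<le> exp (\<theta> * CU * x - real m)"
      by (simp add: exp_diff exp_minus field_simps mult_left_mono)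
  qed
  finally show ?thesis by (simp add: emeasure_eq_measure)
qed

definition "Y q N \<omega> = (\<Sum>j\<in>{q..<q + Suc N}. sq * Dn j \<omega> - CU * U j \<omega>)"
definition "etaE q \<omega> = ennreal (max 0 (sq * Dn q \<omega>) ^ p) + (\<Sum>N. ennreal (max 0 (Y q N \<omega>) ^ p))"
definition "Keta = 2 * (fact (2 * p) / \<theta> ^ (2 * p) * 7 + 1) + 2 * (fact (2 * p) / \<theta> ^ (2 * p) * 1 + 1)"
definition "eta q \<omega> = enn2real (etaE q \<omega>)"

lemma Y_meas [measurable]: "Y q N \<in> borel_measurable M" unfolding Y_def by measurable

lemma etaE_tame: "tame Keta (etaE q)"
  unfolding etaE_def Keta_def
proof (rule tame_add)
  \<comment> \<open>A single variable is fitted into the series lemma as its term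
    \<open>N = 0\<close>. The other terms are the negative constants
    \<open>ln ((1/4) ^ N) / \<theta>\<close>: they have the required exponential moments, and their
    positive parts vanish.\<close>
  have t: "tame (2 * (fact (2 * p) / \<theta> ^ (2 * p) * 7 + 1))
      (\<lambda>\<omega>. \<Sum>N. ennreal (max 0 (if N = (0::nat) then sq * Dn q \<omega> else ln ((1/4) ^ N) / \<theta>) ^ p))"
  proof (rule tame_exp_tail)
    show "(\<integral>\<^sup>+\<omega>. ennreal (exp (\<theta> * (if N = (0::nat) then sq * Dn q \<omega> else ln ((1/4) ^ N) / \<theta>))) \<partial>M) \<le> ennreal (7 * (1/4) ^ N)" for N
    proof (cases "N = 0")
      case True then show ?thesis using D_exp[of q] by simp
    next
      case False
      then show ?thesis using \<theta> by (simp add: emeasure_space_1 exp_ln del: ennreal_power)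
    qed
  qed (use \<theta> p in auto)
  show "tame (2 * (fact (2 * p) / \<theta> ^ (2 * p) * 7 + 1)) (\<lambda>\<omega>. ennreal (max 0 (sq * Dn q \<omega>) ^ p))"
  proof (rule tame_mono[OF t])
    fix \<omega>
    show "ennreal (max 0 (sq * Dn q \<omega>) ^ p) \<le> (\<Sum>N. ennreal (max 0 (if N = (0::nat) then sq * Dn q \<omega> else ln ((1/4) ^ N) / \<theta>) ^ p))"
      using ennreal_term_le_suminf[of "\<lambda>N. ennreal (max 0 (if N = (0::nat) then sq * Dn q \<omega> else ln ((1/4) ^ N) / \<theta>) ^ p)" 0] by simp
  qed auto
  show "tame (2 * (fact (2 * p) / \<theta> ^ (2 * p) * 1 + 1)) (\<lambda>\<omega>. \<Sum>N. ennreal (max 0 (Y q N \<omega>) ^ p))"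
  proof (rule tame_exp_tail)
    fix N
    have "(\<integral>\<^sup>+\<omega>. ennreal (exp (\<theta> * Y q N \<omega>)) \<partial>M) \<le> ennreal ((1/4) ^ Suc N)" unfolding Y_def by (rule joint)
    also have "\<dots> \<le> ennreal (1 * (1/4) ^ N)" by (intro ennreal_leI) (simp add: power_decreasing)
    finally show "(\<integral>\<^sup>+\<omega>. ennreal (exp (\<theta> * Y q N \<omega>)) \<partial>M) \<le> ennreal (1 * (1/4) ^ N)" .
  qed (use \<theta> p in auto)
qed

lemma down_control_AE:
  "AE \<omega> in M. down_control (\<lambda>j. U j \<omega>) (\<lambda>j. Dn j \<omega>) sq CU p (\<lambda>q. eta q \<omega>) \<and> (\<forall>q. ennreal (eta q \<omega>) = etaE q \<omega>)"
proof -
  have 1: "AE \<omega> in M. \<forall>q. etaE q \<omega> < top" using tame_finite[OF etaE_tame] by (simp add: AE_all_countable)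
  have 2: "AE \<omega> in M. \<forall>j. 0 \<le> Dn j \<omega>" using D_nonneg_AE by (simp add: AE_all_countable)
  have 3: "AE \<omega> in M. \<forall>j. 0 \<le> U j \<omega>" using U_nonneg_AE by (simp add: AE_all_countable)
  have 4: "AE \<omega> in M. \<forall>x. \<exists>m. us m \<omega> > x"
  proof (rule unbounded_AE_geometric[where q = "exp (-1)" and K = "\<lambda>x. exp (\<theta> * CU * x)"])
    fix x m
    have "exp (\<theta> * CU * x - real m) = exp (\<theta> * CU * x) * exp (-1) ^ m"
      unfolding exp_of_nat_mult[symmetric] exp_add[symmetric] by simp
    then show "prob {\<omega> \<in> space M. us m \<omega> \<le> x} \<le> exp (\<theta> * CU * x) * exp (-1) ^ m" using hit_prob[of m x] by simp
  qed auto
  from 1 2 3 4 show ?thesis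
  proof eventually_elim
    case (elim \<omega>)
    have eq: "ennreal (eta q \<omega>) = etaE q \<omega>" for q using elim(1) by (simp add: eta_def)
    have le: "x \<le> eta q \<omega>" if "ennreal x \<le> etaE q \<omega>" for x q
      using that unfolding eq[symmetric] by (simp add: eta_def)
    have "down_control (\<lambda>j. U j \<omega>) (\<lambda>j. Dn j \<omega>) sq CU p (\<lambda>q. eta q \<omega>)"
    proof
      show "0 < sq" "0 \<le> CU" "0 < p" using sq CU p by auto
      show "0 \<le> U k \<omega>" "0 \<le> Dn k \<omega>" for k using elim by auto
      show "\<exists>m. us m \<omega> > x" for x using elim by auto
      show "(sq * Dn q \<omega>) ^ p \<le> eta q \<omega>" for q
      proof (rule le)
        have "0 \<le> sq * Dn q \<omega>" using elim(2) sq by simp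
        then have "ennreal ((sq * Dn q \<omega>) ^ p) = ennreal (max 0 (sq * Dn q \<omega>) ^ p)" by (simp only: max_absorb2)
        also have "\<dots> \<le> etaE q \<omega>" unfolding etaE_def by simp
        finally show "ennreal ((sq * Dn q \<omega>) ^ p) \<le> etaE q \<omega>" .
      qed
      show "max 0 (\<Sum>j\<in>{q..<q + N}. sq * Dn j \<omega> - CU * U j \<omega>) ^ p \<le> eta q \<omega>" if N: "0 < N" for N q
      proof (rule le)
        have "\<exists>N'. N = Suc N'" using N by (rule gr0_implies_Suc)
        then obtain N' where N': "N = Suc N'" by blast
        have "ennreal (max 0 (\<Sum>j\<in>{q..<q + N}. sq * Dn j \<omega> - CU * U j \<omega>) ^ p) = ennreal (max 0 (Y q N' \<omega>) ^ p)"
          unfolding N' Y_def ..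
        also have "\<dots> \<le> (\<Sum>N. ennreal (max 0 (Y q N \<omega>) ^ p))" by (rule ennreal_term_le_suminf)
        also have "\<dots> \<le> etaE q \<omega>" unfolding etaE_def by simp
        finally show "ennreal (max 0 (\<Sum>j\<in>{q..<q + N}. sq * Dn j \<omega> - CU * U j \<omega>) ^ p) \<le> etaE q \<omega>" .
      qed
    qed
    then show ?case using eq by blast
  qed
qed

lemma sum_eta_le:
  assumes "\<forall>q. ennreal (eta q \<omega>) = etaE q \<omega>" "\<And>k. k \<le> m \<Longrightarrow> \<omega> \<in> B k"
  shows "ennreal (\<Sum>q\<le>m. eta q \<omega>) \<le> (\<Sum>k. etaE k \<omega> * indicator (B k) \<omega>)"
proof -
  have "ennreal (\<Sum>q\<le>m. eta q \<omega>) = (\<Sum>q\<le>m. ennreal (eta q \<omega>))" by (rule sum_ennreal[symmetric]) (simp add: eta_def)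
  also have "\<dots> = (\<Sum>k\<le>m. etaE k \<omega> * indicator (B k) \<omega>)" using assms by (intro sum.cong) auto
  also have "\<dots> \<le> (\<Sum>k. etaE k \<omega> * indicator (B k) \<omega>)" by (rule sum_le_suminf) auto
  finally show ?thesis .
qed

end

section \<open>The drift of the state process\<close>

lemma zcheck_I0:
  assumes "i \<in> I0"
  shows "zcheck n d rho I0 x i = min (int (x i)) (\<lfloor>real n * rho i / (\<Sum>j\<in>I0. rho j)\<rfloor>
    + max 0 (int n - (\<Sum>j\<in>I0. min (int (x j)) \<lfloor>real n * rho j / (\<Sum>j\<in>I0. rho j)\<rfloor>)
        - (\<Sum>j\<in>{1..<i}. max 0 (int (x j) - \<lfloor>real n * rho j / (\<Sum>j\<in>I0. rho j)\<rfloor>))))"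
  using assms unfolding zcheck_def Let_def by (simp add: min.commute)

lemma zcheck_not_I0:
  "i \<notin> I0 \<Longrightarrow> zcheck n d rho I0 x i = min (int (x i)) (max 0 (int n - (\<Sum>j\<in>{1..<i}. int (x j))))"
  by (simp add: zcheck_def)

lemma up_indicator_measurable [measurable]: "up_indicator u dn \<in> borel_measurable borel"
  unfolding up_indicator_def by measurable

text \<open>The numbers \<open>c\<close>, \<open>Mu\<close>, \<open>Gm\<close>, \<open>L\<close>,
  \<open>Dm\<close>, \<open>C'\<close> and \<open>CU\<close> bound what varies with
  \<open>n\<close>, so the constants built from them are uniform in \<open>n\<close>. The assumption
  named \<open>\<Lambda>\<close> says that the guaranteed share of a class in \<open>I0\<close>
  exceeds its nominal load by \<open>sq * \<Lambda>\<close>; the surplus is of order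
  \<open>n\<close>, so this holds for any fixed level once \<open>n\<close> is large.
  \<open>eps\<close> keeps the relative clock error \<open>4 * C' / sq\<close> below 1/2.\<close>

locale system_path = down_control u dn sq CU "4 * r" \<eta>U
  for u dn :: "nat \<Rightarrow> real" and sq CU :: real and r :: nat and \<eta>U :: "nat \<Rightarrow> real" +
  fixes n d J :: nat and lam mu gam rho :: "nat \<Rightarrow> real" and I0 :: "nat set"
    and GA GS GR \<eta>A \<eta>S \<eta>R :: "nat \<Rightarrow> nat \<Rightarrow> real" and x0 :: "nat \<Rightarrow> nat" and X :: "nat \<Rightarrow> real \<Rightarrow> nat"
    and C' c Mu Gm L Dm \<Lambda> :: real
  assumes n: "n > 0" and sq_def: "sq = sqrt (real n)"
    and noise: "\<And>i. i \<in> {1..d} \<Longrightarrow> noise_control (GA i) sq C' r J (\<eta>A i)"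
      "\<And>i. i \<in> {1..d} \<Longrightarrow> noise_control (GS i) sq C' r J (\<eta>S i)"
      "\<And>i. i \<in> {1..d} \<Longrightarrow> noise_control (GR i) sq C' r J (\<eta>R i)"
    and J: "real n \<le> 2 * 2 ^ J" and eps: "8 * C' \<le> sq" and C'_nonneg: "C' \<ge> 0"
    and c: "0 < c" "c \<le> 1"
    and lam: "\<And>i. i \<in> {1..d} \<Longrightarrow> 0 \<le> lam i \<and> lam i \<le> L * real n"
    and mu: "\<And>i. i \<in> {1..d} \<Longrightarrow> c \<le> mu i \<and> mu i \<le> Mu"
    and gam: "\<And>i. i \<in> {1..d} \<Longrightarrow> 0 \<le> gam i \<and> gam i \<le> Gm"
    and gam_pos: "\<And>i. i \<in> {1..d} \<Longrightarrow> i \<notin> I0 \<Longrightarrow> 2 * c \<le> gam i"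
    and rho: "\<And>i. i \<in> {1..d} \<Longrightarrow> 0 < rho i" and rho_sum: "(\<Sum>i\<in>{1..d}. rho i) = 1"
    and I0: "I0 \<subseteq> {1..d}" and d: "d > 0" and LMuGm: "0 \<le> L" "0 \<le> Mu" "0 \<le> Gm"
    and Dm: "\<And>i. i \<in> {1..d} \<Longrightarrow> \<bar>lam i - mu i * (rho i * real n)\<bar> \<le> Dm * sq"
    and \<Lambda>0: "0 \<le> \<Lambda>"
    and \<Lambda>: "\<And>i. i \<in> I0 \<Longrightarrow> sq * \<Lambda> + rho i * real n \<le> real n * rho i / (\<Sum>j\<in>I0. rho j) - 1"
    and \<Lambda>big: "c * \<Lambda> / 2 \<ge> Dm + (4 * C' * L + 8 * C' * Mu + 2 * Mu * CU) + 1"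
    and X_int: "\<And>t i. t \<ge> 0 \<Longrightarrow> i \<in> {1..d} \<Longrightarrow> set_integrable lborel {0..t} (\<lambda>s. real (X i s))"
    and X_eq: "\<And>t i. t \<ge> 0 \<Longrightarrow> i \<in> {1..d} \<Longrightarrow>
        real (X i t) = real (x0 i) + real (count_proc (GA i) (lam i * t))
          - real (count_proc (GS i) (mu i * (LBINT s:{0..t}.
              real_of_int (zcheck n d rho I0 (\<lambda>j. X j s) i) * up_indicator u dn s)))
          - real (count_proc (GR i) (gam i * (LBINT s:{0..t}.
              real (X i s) - real_of_int (zcheck n d rho I0 (\<lambda>j. X j s) i))))"
begin

abbreviation "Z i s \<equiv> real_of_int (zcheck n d rho I0 (\<lambda>j. X j s) i)"
definition "Q i s = real (X i s) - Z i s"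

lemma \<sigma>0_pos: "i \<in> I0 \<Longrightarrow> 0 < (\<Sum>j\<in>I0. rho j)"
  using I0 rho by (intro sum_pos) (auto intro: finite_subset)

text \<open>The bound by \<open>2 * n\<close> is crude, at most \<open>n\<close> from the guaranteed
  share and at most \<open>n\<close> from redistributed servers. Only the order of magnitude enters
  the error terms.\<close>

lemma zcheck_bounds:
  assumes i: "i \<in> {1..d}"
  shows "0 \<le> zcheck n d rho I0 x i" "zcheck n d rho I0 x i \<le> int (x i)" "zcheck n d rho I0 x i \<le> 2 * int n"
proof -
  let ?s = "\<Sum>j\<in>I0. rho j"
  have "0 \<le> zcheck n d rho I0 x i \<and> zcheck n d rho I0 x i \<le> int (x i) \<and> zcheck n d rho I0 x i \<le> 2 * int n"
  proof (cases "i \<in> I0")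
    case True
    have fin: "finite I0" using I0 finite_subset by blast
    have s0: "0 < ?s" using \<sigma>0_pos[OF True] .
    have k0: "0 \<le> \<lfloor>real n * rho j / ?s\<rfloor>" if "j \<in> I0" for j
      using s0 rho[of j] that I0 by (auto intro!: divide_nonneg_pos)
    have "0 \<le> rho j" if "j \<in> I0" for j using rho[of j] that I0 by force
    then have "rho i \<le> ?s" using True fin by (intro member_le_sum) auto
    then have "real n * rho i / ?s \<le> real n" using s0 by (simp add: divide_le_eq mult_left_mono)
    then have kn: "\<lfloor>real n * rho i / ?s\<rfloor> \<le> int n" by linarith
    have "0 \<le> (\<Sum>j\<in>I0. min (int (x j)) \<lfloor>real n * rho j / ?s\<rfloor>)" using k0 by (intro sum_nonneg) auto
    moreover have "0 \<le> (\<Sum>j\<in>{1..<i}. max 0 (int (x j) - \<lfloor>real n * rho j / ?s\<rfloor>))" by (intro sum_nonneg) auto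
    ultimately show ?thesis unfolding zcheck_I0[OF True] using kn k0[OF True] by auto
  next
    case False
    have "0 \<le> (\<Sum>j\<in>{1..<i}. int (x j))" by (intro sum_nonneg) auto
    then show ?thesis unfolding zcheck_not_I0[OF False] by auto
  qed
  then show "0 \<le> zcheck n d rho I0 x i" "zcheck n d rho I0 x i \<le> int (x i)" "zcheck n d rho I0 x i \<le> 2 * int n" by auto
qed

lemma Z_bounds: assumes "i \<in> {1..d}" shows "0 \<le> Z i s" "Z i s \<le> real (X i s)" "Z i s \<le> 2 * real n" "0 \<le> Q i s"
  using zcheck_bounds[OF assms, of "\<lambda>j. X j s"] unfolding Q_def by linarith+

text \<open>This is measurability in time along one fixed path. It comes from integrability of the
  paths of \<open>X\<close>, of which the allocation is a function built from minima, maxima and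
  sums.\<close>

lemma Z_measurable:
  assumes i: "i \<in> {1..d}" and t: "t \<ge> 0"
  shows "set_borel_measurable lborel {0..t} (\<lambda>s. Z i s)"
proof -
  define f where "f j s = indicator {0..t} s *\<^sub>R real (X j s)" for j s
  have f: "f j \<in> borel_measurable borel" if "j \<in> {1..d}" for j
    using X_int[OF t that] unfolding set_integrable_def f_def by (auto dest: borel_measurable_integrable)
  have fX: "f j s = real (X j s)" if "s \<in> {0..t}" for j s using that by (simp add: f_def)
  have fI0: "f j \<in> borel_measurable borel" if "j \<in> I0" for j using f that I0 by blast
  have fi: "f j \<in> borel_measurable borel" if "j \<in> {1..<i}" for j using f[of j] that i by simp
  define h where "h s = (if i \<in> I0 then min (f i s) (real_of_int \<lfloor>real n * rho i / (\<Sum>j\<in>I0. rho j)\<rfloor>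
    + max 0 (real n - (\<Sum>j\<in>I0. min (f j s) (real_of_int \<lfloor>real n * rho j / (\<Sum>j\<in>I0. rho j)\<rfloor>))
        - (\<Sum>j\<in>{1..<i}. max 0 (f j s - real_of_int \<lfloor>real n * rho j / (\<Sum>j\<in>I0. rho j)\<rfloor>))))
    else min (f i s) (max 0 (real n - (\<Sum>j\<in>{1..<i}. f j s))))" for s
  have h: "h \<in> borel_measurable borel"
    unfolding h_def using f[OF i] fI0 fi
    by (cases "i \<in> I0") (auto intro!: borel_measurable_min borel_measurable_max borel_measurable_add borel_measurable_diff borel_measurable_sum)
  have "Z i s = h s" if "s \<in> {0..t}" for s
    unfolding h_def fX[OF that]
    by (cases "i \<in> I0") (simp_all add: zcheck_I0 zcheck_not_I0 of_int_min of_int_max)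
  then have "(\<lambda>s. indicator {0..t} s *\<^sub>R Z i s) = (\<lambda>s. indicator {0..t} s *\<^sub>R h s)"
    by (auto simp: fun_eq_iff indicator_def)
  then show ?thesis unfolding set_borel_measurable_def using h by simp
qed

lemma set_integrable_parts:
  assumes i: "i \<in> {1..d}" and t: "t \<ge> 0"
  shows "set_integrable lborel {0..t} (\<lambda>s. Z i s)"
    "set_integrable lborel {0..t} (\<lambda>s. Z i s * up_indicator u dn s)"
    "set_integrable lborel {0..t} (Q i)"
proof -
  note Xi = X_int[OF t i]
  note Zm = Z_measurable[OF i t]
  show Zi: "set_integrable lborel {0..t} (\<lambda>s. Z i s)"
    by (rule set_integrable_bound[OF Xi Zm]) (use Z_bounds[OF i] in auto)
  have "set_borel_measurable lborel {0..t} (\<lambda>s. Z i s * up_indicator u dn s)"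
    using Zm unfolding set_borel_measurable_def by (simp add: mult.assoc[symmetric])
  then show "set_integrable lborel {0..t} (\<lambda>s. Z i s * up_indicator u dn s)"
    by (rule set_integrable_bound[OF Xi]) (use Z_bounds[OF i] in \<open>auto simp: up_indicator_def\<close>)
  show "set_integrable lborel {0..t} (Q i)" unfolding Q_def using set_integral_diff(1)[OF Xi Zi] .
qed

lemma integrable_parts:
  assumes i: "i \<in> {1..d}" and st: "0 \<le> s" "s \<le> t"
  shows "(\<lambda>s. Z i s) integrable_on {s..t}" "(\<lambda>s. Z i s * up_indicator u dn s) integrable_on {s..t}"
    "Q i integrable_on {s..t}" "(\<lambda>s. 1 - up_indicator u dn s) integrable_on {s..t}"
proof -
  have t: "0 \<le> t" using st by simp
  have sub: "f integrable_on {s..t}" if "f integrable_on {0..t}" for f :: "real \<Rightarrow> real"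
    using integrable_on_subinterval[OF that, of s t] st by auto
  show "(\<lambda>s. Z i s) integrable_on {s..t}" "(\<lambda>s. Z i s * up_indicator u dn s) integrable_on {s..t}" "Q i integrable_on {s..t}"
    using set_integrable_parts[OF i t] by (auto intro!: sub dest: set_borel_integral_eq_integral(1))
  show "(\<lambda>s. 1 - up_indicator u dn s) integrable_on {s..t}"
    using down_has_integral[OF t] by (intro sub) (auto simp: integrable_on_def)
qed

lemma integral_diff0:
  assumes "f integrable_on {0..t}" "0 \<le> s" "s \<le> t"
  shows "integral {0..t} f - integral {0..s} f = integral {s..t} (f :: real \<Rightarrow> real)"
  using Henstock_Kurzweil_Integration.integral_combine[OF assms(2,3,1)] by simp

definition "\<tau>S i t = mu i * integral {0..t} (\<lambda>s. Z i s * up_indicator u dn s)"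
definition "\<tau>R i t = gam i * integral {0..t} (Q i)"

lemma X_eq':
  assumes "t \<ge> 0" "i \<in> {1..d}"
  shows "real (X i t) = real (x0 i) + real (count_proc (GA i) (lam i * t)) - real (count_proc (GS i) (\<tau>S i t)) - real (count_proc (GR i) (\<tau>R i t))"
proof -
  note sp = set_integrable_parts[OF assms(2,1)]
  have "(LBINT s:{0..t}. real (X i s) - Z i s) = integral {0..t} (Q i)"
    using set_borel_integral_eq_integral(2)[OF sp(3)] unfolding Q_def .
  then show ?thesis
    using X_eq[OF assms] set_borel_integral_eq_integral(2)[OF sp(2)] unfolding \<tau>S_def \<tau>R_def by simp
qed

lemma integral_nonneg': "f integrable_on {s..t} \<Longrightarrow> (\<And>x. 0 \<le> f x) \<Longrightarrow> 0 \<le> integral {s..t} (f :: real \<Rightarrow> real)"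
  by (rule integral_nonneg) auto

lemma clocks:
  assumes i: "i \<in> {1..d}" and st: "0 \<le> s" "s \<le> t"
  shows "\<tau>S i t - \<tau>S i s = mu i * (integral {s..t} (\<lambda>s. Z i s) - integral {s..t} (\<lambda>s. Z i s * (1 - up_indicator u dn s)))"
    "0 \<le> integral {s..t} (\<lambda>s. Z i s * (1 - up_indicator u dn s))"
    "integral {s..t} (\<lambda>s. Z i s * (1 - up_indicator u dn s)) \<le> 2 * real n * (down t - down s)"
    "\<tau>R i t - \<tau>R i s = gam i * integral {s..t} (Q i)"
    "0 \<le> \<tau>S i s" "\<tau>S i s \<le> \<tau>S i t" "0 \<le> \<tau>R i s" "\<tau>R i s \<le> \<tau>R i t"
    "0 \<le> integral {s..t} (\<lambda>s. Z i s)" "integral {s..t} (\<lambda>s. Z i s) \<le> 2 * real n * (t - s)" "0 \<le> integral {s..t} (Q i)"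
proof -
  have t0: "0 \<le> t" using st by simp
  note ip = integrable_parts[OF i st] and ip0 = integrable_parts[OF i order_refl t0] and ips = integrable_parts[OF i order_refl st(1)]
  have up: "0 \<le> up_indicator u dn x" "up_indicator u dn x \<le> 1" for x by (auto simp: up_indicator_def)
  note Zb = Z_bounds[OF i]
  have m0: "0 \<le> mu i" "0 \<le> gam i" using mu[OF i] gam[OF i] c by auto
  have e: "(\<lambda>s. Z i s * (1 - up_indicator u dn s)) = (\<lambda>s. Z i s - Z i s * up_indicator u dn s)" by (simp add: algebra_simps)
  have zd: "integral {s..t} (\<lambda>s. Z i s * (1 - up_indicator u dn s)) = integral {s..t} (\<lambda>s. Z i s) - integral {s..t} (\<lambda>s. Z i s * up_indicator u dn s)"
    unfolding e by (rule Henstock_Kurzweil_Integration.integral_diff[OF ip(1,2)])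
  have zdi: "(\<lambda>s. Z i s * (1 - up_indicator u dn s)) integrable_on {s..t}" unfolding e by (intro integrable_diff ip)
  show S: "\<tau>S i t - \<tau>S i s = mu i * (integral {s..t} (\<lambda>s. Z i s) - integral {s..t} (\<lambda>s. Z i s * (1 - up_indicator u dn s)))"
    unfolding \<tau>S_def zd using integral_diff0[OF ip0(2) st] by (simp add: right_diff_distrib[symmetric])
  show R: "\<tau>R i t - \<tau>R i s = gam i * integral {s..t} (Q i)"
    unfolding \<tau>R_def using integral_diff0[OF ip0(3) st] by (simp add: right_diff_distrib[symmetric])
  show "0 \<le> integral {s..t} (\<lambda>s. Z i s * (1 - up_indicator u dn s))" using zdi Zb up by (intro integral_nonneg') auto
  have "integral {s..t} (\<lambda>s. Z i s * (1 - up_indicator u dn s)) \<le> integral {s..t} (\<lambda>s. 2 * real n * (1 - up_indicator u dn s))"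
    by (rule integral_le[OF zdi integrable_on_mult_right[OF ip(4)]]) (use Zb up in \<open>auto intro!: mult_right_mono\<close>)
  also have "\<dots> = 2 * real n * integral {s..t} (\<lambda>s. 1 - up_indicator u dn s)" by (rule integral_mult_right)
  also have "integral {s..t} (\<lambda>s. 1 - up_indicator u dn s) = down t - down s"
    using integral_diff0[OF ip0(4) st] integral_unique[OF down_has_integral[OF t0]] integral_unique[OF down_has_integral[OF st(1)]] by simp
  finally show "integral {s..t} (\<lambda>s. Z i s * (1 - up_indicator u dn s)) \<le> 2 * real n * (down t - down s)" .
  show "0 \<le> \<tau>S i s" "0 \<le> \<tau>R i s" unfolding \<tau>S_def \<tau>R_def using m0 ips Zb up
    by (auto intro!: mult_nonneg_nonneg integral_nonneg')
  show "0 \<le> integral {s..t} (\<lambda>s. Z i s)" "0 \<le> integral {s..t} (Q i)" using ip Zb by (auto intro!: integral_nonneg')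
  then show "\<tau>R i s \<le> \<tau>R i t" using R m0 mult_nonneg_nonneg[of "gam i" "integral {s..t} (Q i)"] by linarith
  have "0 \<le> integral {s..t} (\<lambda>s. Z i s * up_indicator u dn s)" using ip Zb up by (intro integral_nonneg') auto
  then have "0 \<le> mu i * integral {s..t} (\<lambda>s. Z i s * up_indicator u dn s)" using m0 by simp
  moreover have "\<tau>S i t - \<tau>S i s = mu i * integral {s..t} (\<lambda>s. Z i s * up_indicator u dn s)" using S unfolding zd by simp
  ultimately show "\<tau>S i s \<le> \<tau>S i t" by linarith
  have "integral {s..t} (\<lambda>s. Z i s) \<le> integral {s..t} (\<lambda>s. 2 * real n)"
    by (rule integral_le[OF ip(1)]) (use Zb in auto)
  then show "integral {s..t} (\<lambda>s. Z i s) \<le> 2 * real n * (t - s)" using st by (simp add: mult_ac)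
qed

abbreviation "HA i \<equiv> noise_control.H (GA i) sq r (\<eta>A i)"
abbreviation "HS i \<equiv> noise_control.H (GS i) sq r (\<eta>S i)"
abbreviation "HR i \<equiv> noise_control.H (GR i) sq r (\<eta>R i)"

text \<open>The controls composed with their clocks: nondecreasing in \<open>t\<close> because the
  clocks are, however irregularly these depend on the state.\<close>

definition "Htot i t = HA i (lam i * t) + HS i (\<tau>S i t) + HR i (\<tau>R i t) + H t"
definition "y i t = (real (X i t) - rho i * real n) / sq"
text \<open>Errors proportional to the clock increments. With relative error
  \<open>4 * C' / sq\<close> and increments of at most \<open>L * n\<close> and
  \<open>2 * n * Mu\<close> per unit time, division by \<open>sq\<close> leaves the first two terms;
  the third is the service lost at the average rate of down time.\<close>

definition "gU = 4 * C' * L + 8 * C' * Mu + 2 * Mu * CU"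
text \<open>The queue is not bounded by a multiple of \<open>n\<close>, so the clock error of
  abandonment cannot be put into \<open>gU\<close>. It is absorbed into the rate:
  \<open>gam i / 2\<close> here and \<open>2 * gam i\<close> in \<open>bL\<close>.\<close>

definition "bU i t = (lam i - mu i * Z i t - gam i / 2 * Q i t) / sq + gU"
definition "bL i t = (mu i * Z i t + 2 * gam i * Q i t - lam i) / sq + gU"

lemma increments:
  assumes i: "i \<in> {1..d}" and st: "0 \<le> s" "s \<le> t"
  defines "v \<equiv> root (4 * r) (Htot i t - Htot i s)"
  shows "\<bar>real (count_proc (GA i) (lam i * t)) - real (count_proc (GA i) (lam i * s)) - lam i * (t - s)\<bar> \<le> 4 * C' / sq * (lam i * (t - s)) + 32 * (sq * v)"
    "\<bar>real (count_proc (GS i) (\<tau>S i t)) - real (count_proc (GS i) (\<tau>S i s)) - (\<tau>S i t - \<tau>S i s)\<bar> \<le> 4 * C' / sq * (\<tau>S i t - \<tau>S i s) + 32 * (sq * v)"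
    "\<bar>real (count_proc (GR i) (\<tau>R i t)) - real (count_proc (GR i) (\<tau>R i s)) - (\<tau>R i t - \<tau>R i s)\<bar> \<le> 4 * C' / sq * (\<tau>R i t - \<tau>R i s) + 32 * (sq * v)"
    "sq * (down t - down s) \<le> CU * (t - s) + 3 * v" "Htot i s \<le> Htot i t"
proof -
  note cl = clocks[OF i st]
  interpret A: noise_control "GA i" sq C' r J "\<eta>A i" by (rule noise(1)[OF i])
  interpret S: noise_control "GS i" sq C' r J "\<eta>S i" by (rule noise(2)[OF i])
  interpret R: noise_control "GR i" sq C' r J "\<eta>R i" by (rule noise(3)[OF i])
  have a: "0 \<le> lam i * s" "lam i * s \<le> lam i * t" using lam[OF i] st by (auto intro: mult_left_mono)
  have sq2: "sq * sq = real n" using sq_def by simp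
  have e1: "sq * C' / 2 ^ J \<le> 2 * C' / sq"
  proof -
    have "sq * (C' * sq) \<le> (2 * C') * 2 ^ J" using mult_left_mono[OF J C'_nonneg] sq2 by (simp add: mult_ac)
    then show ?thesis using sq by (simp add: field_simps)
  qed
  have e2: "2 * C' / sq \<le> 1/2" using eps sq C'_nonneg by (simp add: field_simps)
  have dH: "0 \<le> A.H (lam i * t) - A.H (lam i * s)" "0 \<le> S.H (\<tau>S i t) - S.H (\<tau>S i s)" "0 \<le> R.H (\<tau>R i t) - R.H (\<tau>R i s)" "0 \<le> H t - H s"
    using A.H_mono[OF a] S.H_mono[OF cl(5,6)] R.H_mono[OF cl(7,8)] down_increment(1)[OF st] by auto
  have p0: "0 < 4 * r" using p by simp
  have le: "sq * root (4 * r) h \<le> sq * v" "root (4 * r) h \<le> v" if "h \<le> Htot i t - Htot i s" for h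
    using real_root_le_mono[OF p0 that] sq unfolding v_def by (auto intro: mult_left_mono)
  show "Htot i s \<le> Htot i t" using dH unfolding Htot_def by linarith
  have l: "A.H (lam i * t) - A.H (lam i * s) \<le> Htot i t - Htot i s" "S.H (\<tau>S i t) - S.H (\<tau>S i s) \<le> Htot i t - Htot i s"
    "R.H (\<tau>R i t) - R.H (\<tau>R i s) \<le> Htot i t - Htot i s" "H t - H s \<le> Htot i t - Htot i s"
    using dH unfolding Htot_def by linarith+
  have lt: "lam i * t - lam i * s = lam i * (t - s)" by (simp add: right_diff_distrib)
  show "\<bar>real (count_proc (GA i) (lam i * t)) - real (count_proc (GA i) (lam i * s)) - lam i * (t - s)\<bar> \<le> 4 * C' / sq * (lam i * (t - s)) + 32 * (sq * v)"
    using A.increment_bound[OF a e1 e2] le(1)[OF l(1)] unfolding lt by simp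
  show "\<bar>real (count_proc (GS i) (\<tau>S i t)) - real (count_proc (GS i) (\<tau>S i s)) - (\<tau>S i t - \<tau>S i s)\<bar> \<le> 4 * C' / sq * (\<tau>S i t - \<tau>S i s) + 32 * (sq * v)"
    using S.increment_bound[OF cl(5,6) e1 e2] le(1)[OF l(2)] by simp
  show "\<bar>real (count_proc (GR i) (\<tau>R i t)) - real (count_proc (GR i) (\<tau>R i s)) - (\<tau>R i t - \<tau>R i s)\<bar> \<le> 4 * C' / sq * (\<tau>R i t - \<tau>R i s) + 32 * (sq * v)"
    using R.increment_bound[OF cl(7,8) e1 e2] le(1)[OF l(3)] by simp
  show "sq * (down t - down s) \<le> CU * (t - s) + 3 * v"
    using down_increment(2)[OF st] le(2)[OF l(4)] by linarith
qed

lemma b_integrals: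
  assumes i: "i \<in> {1..d}" and st: "0 \<le> s" "s \<le> t"
  shows "bU i integrable_on {s..t}" "bL i integrable_on {s..t}"
    "integral {s..t} (bU i) = (lam i * (t - s) - mu i * integral {s..t} (\<lambda>s. Z i s) - gam i / 2 * integral {s..t} (Q i)) / sq + gU * (t - s)"
    "integral {s..t} (bL i) = (mu i * integral {s..t} (\<lambda>s. Z i s) + 2 * gam i * integral {s..t} (Q i) - lam i * (t - s)) / sq + gU * (t - s)"
proof -
  note ip = integrable_parts[OF i st]
  have k: "((\<lambda>x. k) has_integral k * (t - s)) {s..t}" for k :: real
    using has_integral_const_real[of k s t] st by (simp add: mult.commute)
  have U: "((\<lambda>x. (lam i - mu i * Z i x - gam i / 2 * Q i x) / sq + gU) has_integral
     (lam i * (t - s) - mu i * integral {s..t} (\<lambda>s. Z i s) - gam i / 2 * integral {s..t} (Q i)) / sq + gU * (t - s)) {s..t}"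
    by (intro has_integral_add has_integral_divide has_integral_diff has_integral_mult_right k integrable_integral ip)
  have L: "((\<lambda>x. (mu i * Z i x + 2 * gam i * Q i x - lam i) / sq + gU) has_integral
     (mu i * integral {s..t} (\<lambda>s. Z i s) + 2 * gam i * integral {s..t} (Q i) - lam i * (t - s)) / sq + gU * (t - s)) {s..t}"
    by (intro has_integral_add has_integral_divide has_integral_diff has_integral_mult_right k integrable_integral ip)
  show "bU i integrable_on {s..t}" "bL i integrable_on {s..t}"
    using U L unfolding bU_def bL_def by (auto simp: integrable_on_def)
  show "integral {s..t} (bU i) = (lam i * (t - s) - mu i * integral {s..t} (\<lambda>s. Z i s) - gam i / 2 * integral {s..t} (Q i)) / sq + gU * (t - s)"
    using integral_unique[OF U] unfolding bU_def .
  show "integral {s..t} (bL i) = (mu i * integral {s..t} (\<lambda>s. Z i s) + 2 * gam i * integral {s..t} (Q i) - lam i * (t - s)) / sq + gU * (t - s)"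
    using integral_unique[OF L] unfolding bL_def .
qed

definition "g0 = Dm + gU"
text \<open>Three renewal processes contribute 32 each, and the lost service contributes
  \<open>2 * Mu\<close> times the 3 of the down-time estimate.\<close>

definition "K1 = 96 + 6 * Mu"
definition "K2 = Mu + 2 * Gm"

lemma gU_nonneg: "0 \<le> gU" using C'_nonneg LMuGm CU by (simp add: gU_def)

lemma Dm_nonneg: "0 \<le> Dm"
proof -
  have "0 \<le> Dm * sq" using Dm[of 1] d by (smt (verit) abs_ge_zero atLeastAtMost_iff less_one not_less order_refl)
  then show ?thesis using sq by (simp add: zero_le_mult_iff)
qed

text \<open>The balance equation is combined with the three renewal estimates. Arrivals are bounded
  from above, services and abandonments from below, and the service missing during down times is
  added as a loss.\<close>

lemma y_increment_upper:
  assumes i: "i \<in> {1..d}" and st: "0 \<le> s" "s \<le> t"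
  shows "y i t - y i s \<le> integral {s..t} (bU i) + K1 * root (4 * r) (Htot i t - Htot i s)"
proof -
  define v where "v = root (4 * r) (Htot i t - Htot i s)"
  note cl = clocks[OF i st] and inc = increments[OF i st, folded v_def]
  define A where "A = integral {s..t} (\<lambda>s. Z i s)"
  define B where "B = integral {s..t} (\<lambda>s. Z i s * (1 - up_indicator u dn s))"
  define q where "q = integral {s..t} (Q i)"
  define e where "e = 4 * C' / sq"
  define h where "h = t - s"
  have h0: "0 \<le> h" using st by (simp add: h_def)
  have e: "0 \<le> e" "e \<le> 1/2" using C'_nonneg sq eps by (auto simp: e_def field_simps)
  have m: "0 \<le> mu i" "mu i \<le> Mu" "0 \<le> gam i" "0 \<le> lam i" "lam i \<le> L * real n" using mu[OF i] c gam[OF i] lam[OF i] by auto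
  have nn: "real n = sq * sq" using sq_def by simp
  have AB: "0 \<le> A" "A \<le> 2 * real n * h" "0 \<le> B" "B \<le> 2 * real n * (down t - down s)" "0 \<le> q"
    using cl unfolding A_def B_def q_def h_def by auto
  have v0: "0 \<le> v" unfolding v_def using inc(5) by (intro real_root_ge_zero) simp
  have dA: "real (count_proc (GA i) (lam i * t)) - real (count_proc (GA i) (lam i * s)) \<le> lam i * h + e * (lam i * h) + 32 * (sq * v)"
    using inc(1) unfolding e_def h_def by linarith
  have dS: "real (count_proc (GS i) (\<tau>S i t)) - real (count_proc (GS i) (\<tau>S i s)) \<ge> (mu i * A - mu i * B) - e * (mu i * A) - 32 * (sq * v)"
  proof -
    have eq: "\<tau>S i t - \<tau>S i s = mu i * A - mu i * B" using cl(1) unfolding A_def B_def by (simp add: right_diff_distrib)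
    moreover have "e * (\<tau>S i t - \<tau>S i s) \<le> e * (mu i * A)" unfolding eq using e m AB by (intro mult_left_mono) auto
    ultimately show ?thesis using inc(2)[folded e_def] unfolding abs_le_iff by linarith
  qed
  have dR: "real (count_proc (GR i) (\<tau>R i t)) - real (count_proc (GR i) (\<tau>R i s)) \<ge> gam i / 2 * q - 32 * (sq * v)"
  proof -
    have "e * (gam i * q) \<le> 1/2 * (gam i * q)" using e m AB by (intro mult_right_mono) auto
    then show ?thesis using inc(3) cl(4) unfolding e_def[symmetric] q_def[symmetric] by simp
  qed
  \<comment> \<open>With \<open>n = sq * sq\<close>, one factor \<open>sq\<close> scales the down
    time to order one, and the other is removed by the diffusive scaling.\<close>
  have sqB: "mu i * B \<le> sq * (2 * Mu * (CU * h + 3 * v))"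
  proof -
    have "mu i * B \<le> Mu * (2 * real n * (down t - down s))" using m AB LMuGm by (intro mult_mono) auto
    also have "\<dots> = 2 * Mu * sq * (sq * (down t - down s))" unfolding nn by (simp add: mult_ac)
    also have "\<dots> \<le> 2 * Mu * sq * (CU * h + 3 * v)" using inc(4) LMuGm sq unfolding h_def by (intro mult_left_mono) auto
    finally show ?thesis by (simp add: mult_ac)
  qed
  have eA: "e * (mu i * A) \<le> sq * (8 * C' * Mu * h)"
  proof -
    have "mu i * A \<le> Mu * (2 * real n * h)" using m AB LMuGm by (intro mult_mono) auto
    then have "e * (mu i * A) \<le> e * (Mu * (2 * real n * h))" using e by (intro mult_left_mono)
    also have "\<dots> = sq * (8 * C' * Mu * h)" unfolding nn e_def using sq by simp
    finally show ?thesis .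
  qed
  have eL: "e * (lam i * h) \<le> sq * (4 * C' * L * h)"
  proof -
    have "lam i * h \<le> L * real n * h" using m h0 by (intro mult_right_mono) auto
    then have "e * (lam i * h) \<le> e * (L * real n * h)" using e by (intro mult_left_mono)
    also have "\<dots> = sq * (4 * C' * L * h)" unfolding nn e_def using sq by simp
    finally show ?thesis .
  qed
  have t0: "0 \<le> t" using st by simp
  have "real (X i t) - real (X i s) \<le> (lam i * h - mu i * A - gam i / 2 * q)
      + (sq * (4 * C' * L * h) + sq * (8 * C' * Mu * h) + sq * (2 * Mu * (CU * h + 3 * v)) + 96 * (sq * v))"
    using dA dS dR sqB eA eL X_eq'[OF t0 i] X_eq'[OF st(1) i] by linarith
  also have "sq * (4 * C' * L * h) + sq * (8 * C' * Mu * h) + sq * (2 * Mu * (CU * h + 3 * v)) + 96 * (sq * v) = sq * (gU * h + K1 * v)"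
    unfolding gU_def K1_def by (simp add: algebra_simps)
  finally have "(real (X i t) - real (X i s)) / sq \<le> ((lam i * h - mu i * A - gam i / 2 * q) + sq * (gU * h + K1 * v)) / sq"
    using sq by (intro divide_right_mono) auto
  also have "\<dots> = (lam i * h - mu i * A - gam i / 2 * q) / sq + gU * h + K1 * v"
    using sq by (simp add: add_divide_distrib)
  also have "\<dots> = integral {s..t} (bU i) + K1 * v"
    using b_integrals(3)[OF i st] unfolding A_def q_def h_def by simp
  finally show ?thesis unfolding y_def v_def by (simp add: diff_divide_distrib)
qed

lemma y_increment_lower:
  assumes i: "i \<in> {1..d}" and st: "0 \<le> s" "s \<le> t"
  shows "y i s - y i t \<le> integral {s..t} (bL i) + K1 * root (4 * r) (Htot i t - Htot i s)"
proof -
  define v where "v = root (4 * r) (Htot i t - Htot i s)"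
  note cl = clocks[OF i st] and inc = increments[OF i st, folded v_def]
  define A where "A = integral {s..t} (\<lambda>s. Z i s)"
  define B where "B = integral {s..t} (\<lambda>s. Z i s * (1 - up_indicator u dn s))"
  define q where "q = integral {s..t} (Q i)"
  define e where "e = 4 * C' / sq"
  define h where "h = t - s"
  have h0: "0 \<le> h" using st by (simp add: h_def)
  have e: "0 \<le> e" "e \<le> 1/2" using C'_nonneg sq eps by (auto simp: e_def field_simps)
  have m: "0 \<le> mu i" "mu i \<le> Mu" "0 \<le> gam i" "0 \<le> lam i" "lam i \<le> L * real n" using mu[OF i] c gam[OF i] lam[OF i] by auto
  have nn: "real n = sq * sq" using sq_def by simp
  have AB: "0 \<le> A" "A \<le> 2 * real n * h" "0 \<le> B" "0 \<le> q"
    using cl unfolding A_def B_def q_def h_def by auto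
  have v0: "0 \<le> v" unfolding v_def using inc(5) by (intro real_root_ge_zero) simp
  have dA: "real (count_proc (GA i) (lam i * t)) - real (count_proc (GA i) (lam i * s)) \<ge> lam i * h - e * (lam i * h) - 32 * (sq * v)"
    using inc(1) unfolding e_def h_def by linarith
  have dS: "real (count_proc (GS i) (\<tau>S i t)) - real (count_proc (GS i) (\<tau>S i s)) \<le> mu i * A + e * (mu i * A) + 32 * (sq * v)"
  proof -
    have eq: "\<tau>S i t - \<tau>S i s = mu i * A - mu i * B" using cl(1) unfolding A_def B_def by (simp add: right_diff_distrib)
    moreover have "e * (\<tau>S i t - \<tau>S i s) \<le> e * (mu i * A)" unfolding eq using e m AB by (intro mult_left_mono) auto
    moreover have "0 \<le> mu i * B" using m AB by simp
    ultimately show ?thesis using inc(2)[folded e_def] unfolding abs_le_iff by linarith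
  qed
  have dR: "real (count_proc (GR i) (\<tau>R i t)) - real (count_proc (GR i) (\<tau>R i s)) \<le> 2 * gam i * q + 32 * (sq * v)"
  proof -
    have "e * (gam i * q) \<le> 1 * (gam i * q)" using e m AB by (intro mult_right_mono) auto
    then show ?thesis using inc(3) cl(4) unfolding e_def[symmetric] q_def[symmetric] by simp
  qed
  have eA: "e * (mu i * A) \<le> sq * (8 * C' * Mu * h)"
  proof -
    have "mu i * A \<le> Mu * (2 * real n * h)" using m AB LMuGm by (intro mult_mono) auto
    then have "e * (mu i * A) \<le> e * (Mu * (2 * real n * h))" using e by (intro mult_left_mono)
    also have "\<dots> = sq * (8 * C' * Mu * h)" unfolding nn e_def using sq by simp
    finally show ?thesis .
  qed
  have eL: "e * (lam i * h) \<le> sq * (4 * C' * L * h)"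
  proof -
    have "lam i * h \<le> L * real n * h" using m h0 by (intro mult_right_mono) auto
    then have "e * (lam i * h) \<le> e * (L * real n * h)" using e by (intro mult_left_mono)
    also have "\<dots> = sq * (4 * C' * L * h)" unfolding nn e_def using sq by simp
    finally show ?thesis .
  qed
  have t0: "0 \<le> t" using st by simp
  \<comment> \<open>Down times only help in this direction. The nonnegative term is inserted so that
    both directions share the constants \<open>gU\<close> and \<open>K1\<close>.\<close>
  have slack: "0 \<le> sq * (2 * Mu * (CU * h + 3 * v))" using sq LMuGm CU h0 v0 by simp
  have "real (X i s) - real (X i t) \<le> (mu i * A + 2 * gam i * q - lam i * h)
      + (sq * (4 * C' * L * h) + sq * (8 * C' * Mu * h) + sq * (2 * Mu * (CU * h + 3 * v)) + 96 * (sq * v))"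
    using dA dS dR slack eA eL X_eq'[OF t0 i] X_eq'[OF st(1) i] by linarith
  also have "sq * (4 * C' * L * h) + sq * (8 * C' * Mu * h) + sq * (2 * Mu * (CU * h + 3 * v)) + 96 * (sq * v) = sq * (gU * h + K1 * v)"
    unfolding gU_def K1_def by (simp add: algebra_simps)
  finally have "(real (X i s) - real (X i t)) / sq \<le> ((mu i * A + 2 * gam i * q - lam i * h) + sq * (gU * h + K1 * v)) / sq"
    using sq by (intro divide_right_mono) auto
  also have "\<dots> = (mu i * A + 2 * gam i * q - lam i * h) / sq + gU * h + K1 * v"
    using sq by (simp add: add_divide_distrib)
  also have "\<dots> = integral {s..t} (bL i) + K1 * v"
    using b_integrals(4)[OF i st] unfolding A_def q_def h_def by simp
  finally show ?thesis unfolding y_def v_def by (simp add: diff_divide_distrib)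
qed

definition "zh i s = (Z i s - rho i * real n) / sq"
definition "qh i s = Q i s / sq"

lemma zh_qh: "zh i s + qh i s = y i s"
  by (simp add: zh_def qh_def y_def Q_def add_divide_distrib[symmetric])

lemma qh_nonneg: "i \<in> {1..d} \<Longrightarrow> 0 \<le> qh i s"
  using Z_bounds(4) sq by (simp add: qh_def)

lemma drift_form:
  assumes i: "i \<in> {1..d}"
  shows "bU i s \<le> g0 - mu i * zh i s - gam i / 2 * qh i s" "bL i s \<le> g0 + mu i * zh i s + 2 * gam i * qh i s"
proof -
  define w where "w = (lam i - mu i * (rho i * real n)) / sq"
  have "\<bar>w\<bar> \<le> Dm" unfolding w_def using Dm[OF i] sq by (simp add: abs_divide divide_le_eq)
  then have w: "w \<le> Dm" "- w \<le> Dm" by auto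
  have "bU i s = w - mu i * zh i s - gam i / 2 * qh i s + gU"
    unfolding bU_def w_def zh_def qh_def using sq by (simp add: field_simps)
  then show "bU i s \<le> g0 - mu i * zh i s - gam i / 2 * qh i s" using w by (simp add: g0_def)
  have "bL i s = - w + mu i * zh i s + 2 * gam i * qh i s + gU"
    unfolding bL_def w_def zh_def qh_def using sq by (simp add: field_simps)
  then show "bL i s \<le> g0 + mu i * zh i s + 2 * gam i * qh i s" using w by (simp add: g0_def)
qed

text \<open>A class in \<open>I0\<close> is entitled to the integer part of its share whatever the
  other classes do, since the redistributed amount is nonnegative; the 1 is the rounding.\<close>

lemma Z_sat_lower: assumes i: "i \<in> I0"
  shows "Z i s \<ge> min (real (X i s)) (real n * rho i / (\<Sum>j\<in>I0. rho j) - 1)"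
proof -
  let ?k = "\<lfloor>real n * rho i / (\<Sum>j\<in>I0. rho j)\<rfloor>"
  have "min (int (X i s)) ?k \<le> zcheck n d rho I0 (\<lambda>j. X j s) i" unfolding zcheck_I0[OF i] by auto
  then have "real_of_int (min (int (X i s)) ?k) \<le> Z i s" by (simp only: of_int_le_iff)
  moreover have "real n * rho i / (\<Sum>j\<in>I0. rho j) - 1 \<le> real_of_int ?k" by linarith
  then have "min (real (X i s)) (real n * rho i / (\<Sum>j\<in>I0. rho j) - 1) \<le> min (real (X i s)) (real_of_int ?k)"
    by (intro min.mono) auto
  ultimately show ?thesis unfolding of_int_min by simp
qed

lemma Z_priority_eq: assumes "i \<notin> I0"
  shows "Z i s = min (real (X i s)) (max 0 (real n - (\<Sum>j\<in>{1..<i}. real (X j s))))"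
  using assms by (simp add: zcheck_not_I0 of_int_min of_int_max)

text \<open>The classes ahead occupy at most their nominal loads plus \<open>sq\<close> times their
  deviations, and these loads together with \<open>rho i\<close> add up to at most 1.\<close>

lemma priority_room: assumes i: "i \<in> {1..d}"
  shows "real n - (\<Sum>j\<in>{1..<i}. real (X j s)) \<ge> rho i * real n - sq * (\<Sum>j\<in>{1..<i}. \<bar>y j s\<bar>)"
proof -
  have Xj: "real (X j s) \<le> rho j * real n + sq * \<bar>y j s\<bar>" for j
  proof -
    have "real (X j s) = rho j * real n + sq * y j s" unfolding y_def using sq by simp
    moreover have "sq * y j s \<le> sq * \<bar>y j s\<bar>" using sq by (intro mult_left_mono) auto
    ultimately show ?thesis by linarith
  qed
  have "(\<Sum>j\<in>{1..<i}. real (X j s)) \<le> (\<Sum>j\<in>{1..<i}. rho j * real n + sq * \<bar>y j s\<bar>)" by (intro sum_mono Xj)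
  also have "\<dots> = (\<Sum>j\<in>{1..<i}. rho j) * real n + sq * (\<Sum>j\<in>{1..<i}. \<bar>y j s\<bar>)"
    by (simp add: sum.distrib sum_distrib_left sum_distrib_right)
  finally have 1: "(\<Sum>j\<in>{1..<i}. real (X j s)) \<le> (\<Sum>j\<in>{1..<i}. rho j) * real n + sq * (\<Sum>j\<in>{1..<i}. \<bar>y j s\<bar>)" .
  have "(\<Sum>j\<in>insert i {1..<i}. rho j) \<le> (\<Sum>j\<in>{1..d}. rho j)"
    using i rho by (intro sum_mono2) (auto intro: less_imp_le)
  then have "rho i + (\<Sum>j\<in>{1..<i}. rho j) \<le> 1" using rho_sum by simp
  then have "(rho i + (\<Sum>j\<in>{1..<i}. rho j)) * real n \<le> 1 * real n" by (intro mult_right_mono) auto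
  then show ?thesis using 1 by (simp add: distrib_right)
qed

theorem class_paths_X:
  assumes N: "N > 0"
  shows "class_paths d (4 * r) c g0 K1 K2 \<Lambda> y bU bL Htot I0 N"
proof
  show "2 \<le> 4 * r" using p by simp
  show "0 < c" "c \<le> 1" "0 < N" by (rule c N)+
  show "0 \<le> g0" "0 \<le> K1" "0 \<le> K2" using Dm_nonneg gU_nonneg LMuGm by (simp_all add: g0_def K1_def K2_def)
  show "g0 + 1 \<le> c * \<Lambda> / 2" using \<Lambda>big by (simp add: g0_def gU_def)
  show "bU i integrable_on {0..real N}" "bL i integrable_on {0..real N}" if "i \<in> {1..d}" for i
    using b_integrals(1,2)[OF that, of 0 "real N"] by auto
  show "Htot i s \<le> Htot i t" if "i \<in> {1..d}" "0 \<le> s" "s \<le> t" "t \<le> real N" for i s t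
    using increments(5)[OF that(1-3)] .
  show "y i t - y i s \<le> integral {s..t} (bU i) + K1 * root (4 * r) (Htot i t - Htot i s)"
    if "i \<in> {1..d}" "0 \<le> s" "s \<le> t" "t \<le> real N" for i s t
    using y_increment_upper[OF that(1-3)] .
  show "y i s - y i t \<le> integral {s..t} (bL i) + K1 * root (4 * r) (Htot i t - Htot i s)"
    if "i \<in> {1..d}" "0 \<le> s" "s \<le> t" "t \<le> real N" for i s t
    using y_increment_lower[OF that(1-3)] .
next
  fix i t assume i: "i \<in> {1..d}" "i \<in> I0" and t: "0 \<le> t" "t \<le> real N" "0 < y i t"
  \<comment> \<open>All customers are in service until the guaranteed share is exhausted, and this
    share lies at least \<open>sq * \<Lambda>\<close> above the nominal load.\<close>
  have "zh i t \<ge> min (y i t) \<Lambda>"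
  proof -
    have "min (real (X i t)) (sq * \<Lambda> + rho i * real n) \<le> Z i t" using Z_sat_lower[OF i(2), of t] \<Lambda>[OF i(2)] by simp
    then have "(min (real (X i t)) (sq * \<Lambda> + rho i * real n) - rho i * real n) / sq \<le> zh i t"
      unfolding zh_def using sq by (intro divide_right_mono) auto
    moreover have "(min (real (X i t)) (sq * \<Lambda> + rho i * real n) - rho i * real n) / sq = min (y i t) \<Lambda>"
      unfolding y_def using sq by (simp add: min_def field_simps)
    ultimately show ?thesis by simp
  qed
  moreover have "0 \<le> min (y i t) \<Lambda>" using t \<Lambda>0 by simp
  ultimately have "c * min (y i t) \<Lambda> \<le> mu i * zh i t" using mu[OF i(1)] c by (intro mult_mono) auto
  moreover have "0 \<le> gam i / 2 * qh i t" using gam[OF i(1)] qh_nonneg[OF i(1)] by simp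
  ultimately show "bU i t \<le> g0 - c * min (y i t) \<Lambda>" using drift_form(1)[OF i(1), of t] by linarith
next
  fix i t assume i: "i \<in> {1..d}" "i \<notin> I0" and t: "0 \<le> t" "t \<le> real N" "0 < y i t"
  define S where "S = (\<Sum>j\<in>{1..<i}. \<bar>y j t\<bar>)"
  have S0: "0 \<le> S" unfolding S_def by (intro sum_nonneg) auto
  have m: "c \<le> mu i" "mu i \<le> Mu" "2 * c \<le> gam i" using mu[OF i(1)] gam_pos[OF i] by auto
  \<comment> \<open>Either all customers are served, and there are more than the nominal load, or
    the class fills the room left by the classes ahead, which misses the nominal load by at most
    their deviations.\<close>
  have zS: "- S \<le> zh i t"
  proof -
    have "rho i * real n \<le> real (X i t)" using t(3) sq by (simp add: y_def zero_less_divide_iff)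
    then have "rho i * real n - sq * S \<le> real (X i t)" using S0 sq mult_nonneg_nonneg[of sq S] by linarith
    moreover have "rho i * real n - sq * S \<le> max 0 (real n - (\<Sum>j\<in>{1..<i}. real (X j t)))"
      using priority_room[OF i(1), of t] unfolding S_def by simp
    ultimately have "rho i * real n - sq * S \<le> Z i t" unfolding Z_priority_eq[OF i(2)] by simp
    then have "- (sq * S) / sq \<le> zh i t" unfolding zh_def using sq by (intro divide_right_mono) auto
    then show ?thesis using sq by simp
  qed
  \<comment> \<open>A rate \<open>c\<close> is extracted from both service and abandonment to form
    \<open>- c * y i t\<close>. The queue part left over has the right sign by
    \<open>gam_pos\<close>, and the service part is bounded through \<open>zS\<close>.\<close>
  have "- mu i * zh i t - gam i / 2 * qh i t = - c * y i t - (mu i - c) * zh i t - (gam i / 2 - c) * qh i t"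
    unfolding zh_qh[symmetric] by (simp add: algebra_simps)
  moreover have "0 \<le> (gam i / 2 - c) * qh i t" using m qh_nonneg[OF i(1)] by simp
  moreover have "(mu i - c) * - S \<le> (mu i - c) * zh i t" using m zS by (intro mult_left_mono) auto
  moreover have "(mu i - c) * S \<le> K2 * S" using m c LMuGm S0 by (intro mult_right_mono) (auto simp: K2_def)
  ultimately show "bU i t \<le> g0 + K2 * (\<Sum>j\<in>{1..<i}. \<bar>y j t\<bar>) - c * y i t"
    using drift_form(1)[OF i(1), of t] unfolding S_def[symmetric] by simp
next
  fix i t assume i: "i \<in> {1..d}" and t: "0 \<le> t" "t \<le> real N" "y i t < 0"
  define S where "S = (\<Sum>j\<in>{1..<i}. \<bar>y j t\<bar>)"
  have S0: "0 \<le> S" unfolding S_def by (intro sum_nonneg) auto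
  have m: "c \<le> mu i" "mu i \<le> Mu" "0 \<le> gam i" "gam i \<le> Gm" using mu[OF i] gam[OF i] by auto
  have Xlt: "real (X i t) < rho i * real n" using t(3) sq by (simp add: y_def divide_less_0_iff)
  \<comment> \<open>Below the nominal load a class in \<open>I0\<close> has no queue, since its
    share exceeds that load. Any other class can queue only because of excess in the classes
    ahead.\<close>
  have qS: "qh i t \<le> S"
  proof (cases "i \<in> I0")
    case True
    have "rho i * real n \<le> real n * rho i / (\<Sum>j\<in>I0. rho j) - 1" using \<Lambda>[OF True] sq \<Lambda>0 mult_nonneg_nonneg[of sq \<Lambda>] by linarith
    then have "real (X i t) \<le> Z i t" using Z_sat_lower[OF True, of t] Xlt by simp
    then have "Q i t \<le> 0" by (simp add: Q_def)
    then have "qh i t \<le> 0" using sq by (simp add: qh_def divide_le_0_iff)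
    then show ?thesis using S0 by simp
  next
    case False
    have "Q i t \<le> sq * S"
      using priority_room[OF i, of t] Xlt S0 sq mult_nonneg_nonneg[of sq S]
      unfolding Q_def Z_priority_eq[OF False] S_def[symmetric] by (simp add: min_def max_def split: if_splits)
    then show ?thesis unfolding qh_def using sq by (simp add: divide_le_eq mult.commute)
  qed
  have "mu i * zh i t + 2 * gam i * qh i t = mu i * y i t + (2 * gam i - mu i) * qh i t"
    unfolding zh_qh[symmetric] by (simp add: algebra_simps)
  moreover have "mu i * y i t \<le> c * y i t" using m t by (intro mult_right_mono_neg) auto
  moreover have "(2 * gam i - mu i) * qh i t \<le> K2 * qh i t"
    using m c LMuGm qh_nonneg[OF i] by (intro mult_right_mono) (auto simp: K2_def)
  moreover have "K2 * qh i t \<le> K2 * S" using LMuGm by (intro mult_left_mono qS) (auto simp: K2_def)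
  ultimately show "bL i t \<le> g0 + K2 * (\<Sum>j\<in>{1..<i}. \<bar>y j t\<bar>) - c * (- y i t)"
    using drift_form(2)[OF i, of t] unfolding S_def[symmetric] by simp
qed

text \<open>Nonnegativity of the state bounds services and abandonments by the initial number plus
  the arrivals. So \<open>k\<close>, which depends on the arrival sequence alone, limits the number
  of noise terms used by all three processes.\<close>

lemma Htot_increment_le:
  assumes i: "i \<in> {1..d}" and t: "0 \<le> t"
  defines "k \<equiv> x0 i + count_proc (GA i) (lam i * t)"
  shows "Htot i t - Htot i 0 \<le> (\<Sum>q\<le>k. \<eta>A i q) + (\<Sum>q\<le>k. \<eta>S i q) + (\<Sum>q\<le>k. \<eta>R i q) + (\<Sum>q\<le>count_proc (\<lambda>j. u j + dn j) t. \<eta>U q)"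
proof -
  interpret A: noise_control "GA i" sq C' r J "\<eta>A i" by (rule noise(1)[OF i])
  interpret S: noise_control "GS i" sq C' r J "\<eta>S i" by (rule noise(2)[OF i])
  interpret R: noise_control "GR i" sq C' r J "\<eta>R i" by (rule noise(3)[OF i])
  note cl = clocks[OF i t order_refl]
  have a: "0 \<le> lam i * t" using lam[OF i] t by simp
  have z: "\<tau>S i 0 = 0" "\<tau>R i 0 = 0" by (simp_all add: \<tau>S_def \<tau>R_def)
  have h0: "0 \<le> Htot i 0" unfolding Htot_def z mult_zero_right using A.H_0 S.H_0 R.H_0 H_0 by linarith
  have x: "real (count_proc (GS i) (\<tau>S i t)) + real (count_proc (GR i) (\<tau>R i t)) \<le> real k"
    using X_eq'[OF t i] unfolding k_def by simp
  then have ks: "count_proc (GS i) (\<tau>S i t) \<le> k" "count_proc (GR i) (\<tau>R i t) \<le> k" "count_proc (GA i) (lam i * t) \<le> k"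
    unfolding k_def by linarith+
  have 1: "A.H (lam i * t) \<le> (\<Sum>q\<le>k. \<eta>A i q)"
    by (rule order_trans[OF A.H_le[OF a]], rule sum_mono2) (use ks A.\<eta>_nonneg in auto)
  have 2: "S.H (\<tau>S i t) \<le> (\<Sum>q\<le>k. \<eta>S i q)"
    by (rule order_trans[OF S.H_le[OF cl(5)]], rule sum_mono2) (use ks S.\<eta>_nonneg in auto)
  have 3: "R.H (\<tau>R i t) \<le> (\<Sum>q\<le>k. \<eta>R i q)"
    by (rule order_trans[OF R.H_le[OF cl(7)]], rule sum_mono2) (use ks R.\<eta>_nonneg in auto)
  have 4: "H t \<le> (\<Sum>q\<le>count_proc (\<lambda>j. u j + dn j) t. \<eta>U q)"
    using H_le[OF t] unfolding cyc_def[abs_def] .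
  show ?thesis using 1 2 3 4 h0 unfolding Htot_def by linarith
qed

end

section \<open>Expected path integrals\<close>

lemma hat_norm_le_sum:
  "hat_norm n d rho x \<le> (\<Sum>i\<in>{1..d}. \<bar>(real (x i) - rho i * real n) / sqrt (real n)\<bar>)"
  using L2_set_le_sum_abs[of "\<lambda>i. (real (x i) - rho i * real n) / sqrt (real n)" "{1..d}"]
  unfolding hat_norm_def L2_set_def .

lemma powr_le_one_plus_power:
  fixes x k :: real assumes "0 \<le> x" "0 < k" "k \<le> real P" shows "x powr k \<le> 1 + x ^ P"
proof (cases "x \<le> 1")
  case True
  then have "x powr k \<le> 1" using assms powr_le1 by simp
  then show ?thesis using assms zero_le_power[of x P] by linarith
next
  case False
  then have "x powr k \<le> x powr real P" using assms by (intro powr_mono) auto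
  also have "\<dots> = x ^ P" using False by (simp add: powr_realpow)
  finally show ?thesis by simp
qed

lemma (in system_path) path_integral_le:
  assumes K: "K \<ge> 0"
    and \<sigma>: "\<forall>j\<in>{1..d}. \<forall>m<N. 0 \<le> \<sigma> j m \<and> (\<forall>t\<in>{real m..real m + 1}. \<bar>y j t\<bar> \<le> \<sigma> j m)"
      "(\<Sum>j\<in>{1..d}. \<Sum>m<N. \<sigma> j m ^ (4 * r - 1)) \<le> K * class_paths.budget d (4 * r) y Htot N"
    and k: "0 < k" "k \<le> real (4 * r - 1)" and Tm: "Tm < real N"
  shows "(\<integral>\<^sup>+ s\<in>{0..Tm}. ennreal (hat_norm n d rho (\<lambda>i. X i s) powr k) \<partial>lborel)
    \<le> ennreal (real N + real d ^ (4 * r - 1) * (K * class_paths.budget d (4 * r) y Htot N))"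
proof -
  let ?P = "4 * r - 1"
  define a where "a m = 1 + real d ^ ?P * (\<Sum>j\<in>{1..d}. \<sigma> j m ^ ?P)" for m
  have s0: "0 \<le> \<sigma> j m" if "j \<in> {1..d}" "m < N" for j m using \<sigma>(1) that by auto
  have a0: "0 \<le> a m" if "m < N" for m using s0[OF _ that] unfolding a_def by (intro add_nonneg_nonneg mult_nonneg_nonneg sum_nonneg) auto
  have P: "?P > 0" using p by simp
  have pt: "hat_norm n d rho (\<lambda>i. X i s) powr k \<le> a m" if m: "m < N" "s \<in> {real m..real m + 1}" for s m
  proof -
    have "hat_norm n d rho (\<lambda>i. X i s) \<le> (\<Sum>j\<in>{1..d}. \<bar>y j s\<bar>)"
      using hat_norm_le_sum[of n d rho "\<lambda>i. X i s"] unfolding sq_def[symmetric] y_def .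
    also have "\<dots> \<le> (\<Sum>j\<in>{1..d}. \<sigma> j m)" using \<sigma>(1) m by (intro sum_mono) auto
    finally have h: "hat_norm n d rho (\<lambda>i. X i s) \<le> (\<Sum>j\<in>{1..d}. \<sigma> j m)" .
    have h0: "0 \<le> hat_norm n d rho (\<lambda>i. X i s)" unfolding hat_norm_def by (intro real_sqrt_ge_zero sum_nonneg) auto
    have "hat_norm n d rho (\<lambda>i. X i s) powr k \<le> 1 + hat_norm n d rho (\<lambda>i. X i s) ^ ?P"
      by (rule powr_le_one_plus_power[OF h0 k])
    also have "hat_norm n d rho (\<lambda>i. X i s) ^ ?P \<le> (\<Sum>j\<in>{1..d}. \<sigma> j m) ^ ?P" by (rule power_mono[OF h h0])
    also have "\<dots> \<le> real (card {1..d}) ^ ?P * (\<Sum>j\<in>{1..d}. \<sigma> j m ^ ?P)"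
      using s0[OF _ m(1)] P by (intro power_sum_le) auto
    finally show ?thesis by (simp add: a_def)
  qed
  have "(\<integral>\<^sup>+ s\<in>{0..Tm}. ennreal (hat_norm n d rho (\<lambda>i. X i s) powr k) \<partial>lborel)
    \<le> (\<integral>\<^sup>+ s. (\<Sum>m<N. ennreal (a m) * indicator {real m..real m + 1} s) \<partial>lborel)"
  proof (rule nn_integral_mono)
    fix s
    show "ennreal (hat_norm n d rho (\<lambda>i. X i s) powr k) * indicator {0..Tm} s
      \<le> (\<Sum>m<N. ennreal (a m) * indicator {real m..real m + 1} s)"
    proof (cases "s \<in> {0..Tm}")
      case True
      define m where "m = nat \<lfloor>s\<rfloor>"
      have m: "m < N" "s \<in> {real m..real m + 1}" using True Tm unfolding m_def by (auto simp: nat_less_iff floor_less_iff)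
      have "ennreal (hat_norm n d rho (\<lambda>i. X i s) powr k) * indicator {0..Tm} s \<le> ennreal (a m) * indicator {real m..real m + 1} s"
        using pt[OF m] m True by (simp add: ennreal_leI)
      also have "\<dots> \<le> (\<Sum>m<N. ennreal (a m) * indicator {real m..real m + 1} s)"
        using m by (intro member_le_sum) auto
      finally show ?thesis .
    qed simp
  qed
  also have "\<dots> = (\<Sum>m<N. ennreal (a m))"
    by (subst nn_integral_sum) (auto simp: nn_integral_cmult_indicator)
  also have "\<dots> = ennreal (\<Sum>m<N. a m)" using a0 by (intro sum_ennreal) auto
  also have "(\<Sum>m<N. a m) = real N + real d ^ ?P * (\<Sum>j\<in>{1..d}. \<Sum>m<N. \<sigma> j m ^ ?P)"
    unfolding a_def by (simp add: sum.distrib sum_distrib_left[symmetric]) (subst sum.swap, simp)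
  also have "\<dots> \<le> real N + real d ^ ?P * (K * class_paths.budget d (4 * r) y Htot N)"
    using \<sigma>(2) by (intro add_left_mono mult_left_mono) auto
  finally show ?thesis by (simp add: ennreal_leI)
qed

text \<open>Excludes renewals at time zero, so that the state at time zero is the prescribed initial
  state.\<close>

lemma (in renewal_path) cnt_0: assumes "E 0 > 0" shows "cnt 0 = 0"
proof -
  have "\<not> psum E 1 \<le> 0" using assms by (simp add: psum_def)
  then show ?thesis using psum_le_iff[of 0 1] by simp
qed

locale random_system = prob_space M for M :: "'a measure" +
  fixes n d r J :: nat and lam mu gam rho :: "nat \<Rightarrow> real" and I0 :: "nat set"
    and GA GS GR :: "nat \<Rightarrow> nat \<Rightarrow> 'a \<Rightarrow> real" and U Dn :: "nat \<Rightarrow> 'a \<Rightarrow> real"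
    and x0 :: "nat \<Rightarrow> nat" and X :: "nat \<Rightarrow> real \<Rightarrow> 'a \<Rightarrow> nat"
    and cc ss CU \<theta> c Mu Gm L Dm \<Lambda> :: real
  assumes seqs: "\<And>i. i \<in> {1..d} \<Longrightarrow> noise_seq M (GA i) cc ss n r J"
      "\<And>i. i \<in> {1..d} \<Longrightarrow> noise_seq M (GS i) cc ss n r J"
      "\<And>i. i \<in> {1..d} \<Longrightarrow> noise_seq M (GR i) cc ss n r J"
    and downs: "down_seq M U Dn (sqrt (real n)) CU \<theta> (4 * r)"
    and pos: "\<And>i. i \<in> {1..d} \<Longrightarrow> AE \<omega> in M. GA i 0 \<omega> > 0 \<and> GS i 0 \<omega> > 0 \<and> GR i 0 \<omega> > 0"
    and n: "n > 0" and J: "real n \<le> 2 * 2 ^ J" and eps: "8 * noise_seq.C' cc ss \<le> sqrt (real n)"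
    and c: "0 < c" "c \<le> 1"
    and lam: "\<And>i. i \<in> {1..d} \<Longrightarrow> 0 \<le> lam i \<and> lam i \<le> L * real n"
    and mu: "\<And>i. i \<in> {1..d} \<Longrightarrow> c \<le> mu i \<and> mu i \<le> Mu"
    and gam: "\<And>i. i \<in> {1..d} \<Longrightarrow> 0 \<le> gam i \<and> gam i \<le> Gm"
    and gam_pos: "\<And>i. i \<in> {1..d} \<Longrightarrow> i \<notin> I0 \<Longrightarrow> 2 * c \<le> gam i"
    and rho: "\<And>i. i \<in> {1..d} \<Longrightarrow> 0 < rho i" and rho_sum: "(\<Sum>i\<in>{1..d}. rho i) = 1"
    and I0: "I0 \<subseteq> {1..d}" and d: "d > 0" and LMuGm: "0 \<le> L" "0 \<le> Mu" "0 \<le> Gm"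
    and Dm: "\<And>i. i \<in> {1..d} \<Longrightarrow> \<bar>lam i - mu i * (rho i * real n)\<bar> \<le> Dm * sqrt (real n)"
    and \<Lambda>0: "0 \<le> \<Lambda>"
    and \<Lambda>: "\<And>i. i \<in> I0 \<Longrightarrow> sqrt (real n) * \<Lambda> + rho i * real n \<le> real n * rho i / (\<Sum>j\<in>I0. rho j) - 1"
    and \<Lambda>big: "c * \<Lambda> / 2 \<ge> Dm + (4 * noise_seq.C' cc ss * L + 8 * noise_seq.C' cc ss * Mu + 2 * Mu * CU) + 1"
    and X_eq: "AE \<omega> in M. \<forall>t\<ge>0. \<forall>i\<in>{1..d}.
        set_integrable lborel {0..t} (\<lambda>s. real (X i s \<omega>)) \<and>
        real (X i t \<omega>) = real (x0 i) + real (count_proc (\<lambda>j. GA i j \<omega>) (lam i * t))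
          - real (count_proc (\<lambda>j. GS i j \<omega>) (mu i * (LBINT s:{0..t}.
              real_of_int (zcheck n d rho I0 (\<lambda>j. X j s \<omega>) i) * up_indicator (\<lambda>k. U k \<omega>) (\<lambda>k. Dn k \<omega>) s)))
          - real (count_proc (\<lambda>j. GR i j \<omega>) (gam i * (LBINT s:{0..t}.
              real (X i s \<omega>) - real_of_int (zcheck n d rho I0 (\<lambda>j. X j s \<omega>) i))))"
begin

abbreviation "sqn \<equiv> sqrt (real n)"
abbreviation "etaN E q \<omega> \<equiv> noise_seq.eta E cc ss n r J q \<omega>"
abbreviation "etaEN E q \<omega> \<equiv> noise_seq.etaE E cc ss n r J q \<omega>"
abbreviation "etaD q \<omega> \<equiv> down_seq.eta U Dn sqn CU (4 * r) q \<omega>"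
abbreviation "etaED q \<omega> \<equiv> down_seq.etaE U Dn sqn CU (4 * r) q \<omega>"

lemma system_path_AE:
  "AE \<omega> in M. system_path (\<lambda>k. U k \<omega>) (\<lambda>k. Dn k \<omega>) sqn CU r (\<lambda>q. etaD q \<omega>) n d J lam mu gam rho I0
    (\<lambda>i j. GA i j \<omega>) (\<lambda>i j. GS i j \<omega>) (\<lambda>i j. GR i j \<omega>) (\<lambda>i q. etaN (GA i) q \<omega>) (\<lambda>i q. etaN (GS i) q \<omega>) (\<lambda>i q. etaN (GR i) q \<omega>)
    x0 (\<lambda>i t. X i t \<omega>) (noise_seq.C' cc ss) c Mu Gm L Dm \<Lambda> \<and>
    (\<forall>q. ennreal (etaD q \<omega>) = etaED q \<omega>) \<and>
    (\<forall>i\<in>{1..d}. \<forall>q. ennreal (etaN (GA i) q \<omega>) = etaEN (GA i) q \<omega> \<and> ennreal (etaN (GS i) q \<omega>) = etaEN (GS i) q \<omega>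
      \<and> ennreal (etaN (GR i) q \<omega>) = etaEN (GR i) q \<omega>) \<and>
    (\<forall>i\<in>{1..d}. X i 0 \<omega> = x0 i)"
proof -
  have sq: "noise_seq.sq n = sqn" using noise_seq.sq_def[OF seqs(1)[of 1]] d by simp
  have all: "(AE \<omega> in M. \<forall>i\<in>{1..d}. P i \<omega>) \<longleftrightarrow> (\<forall>i\<in>{1..d}. AE \<omega> in M. P i \<omega>)" for P
    by (rule AE_ball_countable) simp
  have a: "AE \<omega> in M. \<forall>i\<in>{1..d}. noise_control (\<lambda>j. GA i j \<omega>) sqn (noise_seq.C' cc ss) r J (\<lambda>q. etaN (GA i) q \<omega>) \<and> (\<forall>q. ennreal (etaN (GA i) q \<omega>) = etaEN (GA i) q \<omega>)"
    unfolding all using noise_seq.noise_control_AE[OF seqs(1)] unfolding sq by blast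
  have s: "AE \<omega> in M. \<forall>i\<in>{1..d}. noise_control (\<lambda>j. GS i j \<omega>) sqn (noise_seq.C' cc ss) r J (\<lambda>q. etaN (GS i) q \<omega>) \<and> (\<forall>q. ennreal (etaN (GS i) q \<omega>) = etaEN (GS i) q \<omega>)"
    unfolding all using noise_seq.noise_control_AE[OF seqs(2)] unfolding sq by blast
  have rr: "AE \<omega> in M. \<forall>i\<in>{1..d}. noise_control (\<lambda>j. GR i j \<omega>) sqn (noise_seq.C' cc ss) r J (\<lambda>q. etaN (GR i) q \<omega>) \<and> (\<forall>q. ennreal (etaN (GR i) q \<omega>) = etaEN (GR i) q \<omega>)"
    unfolding all using noise_seq.noise_control_AE[OF seqs(3)] unfolding sq by blast
  have p: "AE \<omega> in M. \<forall>i\<in>{1..d}. GA i 0 \<omega> > 0 \<and> GS i 0 \<omega> > 0 \<and> GR i 0 \<omega> > 0"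
    unfolding all using pos by blast
  note dn = down_seq.down_control_AE[OF downs]
  have C'0: "0 \<le> noise_seq.C' cc ss" using noise_seq.C'_nonneg[OF seqs(1)[of 1]] d by simp
  from a s rr p dn X_eq show ?thesis
  proof eventually_elim
    case (elim \<omega>)
    have "system_path_axioms (\<lambda>k. U k \<omega>) (\<lambda>k. Dn k \<omega>) sqn CU r n d J lam mu gam rho I0
      (\<lambda>i j. GA i j \<omega>) (\<lambda>i j. GS i j \<omega>) (\<lambda>i j. GR i j \<omega>) (\<lambda>i q. etaN (GA i) q \<omega>) (\<lambda>i q. etaN (GS i) q \<omega>) (\<lambda>i q. etaN (GR i) q \<omega>)
      x0 (\<lambda>i t. X i t \<omega>) (noise_seq.C' cc ss) c Mu Gm L Dm \<Lambda>"
    proof (rule system_path_axioms.intro)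
      show "n > 0" "sqn = sqrt (real n)" "real n \<le> 2 * 2 ^ J" "8 * noise_seq.C' cc ss \<le> sqn" "0 \<le> noise_seq.C' cc ss"
        "0 < c" "c \<le> 1" "(\<Sum>i\<in>{1..d}. rho i) = 1" "I0 \<subseteq> {1..d}" "0 < d" "0 \<le> L" "0 \<le> Mu" "0 \<le> Gm" "0 \<le> \<Lambda>"
        "Dm + (4 * noise_seq.C' cc ss * L + 8 * noise_seq.C' cc ss * Mu + 2 * Mu * CU) + 1 \<le> c * \<Lambda> / 2"
        using n J eps C'0 c rho_sum I0 d LMuGm \<Lambda>0 \<Lambda>big by auto
    qed (use elim lam mu gam gam_pos rho Dm \<Lambda> in blast)+
    then interpret P: system_path "\<lambda>k. U k \<omega>" "\<lambda>k. Dn k \<omega>" sqn CU r "\<lambda>q. etaD q \<omega>" n d J lam mu gam rho I0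
      "\<lambda>i j. GA i j \<omega>" "\<lambda>i j. GS i j \<omega>" "\<lambda>i j. GR i j \<omega>" "\<lambda>i q. etaN (GA i) q \<omega>" "\<lambda>i q. etaN (GS i) q \<omega>" "\<lambda>i q. etaN (GR i) q \<omega>"
      x0 "\<lambda>i t. X i t \<omega>" "noise_seq.C' cc ss" c Mu Gm L Dm \<Lambda>
      using elim(5) by (intro system_path.intro) auto
    have X0: "X i 0 \<omega> = x0 i" if i: "i \<in> {1..d}" for i
    proof -
      interpret A: noise_control "\<lambda>j. GA i j \<omega>" sqn "noise_seq.C' cc ss" r J "\<lambda>q. etaN (GA i) q \<omega>" using elim(1) i by blast
      interpret S: noise_control "\<lambda>j. GS i j \<omega>" sqn "noise_seq.C' cc ss" r J "\<lambda>q. etaN (GS i) q \<omega>" using elim(2) i by blast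
      interpret R: noise_control "\<lambda>j. GR i j \<omega>" sqn "noise_seq.C' cc ss" r J "\<lambda>q. etaN (GR i) q \<omega>" using elim(3) i by blast
      have "A.cnt 0 = 0" "S.cnt 0 = 0" "R.cnt 0 = 0" using elim(4) i A.cnt_0 S.cnt_0 R.cnt_0 by auto
      then show ?thesis using P.X_eq'[of 0 i] i by (simp add: P.\<tau>S_def P.\<tau>R_def)
    qed
    show ?case using P.system_path_axioms X0 elim(1,2,3,5) by (intro conjI ballI allI) blast+
  qed
qed

text \<open>The event \<open>B N k\<close> says that block \<open>k\<close> can be reached by time
  \<open>N\<close>. It is determined by the arrivals, also when the noise terms belong to services
  or abandonments, and it depends on the noise when they are the arrivals themselves; hence the use
  of \<open>tame\<close>.\<close>

lemma noise_sum_expect: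
  assumes E: "noise_seq M E cc ss n r J" and i: "i \<in> {1..d}"
  defines "B \<equiv> (\<lambda>N k. {\<omega> \<in> space M. psum (\<lambda>j. GA i j \<omega>) (k * 2 ^ J - x0 i) \<le> lam i * real N})"
  shows "(\<integral>\<^sup>+\<omega>. (\<Sum>k. noise_seq.xi E cc ss n r J k \<omega> * indicator (B N k) \<omega>) \<partial>M)
     \<le> ennreal (8 * noise_seq.Cxi cc ss r * L * real N + 2 * noise_seq.Cxi cc ss r *
        (1 + 2 * real (x0 i) + 1 / (1 - exp (- (subexp_seq.hit_rate cc ss / 8)))))"
proof -
  interpret A: noise_seq M "GA i" cc ss n r J by (rule seqs(1)[OF i])
  interpret E: noise_seq M E cc ss n r J by (rule E)
  let ?h = "A.hit_rate" and ?C = "E.Cxi"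
  have h: "?h > 0" by (rule A.hit_rate_pos)
  \<comment> \<open>Since \<open>2 ^ J \<ge> n / 2\<close> and \<open>lam i \<le> L * n\<close>, the
    exponent in the hitting bound is at most \<open>n * (L * N + x0 i / 2 - k / 4)\<close> times the
    rate; it becomes negative beyond \<open>k = 4 * L * N + 2 * x0 i\<close>.\<close>
  define k0 where "k0 = nat \<lceil>4 * L * real N\<rceil> + 2 * x0 i"
  have LN: "0 \<le> 4 * L * real N" using LMuGm by simp
  have k0: "4 * L * real N + 2 * real (x0 i) \<le> real k0" "real k0 \<le> 4 * L * real N + 1 + 2 * real (x0 i)"
    unfolding k0_def using LN by simp_all
  have "(\<integral>\<^sup>+\<omega>. (\<Sum>k. E.xi k \<omega> * indicator (B N k) \<omega>) \<partial>M) \<le> ennreal (2 * ?C * (real k0 + 1 / (1 - exp (- (?h / 4) / 2))))"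
  proof (rule tame_random_sum[OF E.xi_tame])
    show "B N k \<in> events" for k unfolding B_def by measurable
    show "0 < ?h / 4" using h by simp
    fix k assume k: "k0 \<le> k"
    have "prob (B N k) \<le> exp (?h * (lam i * real N - real (k * 2 ^ J - x0 i) / 2))"
      unfolding B_def by (rule A.hit_prob)
    also have "\<dots> \<le> exp (- (?h / 4) * real (k - k0))"
    proof -
      have "real (k * 2 ^ J) - real (x0 i) \<le> real (k * 2 ^ J - x0 i)" by linarith
      moreover have "real k * (real n / 2) \<le> real (k * 2 ^ J)" using mult_left_mono[OF J, of "real k"] by simp
      moreover have "lam i * real N \<le> L * real n * real N" using lam[OF i] by (intro mult_right_mono) auto
      ultimately have 1: "lam i * real N - real (k * 2 ^ J - x0 i) / 2 \<le> L * real n * real N + real (x0 i) / 2 - real k * real n / 4" by linarith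
      have n1: "1 \<le> real n" using n by simp
      have "real (x0 i) / 2 \<le> real n * (real (x0 i) / 2)" using mult_right_mono[OF n1, of "real (x0 i) / 2"] by simp
      then have 2: "L * real n * real N + real (x0 i) / 2 - real k * real n / 4 \<le> real n * ((4 * L * real N + 2 * real (x0 i) - real k) / 4)"
        by (simp add: field_simps)
      have "4 * L * real N + 2 * real (x0 i) - real k \<le> real k0 - real k" using k0(1) by simp
      then have "real n * ((4 * L * real N + 2 * real (x0 i) - real k) / 4) \<le> real n * ((real k0 - real k) / 4)" by (intro mult_left_mono) auto
      also have "\<dots> \<le> 1 * ((real k0 - real k) / 4)" using n1 k by (intro mult_right_mono_neg) auto
      finally have 3: "real n * ((4 * L * real N + 2 * real (x0 i) - real k) / 4) \<le> 1 * ((real k0 - real k) / 4)" .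
      have e4: "1 * ((real k0 - real k) / 4) = - (real (k - k0) / 4)" unfolding of_nat_diff[OF k] by (simp only: mult_1_left minus_divide_left minus_diff_eq)
      have "lam i * real N - real (k * 2 ^ J - x0 i) / 2 \<le> - (real (k - k0) / 4)"
        using order_trans[OF 1 order_trans[OF 2 3]] unfolding e4 .
      then have "?h * (lam i * real N - real (k * 2 ^ J - x0 i) / 2) \<le> ?h * - (real (k - k0) / 4)" using h by (intro mult_left_mono) auto
      then show ?thesis by simp
    qed
    finally show "prob (B N k) \<le> exp (- (?h / 4) * real (k - k0))" .
  qed
  also have "\<dots> \<le> ennreal (8 * ?C * L * real N + 2 * ?C * (1 + 2 * real (x0 i) + 1 / (1 - exp (- (?h / 8)))))"
  proof (rule ennreal_leI)
    have C0: "0 \<le> ?C" using tame_nonneg[OF E.xi_tame[of 0]] .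
    have "2 * ?C * (real k0 + 1 / (1 - exp (- (?h / 8)))) \<le> 2 * ?C * ((4 * L * real N + 1 + 2 * real (x0 i)) + 1 / (1 - exp (- (?h / 8))))"
      using k0(2) C0 by (intro mult_left_mono) auto
    also have "\<dots> = 8 * ?C * L * real N + 2 * ?C * (1 + 2 * real (x0 i) + 1 / (1 - exp (- (?h / 8))))" by (simp add: algebra_simps)
    finally show "2 * ?C * (real k0 + 1 / (1 - exp (- (?h / 4) / 2))) \<le> 8 * ?C * L * real N + 2 * ?C * (1 + 2 * real (x0 i) + 1 / (1 - exp (- (?h / 8))))"
      by simp
  qed
  finally show ?thesis .
qed

lemma down_sum_expect:
  defines "B \<equiv> (\<lambda>N k. {\<omega> \<in> space M. psum (\<lambda>j. U j \<omega>) k \<le> real N})"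
  shows "(\<integral>\<^sup>+\<omega>. (\<Sum>k. etaED k \<omega> * indicator (B N k) \<omega>) \<partial>M)
     \<le> ennreal (2 * down_seq.Keta \<theta> (4 * r) * \<theta> * CU * real N + 2 * down_seq.Keta \<theta> (4 * r) * (1 + 1 / (1 - exp (- (1/2)))))"
proof -
  interpret D: down_seq M U Dn sqn CU \<theta> "4 * r" by (rule downs)
  let ?C = "D.Keta"
  define k0 where "k0 = nat \<lceil>\<theta> * CU * real N\<rceil>"
  have pos: "0 \<le> \<theta> * CU * real N" using D.\<theta> D.CU by simp
  have k0: "\<theta> * CU * real N \<le> real k0" "real k0 \<le> \<theta> * CU * real N + 1"
    unfolding k0_def using pos by simp_all
  have "(\<integral>\<^sup>+\<omega>. (\<Sum>k. etaED k \<omega> * indicator (B N k) \<omega>) \<partial>M) \<le> ennreal (2 * ?C * (real k0 + 1 / (1 - exp (- 1 / 2))))"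
  proof (rule tame_random_sum[OF D.etaE_tame])
    show "B N k \<in> events" for k unfolding B_def by measurable
    fix k assume k: "k0 \<le> k"
    have "prob (B N k) \<le> exp (\<theta> * CU * real N - real k)" unfolding B_def by (rule D.hit_prob)
    also have "\<dots> \<le> exp (- 1 * real (k - k0))" using k0(1) k by (simp add: of_nat_diff)
    finally show "prob (B N k) \<le> exp (- 1 * real (k - k0))" .
  qed simp
  also have "\<dots> \<le> ennreal (2 * ?C * \<theta> * CU * real N + 2 * ?C * (1 + 1 / (1 - exp (- (1/2)))))"
  proof (rule ennreal_leI)
    have C0: "0 \<le> ?C" using tame_nonneg[OF D.etaE_tame[of 0]] .
    have "2 * ?C * (real k0 + 1 / (1 - exp (- (1/2)))) \<le> 2 * ?C * ((\<theta> * CU * real N + 1) + 1 / (1 - exp (- (1/2))))"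
      using k0(2) C0 by (intro mult_left_mono) auto
    also have "\<dots> = 2 * ?C * \<theta> * CU * real N + 2 * ?C * (1 + 1 / (1 - exp (- (1/2))))" by (simp add: algebra_simps)
    finally show "2 * ?C * (real k0 + 1 / (1 - exp (- 1 / 2))) \<le> 2 * ?C * \<theta> * CU * real N + 2 * ?C * (1 + 1 / (1 - exp (- (1/2))))"
      by simp
  qed
  finally show ?thesis .
qed

text \<open>The slope in \<open>T\<close>. It contains neither \<open>n\<close> nor \<open>J\<close>
  nor the initial state, which is what the supremum over \<open>n\<close> requires.\<close>

definition "growth K = 1 + real d ^ (4 * r - 1) * K * (1 + real d *
  (3 * (8 * noise_seq.Cxi cc ss r * L) + 2 * down_seq.Keta \<theta> (4 * r) * \<theta> * CU))"

text \<open>The pathwise bound by \<open>budget\<close> is integrated term by term. The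
  contributions of the initial state, and those of \<open>k0\<close> and of the geometric tails that
  do not grow with \<open>T\<close>, are collected in \<open>\<gamma>\<close>, which may depend on
  \<open>n\<close>.\<close>

lemma expected_integral_le:
  assumes K: "K \<ge> 0"
    and CB: "\<And>\<Lambda> y bU bL H I0 N. class_paths d (4 * r) c (system_path.g0 CU (noise_seq.C' cc ss) Mu L Dm) (system_path.K1 Mu) (system_path.K2 Mu Gm) \<Lambda> y bU bL H I0 N \<Longrightarrow>
      (\<exists>\<sigma>. (\<forall>j\<in>{1..d}. \<forall>m<N. 0 \<le> \<sigma> j m \<and> (\<forall>t\<in>{real m..real m + 1}. \<bar>y j t\<bar> \<le> \<sigma> j m)) \<and>
      (\<Sum>j\<in>{1..d}. \<Sum>m<N. \<sigma> j m ^ (4 * r - 1)) \<le> K * class_paths.budget d (4 * r) y H N)"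
    and k: "0 < k" "k \<le> real (4 * r - 1)"
  shows "\<exists>\<gamma>. \<forall>T\<ge>0. (\<integral>\<^sup>+ \<omega>. (\<integral>\<^sup>+ s\<in>{0..T}. ennreal (hat_norm n d rho (\<lambda>i. X i s \<omega>) powr k) \<partial>lborel) \<partial>M)
    \<le> ennreal (growth K * T + \<gamma>)"
proof -
  define Y0 where "Y0 = (\<Sum>i\<in>{1..d}. \<bar>(real (x0 i) - rho i * real n) / sqn\<bar> ^ (4 * r))"
  define dP where "dP = real d ^ (4 * r - 1) * K"
  define B where "B i N k = {\<omega> \<in> space M. psum (\<lambda>j. GA i j \<omega>) (k * 2 ^ J - x0 i) \<le> lam i * real N}" for i N k :: nat
  define BU where "BU N k = {\<omega> \<in> space M. psum (\<lambda>j. U j \<omega>) k \<le> real N}" for N k :: nat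
  define SA where "SA E i N \<omega> = (\<Sum>k. noise_seq.xi E cc ss n r J k \<omega> * indicator (B i N k) \<omega>)" for E i N \<omega>
  define SU where "SU N \<omega> = (\<Sum>k. etaED k \<omega> * indicator (BU N k) \<omega>)" for N \<omega>
  define gA where "gA i = 2 * noise_seq.Cxi cc ss r * (1 + 2 * real (x0 i) + 1 / (1 - exp (- (subexp_seq.hit_rate cc ss / 8))))" for i
  define gD where "gD = 2 * down_seq.Keta \<theta> (4 * r) * (1 + 1 / (1 - exp (- (1/2))))"
  define cA where "cA = 8 * noise_seq.Cxi cc ss r * L"
  define cD where "cD = 2 * down_seq.Keta \<theta> (4 * r) * \<theta> * CU"
  have dP0: "0 \<le> dP" using K by (simp add: dP_def)
  have Y00: "0 \<le> Y0" unfolding Y0_def by (intro sum_nonneg) auto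
  interpret D: down_seq M U Dn sqn CU \<theta> "4 * r" by (rule downs)
  have Keta0: "0 \<le> D.Keta" using tame_nonneg[OF D.etaE_tame[of 0]] .
  have Cxi0: "0 \<le> noise_seq.Cxi cc ss r"
    using tame_nonneg[OF noise_seq.xi_tame[OF seqs(1)[of 1]]] d by simp
  have hr0: "0 < subexp_seq.hit_rate cc ss"
    using subexp_seq.hit_rate_pos[OF noise_seq.axioms(1)[OF seqs(1)[of 1]]] d by simp
  have c0: "0 \<le> cA" "0 \<le> cD" "0 \<le> gD" "\<And>i. 0 \<le> gA i"
    unfolding cA_def cD_def gD_def gA_def using Cxi0 Keta0 LMuGm D.\<theta> D.CU hr0
    by (auto intro!: mult_nonneg_nonneg add_nonneg_nonneg)
  have SA_int: "(\<integral>\<^sup>+\<omega>. SA E i N \<omega> \<partial>M) \<le> ennreal (cA * real N + gA i)" if "noise_seq M E cc ss n r J" "i \<in> {1..d}" for E i N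
    using noise_sum_expect[OF that] unfolding SA_def B_def cA_def gA_def .
  have SU_int: "(\<integral>\<^sup>+\<omega>. SU N \<omega> \<partial>M) \<le> ennreal (cD * real N + gD)" for N
    using down_sum_expect unfolding SU_def BU_def cD_def gD_def .
  have B_meas: "B i N k \<in> events" if "i \<in> {1..d}" for i N k
  proof -
    interpret A: noise_seq M "GA i" cc ss n r J by (rule seqs(1)[OF that])
    show ?thesis unfolding B_def by measurable
  qed
  have SA_meas: "SA E i N \<in> borel_measurable M" if "noise_seq M E cc ss n r J" "i \<in> {1..d}" for E i N
    using tame_measurable[OF noise_seq.xi_tame[OF that(1)]] B_meas[OF that(2)] unfolding SA_def by measurable
  have BU_meas: "BU N k \<in> events" for N k unfolding BU_def by measurable
  have SU_meas: "SU N \<in> borel_measurable M" for N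
    using tame_measurable[OF D.etaE_tame] BU_meas unfolding SU_def by measurable
  define \<gamma> where "\<gamma> = 1 + dP * (Y0 + 1) + dP * (\<Sum>i\<in>{1..d}. 3 * (cA + gA i) + (cD + gD))"
  have "(\<integral>\<^sup>+ \<omega>. (\<integral>\<^sup>+ s\<in>{0..T}. ennreal (hat_norm n d rho (\<lambda>i. X i s \<omega>) powr k) \<partial>lborel) \<partial>M)
    \<le> ennreal (growth K * T + \<gamma>)" if T: "T \<ge> 0" for T
  proof -
    define N where "N = nat \<lfloor>T\<rfloor> + 1"
    have N: "0 < N" "T < real N" "real N \<le> T + 1" unfolding N_def using T by (simp_all add: of_nat_nat) linarith
    have "AE \<omega> in M. (\<integral>\<^sup>+ s\<in>{0..T}. ennreal (hat_norm n d rho (\<lambda>i. X i s \<omega>) powr k) \<partial>lborel)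
      \<le> ennreal (real N + dP * (Y0 + real N)) + ennreal dP * (\<Sum>i\<in>{1..d}. SA (GA i) i N \<omega> + SA (GS i) i N \<omega> + SA (GR i) i N \<omega> + SU N \<omega>)"
      using system_path_AE AE_space
    proof eventually_elim
      case (elim \<omega>)
      interpret P: system_path "\<lambda>k. U k \<omega>" "\<lambda>k. Dn k \<omega>" sqn CU r "\<lambda>q. etaD q \<omega>" n d J lam mu gam rho I0
        "\<lambda>i j. GA i j \<omega>" "\<lambda>i j. GS i j \<omega>" "\<lambda>i j. GR i j \<omega>" "\<lambda>i q. etaN (GA i) q \<omega>" "\<lambda>i q. etaN (GS i) q \<omega>" "\<lambda>i q. etaN (GR i) q \<omega>"
        x0 "\<lambda>i t. X i t \<omega>" "noise_seq.C' cc ss" c Mu Gm L Dm \<Lambda>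
        using elim(1) by blast
      from CB[OF P.class_paths_X[OF N(1)]] obtain \<sigma> where
        \<sigma>: "\<forall>j\<in>{1..d}. \<forall>m<N. 0 \<le> \<sigma> j m \<and> (\<forall>t\<in>{real m..real m + 1}. \<bar>P.y j t\<bar> \<le> \<sigma> j m)"
        "(\<Sum>j\<in>{1..d}. \<Sum>m<N. \<sigma> j m ^ (4 * r - 1)) \<le> K * class_paths.budget d (4 * r) P.y P.Htot N" by blast
      define kk where "kk i = x0 i + count_proc (\<lambda>j. GA i j \<omega>) (lam i * real N)" for i
      define sA where "sA E i = (\<Sum>q\<le>kk i. etaN E q \<omega>)" for E i
      define sU where "sU = (\<Sum>q\<le>count_proc (\<lambda>j. U j \<omega> + Dn j \<omega>) (real N). etaD q \<omega>)"
      have s0: "0 \<le> sU" unfolding sU_def D.eta_def by (intro sum_nonneg) simp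
      have sA0: "0 \<le> sA E i" if "noise_seq M E cc ss n r J" for E i
        unfolding sA_def noise_seq.eta_def[OF that] by (intro sum_nonneg) simp
      have bud: "class_paths.budget d (4 * r) P.y P.Htot N \<le> Y0 + real N + (\<Sum>i\<in>{1..d}. sA (GA i) i + sA (GS i) i + sA (GR i) i + sU)"
        unfolding class_paths.budget_def[OF P.class_paths_X[OF N(1)]]
      proof (intro add_mono sum_mono)
        show "(\<Sum>i\<in>{1..d}. \<bar>P.y i 0\<bar> ^ (4 * r)) \<le> Y0" unfolding Y0_def P.y_def using elim(1) by (intro sum_mono) simp
        show "P.Htot i (real N) - P.Htot i 0 \<le> sA (GA i) i + sA (GS i) i + sA (GR i) i + sU" if "i \<in> {1..d}" for i
          using P.Htot_increment_le[OF that, of "real N"] unfolding sA_def sU_def kk_def by simp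
      qed simp
      \<comment> \<open>If block \<open>k\<close> starts within the range of indices in use, then at
        least \<open>k * 2 ^ J - x0 i\<close> arrivals have occurred, which translates into a bound
        on their partial sum.\<close>
      have hit: "\<omega> \<in> B i N k" if "i \<in> {1..d}" "k * 2 ^ J \<le> kk i" for i k
      proof -
        interpret A: noise_control "\<lambda>j. GA i j \<omega>" sqn "noise_seq.C' cc ss" r J "\<lambda>q. etaN (GA i) q \<omega>" by (rule P.noise(1)[OF that(1)])
        have "k * 2 ^ J - x0 i \<le> A.cnt (lam i * real N)" using that(2) unfolding kk_def by linarith
        then show ?thesis unfolding B_def using A.psum_le_iff[of "lam i * real N"] lam[OF that(1)] elim(2) by simp
      qed
      have hitU: "\<omega> \<in> BU N k" if "k \<le> count_proc (\<lambda>j. U j \<omega> + Dn j \<omega>) (real N)" for k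
      proof -
        have "psum P.cyc k \<le> real N" using P.psum_le_iff[of "real N" k] that unfolding P.cyc_def[abs_def] by simp
        then have "psum (\<lambda>j. U j \<omega>) k \<le> real N" using P.psum_u_le[of k] by linarith
        then show ?thesis unfolding BU_def using elim(2) by simp
      qed
      have eA: "ennreal (sA (GA i) i) \<le> SA (GA i) i N \<omega>" "ennreal (sA (GS i) i) \<le> SA (GS i) i N \<omega>" "ennreal (sA (GR i) i) \<le> SA (GR i) i N \<omega>"
        if i: "i \<in> {1..d}" for i
        unfolding sA_def SA_def using elim(1) i hit[OF i]
        by (intro noise_seq.sum_eta_le[OF seqs(1)[OF i]] noise_seq.sum_eta_le[OF seqs(2)[OF i]] noise_seq.sum_eta_le[OF seqs(3)[OF i]]; simp)+
      have eU: "ennreal sU \<le> SU N \<omega>" unfolding sU_def SU_def using elim(1) hitU by (intro D.sum_eta_le) auto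
      have "(\<integral>\<^sup>+ s\<in>{0..T}. ennreal (hat_norm n d rho (\<lambda>i. X i s \<omega>) powr k) \<partial>lborel)
        \<le> ennreal (real N + real d ^ (4 * r - 1) * (K * class_paths.budget d (4 * r) P.y P.Htot N))"
        by (rule P.path_integral_le[OF K \<sigma> k N(2)])
      also have "\<dots> \<le> ennreal (real N + dP * (Y0 + real N + (\<Sum>i\<in>{1..d}. sA (GA i) i + sA (GS i) i + sA (GR i) i + sU)))"
        unfolding dP_def mult.assoc using K by (intro ennreal_leI add_left_mono mult_left_mono bud) auto
      also have "\<dots> = ennreal (real N + dP * (Y0 + real N)) + ennreal dP * (\<Sum>i\<in>{1..d}. ennreal (sA (GA i) i) + ennreal (sA (GS i) i) + ennreal (sA (GR i) i) + ennreal sU)"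
      proof -
        have e: "(\<Sum>i\<in>{1..d}. ennreal (sA (GA i) i) + ennreal (sA (GS i) i) + ennreal (sA (GR i) i) + ennreal sU)
          = ennreal (\<Sum>i\<in>{1..d}. sA (GA i) i + sA (GS i) i + sA (GR i) i + sU)"
          using sA0[OF seqs(1)] sA0[OF seqs(2)] sA0[OF seqs(3)] s0
          by (subst sum_ennreal[symmetric]) (auto intro!: sum.cong add_nonneg_nonneg simp: ennreal_plus)
        have "0 \<le> (\<Sum>i\<in>{1..d}. sA (GA i) i + sA (GS i) i + sA (GR i) i + sU)"
          using sA0[OF seqs(1)] sA0[OF seqs(2)] sA0[OF seqs(3)] s0 by (intro sum_nonneg add_nonneg_nonneg) auto
        then show ?thesis unfolding e using dP0 Y00
          by (simp add: ennreal_mult[symmetric] ennreal_plus[symmetric] distrib_left add.assoc del: ennreal_plus)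
      qed
      also have "\<dots> \<le> ennreal (real N + dP * (Y0 + real N)) + ennreal dP * (\<Sum>i\<in>{1..d}. SA (GA i) i N \<omega> + SA (GS i) i N \<omega> + SA (GR i) i N \<omega> + SU N \<omega>)"
        using eA eU by (intro add_left_mono mult_left_mono sum_mono add_mono) auto
      finally show ?case .
    qed
    then have "(\<integral>\<^sup>+ \<omega>. (\<integral>\<^sup>+ s\<in>{0..T}. ennreal (hat_norm n d rho (\<lambda>i. X i s \<omega>) powr k) \<partial>lborel) \<partial>M)
      \<le> (\<integral>\<^sup>+ \<omega>. ennreal (real N + dP * (Y0 + real N)) + ennreal dP * (\<Sum>i\<in>{1..d}. SA (GA i) i N \<omega> + SA (GS i) i N \<omega> + SA (GR i) i N \<omega> + SU N \<omega>) \<partial>M)"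
      by (rule nn_integral_mono_AE)
    also have "\<dots> = ennreal (real N + dP * (Y0 + real N)) + ennreal dP * (\<Sum>i\<in>{1..d}.
        (\<integral>\<^sup>+\<omega>. SA (GA i) i N \<omega> \<partial>M) + (\<integral>\<^sup>+\<omega>. SA (GS i) i N \<omega> \<partial>M) + (\<integral>\<^sup>+\<omega>. SA (GR i) i N \<omega> \<partial>M) + (\<integral>\<^sup>+\<omega>. SU N \<omega> \<partial>M))"
    proof -
      note m = SA_meas[OF seqs(1)] SA_meas[OF seqs(2)] SA_meas[OF seqs(3)] SU_meas
      have F: "(\<lambda>\<omega>. SA (GA i) i N \<omega> + SA (GS i) i N \<omega> + SA (GR i) i N \<omega> + SU N \<omega>) \<in> borel_measurable M" if "i \<in> {1..d}" for i
        using m that by (intro borel_measurable_add) auto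
      have I: "(\<integral>\<^sup>+\<omega>. SA (GA i) i N \<omega> + SA (GS i) i N \<omega> + SA (GR i) i N \<omega> + SU N \<omega> \<partial>M)
        = (\<integral>\<^sup>+\<omega>. SA (GA i) i N \<omega> \<partial>M) + (\<integral>\<^sup>+\<omega>. SA (GS i) i N \<omega> \<partial>M) + (\<integral>\<^sup>+\<omega>. SA (GR i) i N \<omega> \<partial>M) + (\<integral>\<^sup>+\<omega>. SU N \<omega> \<partial>M)"
        if "i \<in> {1..d}" for i
        using m(1)[OF that that] m(2)[OF that that] m(3)[OF that that] m(4) by (simp add: nn_integral_add borel_measurable_add)
      have "(\<lambda>\<omega>. \<Sum>i\<in>{1..d}. SA (GA i) i N \<omega> + SA (GS i) i N \<omega> + SA (GR i) i N \<omega> + SU N \<omega>) \<in> borel_measurable M"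
        by (rule borel_measurable_sum[OF F])
      then show ?thesis
        using nn_integral_sum[OF F, where P = "{1..d}"] I
        by (simp add: nn_integral_add nn_integral_cmult emeasure_space_1)
    qed
    also have "\<dots> \<le> ennreal (real N + dP * (Y0 + real N)) + ennreal dP * (\<Sum>i\<in>{1..d}.
        ennreal (cA * real N + gA i) + ennreal (cA * real N + gA i) + ennreal (cA * real N + gA i) + ennreal (cD * real N + gD))"
      by (intro add_left_mono mult_left_mono sum_mono add_mono SA_int SU_int seqs) auto
    also have "\<dots> = ennreal (real N + dP * (Y0 + real N) + dP * (\<Sum>i\<in>{1..d}. 3 * (cA * real N + gA i) + (cD * real N + gD)))"
    proof -
      have nn: "0 \<le> cA * real N + gA i" "0 \<le> cD * real N + gD" for i using c0 by auto
      have e: "(\<Sum>i\<in>{1..d}. ennreal (cA * real N + gA i) + ennreal (cA * real N + gA i) + ennreal (cA * real N + gA i) + ennreal (cD * real N + gD))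
        = ennreal (\<Sum>i\<in>{1..d}. 3 * (cA * real N + gA i) + (cD * real N + gD))"
      proof -
        have three: "ennreal a + ennreal a + ennreal a + ennreal b = ennreal (3 * a + b)" if "0 \<le> a" "0 \<le> b" for a b
          using that by (simp add: ennreal_plus[symmetric] del: ennreal_plus)
        show ?thesis unfolding three[OF nn]
          by (intro sum_ennreal add_nonneg_nonneg mult_nonneg_nonneg[of 3] nn) simp
      qed
      have "0 \<le> (\<Sum>i\<in>{1..d}. 3 * (cA * real N + gA i) + (cD * real N + gD))"
        using c0 by (intro sum_nonneg add_nonneg_nonneg mult_nonneg_nonneg) auto
      then show ?thesis unfolding e using dP0 Y00
        by (simp add: ennreal_mult[symmetric] ennreal_plus[symmetric] del: ennreal_plus)
    qed
    also have "\<dots> \<le> ennreal (growth K * T + \<gamma>)"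
    proof (rule ennreal_leI)
      have 1: "cA * real N \<le> cA * T + cA" "cD * real N \<le> cD * T + cD"
        using mult_left_mono[OF N(3) c0(1)] mult_left_mono[OF N(3) c0(2)] by (simp_all add: distrib_left)
      have "(\<Sum>i\<in>{1..d}. 3 * (cA * real N + gA i) + (cD * real N + gD)) \<le> (\<Sum>i\<in>{1..d}. (3 * cA + cD) * T + (3 * (cA + gA i) + (cD + gD)))"
        using 1 by (intro sum_mono) (simp add: algebra_simps)
      also have "\<dots> = real d * ((3 * cA + cD) * T) + (\<Sum>i\<in>{1..d}. 3 * (cA + gA i) + (cD + gD))"
        by (simp add: sum.distrib)
      finally have 2: "dP * (\<Sum>i\<in>{1..d}. 3 * (cA * real N + gA i) + (cD * real N + gD))
        \<le> dP * (real d * ((3 * cA + cD) * T) + (\<Sum>i\<in>{1..d}. 3 * (cA + gA i) + (cD + gD)))" using dP0 by (rule mult_left_mono)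
      have 3: "dP * (Y0 + real N) \<le> dP * (Y0 + T + 1)" using N(3) dP0 by (intro mult_left_mono) auto
      have "growth K = 1 + dP * (1 + real d * (3 * cA + cD))" by (simp add: growth_def dP_def cA_def cD_def)
      then have 4: "growth K * T + \<gamma> = (T + 1) + dP * (Y0 + T + 1) + dP * (real d * ((3 * cA + cD) * T) + (\<Sum>i\<in>{1..d}. 3 * (cA + gA i) + (cD + gD)))"
        unfolding \<gamma>_def by (simp add: algebra_simps)
      show "real N + dP * (Y0 + real N) + dP * (\<Sum>i\<in>{1..d}. 3 * (cA * real N + gA i) + (cD * real N + gD)) \<le> growth K * T + \<gamma>"
        unfolding 4 using 2 3 N(3) by linarith
    qed
    finally show ?thesis .
  qed
  then show ?thesis by blast
qed

end

section \<open>The theorem\<close>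

lemma ex_lower_const: assumes "finite A" "\<And>i. i \<in> A \<Longrightarrow> (f i :: real) > 0"
  shows "\<exists>c>0. c \<le> 1 \<and> (\<forall>i\<in>A. c \<le> f i)"
  using assms by (intro exI[of _ "Min (insert 1 (f ` A))"]) auto

lemma ex_upper_const: assumes "finite A" shows "\<exists>B\<ge>0. \<forall>i\<in>A. (f i :: real) \<le> B"
proof (intro exI[of _ "\<Sum>i\<in>A. \<bar>f i\<bar>"] conjI ballI)
  fix i assume "i \<in> A"
  then have "\<bar>f i\<bar> \<le> (\<Sum>i\<in>A. \<bar>f i\<bar>)" using assms by (intro member_le_sum) auto
  then show "f i \<le> (\<Sum>i\<in>A. \<bar>f i\<bar>)" by simp
qed (simp add: sum_nonneg)

text \<open>Each cycle contributes at most \<open>7 * (1/28) = 1/4\<close>. The function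
  \<open>g\<close> tells down from up indices apart, so that the independence of the whole family
  can be used in a single product.\<close>

lemma (in prob_space) cycle_mgf:
  fixes X :: "'i \<Rightarrow> 'a \<Rightarrow> real" and eu ed :: "nat \<Rightarrow> 'i"
  assumes ind: "indep_vars (\<lambda>_. borel) X V" and inj: "inj eu" "inj ed" and sub: "range eu \<subseteq> V" "range ed \<subseteq> V"
    and dis: "range eu \<inter> range ed = {}" and A: "finite A"
    and D: "\<And>j. (\<integral>\<^sup>+\<omega>. ennreal (exp (\<theta> * (s * X (ed j) \<omega>))) \<partial>M) \<le> ennreal 7"
    and U: "\<And>j. (\<integral>\<^sup>+\<omega>. ennreal (exp (- (\<theta> * CU) * X (eu j) \<omega>)) \<partial>M) \<le> ennreal (1/28)"
  shows "(\<integral>\<^sup>+\<omega>. ennreal (exp (\<theta> * (\<Sum>j\<in>A. s * X (ed j) \<omega> - CU * X (eu j) \<omega>))) \<partial>M) \<le> ennreal ((1/4) ^ card A)"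
proof -
  define g where "g i x = (if i \<in> range ed then exp (\<theta> * (s * x)) else exp (- (\<theta> * CU) * x))" for i and x :: real
  let ?I = "ed ` A \<union> eu ` A"
  have gd: "g (ed j) = (\<lambda>x. exp (\<theta> * (s * x)))" and gu: "g (eu j) = (\<lambda>x. exp (- (\<theta> * CU) * x))" for j
    using dis unfolding g_def by (auto simp: fun_eq_iff)
  have split: "(\<Prod>i\<in>?I. h i) = (\<Prod>j\<in>A. h (ed j)) * (\<Prod>j\<in>A. h (eu j))" for h :: "'i \<Rightarrow> 'b::comm_monoid_mult"
  proof -
    have "(\<Prod>i\<in>?I. h i) = (\<Prod>i\<in>ed ` A. h i) * (\<Prod>i\<in>eu ` A. h i)"
      using A dis by (intro prod.union_disjoint) auto
    then show ?thesis using inj by (simp add: prod.reindex inj_on_subset)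
  qed
  have "(\<integral>\<^sup>+\<omega>. ennreal (exp (\<theta> * (\<Sum>j\<in>A. s * X (ed j) \<omega> - CU * X (eu j) \<omega>))) \<partial>M) = (\<integral>\<^sup>+\<omega>. ennreal (\<Prod>i\<in>?I. g i (X i \<omega>)) \<partial>M)"
  proof (rule nn_integral_cong)
    fix \<omega>
    have "exp (\<theta> * (\<Sum>j\<in>A. s * X (ed j) \<omega> - CU * X (eu j) \<omega>)) = (\<Prod>j\<in>A. exp (\<theta> * (s * X (ed j) \<omega>)) * exp (- (\<theta> * CU) * X (eu j) \<omega>))"
      using A by (simp add: sum_distrib_left exp_sum exp_add[symmetric] algebra_simps)
    then show "ennreal (exp (\<theta> * (\<Sum>j\<in>A. s * X (ed j) \<omega> - CU * X (eu j) \<omega>))) = ennreal (\<Prod>i\<in>?I. g i (X i \<omega>))"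
      unfolding split gd gu by (simp add: prod.distrib)
  qed
  also have "\<dots> = (\<Prod>i\<in>?I. \<integral>\<^sup>+\<omega>. ennreal (g i (X i \<omega>)) \<partial>M)"
    by (rule nn_integral_prod_indep[OF ind]) (use A sub in \<open>auto simp: g_def\<close>)
  also have "\<dots> = (\<Prod>j\<in>A. \<integral>\<^sup>+\<omega>. ennreal (exp (\<theta> * (s * X (ed j) \<omega>))) \<partial>M) * (\<Prod>j\<in>A. \<integral>\<^sup>+\<omega>. ennreal (exp (- (\<theta> * CU) * X (eu j) \<omega>)) \<partial>M)"
    unfolding split gd gu ..
  also have "\<dots> \<le> (\<Prod>j\<in>A. ennreal 7) * (\<Prod>j\<in>A. ennreal (1/28))"
    by (intro mult_mono prod_mono_ennreal D U) auto
  also have "\<dots> = ennreal ((1/4) ^ card A)"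
  proof -
    have "ennreal 7 * ennreal (1/28) = ennreal (7 * (1/28))" by (rule ennreal_mult[symmetric]) auto
    then have "ennreal 7 * ennreal (1/28) = ennreal (1/4)" by (simp only:) simp
    then show ?thesis unfolding prod.distrib[symmetric] by (simp only: prod_constant) (rule ennreal_power, simp)
  qed
  finally show ?thesis .
qed

lemma (in prob_space) prob_greater_eq:
  assumes [measurable]: "X \<in> borel_measurable M"
  shows "prob {\<omega> \<in> space M. X \<omega> > t} = 1 - prob {\<omega> \<in> space M. X \<omega> \<le> (t::real)}"
proof -
  have "{\<omega> \<in> space M. X \<omega> > t} = space M - {\<omega> \<in> space M. X \<omega> \<le> t}" by auto
  then show ?thesis using prob_compl[of "{\<omega> \<in> space M. X \<omega> \<le> t}"] by simp
qed

lemma (in prob_space) cdf_tail: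
  fixes H :: "real \<Rightarrow> real"
  assumes X: "X \<in> borel_measurable M" and H: "\<And>x. prob {\<omega> \<in> space M. X \<omega> \<le> x} = H x" and C: "C \<ge> 1"
    and R: "\<And>t. t \<ge> 0 \<Longrightarrow> (\<integral>\<^sup>+ y\<in>{t..}. ennreal (1 - H y) \<partial>lborel) \<le> ennreal (C * (1 - H t))"
  shows "prob {\<omega> \<in> space M. X \<omega> > 2 * C * real k} \<le> (1/2) ^ k"
proof -
  have [measurable]: "X \<in> borel_measurable M" by (rule X)
  have "mono H" unfolding mono_def H[symmetric] by (intro allI impI finite_measure_mono) auto
  moreover have "0 \<le> H 0" "\<And>t. H t \<le> 1" unfolding H[symmetric] by auto
  ultimately show ?thesis
    unfolding prob_greater_eq[OF X] H using C R by (intro residual_life_tail) auto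
qed

text \<open>As soon as \<open>T \<ge> max 1 b\<close>, the additive term \<open>b\<close> is at most
  \<open>T\<close> and costs 1 in the average, whatever its size.\<close>

lemma Limsup_average_le:
  fixes I :: "real \<Rightarrow> ennreal"
  assumes "\<And>T. T \<ge> 0 \<Longrightarrow> I T \<le> ennreal (a * T + b)" and a: "0 \<le> a"
  shows "Limsup at_top (\<lambda>T. ennreal (1 / T) * I T) \<le> ennreal (a + 1)"
proof (rule Limsup_bounded)
  have "eventually (\<lambda>T. T \<ge> max 1 b) at_top" by (rule eventually_ge_at_top)
  then show "eventually (\<lambda>T. ennreal (1 / T) * I T \<le> ennreal (a + 1)) at_top"
  proof eventually_elim
    case (elim T)
    have "ennreal (1 / T) * I T \<le> ennreal (1 / T) * ennreal ((a + 1) * T)"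
    proof (rule mult_left_mono)
      have "I T \<le> ennreal (a * T + b)" using elim by (intro assms) simp
      also have "\<dots> \<le> ennreal ((a + 1) * T)" using elim by (intro ennreal_leI) (simp add: distrib_right)
      finally show "I T \<le> ennreal ((a + 1) * T)" .
    qed simp
    also have "\<dots> = ennreal (a + 1)" using elim a by (simp add: ennreal_mult[symmetric])
    finally show ?case .
  qed
qed

theorem theorem4p1:
  fixes d :: nat
    and lam mu gam :: "nat \<Rightarrow> nat \<Rightarrow> real"
    and lam_lim mu_lim gam_lim lamhat muhat :: "nat \<Rightarrow> real"
    and beta_u vth :: "nat \<Rightarrow> real" and beta vth_lim :: real
    and F :: "nat \<Rightarrow> real \<Rightarrow> real" and Fd :: "real \<Rightarrow> real"
    and M :: "nat \<Rightarrow> 'a measure"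
    and G ES ER :: "nat \<Rightarrow> nat \<Rightarrow> nat \<Rightarrow> 'a \<Rightarrow> real"
    and U D1 :: "nat \<Rightarrow> nat \<Rightarrow> 'a \<Rightarrow> real"
    and x0 :: "nat \<Rightarrow> nat \<Rightarrow> nat"
    and X :: "nat \<Rightarrow> nat \<Rightarrow> real \<Rightarrow> 'a \<Rightarrow> nat"
    and \<kappa> :: real
  defines "rho \<equiv> (\<lambda>i. lam_lim i / mu_lim i)"
    and "I0 \<equiv> {i \<in> {1..d}. gam_lim i = 0}"
  assumes
    \<comment> \<open>(HW)\<close>
    rates_pos: "\<And>n i. i \<in> {1..d} \<Longrightarrow> lam n i > 0 \<and> mu n i > 0 \<and> gam n i \<ge> 0"
    and HW_lam: "\<And>i. i \<in> {1..d} \<Longrightarrow> (\<lambda>n. lam n i / real n) \<longlonglongrightarrow> lam_lim i \<and> lam_lim i > 0"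
    and HW_mu: "\<And>i. i \<in> {1..d} \<Longrightarrow> (\<lambda>n. mu n i) \<longlonglongrightarrow> mu_lim i \<and> mu_lim i > 0"
    and HW_gam: "\<And>i. i \<in> {1..d} \<Longrightarrow> (\<lambda>n. gam n i) \<longlonglongrightarrow> gam_lim i \<and> gam_lim i \<ge> 0"
    and HW_lamhat: "\<And>i. i \<in> {1..d} \<Longrightarrow>
        (\<lambda>n. (lam n i - real n * lam_lim i) / sqrt (real n)) \<longlonglongrightarrow> lamhat i"
    and HW_muhat: "\<And>i. i \<in> {1..d} \<Longrightarrow>
        (\<lambda>n. sqrt (real n) * (mu n i - mu_lim i)) \<longlonglongrightarrow> muhat i"
    and HW_rho: "\<And>i. i \<in> {1..d} \<Longrightarrow>
        (\<lambda>n. lam n i / (real n * mu n i)) \<longlonglongrightarrow> rho i \<and> rho i < 1"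
    and HW_sum: "(\<Sum>i\<in>{1..d}. rho i) = 1"
    and HW_gam_d: "\<exists>c>0. \<forall>n. gam n d \<ge> c"
    and I0_initial: "\<exists>m. I0 = {1..m}"
    \<comment> \<open>(INT)\<close>
    and INT_beta: "\<And>n. beta_u n > 0" "beta_u \<longlonglongrightarrow> beta" "beta > 0"
    and INT_vth: "\<And>n. vth n > 0" "(\<lambda>n. vth n / sqrt (real n)) \<longlonglongrightarrow> vth_lim" "vth_lim > 0"
    \<comment> \<open>(REG)\<close>
    and REG_F: "\<And>i t. i \<in> {1..d} \<Longrightarrow> t \<ge> 0 \<Longrightarrow>
        (\<exists>D. (F i has_real_derivative D) (at_right t)) \<and> F i t < 1"
    and REG_Fd: "\<And>t. t \<ge> 0 \<Longrightarrow> (\<exists>D. (Fd has_real_derivative D) (at_right t)) \<and> Fd t < 1"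
    and REG_tail: "\<exists>C. \<forall>H \<in> {Fd} \<union> F ` {1..d}. \<forall>t\<ge>0.
        (\<integral>\<^sup>+ y\<in>{t..}. ennreal (1 - H y) \<partial>lborel) \<le> ennreal (C * (1 - H t))"
    \<comment> \<open>probabilistic primitives of the n-th system\<close>
    and prob: "\<And>n. prob_space (M n)"
    and indep: "\<And>n. prob_space.indep_vars (M n) (\<lambda>_. borel)
        (prim_rv (G n) (ES n) (ER n) (U n) (D1 n)) (valid_prims d)"
    and G_law: "\<And>n i j x. i \<in> {1..d} \<Longrightarrow>
        measure (M n) {\<omega> \<in> space (M n). G n i j \<omega> \<le> x} = F i x"
    and G_pos: "\<And>n i j. i \<in> {1..d} \<Longrightarrow> AE \<omega> in M n. G n i j \<omega> > 0"
    and G_mean: "\<And>n i j. i \<in> {1..d} \<Longrightarrow>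
        integrable (M n) (G n i j) \<and> integral\<^sup>L (M n) (G n i j) = 1"
    and G_scv: "\<And>n i j. i \<in> {1..d} \<Longrightarrow> integrable (M n) (\<lambda>\<omega>. (G n i j \<omega>)\<^sup>2)"
    and ES_law: "\<And>n i k. i \<in> {1..d} \<Longrightarrow>
        distributed (M n) lborel (ES n i k) (exponential_density 1)"
    and ER_law: "\<And>n i k. i \<in> {1..d} \<Longrightarrow>
        distributed (M n) lborel (ER n i k) (exponential_density 1)"
    and U_law: "\<And>n k. distributed (M n) lborel (U n k) (exponential_density (beta_u n))"
    and D1_law: "\<And>n k x. measure (M n) {\<omega> \<in> space (M n). D1 n k \<omega> \<le> x} = Fd x"
    and D1_nonneg: "\<And>n k. AE \<omega> in M n. D1 n k \<omega> \<ge> 0"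
    and D1_mean: "\<And>n k. integrable (M n) (D1 n k) \<and> integral\<^sup>L (M n) (D1 n k) = 1"
    \<comment> \<open>the state process under the policy Z^n(t) = zcheck^n(X^n(t))\<close>
    and X_eq: "\<And>n. AE \<omega> in M n. \<forall>t\<ge>0. \<forall>i\<in>{1..d}.
        set_integrable lborel {0..t} (\<lambda>s. real (X n i s \<omega>)) \<and>
        real (X n i t \<omega>) = real (x0 n i)
          + real (count_proc (\<lambda>j. G n i j \<omega>) (lam n i * t))
          - real (count_proc (\<lambda>k. ES n i k \<omega>)
               (mu n i * (LBINT s:{0..t}.
                   real_of_int (zcheck n d rho I0 (\<lambda>j. X n j s \<omega>) i)
                   * up_indicator (\<lambda>k. U n k \<omega>) (\<lambda>k. D1 n k \<omega> / vth n) s)))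
          - real (count_proc (\<lambda>k. ER n i k \<omega>)
               (gam n i * (LBINT s:{0..t}.
                   real (X n i s \<omega>) - real_of_int (zcheck n d rho I0 (\<lambda>j. X n j s \<omega>) i))))"
    and kappa_pos: "\<kappa> > 0"
  shows "\<exists>nc::nat. (\<Squnion>n\<in>{nc<..}. Limsup at_top (\<lambda>T::real.
            ennreal (1 / T) * (\<integral>\<^sup>+ \<omega>. (\<integral>\<^sup>+ s\<in>{0..T}.
               ennreal (hat_norm n d rho (\<lambda>i. X n i s \<omega>) powr \<kappa>) \<partial>lborel) \<partial>M n)))
          < \<infinity>"
proof -

  \<comment> \<open>Constants that do not depend on \<open>n\<close>\<close>
  obtain C where C: "\<And>H t. H \<in> {Fd} \<union> F ` {1..d} \<Longrightarrow> t \<ge> 0 \<Longrightarrow>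
      (\<integral>\<^sup>+ y\<in>{t..}. ennreal (1 - H y) \<partial>lborel) \<le> ennreal (C * (1 - H t))" using REG_tail by blast
  \<comment> \<open>The halving length \<open>2 * C1\<close> of the tails must also be at least 1
    for the exponential primitives.\<close>
  define C1 where "C1 = max C 1"
  define a where "a = 2 * C1"
  define cc where "cc = mgf_const a"
  define ss where "ss = exp_rate a / 2"
  define C' where "C' = noise_seq.C' cc ss"
  \<comment> \<open>The summand 2 ensures \<open>r \<ge> 2\<close>, as the block sums require, and
    \<open>\<kappa> \<le> 4 * r - 1\<close> follows.\<close>
  define r where "r = nat \<lceil>\<kappa>\<rceil> + 2"
  \<comment> \<open>Eventually \<open>sqrt n / vth n \<le> 2 / vth_lim\<close>, and then
    \<open>\<theta>\<close> times the scaled down time is at most \<open>exp_rate a\<close> times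
    \<open>D1\<close>.\<close>
  define \<theta> where "\<theta> = exp_rate a * vth_lim / 2"
  \<comment> \<open>Makes \<open>\<theta> * CU = 56 * beta\<close>, so the Laplace transform
    \<open>beta_u n / (beta_u n + 56 * beta)\<close> is at most 1/28 once
    \<open>beta_u n \<le> 2 * beta\<close>.\<close>
  define CU where "CU = 56 * beta / \<theta>"
  have a: "a \<ge> 2" "a > 0" by (auto simp: a_def C1_def)
  have pos: "0 < \<theta>" "0 < CU" using exp_rate_pos[OF a(2)] INT_vth(3) INT_beta(3) by (auto simp: \<theta>_def CU_def)
  have "m \<le> 4 * (m + 2) - 1" for m :: nat by presburger
  then have "nat \<lceil>\<kappa>\<rceil> \<le> 4 * r - 1" unfolding r_def .
  then have "real (nat \<lceil>\<kappa>\<rceil>) \<le> real (4 * r - 1)" by (simp only: of_nat_le_iff)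
  then have kappa: "\<kappa> \<le> real (4 * r - 1)" using real_nat_ceiling_ge[of \<kappa>] by linarith
  have mu0: "\<And>i. i \<in> {1..d} \<Longrightarrow> 0 < mu_lim i" and lam0: "\<And>i. i \<in> {1..d} \<Longrightarrow> 0 < lam_lim i" using HW_mu HW_lam by auto
  have rho0: "0 < rho i" if "i \<in> {1..d}" for i unfolding rho_def using mu0[OF that] lam0[OF that] by simp
  have d: "d > 0" using HW_sum by (cases d) auto
  have I0sub: "I0 \<subseteq> {1..d}" by (auto simp: I0_def)
  have gam_d: "d \<notin> I0"
  proof -
    obtain c where c: "c > 0" "\<And>n. gam n d \<ge> c" using HW_gam_d by blast
    have "c \<le> gam_lim d" using HW_gam[of d] d c(2) by (intro LIMSEQ_le_const[of "\<lambda>n. gam n d"]) auto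
    then show ?thesis using c(1) by (simp add: I0_def)
  qed
  \<comment> \<open>This is what gives the classes in \<open>I0\<close> a surplus of servers: class
    \<open>d\<close> has positive load and lies outside \<open>I0\<close>.\<close>
  have \<sigma>0: "(\<Sum>j\<in>I0. rho j) < 1"
  proof -
    have "(\<Sum>j\<in>I0. rho j) \<le> (\<Sum>j\<in>{1..d} - {d}. rho j)" using I0sub gam_d rho0 by (intro sum_mono2) (auto intro: less_imp_le)
    also have "\<dots> = 1 - rho d" using HW_sum d by (subst sum_diff) auto
    finally show ?thesis using rho0[of d] d by simp
  qed
  have \<sigma>0_pos: "0 < (\<Sum>j\<in>I0. rho j)" if "i \<in> I0" for i
    using that I0sub rho0 by (intro sum_pos) (auto intro: finite_subset)
  \<comment> \<open>Half of the limiting service rate, and a quarter of the limiting abandonment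
    rate because \<open>2 * c\<close> has to stay below half of it; the 1 is a filler for classes in
    \<open>I0\<close>.\<close>
  have "\<exists>c>0. c \<le> 1 \<and> (\<forall>i\<in>{1..d}. c \<le> min (mu_lim i / 2) (if i \<in> I0 then 1 else gam_lim i / 4))"
  proof (rule ex_lower_const)
    show "0 < min (mu_lim i / 2) (if i \<in> I0 then 1 else gam_lim i / 4)" if "i \<in> {1..d}" for i
      using mu0[OF that] HW_gam[OF that] that by (auto simp: I0_def less_le)
  qed simp
  then obtain c where c: "0 < c" "c \<le> 1" "\<And>i. i \<in> {1..d} \<Longrightarrow> c \<le> min (mu_lim i / 2) (if i \<in> I0 then 1 else gam_lim i / 4)"
    by blast
  obtain B where B: "0 \<le> B" "\<And>i. i \<in> {1..d} \<Longrightarrow> max (2 * mu_lim i) (max (gam_lim i + 1) (max (lam_lim i + 1) (\<bar>lamhat i - rho i * muhat i\<bar> + 1))) \<le> B"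
    using ex_upper_const[of "{1..d}" "\<lambda>i. max (2 * mu_lim i) (max (gam_lim i + 1) (max (lam_lim i + 1) (\<bar>lamhat i - rho i * muhat i\<bar> + 1)))"] by blast
  define g0 where "g0 = B + (4 * C' * B + 8 * C' * B + 2 * B * CU)"
  \<comment> \<open>Chosen so that \<open>c * \<Lambda> / 2 = \<bar>g0\<bar> + 1\<close>: at half of
    the saturation level the downward drift beats the drift error by 1.\<close>
  define \<Lambda> where "\<Lambda> = 2 * (\<bar>g0\<bar> + 1) / c"
  have \<Lambda>0: "0 \<le> \<Lambda>" using c by (simp add: \<Lambda>_def)
  have sqrt_top: "filterlim (\<lambda>n. sqrt (real n)) at_top sequentially"
    by (rule filterlim_compose[OF sqrt_at_top filterlim_real_sequentially])

  \<comment> \<open>Validity of the bounds for all large \<open>n\<close>\<close>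
  define good where "good n \<longleftrightarrow> n > 0 \<and> 8 * C' \<le> sqrt (real n) \<and> sqrt (real n) / vth n \<le> 2 / vth_lim \<and> beta_u n \<le> 2 * beta \<and>
    (\<forall>i\<in>{1..d}. lam n i \<le> B * real n \<and> c \<le> mu n i \<and> mu n i \<le> B \<and> gam n i \<le> B \<and> (i \<notin> I0 \<longrightarrow> 2 * c \<le> gam n i) \<and>
      \<bar>lam n i - mu n i * (rho i * real n)\<bar> \<le> B * sqrt (real n) \<and>
      (i \<in> I0 \<longrightarrow> sqrt (real n) * \<Lambda> + rho i * real n \<le> real n * rho i / (\<Sum>j\<in>I0. rho j) - 1))" for n
  have ev: "eventually good sequentially"
    unfolding good_def[abs_def]
  proof (intro eventually_conj eventually_ball_finite ballI)
    show "eventually (\<lambda>n. 0 < n) sequentially" by (rule eventually_gt_at_top)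
    show "eventually (\<lambda>n. 8 * C' \<le> sqrt (real n)) sequentially"
      using sqrt_top by (simp add: filterlim_at_top)
    have "eventually (\<lambda>n. vth n / sqrt (real n) > vth_lim / 2) sequentially"
      using INT_vth(2,3) by (intro order_tendstoD(1)) auto
    then show "eventually (\<lambda>n. sqrt (real n) / vth n \<le> 2 / vth_lim) sequentially"
      using eventually_gt_at_top[of 0]
    proof eventually_elim
      case (elim n)
      then show ?case using INT_vth(1)[of n] INT_vth(3) by (simp add: field_simps)
    qed
    have "eventually (\<lambda>n. beta_u n < 2 * beta) sequentially" using INT_beta by (intro order_tendstoD(2)) auto
    then show "eventually (\<lambda>n. beta_u n \<le> 2 * beta) sequentially" by eventually_elim simp
  next
    fix i assume i: "i \<in> {1..d}"
    have "eventually (\<lambda>n. lam n i / real n < lam_lim i + 1) sequentially" using HW_lam[OF i] by (intro order_tendstoD(2)) auto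
    then show "eventually (\<lambda>n. lam n i \<le> B * real n) sequentially" using eventually_gt_at_top[of 0]
    proof eventually_elim
      case (elim n)
      then have "lam n i < (lam_lim i + 1) * real n" by (simp add: divide_less_eq)
      also have "\<dots> \<le> B * real n" using B(2)[OF i] by (intro mult_right_mono) auto
      finally show ?case by simp
    qed
    have "eventually (\<lambda>n. mu n i > mu_lim i / 2) sequentially" using HW_mu[OF i] by (intro order_tendstoD(1)) auto
    then show "eventually (\<lambda>n. c \<le> mu n i) sequentially" by eventually_elim (use c(3)[OF i] in auto)
    have "eventually (\<lambda>n. mu n i < 2 * mu_lim i) sequentially" using HW_mu[OF i] by (intro order_tendstoD(2)) auto
    then show "eventually (\<lambda>n. mu n i \<le> B) sequentially" by eventually_elim (use B(2)[OF i] in auto)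
    have "eventually (\<lambda>n. gam n i < gam_lim i + 1) sequentially" using HW_gam[OF i] by (intro order_tendstoD(2)) auto
    then show "eventually (\<lambda>n. gam n i \<le> B) sequentially" by eventually_elim (use B(2)[OF i] in auto)
    show "eventually (\<lambda>n. i \<notin> I0 \<longrightarrow> 2 * c \<le> gam n i) sequentially"
    proof (cases "i \<in> I0")
      case False
      then have "gam_lim i > 0" using HW_gam[OF i] i by (auto simp: I0_def less_le)
      then have "eventually (\<lambda>n. gam n i > gam_lim i / 2) sequentially" using HW_gam[OF i] by (intro order_tendstoD(1)) auto
      then show ?thesis by eventually_elim (use c(3)[OF i] False in auto)
    qed simp
    \<comment> \<open>The terms of order \<open>n\<close> cancel because
      \<open>rho i * mu_lim i = lam_lim i\<close>; what is left converges after division by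
      \<open>sqrt n\<close>.\<close>
    have "(\<lambda>n. (lam n i - real n * lam_lim i) / sqrt (real n) - rho i * (sqrt (real n) * (mu n i - mu_lim i))) \<longlonglongrightarrow> lamhat i - rho i * muhat i"
      using HW_lamhat[OF i] HW_muhat[OF i] by (intro tendsto_intros)
    from tendsto_rabs[OF this] have "eventually (\<lambda>n. \<bar>(lam n i - real n * lam_lim i) / sqrt (real n) - rho i * (sqrt (real n) * (mu n i - mu_lim i))\<bar>
        < \<bar>lamhat i - rho i * muhat i\<bar> + 1) sequentially" by (rule order_tendstoD(2)) simp
    then show "eventually (\<lambda>n. \<bar>lam n i - mu n i * (rho i * real n)\<bar> \<le> B * sqrt (real n)) sequentially"
      using eventually_gt_at_top[of 0]
    proof eventually_elim
      case (elim n)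
      have s: "sqrt (real n) > 0" "real n = sqrt (real n) * sqrt (real n)" using elim by auto
      have rl: "rho i * mu_lim i = lam_lim i" using mu0[OF i] by (simp add: rho_def)
      have "lam n i - mu n i * (rho i * real n) = ((lam n i - real n * lam_lim i) / sqrt (real n) - rho i * (sqrt (real n) * (mu n i - mu_lim i))) * sqrt (real n)"
      proof -
        have "(rho i * (sqrt (real n) * (mu n i - mu_lim i))) * sqrt (real n) = rho i * (mu n i - mu_lim i) * real n"
          by (subst (3) s(2)) (simp only: mult_ac)
        also have "\<dots> = mu n i * (rho i * real n) - real n * lam_lim i" unfolding rl[symmetric] by (simp add: algebra_simps)
        finally have 1: "(rho i * (sqrt (real n) * (mu n i - mu_lim i))) * sqrt (real n) = mu n i * (rho i * real n) - real n * lam_lim i" .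
        have 2: "(lam n i - real n * lam_lim i) / sqrt (real n) * sqrt (real n) = lam n i - real n * lam_lim i"
          using elim by simp
        show ?thesis unfolding left_diff_distrib[of _ _ "sqrt (real n)"] 1 2 by simp
      qed
      then have "\<bar>lam n i - mu n i * (rho i * real n)\<bar> \<le> (\<bar>lamhat i - rho i * muhat i\<bar> + 1) * sqrt (real n)"
        using elim s(1) by (simp add: abs_mult)
      also have "\<dots> \<le> B * sqrt (real n)" using B(2)[OF i] by (intro mult_right_mono) auto
      finally show ?case .
    qed
    show "eventually (\<lambda>n. i \<in> I0 \<longrightarrow> sqrt (real n) * \<Lambda> + rho i * real n \<le> real n * rho i / (\<Sum>j\<in>I0. rho j) - 1) sequentially"
    proof (cases "i \<in> I0")
      case True
      let ?s = "\<Sum>j\<in>I0. rho j"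
      \<comment> \<open>The surplus share of class \<open>i\<close>, positive because the traffic of
        \<open>I0\<close> is below one. It yields \<open>\<delta> * n\<close> servers, which
        eventually exceeds \<open>sqrt n * \<Lambda> + 1\<close>.\<close>
      define \<delta> where "\<delta> = rho i / ?s - rho i"
      have "rho i * ?s < rho i * 1" using \<sigma>0 rho0[OF i] by (intro mult_strict_left_mono)
      then have \<delta>: "\<delta> > 0" using \<sigma>0_pos[OF True] by (simp add: \<delta>_def less_divide_eq)
      have "eventually (\<lambda>n. sqrt (real n) \<ge> (\<Lambda> + 1) / \<delta>) sequentially" using sqrt_top by (simp add: filterlim_at_top)
      then have "eventually (\<lambda>n. sqrt (real n) * \<Lambda> + rho i * real n \<le> real n * rho i / ?s - 1) sequentially"
        using eventually_gt_at_top[of 0]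
      proof eventually_elim
        case (elim n)
        have s1: "sqrt (real n) \<ge> 1" using elim by simp
        have "\<Lambda> + 1 \<le> sqrt (real n) * \<delta>" using elim \<delta> by (simp add: divide_le_eq)
        then have "sqrt (real n) * (\<Lambda> + 1) \<le> sqrt (real n) * (sqrt (real n) * \<delta>)" using s1 by (intro mult_left_mono) auto
        also have "\<dots> = real n * \<delta>" by (simp add: mult.assoc[symmetric])
        also have "\<dots> = real n * rho i / ?s - rho i * real n" by (simp add: \<delta>_def right_diff_distrib)
        finally show ?case using s1 unfolding distrib_left by linarith
      qed
      then show ?thesis by eventually_elim simp
    qed simp
  qed auto
  \<comment> \<open>Obtained before any \<open>n\<close> is considered: \<open>B\<close> bounds all
    rates at once, so the arguments of the class bound are the same for every good
    \<open>n\<close>.\<close>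
  obtain K where K: "K \<ge> 0" and CB: "\<And>\<Lambda> y bU bL H I0 N. class_paths d (4 * r) c (system_path.g0 CU C' B B B) (system_path.K1 B) (system_path.K2 B B) \<Lambda> y bU bL H I0 N \<Longrightarrow>
      (\<exists>\<sigma>. (\<forall>j\<in>{1..d}. \<forall>m<N. 0 \<le> \<sigma> j m \<and> (\<forall>t\<in>{real m..real m + 1}. \<bar>y j t\<bar> \<le> \<sigma> j m)) \<and>
      (\<Sum>j\<in>{1..d}. \<Sum>m<N. \<sigma> j m ^ (4 * r - 1)) \<le> K * class_paths.budget d (4 * r) y H N)"
    using class_paths_bound[of d "4 * r" c "system_path.g0 CU C' B B B" "system_path.K1 B" "system_path.K2 B B"] by (elim exE conjE) metis

  \<comment> \<open>The \<open>n\<close>-th system satisfies the pathwise and moment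
    assumptions\<close>
  have sys: "\<exists>J. random_system (M n) n d r J (lam n) (mu n) (gam n) rho I0 (G n) (ES n) (ER n) (U n) (\<lambda>k \<omega>. D1 n k \<omega> / vth n)
      (x0 n) (X n) cc ss CU \<theta> c B B B B \<Lambda>" if good: "good n" for n
  proof -
    interpret prob_space "M n" by (rule prob)
    have n: "n > 0" using good by (simp add: good_def)
    \<comment> \<open>Blocks whose length is the largest power of two not exceeding
      \<open>n\<close>, so that block length and \<open>n\<close> are comparable within a factor
      2.\<close>
    obtain J where J: "2 ^ J \<le> n" "n < 2 ^ (J + 1)" using ex_power_ivl1[of 2 n] n by auto
    let ?X = "prim_rv (G n) (ES n) (ER n) (U n) (D1 n)"
    have ind: "indep_vars (\<lambda>_. borel) ?X (valid_prims d)" by (rule indep)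
    have pr: "?X (Arr i j) = G n i j" "?X (Srv i j) = ES n i j" "?X (Abd i j) = ER n i j" "?X (Up j) = U n j" "?X (prim.Dn j) = D1 n j" for i j
      by (auto simp: prim_rv_def fun_eq_iff)
    have vp: "Arr i j \<in> valid_prims d \<longleftrightarrow> i \<in> {1..d}" "Srv i j \<in> valid_prims d \<longleftrightarrow> i \<in> {1..d}" "Abd i j \<in> valid_prims d \<longleftrightarrow> i \<in> {1..d}"
      "Up j \<in> valid_prims d" "prim.Dn j \<in> valid_prims d" for i j
      by (auto simp: valid_prims_def)
    have meas: "?X q \<in> borel_measurable (M n)" if "q \<in> valid_prims d" for q
      using ind that unfolding indep_vars_def by auto
    have G_meas: "G n i j \<in> borel_measurable (M n)" if "i \<in> {1..d}" for i j
      using meas[of "Arr i j"] vp that unfolding pr by simp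
    have U_meas: "U n j \<in> borel_measurable (M n)" and D_meas: "D1 n j \<in> borel_measurable (M n)" for j
      using meas[of "Up j"] meas[of "prim.Dn j"] vp unfolding pr by simp_all
    have R: "(\<integral>\<^sup>+ y\<in>{t..}. ennreal (1 - H y) \<partial>lborel) \<le> ennreal (C1 * (1 - H t))"
      if "H \<in> {Fd} \<union> F ` {1..d}" "t \<ge> 0" for H t
    proof -
      have "H t < 1" using that REG_F REG_Fd by auto
      then have "C * (1 - H t) \<le> C1 * (1 - H t)" by (intro mult_right_mono) (auto simp: C1_def)
      then show ?thesis using C[OF that] order_trans ennreal_leI by blast
    qed
    have nsI: "noise_seq (M n) E cc ss n r J" if "subexp_seq (M n) E (mgf_const a) (exp_rate a / 2)" for E
      using that J unfolding cc_def ss_def by (intro noise_seq.intro noise_seq_axioms.intro) (auto simp: r_def)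
    have G_seq: "noise_seq (M n) (G n i) cc ss n r J" if i: "i \<in> {1..d}" for i
    proof (rule nsI)
      have "subexp_seq (M n) (\<lambda>j. ?X (Arr i j)) (mgf_const a) (exp_rate a / 2)"
      proof (rule subexp_seq_indep[OF ind])
        show "inj (Arr i)" "range (Arr i) \<subseteq> valid_prims d" "0 < a" using vp i a by (auto simp: inj_def)
        show "AE \<omega> in M n. 0 \<le> ?X (Arr i j) \<omega>" for j using G_pos[OF i, of n j] unfolding pr by eventually_elim simp
        show "integrable (M n) (?X (Arr i j))" "expectation (?X (Arr i j)) = 1" for j using G_mean[OF i] unfolding pr by auto
        show "prob {\<omega> \<in> space (M n). a * real k < ?X (Arr i j) \<omega>} \<le> (1 / 2) ^ k" for j k
          unfolding pr a_def using i R by (intro cdf_tail[OF G_meas[OF i] G_law[OF i]]) (auto simp: C1_def)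
      qed
      then show "subexp_seq (M n) (G n i) (mgf_const a) (exp_rate a / 2)" unfolding pr .
    qed
    have exp_seq: "subexp_seq (M n) (\<lambda>j. ?X (e j)) (mgf_const a) (exp_rate a / 2)"
      if "inj e" "range e \<subseteq> valid_prims d" "\<And>j. distributed (M n) lborel (?X (e j)) (exponential_density 1)" for e
    proof (rule subexp_seq_indep[OF ind that(1,2) a(2)])
      fix j
      have "AE \<omega> in M n. 0 < ?X (e j) \<omega>" by (rule exponential_nonneg[OF that(3)]) simp
      then show "AE \<omega> in M n. 0 \<le> ?X (e j) \<omega>" by eventually_elim simp
      show "prob {\<omega> \<in> space (M n). a * real k < ?X (e j) \<omega>} \<le> (1 / 2) ^ k" for k
        by (rule exponential_tail[OF that(3)]) (use a in simp)
      show "expectation (?X (e j)) = 1" using exponential_distributed_expectation[OF _ that(3)] by simp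
      then show "integrable (M n) (?X (e j))" using not_integrable_integral_eq[of "M n" "?X (e j)"] by (metis zero_neq_one)
    qed
    have S_seq: "noise_seq (M n) (ES n i) cc ss n r J" if i: "i \<in> {1..d}" for i
    proof (rule nsI)
      have "inj (Srv i)" "range (Srv i) \<subseteq> valid_prims d" using vp i by (auto simp: inj_def)
      from exp_seq[OF this, unfolded pr] show "subexp_seq (M n) (ES n i) (mgf_const a) (exp_rate a / 2)"
        using ES_law[OF i] by blast
    qed
    have R_seq: "noise_seq (M n) (ER n i) cc ss n r J" if i: "i \<in> {1..d}" for i
    proof (rule nsI)
      have "inj (Abd i)" "range (Abd i) \<subseteq> valid_prims d" using vp i by (auto simp: inj_def)
      from exp_seq[OF this, unfolded pr] show "subexp_seq (M n) (ER n i) (mgf_const a) (exp_rate a / 2)"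
        using ER_law[OF i] by blast
    qed
    let ?s = "sqrt (real n) / vth n"
    have vn: "vth n > 0" by (rule INT_vth(1))
    have sD: "sqrt (real n) * (x / vth n) = ?s * x" for x by simp
    have D_exp: "(\<integral>\<^sup>+\<omega>. ennreal (exp (\<theta> * (?s * D1 n j \<omega>))) \<partial>M n) \<le> ennreal 7" for j
    proof -
      have "\<theta> * ?s \<le> \<theta> * (2 / vth_lim)" using good pos by (intro mult_left_mono) (auto simp: good_def)
      then have ts: "\<theta> * ?s \<le> exp_rate a" using INT_vth(3) by (simp add: \<theta>_def)
      have "(\<integral>\<^sup>+\<omega>. ennreal (exp (\<theta> * (?s * D1 n j \<omega>))) \<partial>M n) \<le> (\<integral>\<^sup>+\<omega>. ennreal (exp (exp_rate a * D1 n j \<omega>)) \<partial>M n)"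
      proof (rule nn_integral_mono_AE)
        show "AE \<omega> in M n. ennreal (exp (\<theta> * (?s * D1 n j \<omega>))) \<le> ennreal (exp (exp_rate a * D1 n j \<omega>))"
          using D1_nonneg[of n j]
        proof eventually_elim
          case (elim \<omega>)
          show ?case using mult_right_mono[OF ts elim] by (intro ennreal_leI) (simp add: mult.assoc)
        qed
      qed
      also have "\<dots> \<le> ennreal 7"
      proof (rule exp_moment_le[OF D_meas D1_nonneg a(2)])
        show "prob {\<omega> \<in> space (M n). a * real k < D1 n j \<omega>} \<le> (1 / 2) ^ k" for k
          unfolding a_def using R by (intro cdf_tail[OF D_meas D1_law]) (auto simp: C1_def)
      qed
      finally show ?thesis .
    qed
    have U_exp: "(\<integral>\<^sup>+\<omega>. ennreal (exp (- (\<theta> * CU) * U n j \<omega>)) \<partial>M n) \<le> ennreal (1/28)" for j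
    proof -
      have tc: "\<theta> * CU = 56 * beta" using pos by (simp add: CU_def)
      have b: "0 < beta_u n" "beta_u n \<le> 2 * beta" using INT_beta(1) good by (auto simp: good_def)
      have "(\<integral>\<^sup>+\<omega>. ennreal (exp (- (\<theta> * CU) * U n j \<omega>)) \<partial>M n) = ennreal (beta_u n / (beta_u n + \<theta> * CU))"
        using pos by (intro exponential_laplace[OF U_law INT_beta(1)]) auto
      also have "\<dots> \<le> ennreal (1/28)"
        unfolding tc using b INT_beta(3) by (intro ennreal_leI) (simp add: divide_le_eq)
      finally show ?thesis .
    qed
    have down: "down_seq (M n) (U n) (\<lambda>k \<omega>. D1 n k \<omega> / vth n) (sqrt (real n)) CU \<theta> (4 * r)"
    proof
      show "U n j \<in> borel_measurable (M n)" for j by (rule U_meas)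
      show "(\<lambda>\<omega>. D1 n j \<omega> / vth n) \<in> borel_measurable (M n)" for j using D_meas by simp
      show "AE \<omega> in M n. 0 \<le> U n j \<omega>" for j
        using exponential_nonneg[OF U_law[of n j] INT_beta(1)[of n]] by eventually_elim simp
      show "AE \<omega> in M n. 0 \<le> D1 n j \<omega> / vth n" for j using D1_nonneg[of n j] by eventually_elim (use vn in simp)
      show "0 < sqrt (real n)" "0 < CU" "0 < \<theta>" "0 < 4 * r" using n pos by (auto simp: r_def)
      show "(\<integral>\<^sup>+\<omega>. ennreal (exp (\<theta> * (\<Sum>j\<in>{q..<q + N}. sqrt (real n) * (D1 n j \<omega> / vth n) - CU * U n j \<omega>))) \<partial>M n) \<le> ennreal ((1/4) ^ N)" for q N
      proof -
        have "(\<integral>\<^sup>+\<omega>. ennreal (exp (\<theta> * (\<Sum>j\<in>{q..<q + N}. ?s * ?X (prim.Dn j) \<omega> - CU * ?X (Up j) \<omega>))) \<partial>M n) \<le> ennreal ((1/4) ^ card {q..<q + N})"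
          by (rule cycle_mgf[OF ind]) (use vp D_exp U_exp in \<open>auto simp: inj_def pr\<close>)
        then show ?thesis unfolding pr sD by simp
      qed
      show "(\<integral>\<^sup>+\<omega>. ennreal (exp (\<theta> * (sqrt (real n) * (D1 n q \<omega> / vth n)))) \<partial>M n) \<le> ennreal 7" for q
        unfolding sD by (rule D_exp)
    qed
    have "random_system (M n) n d r J (lam n) (mu n) (gam n) rho I0 (G n) (ES n) (ER n) (U n) (\<lambda>k \<omega>. D1 n k \<omega> / vth n)
      (x0 n) (X n) cc ss CU \<theta> c B B B B \<Lambda>"
    proof (rule random_system.intro[OF prob random_system_axioms.intro])
      show "AE \<omega> in M n. 0 < G n i 0 \<omega> \<and> 0 < ES n i 0 \<omega> \<and> 0 < ER n i 0 \<omega>" if "i \<in> {1..d}" for i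
        using G_pos[OF that, of n 0] exponential_nonneg[OF ES_law[OF that, of n 0] zero_less_one] exponential_nonneg[OF ER_law[OF that, of n 0] zero_less_one]
        by eventually_elim blast
      show "real n \<le> 2 * 2 ^ J" using J(2) by (metis Suc_eq_plus1 less_imp_le numeral_power_less_of_nat_cancel_iff of_nat_less_numeral_power_cancel_iff power_Suc)
      show "8 * noise_seq.C' cc ss \<le> sqrt (real n)" using good by (simp add: good_def C'_def)
      show "B + (4 * noise_seq.C' cc ss * B + 8 * noise_seq.C' cc ss * B + 2 * B * CU) + 1 \<le> c * \<Lambda> / 2"
      proof -
        have "c * \<Lambda> / 2 = \<bar>g0\<bar> + 1" using c by (simp add: \<Lambda>_def)
        then show ?thesis unfolding g0_def C'_def[symmetric] by linarith
      qed
      show "0 \<le> lam n i \<and> lam n i \<le> B * real n" "c \<le> mu n i \<and> mu n i \<le> B" "0 \<le> gam n i \<and> gam n i \<le> B"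
        "\<bar>lam n i - mu n i * (rho i * real n)\<bar> \<le> B * sqrt (real n)" if "i \<in> {1..d}" for i
        using good that rates_pos[OF that, of n] by (auto simp: good_def)
      show "2 * c \<le> gam n i" if "i \<in> {1..d}" "i \<notin> I0" for i using good that by (auto simp: good_def)
      show "sqrt (real n) * \<Lambda> + rho i * real n \<le> real n * rho i / sum rho I0 - 1" if "i \<in> I0" for i
        using good that I0sub by (auto simp: good_def)
    qed (fact G_seq S_seq R_seq down n c(1,2) rho0 HW_sum I0sub d B(1) \<Lambda>0 X_eq)+
    then show ?thesis by blast
  qed

  \<comment> \<open>Time averages and the supremum over \<open>n\<close>\<close>
  define g where "g = random_system.growth d r cc ss CU \<theta> B K"
  have main: "Limsup at_top (\<lambda>T::real. ennreal (1 / T) * (\<integral>\<^sup>+ \<omega>. (\<integral>\<^sup>+ s\<in>{0..T}.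
               ennreal (hat_norm n d rho (\<lambda>i. X n i s \<omega>) powr \<kappa>) \<partial>lborel) \<partial>M n)) \<le> ennreal (\<bar>g\<bar> + 1)" if good: "good n" for n
  proof -
    from sys[OF good] obtain J where rs: "random_system (M n) n d r J (lam n) (mu n) (gam n) rho I0 (G n) (ES n) (ER n) (U n) (\<lambda>k \<omega>. D1 n k \<omega> / vth n)
      (x0 n) (X n) cc ss CU \<theta> c B B B B \<Lambda>" ..
    have "\<exists>\<gamma>. \<forall>T\<ge>0. (\<integral>\<^sup>+ \<omega>. (\<integral>\<^sup>+ s\<in>{0..T}. ennreal (hat_norm n d rho (\<lambda>i. X n i s \<omega>) powr \<kappa>) \<partial>lborel) \<partial>M n) \<le> ennreal (g * T + \<gamma>)"
      unfolding g_def
      by (rule random_system.expected_integral_le[OF rs K _ kappa_pos kappa]) (rule CB[unfolded C'_def], assumption)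
    then obtain \<gamma> where \<gamma>: "\<And>T. T \<ge> 0 \<Longrightarrow> (\<integral>\<^sup>+ \<omega>. (\<integral>\<^sup>+ s\<in>{0..T}. ennreal (hat_norm n d rho (\<lambda>i. X n i s \<omega>) powr \<kappa>) \<partial>lborel) \<partial>M n) \<le> ennreal (g * T + \<gamma>)"
      by blast
    show ?thesis
    proof (rule Limsup_average_le)
      fix T :: real assume T: "T \<ge> 0"
      have "g * T \<le> \<bar>g\<bar> * T" using T by (intro mult_right_mono) auto
      then show "(\<integral>\<^sup>+ \<omega>. (\<integral>\<^sup>+ s\<in>{0..T}. ennreal (hat_norm n d rho (\<lambda>i. X n i s \<omega>) powr \<kappa>) \<partial>lborel) \<partial>M n) \<le> ennreal (\<bar>g\<bar> * T + \<gamma>)"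
        using \<gamma>[OF T] by (meson add_right_mono ennreal_leI order_trans)
    qed simp
  qed
  obtain nc where nc: "\<And>n. n \<ge> nc \<Longrightarrow> good n" using ev unfolding eventually_sequentially by blast
  show ?thesis
  proof (intro exI[of _ nc])
    have "(\<Squnion>n\<in>{nc<..}. Limsup at_top (\<lambda>T::real. ennreal (1 / T) * (\<integral>\<^sup>+ \<omega>. (\<integral>\<^sup>+ s\<in>{0..T}.
               ennreal (hat_norm n d rho (\<lambda>i. X n i s \<omega>) powr \<kappa>) \<partial>lborel) \<partial>M n))) \<le> ennreal (\<bar>g\<bar> + 1)"
      by (intro SUP_least main nc) auto
    also have "\<dots> < \<infinity>" by simp
    finally show "(\<Squnion>n\<in>{nc<..}. Limsup at_top (\<lambda>T::real. ennreal (1 / T) * (\<integral>\<^sup>+ \<omega>. (\<integral>\<^sup>+ s\<in>{0..T}.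
               ennreal (hat_norm n d rho (\<lambda>i. X n i s \<omega>) powr \<kappa>) \<partial>lborel) \<partial>M n))) < \<infinity>" .
  qed
qed

end
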